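(* Let $\mathcal G$ be the metric star graph with $N$ infinite edges, let $\gamma\in\mathbb R$, and let $\kappa\ge1$ be an integer. There exist families $(P_{j,k,\beta})$ and $(\alpha_{j,k,\beta})$, depending on $(j,k,\beta)\in\Theta_\kappa\times(-N,N)$, which satisfy the following properties. (i) For $(j,k)\in\Theta_\kappa$, $\beta\in(-N,N)$ and $\ell\in\mathbb N$, we have $P_{j,k,\beta}\in D_\beta$ and $\partial_\beta^\ell P_{j,k,\beta}\in C^\infty_{\exp}$. (ii) For $(j,k)\in\Theta_\kappa$ and $\beta\in(-N,N)$, we have $\alpha_{j,k,\beta}\in\mathbb R$. Moreover, $\alpha_{j,k,\beta}=0$ if $j$ is odd. (iii) In particular, $\alpha_{0,1,0}=\alpha_\star$ (whenever $(0,1)\in\Theta_\kappa$, i.e. $\kappa\ge2$), where $\alpha_\star:=-2\gamma\,Q(0)^2/\|yQ\|_{L^2(\mathcal G)}^2$. (iv) Given an interval $J$ of $\mathbb R$, $b\in C^1(J,\mathbb R)$ and $\lambda\in C^1(J,(0,\infty))$ such that $\gamma\lambda(s)\in(-N,N)$ for all $s\in J$, if we set $$P=P_{b,\lambda}=Q_{\gamma\lambda}+\sum_{(j,k)\in\Theta_\kappa}(ib)^j\lambda^kP_{j,k,\gamma\lambda},\qquad \alpha=\alpha(b,\lambda)=\sum_{(j,k)\in\Theta_\kappa}(ib)^j\lambda^k\alpha_{j,k,\gamma\lambda}$$ and $$\Psi_\kappa=\Psi_\kappa(b,\lambda)=iP_s-H_{\gamma\lambda}P-P+|P|^4P+\alpha\frac{y^2}{4}P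 ,$$ then for any $\nu\in\mathbb N$ there exist $\rho>0$ and $C>0$ such that, for any $s\in J$, there holds $\Psi_\kappa(s)\in C^\nu_{\exp}$ and $$\|\Psi_\kappa\|_{C^\nu_{\exp,\rho}}\le C\lambda\Big(\Big|\frac{\lambda_s}{\lambda}+b\Big|+|b_s+b^2-\alpha(b,\lambda)|\Big)+C(b^2+\lambda)^\kappa .$$ (v) Defining $$\tilde P(b,\lambda,\theta)=\lambda^{-1/2}P_{b,\lambda}\,e^{i(\theta-b\frac{y^2}{4})}$$ (as a function of $x\in\mathcal G$, with $y=x/\lambda$), we have, for any $s\in J$, $$\Big|\frac{d}{ds}E(\tilde P)\Big|\lesssim\frac1{\lambda^2}\Big(\Big|\frac{\lambda_s}\lambda+b\Big|+|b_s+b^2-\alpha(b,\lambda)|+(b^2+\lambda)^\kappa\Big).$$ (vi) There exist $(\varepsilon_{j,k})_{(j,k)\in\Theta_\kappa}\subset\mathbb R$ such that, for any $s\in J$, $$\big|E(\tilde P(b,\lambda,\theta))-C_Q\,\mathcal E(b,\lambda)\big|\lesssim\frac{(b^2+\lambda)^\kappa}{\lambda^2},$$ where $C_Q=\frac18\|yQ\|_{L^2(\mathcal G)}^2$ and $$\mathcal E(b,\lambda)=\mathcal E_{\mathrm{mo}}(b,\lambda)+\sum_{\substack{(j,k)\in\Theta_\kappa\\ j\text{ even},\ j/2+k\ge2}}\varepsilon_{j,k}\,b^j\lambda^{k-2},\qquad \mathcal E_{\mathrm{mo}}(b,\lambda)=\frac{b^2}{\lambda^2}-\frac{2\alpha_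\star}{\lambda}.$$
   Context: Star graph: $\mathcal G$ consists of one vertex $0$ and $N\ge1$ edges, each identified with $[0,\infty)$, the endpoint $0$ being the vertex. A function on $\mathcal G$ is a collection $u=(u_1,\dots,u_N)$ of functions $u_j:[0,\infty)\to\mathbb C$; it is radial if all $u_j$ are equal, and is then identified with any of its components. $L^p(\mathcal G)$, $H^s(\mathcal G)$ are the direct sums over the edges, with $\|u\|_{L^p(\mathcal G)}^p=\sum_j\|u_j\|^p_{L^p(0,\infty)}$. Derivatives and multiplication by $y$ are taken edge by edge. For $\beta\in\mathbb R$, $D_\beta=\{u\in H^2(\mathcal G): u_1(0)=\dots=u_N(0)=:u(0),\ \sum_{j}u_j'(0)=\beta u(0)\}$, and $H_\beta$ is the self-adjoint operator on $L^2(\mathcal G)$ with domain $D_\beta$ acting as $-\partial_{yy}$ on each edge. Energy: $E(u)=\frac12\|u_x\|_{L^2(\mathcal G)}^2+\frac\gamma2|u(0)|^2-\frac16\|u\|_{L^6(\mathcal G)}^6$. $Q$ is the radial function $Q(y)=3^{1/4}(\cosh 2y)^{-1/2}$ on each edge. For $\beta\in(-N,N)$, $Q_\beta$ is the radial function given on each edge by $Q_\beta(y)=3^{1/4}(\cosh(2(y-\tau_\beta)))^{-1/2}$, $\tau_\beta=\frac12\tanh^{-1}(\beta/N)$; it belongs to $D_\beta$ and solves $H_\beta Q_\beta+Q_\beta-Q_\beta^5=0$. $\mathbb N=\{0,1,2,\dots\}$. $\Theta_\kappa=\{(j,k)\in\mathbb N\times\mathbb N: k\ge1,\ \frac j2+k<\kappa\}$.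 For $\nu\in\mathbb N$, $C^\nu_{\exp}$ is the set of radial functions $u$ on $\mathcal G$ that are $C^\nu$ on each edge and satisfy $\|u\|_{C^\nu_{\exp,\rho}}:=\sup_{0\le m\le\nu}\sup_{y\in\mathcal G}e^{\rho|y|}|u^{(m)}(y)|<\infty$ for some $\rho>0$; $C^\infty_{\exp}=\bigcap_\nu C^\nu_{\exp}$. In (v) and (vi), $J,b,\lambda,P_{b,\lambda},\alpha$ are as in (iv), and $\theta$ is a real (phase) parameter, possibly depending on $s$. The subscript $s$ denotes the derivative in $s$; $f\lesssim g$ means $f\le Cg$ with a universal constant $C>0$, i.e. one which does not depend on the dynamical variables.
   Formalization: In (iv)–(vi) the values (b(s),λ(s)) are required to stay in a compact subset of {λ≥0, γλ∈(-N,N)}; the constants depend only on that set, N, γ, κ (and ν), uniformly in J, b, λ, θ. Without such a bound the estimates fail as γλ→±N or for unbounded b. *)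

theory Defs
  imports "HOL-Analysis.Analysis"
begin

text \<open>Derivatives are taken relative to a set, so they are one-sided at the end points of
  closed intervals; in particular at the vertex of an edge \<open>{0..}\<close>.\<close>

definition deriv_in :: "real set \<Rightarrow> (real \<Rightarrow> 'a::real_normed_vector) \<Rightarrow> real \<Rightarrow> 'a" where
  "deriv_in S f x = vector_derivative f (at x within S)"

definition Ck_on :: "real set \<Rightarrow> nat \<Rightarrow> (real \<Rightarrow> 'a::real_normed_vector) \<Rightarrow> bool" where
  "Ck_on S n f \<longleftrightarrow>
     (\<forall>m<n. \<forall>x\<in>S. (deriv_in S ^^ m) f differentiable (at x within S)) \<and>
     continuous_on S ((deriv_in S ^^ n) f)"

text \<open>A function on the star graph with \<open>N\<close> edges is \<open>u\<close>, where \<open>u i y\<close> is the value at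
  the point with coordinate \<open>y \<ge> 0\<close> of the edge \<open>i < N\<close>. Edges are numbered from \<open>0\<close>.
  The values for \<open>i \<ge> N\<close> or \<open>y < 0\<close> are irrelevant.\<close>

type_synonym graph_fun = "nat \<Rightarrow> real \<Rightarrow> complex"

abbreviation edge_deriv :: "(real \<Rightarrow> complex) \<Rightarrow> real \<Rightarrow> complex" where
  "edge_deriv \<equiv> deriv_in {0..}"

definition radial :: "nat \<Rightarrow> graph_fun \<Rightarrow> bool" where
  "radial N u \<longleftrightarrow> (\<forall>i<N. \<forall>j<N. \<forall>y\<ge>0. u i y = u j y)"

definition Lp_norm :: "nat \<Rightarrow> nat \<Rightarrow> graph_fun \<Rightarrow> real" where
  "Lp_norm N p u = root p (\<Sum>i<N. LINT y:{0..}|lborel. cmod (u i y) ^ p)"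

definition L2_edge :: "(real \<Rightarrow> complex) \<Rightarrow> bool" where
  "L2_edge f \<longleftrightarrow> set_borel_measurable lborel {0..} f \<and>
     set_integrable lborel {0..} (\<lambda>y. (cmod (f y))\<^sup>2)"

definition test_fun :: "(real \<Rightarrow> complex) \<Rightarrow> bool" where
  "test_fun \<phi> \<longleftrightarrow> (\<forall>n. Ck_on {0..} n \<phi>) \<and> (\<exists>a>0. \<exists>b. \<forall>y. y \<notin> {a..b} \<longrightarrow> \<phi> y = 0)"

definition weak_deriv :: "(real \<Rightarrow> complex) \<Rightarrow> (real \<Rightarrow> complex) \<Rightarrow> bool" where
  "weak_deriv f g \<longleftrightarrow> (\<forall>\<phi>. test_fun \<phi> \<longrightarrow>
     (LINT y:{0..}|lborel. f y * edge_deriv \<phi> y) = - (LINT y:{0..}|lborel. g y * \<phi> y))"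

definition H2_edge :: "(real \<Rightarrow> complex) \<Rightarrow> bool" where
  "H2_edge f \<longleftrightarrow> L2_edge f \<and>
     (\<exists>g h. L2_edge g \<and> L2_edge h \<and> weak_deriv f g \<and> weak_deriv g h)"

text \<open>\<open>C\<^sup>1\<close> regularity up to the vertex selects, in each \<open>H\<^sup>2\<close> class, the unique
  representative whose traces \<open>u\<^sub>i(0)\<close> and \<open>u\<^sub>i'(0)\<close> are meant.\<close>

definition dom_H :: "nat \<Rightarrow> real \<Rightarrow> graph_fun set" where
  "dom_H N \<beta> = {u. (\<forall>i<N. H2_edge (u i) \<and> Ck_on {0..} 1 (u i)) \<and>
     (\<forall>i<N. u i 0 = u 0 0) \<and>
     (\<Sum>i<N. edge_deriv (u i) 0) = complex_of_real \<beta> * u 0 0}"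

text \<open>The operator is unspecified off its domain. The second derivative is the classical one,
  so this should only be applied to elements of the domain that are \<open>C\<^sup>2\<close> on each edge.\<close>

definition H_op :: "nat \<Rightarrow> real \<Rightarrow> graph_fun \<Rightarrow> graph_fun" where
  "H_op N \<beta> u = (if u \<in> dom_H N \<beta>
     then (\<lambda>i y. - edge_deriv (edge_deriv (u i)) y) else undefined)"

definition energy :: "nat \<Rightarrow> real \<Rightarrow> graph_fun \<Rightarrow> real" where
  "energy N \<gamma> u = 1/2 * (Lp_norm N 2 (\<lambda>i. edge_deriv (u i)))\<^sup>2
     + \<gamma>/2 * (cmod (u 0 0))\<^sup>2 - 1/6 * (Lp_norm N 6 u) ^ 6"

definition Cexp_norm :: "nat \<Rightarrow> nat \<Rightarrow> real \<Rightarrow> graph_fun \<Rightarrow> ennreal" where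
  "Cexp_norm N \<nu> \<rho> u = (SUP m\<in>{..\<nu>}. SUP i\<in>{..<N}. SUP y\<in>{0..}.
     ennreal (exp (\<rho> * \<bar>y\<bar>) * cmod ((edge_deriv ^^ m) (u i) y)))"

definition Cexp :: "nat \<Rightarrow> nat \<Rightarrow> graph_fun set" where
  "Cexp N \<nu> = {u. radial N u \<and> (\<forall>i<N. Ck_on {0..} \<nu> (u i)) \<and>
     (\<exists>\<rho>>0. Cexp_norm N \<nu> \<rho> u < \<infinity>)}"

definition Cexp_inf :: "nat \<Rightarrow> graph_fun set" where
  "Cexp_inf N = (\<Inter>\<nu>. Cexp N \<nu>)"

definition Q :: graph_fun where
  "Q i y = complex_of_real (3 powr (1/4) * cosh (2 * y) powr (-1/2))"

definition tau :: "nat \<Rightarrow> real \<Rightarrow> real" where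
  "tau N \<beta> = 1/2 * artanh (\<beta> / real N)"

definition Q_beta :: "nat \<Rightarrow> real \<Rightarrow> graph_fun" where
  "Q_beta N \<beta> i y = complex_of_real (3 powr (1/4) * cosh (2 * (y - tau N \<beta>)) powr (-1/2))"

definition yQ_norm :: "nat \<Rightarrow> real" where
  "yQ_norm N = Lp_norm N 2 (\<lambda>i y. complex_of_real y * Q i y)"

definition alpha_star :: "nat \<Rightarrow> real \<Rightarrow> real" where
  "alpha_star N \<gamma> = - 2 * \<gamma> * (cmod (Q 0 0))\<^sup>2 / (yQ_norm N)\<^sup>2"

definition C_Q :: "nat \<Rightarrow> real" where
  "C_Q N = 1/8 * (yQ_norm N)\<^sup>2"

definition Theta :: "nat \<Rightarrow> (nat \<times> nat) set" where
  "Theta \<kappa> = {(j, k). k \<ge> 1 \<and> real j / 2 + real k < real \<kappa>}"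

definition profile ::
  "nat \<Rightarrow> real \<Rightarrow> nat \<Rightarrow> (nat \<Rightarrow> nat \<Rightarrow> real \<Rightarrow> graph_fun) \<Rightarrow> real \<Rightarrow> real \<Rightarrow> graph_fun" where
  "profile N \<gamma> \<kappa> P b lam i y = Q_beta N (\<gamma> * lam) i y +
     (\<Sum>(j, k)\<in>Theta \<kappa>. (\<i> * complex_of_real b) ^ j * complex_of_real lam ^ k
        * P j k (\<gamma> * lam) i y)"

definition alpha_sum ::
  "real \<Rightarrow> nat \<Rightarrow> (nat \<Rightarrow> nat \<Rightarrow> real \<Rightarrow> real) \<Rightarrow> real \<Rightarrow> real \<Rightarrow> complex" where
  "alpha_sum \<gamma> \<kappa> \<alpha> b lam = (\<Sum>(j, k)\<in>Theta \<kappa>. (\<i> * complex_of_real b) ^ j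
     * complex_of_real lam ^ k * complex_of_real (\<alpha> j k (\<gamma> * lam)))"

definition Psi ::
  "nat \<Rightarrow> real \<Rightarrow> nat \<Rightarrow> (nat \<Rightarrow> nat \<Rightarrow> real \<Rightarrow> graph_fun) \<Rightarrow> (nat \<Rightarrow> nat \<Rightarrow> real \<Rightarrow> real)
     \<Rightarrow> real set \<Rightarrow> (real \<Rightarrow> real) \<Rightarrow> (real \<Rightarrow> real) \<Rightarrow> real \<Rightarrow> graph_fun" where
  "Psi N \<gamma> \<kappa> P \<alpha> J b lam s i y =
     (let p = profile N \<gamma> \<kappa> P (b s) (lam s) in
        \<i> * deriv_in J (\<lambda>s'. profile N \<gamma> \<kappa> P (b s') (lam s') i y) s
        - H_op N (\<gamma> * lam s) p i y
        - p i y
        + complex_of_real (cmod (p i y) ^ 4) * p i y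
        + alpha_sum \<gamma> \<kappa> \<alpha> (b s) (lam s) * complex_of_real (y\<^sup>2 / 4) * p i y)"

definition profile_tilde ::
  "nat \<Rightarrow> real \<Rightarrow> nat \<Rightarrow> (nat \<Rightarrow> nat \<Rightarrow> real \<Rightarrow> graph_fun)
     \<Rightarrow> real \<Rightarrow> real \<Rightarrow> real \<Rightarrow> graph_fun" where
  "profile_tilde N \<gamma> \<kappa> P b lam \<theta> i x =
     (let y = x / lam in
        complex_of_real (lam powr (-1/2)) * profile N \<gamma> \<kappa> P b lam i y
        * exp (\<i> * complex_of_real (\<theta> - b * y\<^sup>2 / 4)))"

definition E_mo :: "nat \<Rightarrow> real \<Rightarrow> real \<Rightarrow> real \<Rightarrow> real" where
  "E_mo N \<gamma> b lam = b\<^sup>2 / lam\<^sup>2 - 2 * alpha_star N \<gamma> / lam"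

definition E_mod ::
  "nat \<Rightarrow> real \<Rightarrow> nat \<Rightarrow> (nat \<Rightarrow> nat \<Rightarrow> real) \<Rightarrow> real \<Rightarrow> real \<Rightarrow> real" where
  "E_mod N \<gamma> \<kappa> \<epsilon> b lam = E_mo N \<gamma> b lam +
     (\<Sum>(j, k)\<in>{(j, k)\<in>Theta \<kappa>. even j \<and> real j / 2 + real k \<ge> 2}.
        \<epsilon> j k * b ^ j * lam powi (int k - 2))"

definition modulation ::
  "nat \<Rightarrow> real \<Rightarrow> real set \<Rightarrow> (real \<Rightarrow> real) \<Rightarrow> (real \<Rightarrow> real) \<Rightarrow> bool" where
  "modulation N \<gamma> J b lam \<longleftrightarrow> is_interval J \<and> interior J \<noteq> {} \<and> Ck_on J 1 b \<and> Ck_on J 1 lam \<and>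
     (\<forall>s\<in>J. lam s > 0 \<and> \<gamma> * lam s \<in> {- real N <..< real N})"

text \<open>Sets of parameters on which constants are uniform. A set in this class may contain points
  with \<open>\<lambda> = 0\<close>, so the constants do not degenerate in the limit \<open>(b, \<lambda>) \<rightarrow> (0, 0)\<close>, where the
  estimates have content. Compactness in \<open>{\<bar>\<gamma>\<lambda>\<bar> < N}\<close> cannot be dropped: \<open>\<partial>\<^sub>\<beta> Q\<^sub>\<beta>\<close> is unbounded
  as \<open>\<beta> \<rightarrow> \<plusminus>N\<close>, and the profile is a polynomial of high degree in \<open>b\<close>.\<close>

definition param_region :: "nat \<Rightarrow> real \<Rightarrow> (real \<times> real) set \<Rightarrow> bool" where
  "param_region N \<gamma> K \<longleftrightarrow> compact K \<and>
     K \<subseteq> {(b, lam). lam \<ge> 0 \<and> \<gamma> * lam \<in> {- real N <..< real N}}"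

definition mod_defect ::
  "real \<Rightarrow> nat \<Rightarrow> (nat \<Rightarrow> nat \<Rightarrow> real \<Rightarrow> real) \<Rightarrow> real set \<Rightarrow> (real \<Rightarrow> real) \<Rightarrow> (real \<Rightarrow> real)
     \<Rightarrow> real \<Rightarrow> real" where
  "mod_defect \<gamma> \<kappa> \<alpha> J b lam s = \<bar>deriv_in J lam s / lam s + b s\<bar> +
     cmod (complex_of_real (deriv_in J b s + (b s)\<^sup>2) - alpha_sum \<gamma> \<kappa> \<alpha> (b s) (lam s))"

end

theory Submission
  imports Defs
begin

text \<open>The soliton factorizes as \<open>Q\<^sub>\<beta> = G Q\<close> with \<open>\<mu> = \<beta> / N\<close>, \<open>t = tanh (2 y)\<close> and
  \<open>G = (1 - \<mu>\<^sup>2)\<^bsup>1/4\<^esup> (1 - \<mu> t)\<^bsup>-1/2\<^esup>\<close>, and \<open>G\<close> turns a Neumann condition into the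
  vertex condition of \<open>D\<^sub>\<beta>\<close>. So one looks for \<open>P = G V\<close> with \<open>V = Q + \<Sum> (i b)\<^sup>j \<lambda>\<^sup>k V\<^sub>j\<^sub>k\<close>, where
  \<open>V\<^sub>j\<^sub>k\<close> and \<open>\<alpha>\<^sub>j\<^sub>k\<close> do not depend on \<open>\<beta>\<close>: multiplied by \<open>(1 - \<mu>\<^sup>2) (1 - \<mu> t)\<^sup>2\<close>, the equation for \<open>V\<close>
  is polynomial in \<open>\<mu>\<close>, \<open>i b\<close> and \<open>\<lambda>\<close>. Its coefficients are cancelled in pairs \<open>j = J, J + 1\<close>
  (\<open>J\<close> even) by inverting the linearized operators \<open>L\<^sub>+\<close> and \<open>L\<^sub>-\<close> at \<open>Q\<close> with Neumann condition.
  The kernel \<open>Q\<close> of \<open>L\<^sub>-\<close> yields one solvability condition per pair, which determines \<open>\<alpha>\<^sub>J\<^sub>k\<close> since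
  \<open>L\<^sub>+ (\<Lambda>Q) = - 2 Q\<close>.

  The energy is \<open>\<lambda>\<^sup>-\<^sup>2\<close> times an integral of \<open>\<bar>w\<^sub>y\<bar>\<^sup>2 / 2 - \<bar>w\<bar>\<^sup>6 / 6\<close> plus a vertex term, with
  \<open>w = P e\<^bsup>- i b y\<^sup>2 / 4\<^esup>\<close>. Along the flow \<open>b' = - b\<^sup>2 + \<alpha>\<close>, \<open>\<lambda>' = - b \<lambda>\<close> it changes only through the
  error \<open>\<Psi>\<close>, by an exact conservation law. Its expansion in \<open>b\<close> and \<open>\<lambda>\<close> exists because \<open>\<bar>G\<bar>\<^sup>2\<close> is analytic
  in \<open>\<lambda>\<close>. The leading coefficients are found by uniqueness of expansions: at \<open>\<lambda> = 0\<close> the energy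
  integral is explicit, and its \<open>\<lambda>\<close>-derivative at the origin follows from the solvability
  condition for \<open>V\<^sub>0\<^sub>1\<close>.\<close>

section \<open>Smooth functions on the half line\<close>

text \<open>Why pairs: with x = ib, i times the derivative along the flow multiplies x^j \<lambda>^k
  by -(j + k) x to leading order, so a coefficient found at x^j returns as a source at x^(j+1). For
  even J the new term is x^J \<lambda>^k (A + x B) with A, B real, and conjugation flips only the
  sign of B; hence A meets one linearized operator and B the other. The first is invertible because
  its decaying solution Q' is odd. The source for B contains (J + k) A, whose product with Q has to
  match the rest. The multiple of y^2 Q / 4 in the equation for A contributes \<alpha>/8 times the
  squared norm of yQ on one edge, which is nonzero. The obstacle in the estimates is uniformity as
  (b, \<lambda>) tends to 0. Errors are divided by their weights, \<lambda> or (b^2 +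
  \<lambda>)^\<kappa>, and the quotients are shown to form bounded families; b^2 and \<lambda> count
  one order each, whence the threshold j + 2k >= 2\<kappa>. Function classes carry parameters from
  the start, so that one calculus serves single functions, parameter regions and normalized
  errors.\<close>

definition decays :: "'p set \<Rightarrow> ('p \<Rightarrow> real \<Rightarrow> 'a::real_normed_vector) \<Rightarrow> bool" where
  "decays K F \<longleftrightarrow> (\<exists>C. \<exists>\<rho>>0. \<forall>p\<in>K. \<forall>y\<ge>0. norm (F p y) \<le> C * exp (- (\<rho> * y)))"

text \<open>Growth below every exponential rate. Unlike polynomial growth this needs no degree; it
  is stable under products and absorbed by any decaying factor.\<close>

definition tempered :: "'p set \<Rightarrow> ('p \<Rightarrow> real \<Rightarrow> 'a::real_normed_vector) \<Rightarrow> bool" where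
  "tempered K F \<longleftrightarrow> (\<forall>\<rho>>0. \<exists>C. \<forall>p\<in>K. \<forall>y\<ge>0. norm (F p y) \<le> C * exp (\<rho> * y))"

text \<open>The flag lets one closure lemma serve decaying and tempered families; a product decays
  as soon as one factor does.\<close>

definition growth :: "bool \<Rightarrow> 'p set \<Rightarrow> ('p \<Rightarrow> real \<Rightarrow> 'a::real_normed_vector) \<Rightarrow> bool" where
  "growth d K F = (if d then decays K F else tempered K F)"

lemma decaysI:
  "\<rho> > 0 \<Longrightarrow> (\<And>p y. p \<in> K \<Longrightarrow> y \<ge> 0 \<Longrightarrow> norm (F p y) \<le> C * exp (- (\<rho> * y))) \<Longrightarrow> decays K F"
  by (auto simp: decays_def)

lemma decaysE:
  assumes "decays K F"
  obtains C \<rho> where "C > 0" "\<rho> > 0"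
    "\<And>p y. p \<in> K \<Longrightarrow> y \<ge> 0 \<Longrightarrow> norm (F p y) \<le> C * exp (- (\<rho> * y))"
proof -
  obtain C \<rho> where r: "\<rho> > 0"
    and b: "\<And>p y. p \<in> K \<Longrightarrow> y \<ge> 0 \<Longrightarrow> norm (F p y) \<le> C * exp (- (\<rho> * y))"
    using assms unfolding decays_def by blast
  have "norm (F p y) \<le> (\<bar>C\<bar> + 1) * exp (- (\<rho> * y))" if "p \<in> K" "y \<ge> 0" for p y
  proof -
    have "C * exp (- (\<rho> * y)) \<le> (\<bar>C\<bar> + 1) * exp (- (\<rho> * y))"
      by (rule mult_right_mono) auto
    then show ?thesis using b[OF that] by linarith
  qed
  then show thesis using that[of "\<bar>C\<bar> + 1" \<rho>] r by auto
qed

lemma temperedE: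
  assumes "tempered K F" "\<rho> > 0"
  obtains C where "C > 0" "\<And>p y. p \<in> K \<Longrightarrow> y \<ge> 0 \<Longrightarrow> norm (F p y) \<le> C * exp (\<rho> * y)"
proof -
  obtain C where b: "\<And>p y. p \<in> K \<Longrightarrow> y \<ge> 0 \<Longrightarrow> norm (F p y) \<le> C * exp (\<rho> * y)"
    using assms unfolding tempered_def by blast
  have "norm (F p y) \<le> (\<bar>C\<bar> + 1) * exp (\<rho> * y)" if "p \<in> K" "y \<ge> 0" for p y
  proof -
    have "C * exp (\<rho> * y) \<le> (\<bar>C\<bar> + 1) * exp (\<rho> * y)"
      by (rule mult_right_mono) auto
    then show ?thesis using b[OF that] by linarith
  qed
  then show thesis using that[of "\<bar>C\<bar> + 1"] by auto
qed

lemma decays_imp_tempered: "decays K F \<Longrightarrow> tempered K F"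
proof -
  assume "decays K F"
  then obtain C \<rho> where C: "C > 0" "\<rho> > 0"
    and b: "\<And>p y. p \<in> K \<Longrightarrow> y \<ge> 0 \<Longrightarrow> norm (F p y) \<le> C * exp (- (\<rho> * y))"
    using decaysE[of K F] by metis
  have "norm (F p y) \<le> C * exp (r * y)" if "p \<in> K" "y \<ge> 0" "r > 0" for p y r
  proof -
    have "C * exp (- (\<rho> * y)) \<le> C * exp (r * y)"
      using C that by (intro mult_left_mono) (auto simp: mult_nonneg_nonneg intro: order_trans[of _ 0])
    then show ?thesis using b[OF that(1,2)] by linarith
  qed
  then show ?thesis unfolding tempered_def by blast
qed

lemma growth_tempered: "growth d K F \<Longrightarrow> tempered K F"
  by (auto simp: growth_def decays_imp_tempered split: if_splits)

lemma growth_add: "growth d K F \<Longrightarrow> growth d K G \<Longrightarrow> growth d K (\<lambda>p y. F p y + G p y)"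
proof (cases d)
  case True
  assume "growth d K F" "growth d K G"
  then have F: "decays K F" and G: "decays K G" by (auto simp: growth_def True)
  obtain C \<rho> where C: "C > 0" "\<rho> > 0"
    "\<And>p y. p \<in> K \<Longrightarrow> y \<ge> 0 \<Longrightarrow> norm (F p y) \<le> C * exp (- (\<rho> * y))" using decaysE[OF F] by metis
  obtain C' \<rho>' where C': "C' > 0" "\<rho>' > 0"
    "\<And>p y. p \<in> K \<Longrightarrow> y \<ge> 0 \<Longrightarrow> norm (G p y) \<le> C' * exp (- (\<rho>' * y))" using decaysE[OF G] by metis
  have "norm (F p y + G p y) \<le> (C + C') * exp (- (min \<rho> \<rho>' * y))" if "p \<in> K" "y \<ge> 0" for p y
  proof -
    have "norm (F p y + G p y) \<le> C * exp (- (\<rho> * y)) + C' * exp (- (\<rho>' * y))"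
      using C(3)[OF that] C'(3)[OF that] norm_triangle_ineq[of "F p y" "G p y"] by linarith
    also have "\<dots> \<le> C * exp (- (min \<rho> \<rho>' * y)) + C' * exp (- (min \<rho> \<rho>' * y))"
      using C C' that by (intro add_mono mult_left_mono) (auto intro: mult_right_mono)
    finally show ?thesis by (simp add: algebra_simps)
  qed
  then have "decays K (\<lambda>p y. F p y + G p y)"
    by (intro decaysI[of "min \<rho> \<rho>'"]) (use C C' in auto)
  then show ?thesis by (simp add: growth_def True)
next
  case False
  assume "growth d K F" "growth d K G"
  then have F: "tempered K F" and G: "tempered K G" by (auto simp: growth_def False)
  have "\<exists>C. \<forall>p\<in>K. \<forall>y\<ge>0. norm (F p y + G p y) \<le> C * exp (\<rho> * y)" if r: "\<rho> > 0" for \<rho>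
  proof -
    obtain C where C: "\<And>p y. p \<in> K \<Longrightarrow> y \<ge> 0 \<Longrightarrow> norm (F p y) \<le> C * exp (\<rho> * y)"
      using temperedE[OF F r] by metis
    obtain C' where C': "\<And>p y. p \<in> K \<Longrightarrow> y \<ge> 0 \<Longrightarrow> norm (G p y) \<le> C' * exp (\<rho> * y)"
      using temperedE[OF G r] by metis
    have "norm (F p y + G p y) \<le> (C + C') * exp (\<rho> * y)" if "p \<in> K" "y \<ge> 0" for p y
      using C[OF that] C'[OF that] norm_triangle_ineq[of "F p y" "G p y"]
      by (simp add: algebra_simps)
    then show ?thesis by blast
  qed
  then show ?thesis by (simp add: growth_def False tempered_def)
qed

text \<open>Half of the decay rate is spent on the tempered factor, which is bounded by a multiple
  of \<open>exp (\<rho>/2 * y)\<close>.\<close>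

lemma decays_mult_tempered:
  fixes F G :: "'p \<Rightarrow> real \<Rightarrow> 'a::real_normed_algebra"
  assumes F: "decays K F" and G: "tempered K G"
  shows "decays K (\<lambda>p y. F p y * G p y)"
proof -
  obtain C \<rho> where C: "C > 0" "\<rho> > 0"
    "\<And>p y. p \<in> K \<Longrightarrow> y \<ge> 0 \<Longrightarrow> norm (F p y) \<le> C * exp (- (\<rho> * y))" using decaysE[OF F] by metis
  obtain C' where C': "C' > 0" "\<And>p y. p \<in> K \<Longrightarrow> y \<ge> 0 \<Longrightarrow> norm (G p y) \<le> C' * exp (\<rho>/2 * y)"
    using temperedE[OF G, of "\<rho>/2"] C by (metis half_gt_zero)
  have "norm (F p y * G p y) \<le> (C * C') * exp (- (\<rho>/2 * y))" if "p \<in> K" "y \<ge> 0" for p y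
  proof -
    have "norm (F p y * G p y) \<le> norm (F p y) * norm (G p y)" by (rule norm_mult_ineq)
    also have "\<dots> \<le> (C * exp (- (\<rho> * y))) * (C' * exp (\<rho>/2 * y))"
      using C(3)[OF that] C'(2)[OF that] C C' by (intro mult_mono) auto
    also have "\<dots> = (C * C') * (exp (- (\<rho> * y)) * exp (\<rho>/2 * y))" by simp
    also have "exp (- (\<rho> * y)) * exp (\<rho>/2 * y) = exp (- (\<rho>/2 * y))"
      by (simp add: exp_add[symmetric])
    finally show ?thesis .
  qed
  then show ?thesis by (intro decaysI[of "\<rho>/2"]) (use C in auto)
qed

lemma growth_mult:
  fixes F G :: "'p \<Rightarrow> real \<Rightarrow> 'a::{real_normed_field}"
  assumes F: "growth d K F" and G: "growth e K G"
  shows "growth (d \<or> e) K (\<lambda>p y. F p y * G p y)"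
proof -
  consider "d" | "\<not> d" "e" | "\<not> d" "\<not> e" by blast
  then show ?thesis
  proof cases
    case 1
    then show ?thesis using decays_mult_tempered[of K F G] F growth_tempered[OF G] by (auto simp: growth_def)
  next
    case 2
    then have "decays K (\<lambda>p y. G p y * F p y)"
      using decays_mult_tempered[of K G F] G growth_tempered[OF F] by (auto simp: growth_def)
    then show ?thesis using 2 by (simp add: growth_def mult.commute)
  next
    case 3
    then have F: "tempered K F" and G: "tempered K G" using F G by (auto simp: growth_def)
    have "\<exists>C. \<forall>p\<in>K. \<forall>y\<ge>0. norm (F p y * G p y) \<le> C * exp (\<rho> * y)" if r: "\<rho> > 0" for \<rho>
    proof -
      obtain C where C: "C > 0" "\<And>p y. p \<in> K \<Longrightarrow> y \<ge> 0 \<Longrightarrow> norm (F p y) \<le> C * exp (\<rho>/2 * y)"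
        using temperedE[OF F, of "\<rho>/2"] r by (metis half_gt_zero)
      obtain C' where C': "C' > 0" "\<And>p y. p \<in> K \<Longrightarrow> y \<ge> 0 \<Longrightarrow> norm (G p y) \<le> C' * exp (\<rho>/2 * y)"
        using temperedE[OF G, of "\<rho>/2"] r by (metis half_gt_zero)
      have "norm (F p y * G p y) \<le> (C * C') * exp (\<rho> * y)" if "p \<in> K" "y \<ge> 0" for p y
      proof -
        have "norm (F p y * G p y) \<le> norm (F p y) * norm (G p y)" by (rule norm_mult_ineq)
        also have "\<dots> \<le> (C * exp (\<rho>/2 * y)) * (C' * exp (\<rho>/2 * y))"
          using C(2)[OF that] C'(2)[OF that] C C' by (intro mult_mono) auto
        also have "\<dots> = (C * C') * (exp (\<rho>/2 * y) * exp (\<rho>/2 * y))" by simp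
        also have "exp (\<rho>/2 * y) * exp (\<rho>/2 * y) = exp (\<rho> * y)"
          by (simp add: exp_add[symmetric])
        finally show ?thesis .
      qed
      then show ?thesis by blast
    qed
    then show ?thesis using 3 by (auto simp: growth_def tempered_def)
  qed
qed

lemma growth_linear:
  assumes h: "bounded_linear h" and F: "growth d K F"
  shows "growth d K (\<lambda>p y. h (F p y))"
proof -
  obtain B where B: "B > 0" "\<And>x. norm (h x) \<le> norm x * B"
    using bounded_linear.pos_bounded[OF h] by auto
  have *: "norm (h (F p y)) \<le> (C * B) * e" if "norm (F p y) \<le> C * e" for C e p y
  proof -
    have "norm (F p y) * B \<le> (C * e) * B" using that B(1) by (intro mult_right_mono) auto
    then show ?thesis using B(2)[of "F p y"] by (simp add: mult_ac)
  qed
  show ?thesis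
    using F by (auto simp: growth_def decays_def tempered_def split: if_splits) (meson *)+
qed

lemma growth_cong:
  assumes "\<And>p y. p \<in> K \<Longrightarrow> y \<ge> 0 \<Longrightarrow> F p y = G p y" "growth d K F"
  shows "growth d K G"
  using assms by (auto simp: growth_def decays_def tempered_def)

lemma growth_reindex:
  assumes "\<And>q. q \<in> L \<Longrightarrow> h q \<in> K" "growth d K F"
  shows "growth d L (\<lambda>q. F (h q))"
  using assms unfolding growth_def decays_def tempered_def by (auto split: if_splits) meson+

lemma growth_weaken: "growth d K F \<Longrightarrow> (e \<Longrightarrow> d) \<Longrightarrow> growth e K F"
  by (cases e) (auto simp: growth_tempered, auto simp: growth_def decays_imp_tempered split: if_splits)

abbreviation hderiv :: "(real \<Rightarrow> 'a::real_normed_vector) \<Rightarrow> 'a \<Rightarrow> real \<Rightarrow> bool" where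
  "hderiv f f' y \<equiv> (f has_vector_derivative f') (at y within {0..})"

text \<open>Derivatives up to order \<open>n\<close>, one-sided at the vertex, with bounds uniform
  over the parameter set. The derivative is existentially quantified instead of being an iterate of
  \<open>deriv_in\<close>, so closure rules only have to exhibit it. Single functions are families
  over \<open>{()}\<close>.\<close>

primrec sm :: "bool \<Rightarrow> 'p set \<Rightarrow> nat \<Rightarrow> ('p \<Rightarrow> real \<Rightarrow> 'a::real_normed_vector) \<Rightarrow> bool" where
  "sm d K 0 F = growth d K F"
| "sm d K (Suc n) F = (growth d K F \<and>
     (\<exists>F'. (\<forall>p\<in>K. \<forall>y\<ge>0. hderiv (F p) (F' p y) y) \<and> sm d K n F'))"

lemma sm_growth: "sm d K n F \<Longrightarrow> growth d K F"
  by (cases n) auto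

lemma sm_SucE:
  assumes "sm d K (Suc n) F"
  obtains F' where "\<And>p y. p \<in> K \<Longrightarrow> y \<ge> 0 \<Longrightarrow> hderiv (F p) (F' p y) y" "sm d K n F'"
  using assms by auto

lemma sm_SucI:
  "growth d K F \<Longrightarrow> (\<And>p y. p \<in> K \<Longrightarrow> y \<ge> 0 \<Longrightarrow> hderiv (F p) (F' p y) y) \<Longrightarrow> sm d K n F' \<Longrightarrow> sm d K (Suc n) F"
  by auto

lemma sm_SucD: "sm d K (Suc n) F \<Longrightarrow> sm d K n F"
  by (induction n arbitrary: F) auto

lemma sm_le: "sm d K n F \<Longrightarrow> m \<le> n \<Longrightarrow> sm d K m F"
  by (induction n arbitrary: m) (auto simp del: sm.simps simp: le_Suc_eq dest: sm_SucD)

lemma sm_weaken: "sm d K n F \<Longrightarrow> (e \<Longrightarrow> d) \<Longrightarrow> sm e K n F"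
  by (induction n arbitrary: F) (auto intro: growth_weaken)

lemma sm_False: "sm d K n F \<Longrightarrow> sm False K n F"
  by (erule sm_weaken) auto

lemma hderiv_cong:
  assumes "\<And>y. y \<ge> 0 \<Longrightarrow> f y = g y" "hderiv f f' y" "y \<ge> 0"
  shows "hderiv g f' y"
  by (rule has_vector_derivative_transform[OF _ _ assms(2)]) (use assms in auto)

lemma sm_cong:
  assumes "sm d K n F" "\<And>p y. p \<in> K \<Longrightarrow> y \<ge> 0 \<Longrightarrow> F p y = G p y"
  shows "sm d K n G"
proof (cases n)
  case 0
  then show ?thesis using assms growth_cong[of K F G] by simp
next
  case (Suc m)
  then obtain F' where F': "\<And>p y. p \<in> K \<Longrightarrow> y \<ge> 0 \<Longrightarrow> hderiv (F p) (F' p y) y" "sm d K m F'"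
    using assms(1) by auto
  have "hderiv (G p) (F' p y) y" if "p \<in> K" "y \<ge> 0" for p y
    using hderiv_cong[of "F p" "G p"] assms(2) that F' by auto
  then show ?thesis
    unfolding Suc using assms F' by (intro sm_SucI[of _ _ _ F']) (auto intro: growth_cong[of K F] sm_growth)
qed

lemma sm_add: "sm d K n F \<Longrightarrow> sm d K n G \<Longrightarrow> sm d K n (\<lambda>p y. F p y + G p y)"
proof (induction n arbitrary: F G)
  case (Suc n)
  obtain F' where F': "\<And>p y. p \<in> K \<Longrightarrow> y \<ge> 0 \<Longrightarrow> hderiv (F p) (F' p y) y" "sm d K n F'"
    using sm_SucE[OF Suc.prems(1)] by metis
  obtain G' where G': "\<And>p y. p \<in> K \<Longrightarrow> y \<ge> 0 \<Longrightarrow> hderiv (G p) (G' p y) y" "sm d K n G'"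
    using sm_SucE[OF Suc.prems(2)] by metis
  show ?case using Suc F' G' growth_add
    by (intro sm_SucI[of _ _ _ "\<lambda>p y. F' p y + G' p y"]) (auto intro!: growth_add derivative_intros)
qed (auto intro: growth_add)

lemma sm_linear:
  assumes h: "bounded_linear h"
  shows "sm d K n F \<Longrightarrow> sm d K n (\<lambda>p y. h (F p y))"
proof (induction n arbitrary: F)
  case (Suc n)
  obtain F' where "\<And>p y. p \<in> K \<Longrightarrow> y \<ge> 0 \<Longrightarrow> hderiv (F p) (F' p y) y" "sm d K n F'"
    using sm_SucE[OF Suc.prems(1)] by metis
  then show ?case using Suc growth_linear[OF h]
    by (intro sm_SucI[of _ _ _ "\<lambda>p y. h (F' p y)"])
       (auto intro!: bounded_linear.has_vector_derivative[OF h])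
qed (auto intro: growth_linear[OF h])

lemma sm_mult:
  fixes F G :: "'p \<Rightarrow> real \<Rightarrow> 'a::{real_normed_field}"
  shows "sm d K n F \<Longrightarrow> sm e K n G \<Longrightarrow> sm (d \<or> e) K n (\<lambda>p y. F p y * G p y)"
proof (induction n arbitrary: F G)
  case (Suc n)
  obtain F' where F': "\<And>p y. p \<in> K \<Longrightarrow> y \<ge> 0 \<Longrightarrow> hderiv (F p) (F' p y) y" "sm d K n F'"
    using sm_SucE[OF Suc.prems(1)] by metis
  obtain G' where G': "\<And>p y. p \<in> K \<Longrightarrow> y \<ge> 0 \<Longrightarrow> hderiv (G p) (G' p y) y" "sm e K n G'"
    using sm_SucE[OF Suc.prems(2)] by metis
  show ?case using F' G' Suc.prems Suc.IH sm_SucD[OF Suc.prems(1)] sm_SucD[OF Suc.prems(2)]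
    by (intro sm_SucI[of _ _ _ "\<lambda>p y. F p y * G' p y + F' p y * G p y"])
      (auto simp del: sm.simps intro!: growth_mult sm_add has_vector_derivative_mult intro: sm_growth)
qed (auto intro: growth_mult)

lemma sm_mult_decay:
  fixes F G :: "'p \<Rightarrow> real \<Rightarrow> 'a::{real_normed_field}"
  shows "sm True K n F \<Longrightarrow> sm d K n G \<Longrightarrow> sm True K n (\<lambda>p y. F p y * G p y)"
    "sm d K n G \<Longrightarrow> sm True K n F \<Longrightarrow> sm True K n (\<lambda>p y. G p y * F p y)"
    "sm False K n F \<Longrightarrow> sm d K n G \<Longrightarrow> sm d K n (\<lambda>p y. F p y * G p y)"
    "sm d K n G \<Longrightarrow> sm False K n F \<Longrightarrow> sm d K n (\<lambda>p y. G p y * F p y)"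
    "sm d K n F \<Longrightarrow> sm d K n G \<Longrightarrow> sm d K n (\<lambda>p y. F p y * G p y)"
  using sm_mult[of True K n F d G] sm_mult[of d K n G True F] sm_mult[of False K n F d G]
    sm_mult[of d K n G False F] sm_mult[of d K n F d G] by auto

lemma sm_reindex:
  assumes "\<And>q. q \<in> L \<Longrightarrow> h q \<in> K"
  shows "sm d K n F \<Longrightarrow> sm d L n (\<lambda>q. F (h q))"
proof (induction n arbitrary: F)
  case (Suc n)
  obtain F' where "\<And>p y. p \<in> K \<Longrightarrow> y \<ge> 0 \<Longrightarrow> hderiv (F p) (F' p y) y" "sm d K n F'"
    using sm_SucE[OF Suc.prems(1)] by metis
  then show ?case using Suc assms
    by (intro sm_SucI[of _ _ _ "\<lambda>q. F' (h q)"]) (auto intro: growth_reindex[of L h K])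
qed (auto intro: growth_reindex assms)

lemma sm_zero: "sm d K n (\<lambda>p y. 0)"
proof (induction n)
  case 0
  show ?case by (auto simp: growth_def decays_def tempered_def intro!: exI[of _ 0] exI[of _ 1])
next
  case (Suc n)
  then show ?case by (intro sm_SucI[of _ _ _ "\<lambda>p y. 0"]) (auto simp del: sm.simps intro: sm_growth)
qed

lemma growth_bounded:
  assumes "\<And>p y. p \<in> K \<Longrightarrow> y \<ge> 0 \<Longrightarrow> norm (F p y) \<le> M"
  shows "growth False K F"
proof -
  have "norm (F p y) \<le> \<bar>M\<bar> * exp (\<rho> * y)" if "p \<in> K" "y \<ge> 0" "\<rho> > 0" for p y \<rho>
  proof -
    have "\<bar>M\<bar> * 1 \<le> \<bar>M\<bar> * exp (\<rho> * y)" using that by (intro mult_left_mono) auto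
    then show ?thesis using assms[OF that(1,2)] by linarith
  qed
  then show ?thesis unfolding growth_def tempered_def by auto
qed

lemma sm_const:
  assumes "\<And>p. p \<in> K \<Longrightarrow> norm (c p) \<le> M"
  shows "sm False K n (\<lambda>p y. c p)"
proof (cases n)
  case 0
  then show ?thesis by (auto intro!: growth_bounded assms)
next
  case (Suc m)
  show ?thesis unfolding Suc
    by (rule sm_SucI[of _ _ _ "\<lambda>p y. 0"]) (auto intro!: growth_bounded assms sm_zero)
qed

lemma sm_uminus: "sm d K n F \<Longrightarrow> sm d K n (\<lambda>p y. - F p y)"
  by (rule sm_linear[where h=uminus, OF bounded_linear_minus[OF bounded_linear_ident]])

lemma sm_diff: "sm d K n F \<Longrightarrow> sm d K n G \<Longrightarrow> sm d K n (\<lambda>p y. F p y - G p y)"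
  using sm_add[of d K n F "\<lambda>p y. - G p y"] sm_uminus[of d K n G] by simp

lemma sm_of_real:
  "sm d K n F \<Longrightarrow> sm d K n (\<lambda>p y. of_real (F p y) :: 'a::{real_normed_algebra_1,real_normed_field})"
  by (rule sm_linear[where h=of_real]) (auto intro: bounded_linear_of_real)

lemma sm_y: "sm False K n (\<lambda>p y. y :: real)"
proof -
  have g: "growth False K (\<lambda>p y. y :: real)"
  proof -
    have "\<bar>y\<bar> \<le> (1/\<rho>) * exp (\<rho> * y)" if "y \<ge> 0" "\<rho> > 0" for y \<rho> :: real
      proof -
      have "\<rho> * y \<le> exp (\<rho> * y)" using exp_ge_add_one_self[of "\<rho> * y"] by linarith
      then show ?thesis using that by (simp add: field_simps)
    qed
    then have "\<forall>p\<in>K. \<forall>y\<ge>0. norm y \<le> (1/\<rho>) * exp (\<rho> * y)" if "\<rho> > 0" for \<rho>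
      using that by auto
    then show ?thesis unfolding growth_def tempered_def by (metis (full_types))
  qed
  show ?thesis
  proof (cases n)
    case 0 then show ?thesis using g by simp
  next
    case (Suc m)
    show ?thesis unfolding Suc
      by (rule sm_SucI[of _ _ _ "\<lambda>p y. 1"])
        (auto intro!: g sm_const[where M=1] derivative_eq_intros simp: has_real_derivative_iff_has_vector_derivative[symmetric])
  qed
qed

lemma sm_power:
  fixes F :: "'p \<Rightarrow> real \<Rightarrow> 'a::{real_normed_field}"
  shows "sm False K n F \<Longrightarrow> sm False K n (\<lambda>p y. F p y ^ m)"
proof (induction m)
  case 0
  show ?case by (auto intro!: sm_const[where M=1])
next
  case (Suc m)
  then show ?case using sm_mult_decay(3)[of K n F False] by simp
qed

section \<open>Rational expressions in tanh\<close>

lemma tanh_bound: "\<bar>tanh x\<bar> \<le> (1::real)"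
  using tanh_real_bounds[of x] by auto

lemma hderiv_tanh2: "hderiv (\<lambda>y. tanh (2 * y :: real)) (2 * (1 - tanh (2 * y) ^ 2)) y"
  unfolding has_real_derivative_iff_has_vector_derivative[symmetric]
  by (auto intro!: derivative_eq_intros)

lemma sm_tanh: "sm False K n (\<lambda>p y. tanh (2 * y) :: real)"
proof (induction n)
  case 0
  show ?case unfolding sm.simps
    by (rule growth_bounded[where M=1]) (simp only: real_norm_def tanh_bound)
next
  case (Suc n)
  have "sm False K n (\<lambda>p y. 2 * (1 - tanh (2 * y) ^ 2) :: real)"
    by (intro sm_mult_decay(3) sm_diff sm_power Suc sm_const[where M=2]) auto
  then show ?case by (rule sm_SucI[OF sm_growth[OF Suc] hderiv_tanh2])
qed

lemma one_minus_mt_bound: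
  assumes "\<bar>m\<bar> \<le> q" "q < 1"
  shows "1 - q \<le> 1 - m * tanh (2 * y :: real)" "1 - m * tanh (2 * y) > 0"
proof -
  have "\<bar>m * tanh (2 * y)\<bar> \<le> q * 1"
    unfolding abs_mult using assms tanh_bound[of "2*y"] by (intro mult_mono) auto
  then show "1 - q \<le> 1 - m * tanh (2 * y :: real)" "1 - m * tanh (2 * y) > 0"
    using assms by linarith+
qed

text \<open>The derivative of r = 1 / (1 - m t) is 2 m (1 - t^2) r^2, again a polynomial in r and t,
  so the induction closes; |m| <= q < 1 keeps the denominator above 1 - q.\<close>

lemma sm_recip:
  fixes m :: "'p \<Rightarrow> real"
  assumes m: "\<And>p. p \<in> K \<Longrightarrow> \<bar>m p\<bar> \<le> q" and q: "q < 1"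
  shows "sm False K n (\<lambda>p y. 1 / (1 - m p * tanh (2 * y)) :: real)"
proof (induction n)
  case 0
  have "\<bar>1 / (1 - m p * tanh (2 * y))\<bar> \<le> 1 / (1 - q)" if "p \<in> K" for p y
    using one_minus_mt_bound[OF m[OF that] q, of y] q by (simp add: frac_le)
  then show ?case by (auto intro!: growth_bounded[where M="1/(1-q)"])
next
  case (Suc n)
  let ?r = "\<lambda>p y. 1 / (1 - m p * tanh (2 * y))"
  have M: "sm False K n (\<lambda>p y. m p)" by (rule sm_const[where M=q]) (use m in auto)
  have "sm False K n (\<lambda>p y. m p * (2 * (1 - tanh (2 * y) ^ 2)) * (?r p y * ?r p y))"
    by (intro sm_mult_decay(3) sm_diff sm_power Suc sm_const[where M=2] sm_tanh M) auto
  moreover have "hderiv (?r p) (m p * (2 * (1 - tanh (2 * y) ^ 2)) * (?r p y * ?r p y)) y" if "p \<in> K" for p y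
    unfolding has_real_derivative_iff_has_vector_derivative[symmetric]
    using one_minus_mt_bound[OF m[OF that] q, of y]
    by (auto intro!: derivative_eq_intros simp: field_simps power2_eq_square)
  ultimately show ?case
    using sm_growth[OF Suc]
    by (intro sm_SucI[of _ _ _ "\<lambda>p y. m p * (2 * (1 - tanh (2 * y) ^ 2)) * (?r p y * ?r p y)"]) auto
qed

text \<open>Makes one-sided derivatives unique also at the vertex, so that \<open>deriv_in\<close>
  returns the exhibited derivative.\<close>

lemma at_within_half_nontriv: "y \<ge> 0 \<Longrightarrow> at y within {0::real..} \<noteq> bot"
proof -
  assume "y \<ge> 0"
  have "y islimpt {y..y+1}" by (rule islimpt_Icc[THEN iffD2]) auto
  then have "y islimpt {0..}" by (rule islimpt_subset) (use \<open>y \<ge> 0\<close> in auto)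
  then show ?thesis by (simp add: trivial_limit_within)
qed

lemma deriv_in_half: "hderiv f f' y \<Longrightarrow> y \<ge> 0 \<Longrightarrow> deriv_in {0..} f y = f'"
  unfolding deriv_in_def by (rule vector_derivative_within) (auto simp: at_within_half_nontriv)

lemma hderiv_deriv_in: "hderiv f f' y \<Longrightarrow> y \<ge> 0 \<Longrightarrow> hderiv f (deriv_in {0..} f y) y"
  using deriv_in_half by metis

lemma sm_deriv_in: "sm d K (Suc n) F \<Longrightarrow> sm d K n (\<lambda>p y. deriv_in {0..} (F p) y)"
proof -
  assume "sm d K (Suc n) F"
  then obtain F' where F': "\<And>p y. p \<in> K \<Longrightarrow> y \<ge> 0 \<Longrightarrow> hderiv (F p) (F' p y) y" "sm d K n F'"
    by auto
  show ?thesis by (rule sm_cong[OF F'(2)]) (use F'(1) deriv_in_half in metis)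
qed

lemma sm_hderiv: "sm d K (Suc n) F \<Longrightarrow> p \<in> K \<Longrightarrow> y \<ge> 0 \<Longrightarrow> hderiv (F p) (deriv_in {0..} (F p) y) y"
  by (auto intro: hderiv_deriv_in)

lemma sm_continuous: "sm d K (Suc n) F \<Longrightarrow> p \<in> K \<Longrightarrow> continuous_on {0..} (F p)"
  unfolding continuous_on_eq_continuous_within
  by (intro ballI has_vector_derivative_continuous[OF sm_hderiv[of d K n F p]]) (auto simp del: sm.simps)

lemma deriv_in_cong: "(\<And>y. y \<ge> 0 \<Longrightarrow> f y = g y) \<Longrightarrow> y \<ge> 0 \<Longrightarrow> deriv_in {0..} f y = deriv_in {0..} g y"
proof -
  assume a: "\<And>y. y \<ge> 0 \<Longrightarrow> f y = g y" "y \<ge> 0"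
  have "hderiv f v y \<longleftrightarrow> hderiv g v y" for v
    using hderiv_cong[of f g v y] hderiv_cong[of g f v y] a by auto
  then show ?thesis unfolding deriv_in_def vector_derivative_def by simp
qed

lemma iter_deriv_in_cong:
  "(\<And>y. y \<ge> 0 \<Longrightarrow> f y = g y) \<Longrightarrow> y \<ge> 0 \<Longrightarrow> (deriv_in {0..} ^^ m) f y = (deriv_in {0..} ^^ m) g y"
proof (induction m arbitrary: y)
  case (Suc m)
  then show ?case using deriv_in_cong[of "(deriv_in {0..} ^^ m) f" "(deriv_in {0..} ^^ m) g" y] by auto
qed auto

lemma sm_iter_deriv_in: "sm d K (m + n) F \<Longrightarrow> sm d K n (\<lambda>p y. (deriv_in {0..} ^^ m) (F p) y)"
proof (induction m arbitrary: n)
  case (Suc m)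
  from Suc.IH[of "Suc n"] Suc.prems have "sm d K (Suc n) (\<lambda>p y. (deriv_in {0..} ^^ m) (F p) y)"
    by (simp del: sm.simps)
  from sm_deriv_in[OF this] show ?case by simp
qed auto

text \<open>One order more than in the conclusion: continuity of the \<open>n\<close>-th derivative
  is obtained from its differentiability.\<close>

lemma Ck_on_sm:
  assumes "sm d K (Suc n) F" "p \<in> K"
  shows "Ck_on {0..} n (F p)"
  unfolding Ck_on_def
proof (intro conjI allI impI ballI)
  fix m and y :: real assume "m < n" "y \<in> {0..}"
  then have "sm d K (Suc 0) (\<lambda>p y. (deriv_in {0..} ^^ m) (F p) y)"
    by (intro sm_iter_deriv_in sm_le[OF assms(1)]) auto
  from sm_hderiv[OF this assms(2)] \<open>y \<in> {0..}\<close>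
  show "(deriv_in {0..} ^^ m) (F p) differentiable at y within {0..}"
    using vector_derivative_works differentiableI_vector by fastforce
next
  have "sm d K (Suc 0) (\<lambda>p y. (deriv_in {0..} ^^ n) (F p) y)"
    by (intro sm_iter_deriv_in sm_le[OF assms(1)]) auto
  from sm_continuous[OF this assms(2)]
  show "continuous_on {0..} ((deriv_in {0..} ^^ n) (F p))" by simp
qed

lemma iter_deriv_in_cmult:
  fixes F :: "'p \<Rightarrow> real \<Rightarrow> complex"
  assumes "sm d K n F" "p \<in> K" "m \<le> n" "y \<ge> 0"
  shows "(deriv_in {0..} ^^ m) (\<lambda>y. c * F p y) y = c * (deriv_in {0..} ^^ m) (F p) y"
  using assms(3,4)
proof (induction m arbitrary: y)
  case (Suc m)
  have "sm d K (Suc 0) (\<lambda>p y. (deriv_in {0..} ^^ m) (F p) y)"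
    using Suc by (intro sm_iter_deriv_in sm_le[OF assms(1)]) auto
  from sm_hderiv[OF this assms(2) Suc.prems(2)]
  have *: "hderiv (\<lambda>y. c * (deriv_in {0..} ^^ m) (F p) y) (c * deriv_in {0..} ((deriv_in {0..} ^^ m) (F p)) y) y"
    by (intro has_vector_derivative_mult_right) auto
  have "deriv_in {0..} ((deriv_in {0..} ^^ m) (\<lambda>y. c * F p y)) y
      = deriv_in {0..} (\<lambda>y. c * (deriv_in {0..} ^^ m) (F p) y) y"
    by (rule deriv_in_cong) (use Suc in auto)
  also have "\<dots> = c * deriv_in {0..} ((deriv_in {0..} ^^ m) (F p)) y"
    by (rule deriv_in_half[OF *]) (use Suc in auto)
  finally show ?case by simp
qed auto

text \<open>\<open>Cexp_norm\<close> uses one rate for all orders of differentiation, hence the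
  minimum of finitely many rates.\<close>

lemma decays_finite_uniform:
  assumes "finite I" "\<And>i. i \<in> I \<Longrightarrow> decays K (F i)"
  obtains C \<rho> where "C > 0" "\<rho> > 0"
    "\<And>i p y. i \<in> I \<Longrightarrow> p \<in> K \<Longrightarrow> y \<ge> 0 \<Longrightarrow> norm (F i p y) \<le> C * exp (- (\<rho> * y))"
proof -
  have "\<exists>C>0. \<exists>\<rho>>0. \<forall>i\<in>I. \<forall>p\<in>K. \<forall>y\<ge>0. norm (F i p y) \<le> C * exp (- (\<rho> * y))"
    using assms
  proof (induction I rule: finite_induct)
    case empty
    show ?case by (auto intro!: exI[of _ 1])
  next
    case (insert i I)
    then obtain C \<rho> where C: "C > 0" "\<rho> > 0"
      and b: "\<And>i p y. i \<in> I \<Longrightarrow> p \<in> K \<Longrightarrow> y \<ge> 0 \<Longrightarrow> norm (F i p y) \<le> C * exp (- (\<rho> * y))"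
      by auto
    have "decays K (F i)" using insert by auto
    then obtain C' \<rho>' where C': "C' > 0" "\<rho>' > 0"
      and b': "\<And>p y. p \<in> K \<Longrightarrow> y \<ge> 0 \<Longrightarrow> norm (F i p y) \<le> C' * exp (- (\<rho>' * y))"
      using decaysE[of K "F i"] by metis
    have e1: "C * exp (- (\<rho> * y)) \<le> max C C' * exp (- (min \<rho> \<rho>' * y))" if "y \<ge> 0" for y
      using that C by (intro mult_mono) (auto intro: mult_right_mono)
    have e2: "C' * exp (- (\<rho>' * y)) \<le> max C C' * exp (- (min \<rho> \<rho>' * y))" if "y \<ge> 0" for y
      using that C' by (intro mult_mono) (auto intro: mult_right_mono)
    show ?case
    proof (rule exI[of _ "max C C'"], rule conjI[OF _ exI[of _ "min \<rho> \<rho>'"]],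
        goal_cases)
      case 2
      show ?case
      proof (intro conjI ballI allI impI)
      fix k p y assume k: "k \<in> insert i I" "p \<in> K" "0 \<le> (y::real)"
      then show "norm (F k p y) \<le> max C C' * exp (- (min \<rho> \<rho>' * y))"
        using b[of k p y] b'[of p y] e1[of y] e2[of y] by force
      qed (use C C' in auto)
    qed (use C C' in auto)
  qed
  then show thesis using that by blast
qed

text \<open>The rate and the constant belong to the family, while the scalar \<open>c\<close>
  carries the size. An error bound results from writing the error as its expected size times a
  member of a bounded family.\<close>

lemma sm_Cexp_norm:
  assumes "sm True K \<nu> (F :: 'p \<Rightarrow> real \<Rightarrow> complex)"
  obtains \<rho> C where "\<rho> > 0" "C > 0" "\<And>p c f. p \<in> K \<Longrightarrow> (\<And>i y. i < N \<Longrightarrow> y \<ge> 0 \<Longrightarrow> f i y = c * F p y) \<Longrightarrow>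
     Cexp_norm N \<nu> \<rho> f \<le> ennreal (C * norm c)"
proof -
  have "decays K (\<lambda>p y. (deriv_in {0..} ^^ m) (F p) y)" if "m \<in> {..\<nu>}" for m
    using sm_growth[OF sm_iter_deriv_in[of True K m 0 F]] sm_le[OF assms, of m] that by (auto simp: growth_def)
  from decays_finite_uniform[where I="{..\<nu>}" and F="\<lambda>m p y. (deriv_in {0..} ^^ m) (F p) y", OF _ this] obtain C \<rho> where C: "C > 0" "\<rho> > 0"
    and b: "\<And>m p y. m \<in> {..\<nu>} \<Longrightarrow> p \<in> K \<Longrightarrow> y \<ge> 0 \<Longrightarrow> norm ((deriv_in {0..} ^^ m) (F p) y) \<le> C * exp (- (\<rho> * y))"
    by blast
  show thesis
  proof (rule that[OF C(2) C(1)])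
    fix p c and f :: "nat \<Rightarrow> real \<Rightarrow> complex"
    assume p: "p \<in> K" and f: "\<And>i y. i < N \<Longrightarrow> y \<ge> 0 \<Longrightarrow> f i y = c * F p y"
    have "exp (\<rho> * \<bar>y\<bar>) * cmod ((edge_deriv ^^ m) (f i) y) \<le> C * norm c" if "m \<le> \<nu>" "i < N" "y \<ge> 0" for m i y
    proof -
      have "(edge_deriv ^^ m) (f i) y = c * (edge_deriv ^^ m) (F p) y"
        using iter_deriv_in_cong[of "f i" "\<lambda>y. c * F p y" y m] f that
          iter_deriv_in_cmult[OF assms p that(1,3), of c] by auto
      then have "exp (\<rho> * \<bar>y\<bar>) * cmod ((edge_deriv ^^ m) (f i) y)
          = exp (\<rho> * y) * (cmod c * cmod ((edge_deriv ^^ m) (F p) y))"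
        using that by (simp add: norm_mult)
      also have "\<dots> \<le> exp (\<rho> * y) * (cmod c * (C * exp (- (\<rho> * y))))"
        using b[of m p y] that p by (intro mult_left_mono) auto
      also have "\<dots> = C * norm c" by (simp add: exp_minus field_simps)
      finally show ?thesis .
    qed
    then show "Cexp_norm N \<nu> \<rho> f \<le> ennreal (C * norm c)"
      unfolding Cexp_norm_def by (auto intro!: SUP_least ennreal_leI)
  qed
qed

section \<open>Integration over the half line\<close>

abbreviation hint :: "(real \<Rightarrow> 'a::{banach, second_countable_topology}) \<Rightarrow> 'a" where
  "hint f \<equiv> (LINT y:{0..}|lborel. f y)"

abbreviation hintegrable :: "(real \<Rightarrow> 'a::{banach, second_countable_topology}) \<Rightarrow> bool" where
  "hintegrable \<equiv> set_integrable lborel {0..}"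

lemma exp_hintegrable:
  assumes "\<rho> > 0"
  shows "hintegrable (\<lambda>y. C * exp (- (\<rho> * y)) :: real)"
proof -
  have "(\<lambda>y. exp (- \<rho> * y)) absolutely_integrable_on {0::real..}"
    by (rule nonnegative_absolutely_integrable_1) (use integrable_on_exp_minus_to_infinity[OF assms, of 0] in auto)
  then have "hintegrable (\<lambda>y. exp (- \<rho> * y) :: real)"
    unfolding set_integrable_def by (rule integrable_completion[THEN iffD1, rotated]) auto
  then show ?thesis by (intro set_integrable_mult_right) simp
qed

lemma hint_exp:
  assumes "\<rho> > 0"
  shows "hint (\<lambda>y. C * exp (- (\<rho> * y)) :: real) = C / \<rho>"
proof -
  have 1: "((\<lambda>y. exp (- \<rho> * y)) has_integral exp (- \<rho> * 0) / \<rho>) {0::real..}"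
    by (rule has_integral_exp_minus_to_infinity[OF assms])
  have "hintegrable (\<lambda>y. exp (- (\<rho> * y)) :: real)" using exp_hintegrable[OF assms, of 1] by simp
  from set_borel_integral_eq_integral(2)[OF this] 1
  have "hint (\<lambda>y. exp (- (\<rho> * y)) :: real) = 1 / \<rho>" by (simp add: integral_unique)
  then show ?thesis by simp
qed

lemma hborel_continuous:
  fixes f :: "real \<Rightarrow> 'a::{banach, second_countable_topology}"
  shows "continuous_on {0..} f \<Longrightarrow> set_borel_measurable lborel {0..} f"
  unfolding set_borel_measurable_def by (simp add: borel_measurable_continuous_on_indicator)

lemma decay_hintegrable:
  fixes f :: "real \<Rightarrow> 'a::{banach, second_countable_topology}"
  assumes "continuous_on {0..} f" "\<rho> > 0" "\<And>y. y \<ge> 0 \<Longrightarrow> norm (f y) \<le> C * exp (- (\<rho> * y))"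
  shows "hintegrable f"
proof (rule set_integrable_bound[OF exp_hintegrable[OF assms(2), of C] hborel_continuous[OF assms(1)]])
  show "AE y in lborel. y \<in> {0..} \<longrightarrow> norm (f y) \<le> norm (C * exp (- (\<rho> * y)))"
    using assms(3) by (auto intro!: AE_I2 order_trans[OF assms(3)])
qed

lemma sm_hintegrable:
  fixes F :: "'p \<Rightarrow> real \<Rightarrow> 'a::{banach, second_countable_topology}"
  assumes "sm True K (Suc n) F" "p \<in> K"
  shows "hintegrable (F p)"
proof -
  obtain C \<rho> where "C > 0" "\<rho> > 0" "\<And>p y. p \<in> K \<Longrightarrow> y \<ge> 0 \<Longrightarrow> norm (F p y) \<le> C * exp (- (\<rho> * y))"
    using decaysE[of K F] sm_growth[OF assms(1)] by (auto simp: growth_def)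
  then show ?thesis using decay_hintegrable[of "F p" \<rho> C] sm_continuous[OF assms] assms(2) by auto
qed

lemma hint_bound:
  fixes f :: "real \<Rightarrow> 'a::{banach, second_countable_topology}"
  assumes "continuous_on {0..} f" "\<rho> > 0" "\<And>y. y \<ge> 0 \<Longrightarrow> norm (f y) \<le> C * exp (- (\<rho> * y))"
  shows "norm (hint f) \<le> C / \<rho>"
proof -
  have "norm (hint f) \<le> hint (\<lambda>y. norm (f y))"
    using set_integral_norm_bound[OF decay_hintegrable[OF assms]] by simp
  also have "\<dots> \<le> hint (\<lambda>y. C * exp (- (\<rho> * y)))"
    by (rule set_integral_mono[OF set_integrable_norm[OF decay_hintegrable[OF assms]] exp_hintegrable[OF assms(2)]])
      (use assms in auto)
  finally show ?thesis by (simp only: hint_exp[OF assms(2)])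
qed

lemma hderiv_Icc: "hderiv f f' y \<Longrightarrow> a \<ge> 0 \<Longrightarrow> (f has_vector_derivative f') (at y within {a..b})"
  by (erule has_vector_derivative_within_subset) auto

text \<open>Integration by parts on an edge: decay removes the boundary term at infinity and only
  the vertex value survives, with the sign of a lower end point.\<close>

lemma hint_deriv:
  fixes f :: "real \<Rightarrow> 'a::euclidean_space"
  assumes d: "\<And>y. y \<ge> 0 \<Longrightarrow> hderiv f (f' y) y" and c: "continuous_on {0..} f'"
    and b: "\<rho> > 0" "\<And>y. y \<ge> 0 \<Longrightarrow> norm (f y) \<le> C * exp (- (\<rho> * y))"
    and i: "hintegrable f'"
  shows "hint f' = - f 0"
proof -
  have "((\<lambda>b. LINT y:{0..b}|lborel. f' y) \<longlongrightarrow> hint f') at_top"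
    by (rule tendsto_set_lebesgue_integral_at_top[OF _ i]) auto
  moreover have "eventually (\<lambda>b. f b - f 0 = (LINT y:{0..b}|lborel. f' y)) at_top"
    using eventually_ge_at_top[of 0]
  proof eventually_elim
    case (elim b)
    show ?case unfolding set_lebesgue_integral_def
      by (subst integral_FTC_Icc[of 0 b f f'])
        (use elim d in \<open>auto intro: hderiv_Icc continuous_on_subset[OF c]\<close>)
  qed
  ultimately have "((\<lambda>b. f b - f 0) \<longlongrightarrow> hint f') at_top"
    by (subst tendsto_cong) auto
  moreover have "(f \<longlongrightarrow> 0) at_top"
  proof (rule Lim_null_comparison)
    show "eventually (\<lambda>y. norm (f y) \<le> C * exp (- (\<rho> * y))) at_top"
      using eventually_ge_at_top[of 0] by eventually_elim (rule b)
    have "filterlim (\<lambda>y. \<rho> * y) at_top at_top"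
      using b(1) by (intro filterlim_tendsto_pos_mult_at_top[OF tendsto_const _ filterlim_ident])
    then have "((\<lambda>y. exp (- (\<rho> * y))) \<longlongrightarrow> 0) at_top"
      by (intro filterlim_compose[OF exp_at_bot]) (simp add: filterlim_uminus_at_bot)
    then show "((\<lambda>y. C * exp (- (\<rho> * y))) \<longlongrightarrow> 0) at_top"
      by (rule tendsto_mult_right_zero)
  qed
  then have "((\<lambda>b. f b - f 0) \<longlongrightarrow> 0 - f 0) at_top" by (intro tendsto_intros)
  ultimately show ?thesis
    using tendsto_unique[of at_top "\<lambda>b. f b - f 0" "hint f'" "0 - f 0"] by auto
qed

lemma sm_hint_deriv:
  fixes F :: "'p \<Rightarrow> real \<Rightarrow> 'a::euclidean_space"
  assumes "sm True K (Suc (Suc 0)) F" "p \<in> K" "\<And>y. y \<ge> 0 \<Longrightarrow> hderiv (F p) (f' y) y"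
  shows "hint f' = - F p 0"
proof -
  obtain C \<rho> where C: "C > 0" "\<rho> > 0" "\<And>p y. p \<in> K \<Longrightarrow> y \<ge> 0 \<Longrightarrow> norm (F p y) \<le> C * exp (- (\<rho> * y))"
    using decaysE[of K F] sm_growth[OF assms(1)] by (auto simp: growth_def simp del: sm.simps)
  note s = sm_deriv_in[OF assms(1)]
  have e: "deriv_in {0..} (F p) y = f' y" if "y \<ge> 0" for y
    by (rule deriv_in_half) (use assms that in auto)
  have "hint (\<lambda>y. deriv_in {0..} (F p) y) = - F p 0"
    by (rule hint_deriv[OF _ sm_continuous[OF s assms(2)] C(2) C(3)[OF assms(2)] sm_hintegrable[OF s assms(2)]])
      (use assms e in auto)
  moreover have "hint (\<lambda>y. deriv_in {0..} (F p) y) = hint f'"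
    by (rule set_lebesgue_integral_cong) (use e in auto)
  ultimately show ?thesis by simp
qed

lemma hderiv_integral:
  fixes f :: "real \<Rightarrow> real"
  assumes "continuous_on {0..} f" "y \<ge> 0"
  shows "hderiv (\<lambda>y. integral {0..y} f) (f y) y"
proof -
  have "((\<lambda>u. integral {0..u} f) has_vector_derivative f y) (at y within {0..y+1})"
    by (rule integral_has_vector_derivative) (use assms in \<open>auto intro: continuous_on_subset\<close>)
  moreover have "at y within {0..y+1} = at y within {0..}"
    by (rule at_within_nhd[of _ "{..<y+1}"]) auto
  ultimately show ?thesis by simp
qed

lemma integral_exp_le:
  fixes f :: "real \<Rightarrow> real"
  assumes c: "continuous_on {0..} f" and b: "\<And>y. y \<ge> 0 \<Longrightarrow> \<bar>f y\<bar> \<le> C * exp (k * y)"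
    and "k \<noteq> 0" "0 \<le> a" "a \<le> y"
  shows "\<bar>integral {a..y} f\<bar> \<le> C / k * (exp (k * y) - exp (k * a))"
proof -
  have i: "((\<lambda>z. C * exp (k * z)) has_integral (C / k * exp (k * y) - C / k * exp (k * a))) {a..y}"
    using assms by (intro fundamental_theorem_of_calculus)
      (auto intro!: derivative_eq_intros simp flip: has_real_derivative_iff_has_vector_derivative)
  then have "(\<lambda>z. C * exp (k * z)) integrable_on {a..y}" by blast
  moreover have "f integrable_on {a..y}"
    by (rule integrable_continuous_interval) (use assms in \<open>auto intro: continuous_on_subset\<close>)
  ultimately have "norm (integral {a..y} f) \<le> integral {a..y} (\<lambda>z. C * exp (k * z))"
    by (intro integral_norm_bound_integral) (use b assms(4) in \<open>auto simp del: integral_mult_right\<close>)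
  then show ?thesis by (simp only: integral_unique[OF i] real_norm_def right_diff_distrib)
qed

text \<open>The primitive that vanishes at infinity, that is, minus the tail integral. It keeps the
  rate of \<open>f\<close>; its value at the vertex is minus the full integral, and this is where a
  solvability condition becomes visible.\<close>

lemma decaying_primitive:
  fixes f :: "real \<Rightarrow> real"
  assumes c: "continuous_on {0..} f" and "\<rho> > 0"
    and b: "\<And>y. y \<ge> 0 \<Longrightarrow> \<bar>f y\<bar> \<le> C * exp (- (\<rho> * y))"
  obtains H where "\<And>y. y \<ge> 0 \<Longrightarrow> hderiv H (f y) y" "H 0 = - hint f"
    "\<And>y. y \<ge> 0 \<Longrightarrow> \<bar>H y\<bar> \<le> C / \<rho> * exp (- (\<rho> * y))"
proof
  let ?H = "\<lambda>y. integral {0..y} f - hint f"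
  show "hderiv ?H (f y) y" if "y \<ge> 0" for y
    using hderiv_integral[OF c that] by (auto intro!: derivative_eq_intros)
  show "?H 0 = - hint f" by simp
  have i: "hintegrable f" by (rule decay_hintegrable[OF c assms(2)]) (use b in auto)
  show "\<bar>?H y\<bar> \<le> C / \<rho> * exp (- (\<rho> * y))" if y: "y \<ge> 0" for y
  proof -
    have I: "f integrable_on {a..z}" if "a \<ge> 0" for a z
      by (rule integrable_continuous_interval) (use that c in \<open>auto intro: continuous_on_subset\<close>)
    have "((\<lambda>b. LINT z:{0..b}|lborel. f z) \<longlongrightarrow> hint f) at_top"
      by (rule tendsto_set_lebesgue_integral_at_top[OF _ i]) auto
    moreover have "(LINT z:{0..b}|lborel. f z) = integral {0..b} f" for b
      by (rule set_borel_integral_eq_integral) (rule set_integrable_subset[OF i], auto)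
    ultimately have "((\<lambda>b. integral {0..b} f) \<longlongrightarrow> hint f) at_top" by simp
    then have "((\<lambda>b. \<bar>integral {0..y} f - integral {0..b} f\<bar>) \<longlongrightarrow> \<bar>?H y\<bar>) at_top"
      by (intro tendsto_intros)
    then show ?thesis
    proof (rule tendsto_upperbound)
      show "eventually (\<lambda>b. \<bar>integral {0..y} f - integral {0..b} f\<bar> \<le> C / \<rho> * exp (- (\<rho> * y))) at_top"
        using eventually_ge_at_top[of y]
      proof eventually_elim
        case (elim b)
        have "integral {0..y} f + integral {y..b} f = integral {0..b} f"
          by (rule Henstock_Kurzweil_Integration.integral_combine) (use y elim I in auto)
        moreover have "\<bar>integral {y..b} f\<bar> \<le> C / (-\<rho>) * (exp (-\<rho> * b) - exp (-\<rho> * y))"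
          by (rule integral_exp_le) (use c b y elim assms in auto)
        moreover have "C \<ge> 0" using b[of 0] by simp
        then have "C / \<rho> * exp (- (\<rho> * b)) \<ge> 0" using assms by simp
        ultimately show ?case by (simp add: algebra_simps)
      qed
    qed auto
  qed
qed

text \<open>Strict positivity is tested at 1 and not at the vertex, because the integrand of
  interest, y^2 Q^2, vanishes at 0.\<close>

lemma hint_pos:
  fixes f :: "real \<Rightarrow> real"
  assumes c: "continuous_on {0..} f" and i: "hintegrable f" and n: "\<And>y. y \<ge> 0 \<Longrightarrow> f y \<ge> 0"
    and p: "f 1 > 0"
  shows "hint f > 0"
proof (rule ccontr)
  assume "\<not> ?thesis"
  have n0: "0 \<le> indicator {0..} y *\<^sub>R f y" for y using n by (auto simp: indicator_def)
  with \<open>\<not> ?thesis\<close> have z: "hint f = 0"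
    unfolding set_lebesgue_integral_def using integral_nonneg_AE[where M=lborel and f="\<lambda>y. indicator {0..} y *\<^sub>R f y"]
    by (auto intro: antisym)
  then have ae: "AE y in lborel. indicator {0..} y *\<^sub>R f y = 0"
    using integral_nonneg_eq_0_iff_AE[where M=lborel and f="\<lambda>y. indicator {0..} y *\<^sub>R f y"] i n0
    unfolding set_integrable_def set_lebesgue_integral_def by auto
  have "isCont f 1" using continuous_on_interior[OF c, of 1] by simp
  then obtain e where e: "e > 0" "\<And>y. dist y 1 < e \<Longrightarrow> dist (f y) (f 1) < f 1"
    unfolding continuous_at_eps_delta using p by blast
  then have e: "e > 0" "\<And>y. dist y 1 < e \<Longrightarrow> f y > 0"
    by (force simp: dist_real_def)+
  have "AE y in lborel. y \<notin> {1<..<1+e}"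
    using ae
  proof eventually_elim
    case (elim y)
    then show ?case using e(2)[of y] by (auto simp: dist_real_def indicator_def)
  qed
  then have "emeasure lborel {1<..<1+e} = 0"
    by (subst (asm) AE_iff_measurable[OF _ refl]) (auto simp: greaterThanLessThan_eq Int_def)
  then show False using e(1) by simp
qed

section \<open>The linearized operators at the solitary wave\<close>

abbreviation smi :: "bool \<Rightarrow> (real \<Rightarrow> real) \<Rightarrow> bool" where
  "smi d f \<equiv> (\<forall>n. sm d {()} n (\<lambda>_. f))"

abbreviation th :: "real \<Rightarrow> real" where "th y \<equiv> tanh (2 * y)"

text \<open>Green's function: the solution built from \<open>u1\<close>, decaying at infinity, and \<open>u2\<close>; the last
  hypothesis on \<open>u2\<close> makes the solution satisfy the Neumann condition.\<close>

lemma variation_of_parameters: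
  fixes u1 u2 u1' u2' w f :: "real \<Rightarrow> real"
  assumes d: "\<And>y. y \<ge> 0 \<Longrightarrow> hderiv u1 (u1' y) y" "\<And>y. y \<ge> 0 \<Longrightarrow> hderiv u2 (u2' y) y"
      "\<And>y. y \<ge> 0 \<Longrightarrow> hderiv u1' (w y * u1 y) y" "\<And>y. y \<ge> 0 \<Longrightarrow> hderiv u2' (w y * u2 y) y"
    and W: "\<And>y. y \<ge> 0 \<Longrightarrow> u1 y * u2' y - u1' y * u2 y = W" "W \<noteq> 0"
    and b: "\<And>y. y \<ge> 0 \<Longrightarrow> \<bar>u1 y\<bar> \<le> M * exp (- y)" "\<And>y. y \<ge> 0 \<Longrightarrow> \<bar>u1' y\<bar> \<le> M * exp (- y)"
      "\<And>y. y \<ge> 0 \<Longrightarrow> \<bar>u2 y\<bar> \<le> M * exp y" "\<And>y. y \<ge> 0 \<Longrightarrow> \<bar>u2' y\<bar> \<le> M * exp y"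
    and w: "smi False w" and f: "smi True f"
    and N: "u2' 0 * hint (\<lambda>y. u1 y * f y) = 0"
  obtains u u' where "smi True u" "u' 0 = 0"
    "\<And>y. y \<ge> 0 \<Longrightarrow> hderiv u (u' y) y" "\<And>y. y \<ge> 0 \<Longrightarrow> hderiv u' (w y * u y - f y) y"
proof -
  have M: "M \<ge> 0" using b(1)[of 0] by simp
  have cf: "continuous_on {0..} f" using sm_continuous[of True "{()}" 0 "\<lambda>_. f"] f by blast
  have cu: "continuous_on {0..} u1" "continuous_on {0..} u2"
    unfolding continuous_on_eq_continuous_within
    using d has_vector_derivative_continuous by fastforce+
  have "decays {()} (\<lambda>_. f)" using sm_growth[OF f[rule_format, of 0]] by (simp add: growth_def)
  then obtain C r0 where C: "C > 0" "r0 > 0"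
    and Cb0: "\<And>p y. p \<in> {()} \<Longrightarrow> y \<ge> 0 \<Longrightarrow> norm (f y) \<le> C * exp (- (r0 * y))"
    by (rule decaysE) blast
  \<comment> \<open>The cap at 1/2 keeps \<open>r < 1\<close>, so that \<open>u2 * f\<close> is
    bounded by an exponential of positive rate \<open>1 - r\<close>.\<close>
  define r where "r = min r0 (1/2)"
  have r: "r > 0" "r < 1" using C by (auto simp: r_def)
  have Cb: "\<bar>f y\<bar> \<le> C * exp (- (r * y))" if "y \<ge> 0" for y
  proof -
    have "C * exp (- (r0 * y)) \<le> C * exp (- (r * y))"
      using C that by (auto simp: r_def intro: mult_right_mono)
    then show ?thesis using Cb0[of "()" y] that by auto
  qed
  have b2: "\<bar>u2 y * f y\<bar> \<le> (M * C) * exp ((1 - r) * y)" if "y \<ge> 0" for y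
  proof -
    have "\<bar>u2 y * f y\<bar> \<le> (M * exp y) * (C * exp (- (r * y)))"
      unfolding abs_mult using b(3)[OF that] Cb[OF that] M by (intro mult_mono) auto
    also have "\<dots> = (M * C) * (exp y * exp (- (r * y)))" by simp
    also have "exp y * exp (- (r * y)) = exp ((1 - r) * y)"
      by (simp add: exp_add[symmetric] algebra_simps)
    finally show ?thesis .
  qed
  have b1: "\<bar>u1 y * f y\<bar> \<le> (M * C) * exp (- ((1 + r) * y))" if "y \<ge> 0" for y
  proof -
    have "\<bar>u1 y * f y\<bar> \<le> (M * exp (- y)) * (C * exp (- (r * y)))"
      unfolding abs_mult using b(1)[OF that] Cb[OF that] M by (intro mult_mono) auto
    also have "\<dots> = (M * C) * (exp (- y) * exp (- (r * y)))" by simp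
    also have "exp (- y) * exp (- (r * y)) = exp (- ((1 + r) * y))"
      by (simp add: exp_add[symmetric] algebra_simps)
    finally show ?thesis .
  qed
  define A where "A y = integral {0..y} (\<lambda>y. u2 y * f y)" for y
  have A': "hderiv A (u2 y * f y) y" if "y \<ge> 0" for y
    unfolding A_def by (rule hderiv_integral) (use cu cf that in \<open>auto intro: continuous_intros\<close>)
  have A0: "A 0 = 0" by (simp add: A_def)
  have Ab: "\<bar>A y\<bar> \<le> (M * C / (1 - r)) * exp ((1 - r) * y)" if "y \<ge> 0" for y
  proof -
    have "\<bar>A y\<bar> \<le> M * C / (1 - r) * (exp ((1 - r) * y) - exp ((1 - r) * 0))"
      unfolding A_def by (rule integral_exp_le) (use b2 cu cf r that in \<open>auto intro: continuous_intros\<close>)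
    also have "\<dots> \<le> M * C / (1 - r) * exp ((1 - r) * y)"
      using M C r by (intro mult_left_mono) auto
    finally show ?thesis .
  qed
  obtain H where H': "\<And>y. y \<ge> 0 \<Longrightarrow> hderiv H (u1 y * f y) y" and H0: "H 0 = - hint (\<lambda>y. u1 y * f y)"
    and Hb: "\<And>y. y \<ge> 0 \<Longrightarrow> \<bar>H y\<bar> \<le> M * C / (1 + r) * exp (- ((1 + r) * y))"
    by (rule decaying_primitive[of "\<lambda>y. u1 y * f y" "1 + r" "M * C"])
      (use b1 cu cf r in \<open>auto intro: continuous_intros\<close>)
  \<comment> \<open>\<open>A\<close> integrates the product with \<open>u2\<close> from the vertex,
    \<open>H\<close> the product with \<open>u1\<close> from infinity. In \<open>u1 * A\<close> and
    in \<open>u2 * H\<close> the rates 1 cancel and \<open>exp (- (r * y))\<close> is left.\<close>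
  define D where "D = (M * (M * C / (1 - r)) + M * (M * C / (1 + r))) / \<bar>W\<bar>"
  have bound: "\<bar>(p * A y - q * H y) / W\<bar> \<le> D * exp (- (r * y))"
    if "y \<ge> 0" "\<bar>p\<bar> \<le> M * exp (- y)" "\<bar>q\<bar> \<le> M * exp y" for p q y
  proof -
    have "\<bar>p * A y\<bar> \<le> (M * exp (- y)) * ((M * C / (1 - r)) * exp ((1 - r) * y))"
      unfolding abs_mult using that Ab[OF that(1)] M by (intro mult_mono) auto
    also have "\<dots> = (M * (M * C / (1 - r))) * (exp (- y) * exp ((1 - r) * y))" by simp
    also have "exp (- y) * exp ((1 - r) * y) = exp (- (r * y))"
      by (simp add: exp_add[symmetric] algebra_simps)
    finally have 1: "\<bar>p * A y\<bar> \<le> (M * (M * C / (1 - r))) * exp (- (r * y))" .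
    have "\<bar>q * H y\<bar> \<le> (M * exp y) * ((M * C / (1 + r)) * exp (- ((1 + r) * y)))"
      unfolding abs_mult using that Hb[OF that(1)] M by (intro mult_mono) auto
    also have "\<dots> = (M * (M * C / (1 + r))) * (exp y * exp (- ((1 + r) * y)))" by simp
    also have "exp y * exp (- ((1 + r) * y)) = exp (- (r * y))"
      by (simp add: exp_add[symmetric] algebra_simps)
    finally have 2: "\<bar>q * H y\<bar> \<le> (M * (M * C / (1 + r))) * exp (- (r * y))" .
    have "\<bar>p * A y - q * H y\<bar> \<le> (M * (M * C / (1 - r)) + M * (M * C / (1 + r))) * exp (- (r * y))"
      using 1 2 by (simp add: distrib_right)
    then show ?thesis using W(2) by (simp add: D_def abs_divide divide_right_mono)
  qed
  define u where "u y = (u1 y * A y - u2 y * H y) / W" for y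
  define u' where "u' y = (u1' y * A y - u2' y * H y) / W" for y
  have gu: "growth True {()} (\<lambda>_. u)" "growth True {()} (\<lambda>_. u')"
    unfolding growth_def u_def u'_def using bound b r by (auto intro!: decaysI[of r _ _ D])
  have du: "hderiv u (u' y) y" if "y \<ge> 0" for y
  proof -
    have "hderiv u ((u1' y * A y + u1 y * (u2 y * f y) - (u2' y * H y + u2 y * (u1 y * f y))) / W) y"
      unfolding u_def using d[OF that] A'[OF that] H'[OF that]
      unfolding has_real_derivative_iff_has_vector_derivative[symmetric]
      by (auto intro!: derivative_eq_intros simp: W(2))
    then show ?thesis by (simp add: u'_def mult_ac)
  qed
  have du': "hderiv u' (w y * u y - f y) y" if "y \<ge> 0" for y
  proof -
    have "hderiv u' ((w y * u1 y * A y + u1' y * (u2 y * f y) - (w y * u2 y * H y + u2' y * (u1 y * f y))) / W) y"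
      unfolding u'_def using d[OF that] A'[OF that] H'[OF that]
      unfolding has_real_derivative_iff_has_vector_derivative[symmetric]
      by (auto intro!: derivative_eq_intros simp: W(2))
    moreover have "(w y * u1 y * A y + u1' y * (u2 y * f y) - (w y * u2 y * H y + u2' y * (u1 y * f y)))
        = w y * (u1 y * A y - u2 y * H y) - (u1 y * u2' y - u1' y * u2 y) * f y" by algebra
    moreover have "(w y * (u1 y * A y - u2 y * H y) - W * f y) / W = w y * u y - f y"
      unfolding u_def using W(2) by (simp add: field_simps)
    ultimately show ?thesis by (simp only: W(1)[OF that])
  qed
  \<comment> \<open>Bootstrap: the equation expresses the second derivative through \<open>u\<close>
    and \<open>f\<close>, so each order of regularity yields the next.\<close>
  have "sm True {()} n (\<lambda>_. u) \<and> sm True {()} n (\<lambda>_. u')" for n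
  proof (induction n)
    case 0
    show ?case using gu by simp
  next
    case (Suc n)
    have S: "sm True {()} n (\<lambda>_ y. w y * u y - f y)"
      by (rule sm_diff[OF sm_mult_decay(2)[OF w[rule_format] conjunct1[OF Suc.IH]] f[rule_format]])
    have "sm True {()} (Suc n) (\<lambda>_. u')" by (rule sm_SucI[OF gu(2) du' S])
    moreover have "sm True {()} (Suc n) (\<lambda>_. u)" by (rule sm_SucI[OF gu(1) du conjunct2[OF Suc.IH]])
    ultimately show ?case by (rule conjI[rotated])
  qed
  \<comment> \<open>As \<open>A 0 = 0\<close>, only the term \<open>u2' 0 * H 0\<close> is left, and
    hypothesis \<open>N\<close> removes it.\<close>
  moreover have "u' 0 = 0" using N A0 H0 by (simp add: u'_def)
  ultimately show thesis using that[of u u'] du du' by auto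
qed

section \<open>The soliton and its growing companion\<close>

definition qr :: "real \<Rightarrow> real" where "qr y = 3 powr (1/4) * cosh (2 * y) powr (-1/2)"
text \<open>This is sqrt 3 / Q. The growing solutions of both homogeneous equations are polynomials
  in tanh times \<open>gr\<close>.\<close>

definition gr :: "real \<Rightarrow> real" where "gr y = cosh (2 * y) * qr y"

lemma Q_qr: "Q i y = complex_of_real (qr y)" by (simp add: Q_def qr_def)

lemma qr_pos: "qr y > 0" using cosh_real_pos[of "2*y"] by (simp add: qr_def)

lemma qr_sq: "qr y ^ 2 = sqrt 3 / cosh (2 * y)"
proof -
  have "qr y ^ 2 = (3 powr (1/4) * 3 powr (1/4)) * (cosh (2 * y) powr (-1/2) * cosh (2 * y) powr (-1/2))"
    by (simp add: qr_def power2_eq_square)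
  also have "\<dots> = 3 powr (1/2) * cosh (2 * y) powr (-1)"
    unfolding powr_add[symmetric] by simp
  also have "\<dots> = sqrt 3 * (1 / cosh (2 * y))"
    using cosh_real_pos[of "2*y"] by (simp only: powr_neg_one powr_half_sqrt)
  finally show ?thesis by simp
qed

lemma th_sq: "1 - th y ^ 2 = 1 / cosh (2 * y) ^ 2"
proof -
  have "1 - th y ^ 2 = (cosh (2 * y) ^ 2 - sinh (2 * y) ^ 2) / cosh (2 * y) ^ 2"
    using cosh_real_pos[of "2*y"] by (simp add: tanh_def power_divide diff_divide_distrib)
  then show ?thesis using hyperbolic_pythagoras[of "2 * y"] by simp
qed

lemma qr_4: "qr y ^ 4 = 3 * (1 - th y ^ 2)"
proof -
  have "qr y ^ 4 = (qr y ^ 2) ^ 2" by simp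
  then show ?thesis unfolding qr_sq th_sq by (simp add: power_divide)
qed

lemma hderiv_qr: "hderiv qr (- (th y * qr y)) y"
proof -
  have "((\<lambda>y. 3 powr (1/4) * cosh (2 * y) powr (-1/2)) has_real_derivative
      3 powr (1/4) * (-1/2 * cosh (2 * y) powr (-1/2 - 1) * (sinh (2 * y) * 2))) (at y within {0..})"
    using cosh_real_pos[of "2*y"] by (auto intro!: derivative_eq_intros)
  moreover have "cosh (2 * y) powr (-1/2 - 1) = cosh (2 * y) powr (-1/2) / cosh (2 * y)"
    using cosh_real_pos[of "2*y"] powr_diff[of "cosh (2 * y)" "-1/2" 1] by (simp only: powr_one less_imp_le)
  ultimately show ?thesis
    unfolding has_real_derivative_iff_has_vector_derivative[symmetric] qr_def[abs_def]
    by (simp add: tanh_def mult_ac)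
qed

lemma gr_qr: "gr y * qr y = sqrt 3"
  using qr_sq[of y] cosh_real_pos[of "2*y"] by (simp add: gr_def power2_eq_square field_simps)

lemma hderiv_gr: "hderiv gr (th y * gr y) y"
proof -
  have "hderiv (\<lambda>y. cosh (2 * y) * qr y) (cosh (2 * y) * - (th y * qr y) + sinh (2 * y) * 2 * qr y) y"
    using hderiv_qr[of y] unfolding has_real_derivative_iff_has_vector_derivative[symmetric]
    by (auto intro!: derivative_eq_intros)
  moreover have "sinh (2 * y) = cosh (2 * y) * th y" using cosh_real_pos[of "2*y"] by (simp add: tanh_def)
  ultimately show ?thesis unfolding gr_def[abs_def] by (simp add: algebra_simps)
qed

lemma qr_gr_bound:
  assumes "y \<ge> 0"
  shows "qr y \<le> 3 * exp (- y)" "gr y \<le> 3 * exp y"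
proof -
  have c: "exp (2 * y) / 2 \<le> cosh (2 * y)" by (simp add: cosh_field_def)
  have "qr y ^ 2 \<le> sqrt 3 / (exp (2 * y) / 2)"
    unfolding qr_sq by (intro divide_left_mono c) auto
  also have "\<dots> = 2 * sqrt 3 * exp (- y) ^ 2"
    by (simp add: exp_minus power2_eq_square exp_add[symmetric] field_simps)
  also have "\<dots> \<le> 9 * exp (- y) ^ 2"
    using real_sqrt_le_mono[of 3 4] by (intro mult_right_mono) auto
  finally have "qr y ^ 2 \<le> (3 * exp (- y)) ^ 2" by (simp add: power_mult_distrib)
  then show "qr y \<le> 3 * exp (- y)" by (rule power2_le_imp_le) simp
  have ch: "cosh (2 * y) \<le> exp (2 * y)" using assms by (simp add: cosh_field_def)
  have "gr y ^ 2 = sqrt 3 * cosh (2 * y)"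
    unfolding gr_def power_mult_distrib qr_sq using cosh_real_pos[of "2*y"] by (simp add: power2_eq_square)
  also have "\<dots> \<le> 9 * exp (2 * y)"
    using ch real_sqrt_le_mono[of 3 4] by (intro mult_mono) auto
  also have "\<dots> = (3 * exp y) ^ 2" by (simp add: power2_eq_square exp_add[symmetric])
  finally show "gr y \<le> 3 * exp y" by (rule power2_le_imp_le) simp
qed

lemma gr_pos: "gr y > 0" using cosh_real_pos[of "2*y"] qr_pos by (simp add: gr_def)

lemma sm_th: "sm False K n (\<lambda>p. th)" using sm_tanh .

lemma smi_qr: "smi True qr"
proof
  fix n show "sm True {()} n (\<lambda>_. qr)"
  proof (induction n)
    case 0
    show ?case using qr_gr_bound(1) less_imp_le[OF qr_pos]
      by (auto simp: growth_def intro!: decaysI[of 1 _ _ 3])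
  next
    case (Suc n)
    have "sm True {()} n (\<lambda>_ y. - (th y * qr y))"
      by (intro sm_uminus sm_mult_decay(2)[of False] sm_th Suc)
    then show ?case by (intro sm_SucI[OF sm_growth[OF Suc], of "\<lambda>_ y. - (th y * qr y)"]) (auto intro: hderiv_qr)
  qed
qed

lemma th_poly_bound:
  assumes "\<bar>t\<bar> \<le> (1::real)" shows "\<bar>t\<bar> * \<bar>a\<bar> \<le> \<bar>a\<bar>"
  using mult_right_mono[OF assms, of "\<bar>a\<bar>"] by simp

lemma th_abs: "\<bar>th y\<bar> \<le> 1" "th y ^ 2 \<le> 1" "0 \<le> th y ^ 2"
  using tanh_bound[of "2*y"] by (auto simp: abs_square_le_1)

text \<open>Here w = 1 - Q^4 and Q itself is the decaying solution. It satisfies the Neumann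
  condition, whereas the second solution \<open>th y * gr y\<close> has slope
  \<open>2 * gr 0\<close> at the vertex; orthogonality to Q is what makes the Neumann condition
  attainable.\<close>

lemma solve_minus:
  assumes f: "smi True f" and o: "hint (\<lambda>y. qr y * f y) = 0"
  obtains u u' where "smi True u" "u' 0 = 0"
    "\<And>y. y \<ge> 0 \<Longrightarrow> hderiv u (u' y) y" "\<And>y. y \<ge> 0 \<Longrightarrow> hderiv u' ((3 * th y ^ 2 - 2) * u y - f y) y"
proof (rule variation_of_parameters[where ?u1.0=qr and ?u1'.0="\<lambda>y. - (th y * qr y)" and
      ?u2.0="\<lambda>y. th y * gr y" and ?u2'.0="\<lambda>y. (2 - th y ^ 2) * gr y" and
      w="\<lambda>y. 3 * th y ^ 2 - 2" and f=f and W="2 * sqrt 3" and M=6])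
  fix y :: real assume y: "y \<ge> 0"
  note dd = hderiv_qr[of y] hderiv_gr[of y] hderiv_tanh2[of y]
  show "hderiv qr (- (th y * qr y)) y" by (rule hderiv_qr)
  show "hderiv (\<lambda>y. th y * gr y) ((2 - th y ^ 2) * gr y) y"
    "hderiv (\<lambda>y. - (th y * qr y)) ((3 * th y ^ 2 - 2) * qr y) y"
    "hderiv (\<lambda>y. (2 - th y ^ 2) * gr y) ((3 * th y ^ 2 - 2) * (th y * gr y)) y"
    using dd unfolding has_real_derivative_iff_has_vector_derivative[symmetric]
    by (auto intro!: derivative_eq_intros simp: algebra_simps power2_eq_square)
  have "qr y * ((2 - (th y)\<^sup>2) * gr y) - - (th y * qr y) * (th y * gr y) = 2 * (gr y * qr y)"
    by (simp add: algebra_simps power2_eq_square)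
  then show "qr y * ((2 - (th y)\<^sup>2) * gr y) - - (th y * qr y) * (th y * gr y) = 2 * sqrt 3"
    by (simp add: gr_qr)
  have e: "exp (-y) \<ge> 0" "exp y \<ge> 0" by auto
  have q: "\<bar>qr y\<bar> \<le> 3 * exp (- y)" "\<bar>gr y\<bar> \<le> 3 * exp y"
    using qr_gr_bound[OF y] less_imp_le[OF qr_pos] less_imp_le[OF gr_pos] by auto
  show "\<bar>qr y\<bar> \<le> 6 * exp (- y)" using q e by linarith
  show "\<bar>- (th y * qr y)\<bar> \<le> 6 * exp (- y)" "\<bar>th y * gr y\<bar> \<le> 6 * exp y"
    using th_poly_bound[OF th_abs(1)[of y], of "qr y"] th_poly_bound[OF th_abs(1)[of y], of "gr y"] q e
    unfolding abs_minus_cancel abs_mult by linarith+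
  have "\<bar>(2 - (th y)\<^sup>2) * gr y\<bar> \<le> 2 * (3 * exp y)"
    unfolding abs_mult using th_abs[of y] q by (intro mult_mono) linarith+
  then show "\<bar>(2 - (th y)\<^sup>2) * gr y\<bar> \<le> 6 * exp y" by simp
next
  show "smi False (\<lambda>y. 3 * th y ^ 2 - 2)"
    by (intro allI sm_diff sm_mult_decay(3) sm_power sm_th sm_const[where M=3]) auto
qed (use f o that in auto)

text \<open>Here w = 1 - 5 Q^4. The decaying solution is -Q', which is odd in y, and the growing one
  is even, so its slope at the vertex is 0 and no solvability condition arises.\<close>

lemma solve_plus:
  assumes f: "smi True f"
  obtains u u' where "smi True u" "u' 0 = 0"
    "\<And>y. y \<ge> 0 \<Longrightarrow> hderiv u (u' y) y" "\<And>y. y \<ge> 0 \<Longrightarrow> hderiv u' ((15 * th y ^ 2 - 14) * u y - f y) y"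
proof (rule variation_of_parameters[where ?u1.0="\<lambda>y. th y * qr y" and ?u1'.0="\<lambda>y. (2 - 3 * th y ^ 2) * qr y" and
      ?u2.0="\<lambda>y. (2 * th y ^ 2 - 1) * gr y" and ?u2'.0="\<lambda>y. th y * ((7 - 6 * th y ^ 2) * gr y)" and
      w="\<lambda>y. 15 * th y ^ 2 - 14" and f=f and W="2 * sqrt 3" and M=21])
  fix y :: real assume y: "y \<ge> 0"
  note dd = hderiv_qr[of y] hderiv_gr[of y] hderiv_tanh2[of y]
  show "hderiv (\<lambda>y. th y * qr y) ((2 - 3 * th y ^ 2) * qr y) y"
    "hderiv (\<lambda>y. (2 * th y ^ 2 - 1) * gr y) (th y * ((7 - 6 * th y ^ 2) * gr y)) y"
    "hderiv (\<lambda>y. (2 - 3 * th y ^ 2) * qr y) ((15 * th y ^ 2 - 14) * (th y * qr y)) y"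
    "hderiv (\<lambda>y. th y * ((7 - 6 * th y ^ 2) * gr y)) ((15 * th y ^ 2 - 14) * ((2 * th y ^ 2 - 1) * gr y)) y"
    using dd unfolding has_real_derivative_iff_has_vector_derivative[symmetric]
    by (auto intro!: derivative_eq_intros simp: algebra_simps power2_eq_square)
  have "th y * qr y * (th y * ((7 - 6 * (th y)\<^sup>2) * gr y)) - (2 - 3 * (th y)\<^sup>2) * qr y * ((2 * (th y)\<^sup>2 - 1) * gr y)
     = 2 * (gr y * qr y)"
    by (simp add: algebra_simps power2_eq_square)
  then show "th y * qr y * (th y * ((7 - 6 * (th y)\<^sup>2) * gr y)) - (2 - 3 * (th y)\<^sup>2) * qr y * ((2 * (th y)\<^sup>2 - 1) * gr y)
     = 2 * sqrt 3"
    by (simp add: gr_qr)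
  have e: "exp (-y) \<ge> 0" "exp y \<ge> 0" by auto
  have q: "\<bar>qr y\<bar> \<le> 3 * exp (- y)" "\<bar>gr y\<bar> \<le> 3 * exp y"
    using qr_gr_bound[OF y] less_imp_le[OF qr_pos] less_imp_le[OF gr_pos] by auto
  have "\<bar>th y * qr y\<bar> \<le> 7 * (3 * exp (- y))" unfolding abs_mult using th_abs[of y] q by (intro mult_mono) linarith+
  then show "\<bar>th y * qr y\<bar> \<le> 21 * exp (- y)" by simp
  have "\<bar>(2 - 3 * th y ^ 2) * qr y\<bar> \<le> 7 * (3 * exp (- y))" unfolding abs_mult using th_abs[of y] q by (intro mult_mono) linarith+
  then show "\<bar>(2 - 3 * th y ^ 2) * qr y\<bar> \<le> 21 * exp (- y)" by simp
  have "\<bar>(2 * th y ^ 2 - 1) * gr y\<bar> \<le> 7 * (3 * exp y)" unfolding abs_mult using th_abs[of y] q by (intro mult_mono) linarith+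
  then show "\<bar>(2 * th y ^ 2 - 1) * gr y\<bar> \<le> 21 * exp y" by simp
  have "\<bar>(7 - 6 * th y ^ 2) * gr y\<bar> \<le> 7 * (3 * exp y)" unfolding abs_mult using th_abs[of y] q by (intro mult_mono) linarith+
  then show "\<bar>th y * ((7 - 6 * th y ^ 2) * gr y)\<bar> \<le> 21 * exp y"
    using th_poly_bound[OF th_abs(1)[of y], of "(7 - 6 * th y ^ 2) * gr y"] by (simp add: abs_mult)
next
  show "smi False (\<lambda>y. 15 * th y ^ 2 - 14)"
    by (intro allI sm_diff sm_mult_decay(3) sm_power sm_th sm_const[where M=15]) auto
qed (use f that in auto)

abbreviation hD :: "(real \<Rightarrow> 'a::real_normed_vector) \<Rightarrow> real \<Rightarrow> 'a" where "hD \<equiv> deriv_in {0..}"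

lemma smi_hD: "smi d f \<Longrightarrow> smi d (hD f)"
proof
  fix n assume "smi d f"
  then have "sm d {()} (Suc n) (\<lambda>_. f)" by blast
  from sm_deriv_in[OF this] show "sm d {()} n (\<lambda>_. hD f)" .
qed

lemma smi_hderiv: "smi d f \<Longrightarrow> y \<ge> 0 \<Longrightarrow> hderiv f (hD f y) y"
  by (rule sm_hderiv[of d "{()}" 0 "\<lambda>_. f" "()"]) blast+

lemma smi_hintegrable: "smi True f \<Longrightarrow> hintegrable f"
  by (rule sm_hintegrable[of "{()}" 0 "\<lambda>_. f" "()"]) blast+

lemma smi_hint_deriv: "smi True f \<Longrightarrow> (\<And>y. y \<ge> 0 \<Longrightarrow> hderiv f (f' y) y) \<Longrightarrow> hint f' = - f 0"
  by (rule sm_hint_deriv[of "{()}" "\<lambda>_. f" "()"]) blast+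

lemma smi_mult: "smi True f \<Longrightarrow> smi d g \<Longrightarrow> smi True (\<lambda>y. f y * g y)"
  using sm_mult_decay(1)[of "{()}" _ "\<lambda>_. f" d "\<lambda>_. g"] by blast

lemma smi_const: "smi False (\<lambda>y. c)" using sm_const[of "{()}" "\<lambda>_. c" "norm c"] by auto

lemma smi_cmult: "smi True f \<Longrightarrow> smi True (\<lambda>y. c * f y)"
  using sm_mult_decay(2)[OF smi_const[rule_format, of _ c], of _ "\<lambda>_. f"] by blast

lemma smi_ysq: "smi False (\<lambda>y. y ^ 2)" using sm_power[OF sm_y] by blast

lemma hint_add: "smi True f \<Longrightarrow> smi True g \<Longrightarrow> hint (\<lambda>y. f y + g y) = hint f + hint g"
  by (intro set_integral_add smi_hintegrable)

lemma hint_cmult: "hint (\<lambda>y. c * f y) = c * hint f" for f :: "real \<Rightarrow> real"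
  by (rule set_integral_mult_right)

lemma hint_cong: "(\<And>y. y \<ge> 0 \<Longrightarrow> f y = g y) \<Longrightarrow> hint f = hint g"
  by (rule set_lebesgue_integral_cong) auto

text \<open>\<open>\<Lambda>Q = Q/2 + y Q'\<close>, the generator of scaling.\<close>

definition Lq :: "real \<Rightarrow> real" where "Lq y = (1/2 - y * th y) * qr y"

lemma smi_Lq: "smi True Lq"
proof -
  have "sm True {()} n (\<lambda>_ y. (1/2 - y * th y) * qr y)" for n
    by (intro sm_mult_decay(2)[of False] sm_diff sm_mult_decay(3) sm_y sm_th sm_const[where M="1/2"] smi_qr[rule_format]) auto
  then show ?thesis unfolding Lq_def[abs_def] by blast
qed

text \<open>\<open>dL'\<close> expresses that L_+ sends \<open>Lq\<close> to -2 Q. Moving L_+ from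
  \<open>Lq\<close> onto \<open>A\<close> gives the pairing with the source \<open>h\<close>; the
  boundary terms vanish since both functions have slope 0 at the vertex.\<close>

lemma hint_qr_Lq:
  assumes A: "smi True A" and dA: "\<And>y. y \<ge> 0 \<Longrightarrow> hderiv A (A' y) y"
    "\<And>y. y \<ge> 0 \<Longrightarrow> hderiv A' ((15 * th y ^ 2 - 14) * A y - h y) y" "A' 0 = 0" and h: "smi True h"
  shows "hint (\<lambda>y. qr y * A y) = - 1/2 * hint (\<lambda>y. Lq y * h y)"
proof -
  define L' where "L' y = (- (3/2) * th y - 2 * y + 3 * y * th y ^ 2) * qr y" for y
  have dL: "hderiv Lq (L' y) y" for y
    using hderiv_qr[of y] hderiv_tanh2[of y] unfolding has_real_derivative_iff_has_vector_derivative[symmetric]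
    unfolding Lq_def[abs_def] L'_def
    by (auto intro!: derivative_eq_intros simp: algebra_simps power2_eq_square)
  have dL': "hderiv L' ((15 * th y ^ 2 - 14) * Lq y + 2 * qr y) y" for y
    using hderiv_qr[of y] hderiv_tanh2[of y] unfolding has_real_derivative_iff_has_vector_derivative[symmetric]
    unfolding Lq_def[abs_def] L'_def[abs_def]
    by (auto intro!: derivative_eq_intros simp: field_simps power2_eq_square)
  have e: "hD Lq y = L' y" "hD A y = A' y" if "y \<ge> 0" for y
    using deriv_in_half[OF dL that] deriv_in_half[OF dA(1)[OF that] that] by auto
  have s: "smi True (\<lambda>y. Lq y * hD A y + (-1) * (hD Lq y * A y))"
  proof
    fix n
    show "sm True {()} n (\<lambda>_ y. Lq y * hD A y + (-1) * (hD Lq y * A y))"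
      by (intro sm_add sm_mult_decay(1)[of _ _ _ True] sm_mult_decay(2)[of False] sm_const[where M=1] smi_hD[OF A, rule_format]
          smi_hD[OF smi_Lq, rule_format] smi_Lq[rule_format] A[rule_format]) auto
  qed
  have d: "hderiv (\<lambda>y. Lq y * hD A y + (-1) * (hD Lq y * A y)) ((-1) * (Lq y * h y) + (-2) * (qr y * A y)) y" if "y \<ge> 0" for y
  proof (rule hderiv_cong[OF _ _ that])
    show "hderiv (\<lambda>y. Lq y * A' y + (-1) * (L' y * A y)) ((-1) * (Lq y * h y) + (-2) * (qr y * A y)) y"
      using dL[of y] dL'[of y] dA(1,2)[OF that]
      unfolding has_real_derivative_iff_has_vector_derivative[symmetric]
      by (auto intro!: derivative_eq_intros simp: algebra_simps power2_eq_square)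
  qed (use e in auto)
  have "hint (\<lambda>y. (-1) * (Lq y * h y) + (-2) * (qr y * A y)) = - (Lq 0 * hD A 0 + (-1) * (hD Lq 0 * A 0))"
    by (rule smi_hint_deriv[OF s d])
  also have "\<dots> = 0" using e dA(3) by (simp add: L'_def)
  also have "hint (\<lambda>y. (-1) * (Lq y * h y) + (-2) * (qr y * A y)) = (-1) * hint (\<lambda>y. Lq y * h y) + (-2) * hint (\<lambda>y. qr y * A y)"
    by (simp only: hint_cmult hint_add[OF smi_cmult[OF smi_mult[OF smi_Lq h]] smi_cmult[OF smi_mult[OF smi_qr A]]])
  finally show ?thesis by simp
qed

text \<open>The share of a single edge in the squared norm of yQ.\<close>

definition Iq :: real where "Iq = hint (\<lambda>y. y ^ 2 * qr y ^ 2)"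

lemma smi_yq: "smi True (\<lambda>y. y ^ 2 * qr y ^ 2)"
  using smi_mult[OF smi_mult[OF smi_qr smi_qr] smi_ysq] by (simp add: power2_eq_square mult_ac)

lemma Iq_pos: "Iq > 0"
  unfolding Iq_def
proof (rule hint_pos)
  show "continuous_on {0..} (\<lambda>y. y ^ 2 * qr y ^ 2)"
    by (rule sm_continuous[of True "{()}" 0 "\<lambda>_ y. y ^ 2 * qr y ^ 2" "()"]) (use smi_yq in blast)+
  show "hintegrable (\<lambda>y. y ^ 2 * qr y ^ 2)" by (rule smi_hintegrable[OF smi_yq])
qed (use qr_pos[of 1] in auto)

text \<open>Adding y^2 Q^2 to the integrand produces the derivative of y^3 Q^2 / 2. That the value
  is nonzero is what allows \<alpha> to be solved for.\<close>

lemma hint_Lq_yq: "hint (\<lambda>y. Lq y * (y ^ 2 * qr y)) = - Iq"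
proof -
  have s: "smi True (\<lambda>y. (1/2) * (y * (y ^ 2 * qr y ^ 2)))"
    by (rule smi_cmult) (use smi_mult[OF smi_yq allI[OF sm_y]] in \<open>simp add: mult_ac\<close>)
  have d: "hderiv (\<lambda>y. (1/2) * (y * (y ^ 2 * qr y ^ 2))) (Lq y * (y ^ 2 * qr y) + y ^ 2 * qr y ^ 2) y" for y
    using hderiv_qr[of y] unfolding has_real_derivative_iff_has_vector_derivative[symmetric] Lq_def
    by (auto intro!: derivative_eq_intros simp: field_simps power2_eq_square)
  have "hint (\<lambda>y. Lq y * (y ^ 2 * qr y) + y ^ 2 * qr y ^ 2) = 0"
    using smi_hint_deriv[OF s d] by simp
  moreover have "smi True (\<lambda>y. Lq y * (y ^ 2 * qr y))"
    using smi_mult[OF smi_mult[OF smi_Lq smi_qr] smi_ysq] by (simp add: mult_ac)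
  ultimately show ?thesis unfolding Iq_def using hint_add[OF _ smi_yq] by simp
qed

text \<open>One step of the construction: the coefficient \<open>a\<close> is fixed by the solvability condition of
  the equation for \<open>B\<close>.\<close>

lemma solve_pair:
  assumes f: "smi True f0" "smi True f1" and c: "c \<noteq> (0::real)"
  obtains a A A' B B' where "smi True A" "A' 0 = 0" "\<And>y. y \<ge> 0 \<Longrightarrow> hderiv A (A' y) y"
    "\<And>y. y \<ge> 0 \<Longrightarrow> hderiv A' ((15 * th y ^ 2 - 14) * A y - (f0 y + a * (y ^ 2 / 4 * qr y))) y"
    "smi True B" "B' 0 = 0" "\<And>y. y \<ge> 0 \<Longrightarrow> hderiv B (B' y) y"
    "\<And>y. y \<ge> 0 \<Longrightarrow> hderiv B' ((3 * th y ^ 2 - 2) * B y - (f1 y - c * A y)) y"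
    "hint (\<lambda>y. qr y * (f1 y - c * A y)) = 0"
    "c * (a / 8 * Iq - 1/2 * hint (\<lambda>y. Lq y * f0 y)) = hint (\<lambda>y. qr y * f1 y)"
proof -
  \<comment> \<open>Solution of c <Q, A> = <Q, f1>, where <Q, A> = (a / 8) Iq - (1/2) <Lq, f0> is
    computed below from the equation for \<open>A\<close>.\<close>
  define a where "a = (hint (\<lambda>y. qr y * f1 y) / c + 1/2 * hint (\<lambda>y. Lq y * f0 y)) * 8 / Iq"
  have yq: "smi True (\<lambda>y. y ^ 2 * qr y)" using smi_mult[OF smi_qr smi_ysq] by (simp add: mult.commute)
  have s: "smi True (\<lambda>y. f0 y + a / 4 * (y ^ 2 * qr y))"
    using sm_add[of True "{()}" _ "\<lambda>_. f0" "\<lambda>_ y. a / 4 * (y ^ 2 * qr y)"] f smi_cmult[OF yq, of "a/4"] by blast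
  obtain A A' where A: "smi True A" "A' 0 = 0" "\<And>y. y \<ge> 0 \<Longrightarrow> hderiv A (A' y) y"
    "\<And>y. y \<ge> 0 \<Longrightarrow> hderiv A' ((15 * th y ^ 2 - 14) * A y - (f0 y + a / 4 * (y ^ 2 * qr y))) y"
    using solve_plus[OF s] by metis
  have "hint (\<lambda>y. qr y * A y) = - 1/2 * hint (\<lambda>y. Lq y * (f0 y + a / 4 * (y ^ 2 * qr y)))"
    by (rule hint_qr_Lq[OF A(1,3,4,2) s])
  also have "hint (\<lambda>y. Lq y * (f0 y + a / 4 * (y ^ 2 * qr y))) = hint (\<lambda>y. Lq y * f0 y + a / 4 * (Lq y * (y ^ 2 * qr y)))"
    by (rule hint_cong) (simp add: algebra_simps)
  also have "\<dots> = hint (\<lambda>y. Lq y * f0 y) + a / 4 * hint (\<lambda>y. Lq y * (y ^ 2 * qr y))"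
    by (simp only: hint_cmult hint_add[OF smi_mult[OF smi_Lq f(1)] smi_cmult[OF smi_mult[OF smi_Lq yq]]])
  finally have qA: "hint (\<lambda>y. qr y * A y) = a / 8 * Iq - 1/2 * hint (\<lambda>y. Lq y * f0 y)"
    unfolding hint_Lq_yq by (simp add: algebra_simps)
  have aeq: "c * (a / 8 * Iq - 1/2 * hint (\<lambda>y. Lq y * f0 y)) = hint (\<lambda>y. qr y * f1 y)"
    unfolding a_def using Iq_pos c by (simp add: field_simps)
  have s1: "smi True (\<lambda>y. f1 y - c * A y)"
    using sm_diff[of True "{()}" _ "\<lambda>_. f1" "\<lambda>_ y. c * A y"] f smi_cmult[OF A(1), of c] by blast
  have "hint (\<lambda>y. qr y * (f1 y - c * A y)) = hint (\<lambda>y. qr y * f1 y + (-c) * (qr y * A y))"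
    by (rule hint_cong) (simp add: algebra_simps)
  also have "\<dots> = hint (\<lambda>y. qr y * f1 y) + (-c) * hint (\<lambda>y. qr y * A y)"
    by (simp only: hint_cmult hint_add[OF smi_mult[OF smi_qr f(2)] smi_cmult[OF smi_mult[OF smi_qr A(1)]]])
  also have "\<dots> = 0" unfolding qA using aeq by simp
  finally have o: "hint (\<lambda>y. qr y * (f1 y - c * A y)) = 0" .
  obtain B B' where B: "smi True B" "B' 0 = 0" "\<And>y. y \<ge> 0 \<Longrightarrow> hderiv B (B' y) y"
    "\<And>y. y \<ge> 0 \<Longrightarrow> hderiv B' ((3 * th y ^ 2 - 2) * B y - (f1 y - c * A y)) y"
    using solve_minus[OF s1 o] by metis
  have A4: "\<And>y. y \<ge> 0 \<Longrightarrow> hderiv A' ((15 * th y ^ 2 - 14) * A y - (f0 y + a * (y ^ 2 / 4 * qr y))) y"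
    using A(4) by simp
  show thesis by (rule that[OF A(1-3) A4 B o aeq])
qed

section \<open>Polynomials in the parameters\<close>

abbreviation xb :: "real \<Rightarrow> complex" where "xb b \<equiv> \<i> * complex_of_real b"

text \<open>Polynomials in \<open>i b\<close> and \<open>\<lambda>\<close> with real coefficient functions on the half line,
  supported in the set \<open>T\<close> of exponents.\<close>

inductive SP :: "bool \<Rightarrow> (nat \<times> nat) set \<Rightarrow> (real \<Rightarrow> real \<Rightarrow> real \<Rightarrow> complex) \<Rightarrow> bool" for d T where
  SP_zero: "SP d T (\<lambda>b l y. 0)"
| SP_term: "(j, k) \<in> T \<Longrightarrow> smi d f \<Longrightarrow>
    SP d T (\<lambda>b l y. xb b ^ j * complex_of_real l ^ k * complex_of_real (f y))"
| SP_add: "SP d T F \<Longrightarrow> SP d T G \<Longrightarrow> SP d T (\<lambda>b l y. F b l y + G b l y)"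
| SP_cong: "SP d T F \<Longrightarrow> (\<And>b l y. y \<ge> 0 \<Longrightarrow> F b l y = G b l y) \<Longrightarrow> SP d T G"

lemma SP_weaken:
  assumes "SP d T F" "T \<subseteq> T'" "e \<longrightarrow> d"
  shows "SP e T' F"
  using assms(1)
proof induction
  case (SP_term j k f)
  then show ?case using assms sm_weaken[of d "{()}" _ "\<lambda>_. f" e] by (intro SP.SP_term) blast+
qed (auto intro: SP.intros)

lemma SP_mult_term:
  assumes "SP e T' G" "(j, k) \<in> T" "smi d f" and T: "\<And>j k j' k'. (j, k) \<in> T \<Longrightarrow> (j', k') \<in> T' \<Longrightarrow> (j + j', k + k') \<in> T''"
  shows "SP (d \<or> e) T'' (\<lambda>b l y. (xb b ^ j * complex_of_real l ^ k * complex_of_real (f y)) * G b l y)"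
  using assms(1)
proof induction
  case SP_zero
  then show ?case by (simp add: SP.SP_zero)
next
  case (SP_term j' k' g)
  have "smi (d \<or> e) (\<lambda>y. f y * g y)"
    using sm_mult[of d "{()}" _ "\<lambda>_. f" e "\<lambda>_. g"] assms(3) SP_term by blast
  then have "SP (d \<or> e) T'' (\<lambda>b l y. xb b ^ (j + j') * complex_of_real l ^ (k + k') * complex_of_real (f y * g y))"
    by (intro SP.SP_term T assms SP_term)
  then show ?case by (rule SP.SP_cong) (simp add: power_add mult_ac)
next
  case (SP_add F G)
  show ?case by (rule SP.SP_cong[OF SP.SP_add[OF SP_add.IH]]) (simp add: distrib_left)
next
  case (SP_cong F G)
  show ?case by (rule SP.SP_cong[OF SP_cong.IH]) (simp add: SP_cong.hyps)
qed

lemma SP_mult: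
  assumes "SP d T F" "SP e T' G" and T: "\<And>j k j' k'. (j, k) \<in> T \<Longrightarrow> (j', k') \<in> T' \<Longrightarrow> (j + j', k + k') \<in> T''"
  shows "SP (d \<or> e) T'' (\<lambda>b l y. F b l y * G b l y)"
  using assms(1)
proof induction
  case SP_zero
  then show ?case by (simp add: SP.SP_zero)
next
  case (SP_term j k f)
  show ?case by (rule SP_mult_term[OF assms(2) SP_term T])
next
  case (SP_add F F')
  show ?case by (rule SP.SP_cong[OF SP.SP_add[OF SP_add.IH]]) (simp add: distrib_right)
next
  case (SP_cong F F')
  show ?case by (rule SP.SP_cong[OF SP_cong.IH]) (simp add: SP_cong.hyps)
qed

text \<open>Conjugation maps ib to -ib: the coefficient of (ib)^j is multiplied by (-1)^j and stays
  real.\<close>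

lemma SP_cnj: "SP d T F \<Longrightarrow> SP d T (\<lambda>b l y. cnj (F b l y))"
proof (induction rule: SP.induct)
  case (SP_term j k f)
  have "smi d (\<lambda>y. (-1) ^ j * f y)"
    using sm_linear[of "\<lambda>x. (-1) ^ j * x" d "{()}" _ "\<lambda>_. f"] SP_term bounded_linear_mult_right by blast
  from SP.SP_term[OF SP_term(1) this]
  have "SP d T (\<lambda>b l y. xb b ^ j * complex_of_real l ^ k * complex_of_real ((-1) ^ j * f y))" .
  then show ?case
  proof (rule SP.SP_cong)
    fix b l y
    have c: "cnj (xb b) = - 1 * xb b" by simp
    have e: "cnj (xb b) ^ j = xb b ^ j * (-1) ^ j"
      unfolding c power_mult_distrib by (rule mult.commute)
    have "cnj (xb b ^ j * complex_of_real l ^ k * complex_of_real (f y)) = cnj (xb b) ^ j * complex_of_real l ^ k * complex_of_real (f y)"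
      by (simp only: complex_cnj_mult complex_cnj_power complex_cnj_complex_of_real)
    then show "xb b ^ j * complex_of_real l ^ k * complex_of_real ((-1) ^ j * f y) =
      cnj (xb b ^ j * complex_of_real l ^ k * complex_of_real (f y))"
      unfolding e by (simp only: of_real_mult of_real_power of_real_minus of_real_1 mult_ac)
  qed
qed (auto intro: SP.intros)

text \<open>Isolates one monomial. Its real coefficient function becomes the source of a linear
  equation in the construction.\<close>

lemma SP_split:
  assumes "SP d T F" "T \<subseteq> insert (j0, k0) T'"
  obtains f G where "smi d f" "SP d T' G"
    "\<And>b l y. y \<ge> 0 \<Longrightarrow> F b l y = xb b ^ j0 * complex_of_real l ^ k0 * complex_of_real (f y) + G b l y"
proof -
  have "\<exists>f G. smi d f \<and> SP d T' G \<and>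
    (\<forall>b l y. y \<ge> 0 \<longrightarrow> F b l y = xb b ^ j0 * complex_of_real l ^ k0 * complex_of_real (f y) + G b l y)"
    using assms(1)
  proof induction
    case SP_zero
    show ?case by (rule exI[of _ "\<lambda>_. 0"], rule exI[of _ "\<lambda>_ _ _. 0"]) (auto intro: sm_zero SP.SP_zero)
  next
    case (SP_term j k f)
    show ?case
    proof (cases "(j, k) = (j0, k0)")
      case True
      then show ?thesis using SP_term
        by (intro exI[of _ f], intro exI[of _ "\<lambda>_ _ _. 0"]) (auto intro: SP.SP_zero)
    next
      case False
      then have "(j, k) \<in> T'" using SP_term assms by auto
      from SP.SP_term[OF this SP_term(2)] show ?thesis
        by (intro exI[of _ "\<lambda>_. 0"] exI conjI) (auto intro: sm_zero)
    qed
  next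
    case (SP_add F F')
    then obtain f G f' G' where *: "smi d f" "SP d T' G" "smi d f'" "SP d T' G'"
      "\<And>b l y. y \<ge> 0 \<Longrightarrow> F b l y = xb b ^ j0 * complex_of_real l ^ k0 * complex_of_real (f y) + G b l y"
      "\<And>b l y. y \<ge> 0 \<Longrightarrow> F' b l y = xb b ^ j0 * complex_of_real l ^ k0 * complex_of_real (f' y) + G' b l y"
      by metis
    show ?case
      by (rule exI[of _ "\<lambda>y. f y + f' y"], rule exI[of _ "\<lambda>b l y. G b l y + G' b l y"])
        (use * in \<open>auto intro!: sm_add SP.SP_add simp: algebra_simps\<close>)
  next
    case (SP_cong F G)
    then show ?case by metis
  qed
  then show thesis using that by blast
qed

lemma SP_minus: "SP d T F \<Longrightarrow> SP d T (\<lambda>b l y. - F b l y)"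
proof (induction rule: SP.induct)
  case (SP_term j k f)
  have "smi d (\<lambda>y. - f y)" using sm_uminus[of d "{()}" _ "\<lambda>_. f"] SP_term by blast
  from SP.SP_term[OF SP_term(1) this] show ?case by (rule SP.SP_cong) simp
next
  case (SP_add F G)
  show ?case by (rule SP.SP_cong[OF SP.SP_add[OF SP_add.IH]]) simp
qed (auto intro: SP.intros)

lemma SP_diff: "SP d T F \<Longrightarrow> SP d T G \<Longrightarrow> SP d T (\<lambda>b l y. F b l y - G b l y)"
  using SP_add[OF _ SP_minus] by fastforce

lemma SP_sum: "(\<And>i. i \<in> I \<Longrightarrow> SP d T (F i)) \<Longrightarrow> SP d T (\<lambda>b l y. \<Sum>i\<in>I. F i b l y)"
  by (induction I rule: infinite_finite_induct) (auto intro: SP.intros)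

text \<open>Divisibility by \<open>\<lambda>\<^sup>m\<close>.\<close>

abbreviation L :: "bool \<Rightarrow> nat \<Rightarrow> (real \<Rightarrow> real \<Rightarrow> real \<Rightarrow> complex) \<Rightarrow> bool" where
  "L d m \<equiv> SP d {(j, k). m \<le> k}"

lemma L_mult: "L d m F \<Longrightarrow> L e n G \<Longrightarrow> L (d \<or> e) (m + n) (\<lambda>b l y. F b l y * G b l y)"
  by (erule SP_mult) auto

lemma L_weaken: "L d m F \<Longrightarrow> n \<le> m \<Longrightarrow> e \<longrightarrow> d \<Longrightarrow> L e n F"
  by (erule SP_weaken) auto

lemma L_real: "smi d f \<Longrightarrow> L d 0 (\<lambda>b l y. complex_of_real (f y))"
  using SP_term[of 0 0 "{(j, k). 0 \<le> k}" d f] by simp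

lemma L_const: "L False 0 (\<lambda>b l y. complex_of_real c)"
  using L_real[OF smi_const[of c]] .

lemma L_numeral: "L False 0 (\<lambda>b l y. numeral n)" "L False 0 (\<lambda>b l y. 1)"
  using L_const[of "numeral n"] L_const[of 1] by auto

lemma L_xb: "L False 0 (\<lambda>b l y. xb b)"
  using SP_term[of 1 0 "{(j, k). 0 \<le> k}" False "\<lambda>_. 1"] smi_const[of 1] by simp

lemma L_lam: "L False 1 (\<lambda>b l y. complex_of_real l)"
  using SP_term[of 0 1 "{(j, k). 1 \<le> k}" False "\<lambda>_. 1"] smi_const[of 1] by simp

lemma L_mu: "L False 1 (\<lambda>b l y. complex_of_real (s * l))"
  using L_mult[OF L_const[of s] L_lam] by simp

lemma L_th: "L False 0 (\<lambda>b l y. complex_of_real (th y))"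
  by (intro L_real allI sm_th)

lemma L_ysq: "L False 0 (\<lambda>b l y. complex_of_real (y\<^sup>2 / 4))"
proof -
  have "smi False (\<lambda>y. (1/4) * y\<^sup>2)"
    by (intro allI sm_mult_decay(3) sm_power sm_y sm_const[where M="1/4"]) auto
  then show ?thesis using L_real[of False "\<lambda>y. (1/4) * y\<^sup>2"] by simp
qed

lemma L0_mult: "L False 0 F \<Longrightarrow> L False 0 G \<Longrightarrow> L False 0 (\<lambda>b l y. F b l y * G b l y)"
  using L_mult[of False 0 F False 0 G] by simp

lemma L0_power: "L False 0 F \<Longrightarrow> L False 0 (\<lambda>b l y. F b l y ^ n)"
  by (induction n) (auto intro: L0_mult L_numeral)

lemmas L0_intros = L0_mult L0_power SP_add SP_diff SP_minus L_numeral L_xb L_th L_ysq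

lemma L_mu0: "L False 0 (\<lambda>b l y. complex_of_real (s * l))"
  by (rule L_weaken[OF L_mu]) auto

text \<open>Congruences modulo \<lambda>^m can be multiplied, by the usual telescoping of a
  difference of products.\<close>

lemma L_cong_mult:
  assumes "L False m (\<lambda>b l y. F b l y - F' b l y)" "L False m (\<lambda>b l y. G b l y - G' b l y)"
    "L False 0 G" "L False 0 F'"
  shows "L False m (\<lambda>b l y. F b l y * G b l y - F' b l y * G' b l y)"
proof -
  have "L False m (\<lambda>b l y. (F b l y - F' b l y) * G b l y + F' b l y * (G b l y - G' b l y))"
    using L_mult[OF assms(1,3)] L_mult[OF assms(4,2)] by (intro SP_add) auto
  then show ?thesis by (rule SP_cong) (simp add: algebra_simps)
qed

section \<open>Polynomials summed over the index set\<close>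

lemma finite_Theta: "finite (Theta \<kappa>)"
proof (rule finite_subset)
  show "Theta \<kappa> \<subseteq> {..2*\<kappa>} \<times> {..\<kappa>}" by (auto simp: Theta_def)
qed auto

lemma Theta_iff: "(j, k) \<in> Theta \<kappa> \<longleftrightarrow> k \<ge> 1 \<and> j + 2 * k < 2 * \<kappa>"
proof -
  have "real j / 2 + real k < real \<kappa> \<longleftrightarrow> real (j + 2 * k) < real (2 * \<kappa>)" by auto
  then show ?thesis unfolding Theta_def by (simp only: of_nat_less_iff) auto
qed

definition Sg :: "nat \<Rightarrow> (nat \<Rightarrow> nat \<Rightarrow> real \<Rightarrow> real) \<Rightarrow> real \<Rightarrow> real \<Rightarrow> real \<Rightarrow> complex" where
  "Sg \<kappa> c b l y = (\<Sum>(j, k)\<in>Theta \<kappa>. xb b ^ j * complex_of_real l ^ k * complex_of_real (c j k y))"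

text \<open>The derivative of \<open>Sg\<close> in x = ib. At j = 0 the truncated exponent j - 1 is
  paired with the factor \<open>of_nat j\<close>, which is 0.\<close>

definition Sx :: "nat \<Rightarrow> (nat \<Rightarrow> nat \<Rightarrow> real \<Rightarrow> real) \<Rightarrow> real \<Rightarrow> real \<Rightarrow> real \<Rightarrow> complex" where
  "Sx \<kappa> c b l y = (\<Sum>(j, k)\<in>Theta \<kappa>. of_nat j * xb b ^ (j - 1) * complex_of_real l ^ k * complex_of_real (c j k y))"

lemma Sg_SP: "(\<And>j k. smi d (c j k)) \<Longrightarrow> SP d (Theta \<kappa>) (Sg \<kappa> c)"
  unfolding Sg_def case_prod_beta by (intro SP_sum SP_term) auto

lemma L_Sg: "(\<And>j k. smi d (c j k)) \<Longrightarrow> L d 1 (Sg \<kappa> c)"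
  by (rule SP_weaken[OF Sg_SP]) (auto simp: Theta_iff)

lemma L_Sx: assumes "\<And>j k. smi d (c j k)" shows "L d 1 (Sx \<kappa> c)"
proof -
  have "L d 1 (\<lambda>b l y. of_nat (fst p) * xb b ^ (fst p - 1) * complex_of_real l ^ snd p * complex_of_real (c (fst p) (snd p) y))"
    if "p \<in> Theta \<kappa>" for p
  proof -
    have "smi d (\<lambda>y. real (fst p) * c (fst p) (snd p) y)"
      using sm_linear[of "\<lambda>x. real (fst p) * x" d "{()}" _ "\<lambda>_. c (fst p) (snd p)"] assms bounded_linear_mult_right by blast
    then have "L d 1 (\<lambda>b l y. xb b ^ (fst p - 1) * complex_of_real l ^ snd p * complex_of_real (real (fst p) * c (fst p) (snd p) y))"
      by (rule SP_term[rotated]) (use that in \<open>cases p, auto simp: Theta_iff\<close>)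
    then show ?thesis by (rule SP_cong) (simp add: mult_ac)
  qed
  then show ?thesis unfolding Sx_def[abs_def] case_prod_beta by (intro SP_sum) auto
qed

lemma Sg_add: "Sg \<kappa> (\<lambda>j k y. c j k y + e j k y) b l y = Sg \<kappa> c b l y + Sg \<kappa> e b l y"
  unfolding Sg_def case_prod_beta by (simp add: sum.distrib[symmetric] algebra_simps)

lemma Sx_add: "Sx \<kappa> (\<lambda>j k y. c j k y + e j k y) b l y = Sx \<kappa> c b l y + Sx \<kappa> e b l y"
  unfolding Sx_def case_prod_beta by (simp add: sum.distrib[symmetric] algebra_simps)

lemma Sg_single:
  assumes "(J, K) \<in> Theta \<kappa>"
  shows "Sg \<kappa> (\<lambda>j k y. if (j, k) = (J, K) then f y else 0) b l y = xb b ^ J * complex_of_real l ^ K * complex_of_real (f y)"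
proof -
  have "Sg \<kappa> (\<lambda>j k y. if (j, k) = (J, K) then f y else 0) b l y
     = (\<Sum>p\<in>Theta \<kappa>. if p = (J, K) then xb b ^ J * complex_of_real l ^ K * complex_of_real (f y) else 0)"
    unfolding Sg_def by (intro sum.cong) (auto split: if_splits)
  then show ?thesis using assms finite_Theta by (simp add: sum.delta)
qed

lemma Sx_single:
  assumes "(J, K) \<in> Theta \<kappa>"
  shows "Sx \<kappa> (\<lambda>j k y. if (j, k) = (J, K) then f y else 0) b l y = of_nat J * xb b ^ (J - 1) * complex_of_real l ^ K * complex_of_real (f y)"
proof -
  have "Sx \<kappa> (\<lambda>j k y. if (j, k) = (J, K) then f y else 0) b l y
     = (\<Sum>p\<in>Theta \<kappa>. if p = (J, K) then of_nat J * xb b ^ (J - 1) * complex_of_real l ^ K * complex_of_real (f y) else 0)"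
    unfolding Sx_def by (intro sum.cong) (auto split: if_splits)
  then show ?thesis using assms finite_Theta by (simp add: sum.delta)
qed

text \<open>The equation for V as a polynomial in independent complex variables, which keeps
  functions out of the algebra. The coefficients, cleared of denominators, are 2 G_y / G at
  \<open>V1\<close>, G_yy / G at \<open>V\<close>, G^4 at the quintic product and, in the last term,
  -x m times the derivative of log G in m. \<open>D\<close> stands for the Euler derivative of V,
  and \<open>al * Vx\<close> accounts for \<alpha> in the law of b.\<close>

definition rs :: "complex \<Rightarrow> complex \<Rightarrow> complex \<Rightarrow> complex \<Rightarrow> complex \<Rightarrow> complex \<Rightarrow> complex \<Rightarrow> complex \<Rightarrow> complex \<Rightarrow> complex \<Rightarrow> complex \<Rightarrow> complex" where
  "rs m t x w al V Vb V1 V2 D Vx =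
     (1 - m\<^sup>2) * (1 - m * t)\<^sup>2 * (- x * D - al * Vx + V2 - V + al * w * V)
     + 2 * ((1 - m\<^sup>2) * (1 - m * t) * m * (1 - t\<^sup>2)) * V1
     + (1 - m\<^sup>2) * (3 * m\<^sup>2 * (1 - t\<^sup>2)\<^sup>2 - 4 * m * t * (1 - t\<^sup>2) * (1 - m * t)) * V
     + (1 - m\<^sup>2)\<^sup>2 * (V ^ 3 * Vb ^ 2)
     - x * m * ((1 - m * t) * (t - m) / 2) * V"

text \<open>Exact bookkeeping for the increment d = X (A + x B). The linearization of the quintic
  term at Q is q^4 (3 d + 2 db), which amounts to 5 q^4 on A and q^4 on x B: this is how the two
  linearized operators arise. The coefficients \<open>p\<close>, \<open>p1\<close>,
  \<open>p2\<close>, \<open>p4\<close>, \<open>p0\<close> stay opaque to keep the identity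
  small.\<close>

lemma rs_increment_aux:
  fixes p p1 p2 p4 p0 :: complex
  assumes d: "d = X * (A + x * B)" "db = X * (A - x * B)" "d2 = X * (A2 + x * B2)"
    "Dd = X * (c * A + (c + 1) * x * B)"
  shows "(p * (- x * (D + Dd) - (al + a * X) * (Vx + dx) + (V2 + d2) - (V + d) + (al + a * X) * w * (V + d))
      + 2 * p1 * (V1 + d1) + p2 * (V + d) + p4 * ((V + d) ^ 3 * (Vb + db) ^ 2) - x * m * p0 * (V + d))
    = (p * (- x * D - al * Vx + V2 - V + al * w * V)
      + 2 * p1 * V1 + p2 * V + p4 * (V ^ 3 * Vb ^ 2) - x * m * p0 * V)
     + (X * (A2 - A + 5 * q ^ 4 * A + a * w * q) + x * X * (B2 - B + q ^ 4 * B - c * A))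
     + (- (p - 1) * x * Dd - X * x\<^sup>2 * ((c + 1) * B) - p * (al * dx) - p * (a * X * Vx) - p * (a * X * dx)
        + (p - 1) * (d2 - d) + w * p * (al * d) + w * p * (a * X * (V - q)) + w * p * (a * X * d) + w * (p - 1) * (a * X * q)
        + 2 * p1 * d1 + p2 * d + (p4 - 1) * ((V + d) ^ 3 * (Vb + db) ^ 2 - V ^ 3 * Vb ^ 2)
        + ((V + d) ^ 3 * (Vb + db) ^ 2 - V ^ 3 * Vb ^ 2 - q ^ 4 * (3 * d + 2 * db)) - x * m * p0 * d)"
proof -
  define M where "M = (V + d) ^ 3 * (Vb + db) ^ 2"
  define M0 where "M0 = V ^ 3 * Vb ^ 2"
  define q4 where "q4 = q ^ 4"
  define I0 where "I0 = - x * D - al * Vx + V2 - V + al * w * V"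
  define R where "R = - al * dx - a * X * Vx - a * X * dx + w * (al * d) + w * (a * X * (V - q)) + w * (a * X * d)"
  define S where "S = - x * Dd + (d2 - d) + w * (a * X * q)"
  have 1: "- x * (D + Dd) - (al + a * X) * (Vx + dx) + (V2 + d2) - (V + d) + (al + a * X) * w * (V + d) = I0 + R + S"
    unfolding I0_def R_def S_def by (simp add: algebra_simps)
  define MN where "MN = X * (A2 - A + 5 * q4 * A + a * w * q) + x * X * (B2 - B + q4 * B - c * A)"
  define Z where "Z = X * x\<^sup>2 * ((c + 1) * B)"
  have 2: "S = MN - Z - q4 * (3 * d + 2 * db)"
    unfolding S_def MN_def Z_def d by (simp add: algebra_simps power2_eq_square)
  have 3: "p * R = - p * (al * dx) - p * (a * X * Vx) - p * (a * X * dx) + w * p * (al * d) + w * p * (a * X * (V - q)) + w * p * (a * X * d)"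
    unfolding R_def by (simp add: algebra_simps)
  have 4: "(p - 1) * S = - (p - 1) * x * Dd + (p - 1) * (d2 - d) + w * (p - 1) * (a * X * q)"
    unfolding S_def by (simp add: algebra_simps)
  have "p * (I0 + R + S) = p * I0 + p * R + (p - 1) * S + S" by (simp add: algebra_simps)
  then have 5: "p * (I0 + R + S) = p * I0 + p * R + (p - 1) * S + (MN - Z - q4 * (3 * d + 2 * db))"
    using 2 by simp
  show ?thesis
    unfolding M_def[symmetric] M0_def[symmetric] q4_def[symmetric] I0_def[symmetric] MN_def[symmetric] Z_def[symmetric]
    unfolding 1 5 unfolding 3 4 by (simp add: algebra_simps)
qed

section \<open>Construction of the profile\<close>

definition Vf :: "nat \<Rightarrow> (nat \<Rightarrow> nat \<Rightarrow> real \<Rightarrow> real) \<Rightarrow> real \<Rightarrow> real \<Rightarrow> real \<Rightarrow> complex" where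
  "Vf \<kappa> c b l y = complex_of_real (qr y) + Sg \<kappa> c b l y"

definition Vy :: "nat \<Rightarrow> (nat \<Rightarrow> nat \<Rightarrow> real \<Rightarrow> real) \<Rightarrow> real \<Rightarrow> real \<Rightarrow> real \<Rightarrow> complex" where
  "Vy \<kappa> c b l y = complex_of_real (- (th y * qr y)) + Sg \<kappa> (\<lambda>j k. hD (c j k)) b l y"

definition Vyy :: "nat \<Rightarrow> (nat \<Rightarrow> nat \<Rightarrow> real \<Rightarrow> real) \<Rightarrow> real \<Rightarrow> real \<Rightarrow> real \<Rightarrow> complex" where
  "Vyy \<kappa> c b l y = complex_of_real ((3 * th y ^ 2 - 2) * qr y) + Sg \<kappa> (\<lambda>j k. hD (hD (c j k))) b l y"

text \<open>\<open>x \<partial>\<^sub>x + \<lambda> \<partial>\<^sub>\<lambda>\<close> applied to the polynomial, where \<open>x = i b\<close>.\<close>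

definition Vd :: "nat \<Rightarrow> (nat \<Rightarrow> nat \<Rightarrow> real \<Rightarrow> real) \<Rightarrow> real \<Rightarrow> real \<Rightarrow> real \<Rightarrow> complex" where
  "Vd \<kappa> c = Sg \<kappa> (\<lambda>j k y. real (j + k) * c j k y)"

definition Af :: "nat \<Rightarrow> (nat \<Rightarrow> nat \<Rightarrow> real) \<Rightarrow> real \<Rightarrow> real \<Rightarrow> real \<Rightarrow> complex" where
  "Af \<kappa> a = Sg \<kappa> (\<lambda>j k y. a j k)"

text \<open>The equation for \<open>V = P / G\<close>, along the flow \<open>b' = - b\<^sup>2 + \<alpha>\<close>, \<open>\<lambda>' = - b \<lambda>\<close>, multiplied by
  \<open>(1 - \<mu>\<^sup>2) (1 - \<mu> t)\<^sup>2\<close> with \<open>\<mu> = \<sigma> \<lambda>\<close> and \<open>t = tanh (2 y)\<close>, which makes it polynomial.\<close>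

definition resid :: "real \<Rightarrow> nat \<Rightarrow> (nat \<Rightarrow> nat \<Rightarrow> real \<Rightarrow> real) \<Rightarrow> (nat \<Rightarrow> nat \<Rightarrow> real) \<Rightarrow> real \<Rightarrow> real \<Rightarrow> real \<Rightarrow> complex" where
  "resid \<sigma> \<kappa> c a b l y = rs (complex_of_real (\<sigma> * l)) (complex_of_real (th y)) (xb b) (complex_of_real (y\<^sup>2 / 4))
     (Af \<kappa> a b l y) (Vf \<kappa> c b l y) (cnj (Vf \<kappa> c b l y)) (Vy \<kappa> c b l y) (Vyy \<kappa> c b l y) (Vd \<kappa> c b l y) (Sx \<kappa> c b l y)"

text \<open>Exponents of the residual still to be treated when \<open>(J, K)\<close> comes next.\<close>

definition TT :: "nat \<Rightarrow> nat \<Rightarrow> nat \<Rightarrow> (nat \<times> nat) set" where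
  "TT \<kappa> J K = {(j, k). 2 * \<kappa> \<le> j + 2 * k \<or> K < k \<or> (k = K \<and> J \<le> j)}"

definition coeffs_ok :: "nat \<Rightarrow> (nat \<Rightarrow> nat \<Rightarrow> real \<Rightarrow> real) \<Rightarrow> (nat \<Rightarrow> nat \<Rightarrow> real) \<Rightarrow> bool" where
  "coeffs_ok \<kappa> c a \<longleftrightarrow> (\<forall>j k. smi True (c j k) \<and> hD (c j k) 0 = 0) \<and> (\<forall>j k. odd j \<longrightarrow> a j k = 0)"

lemma L_qr: "L True 0 (\<lambda>b l y. complex_of_real (qr y))" by (rule L_real[OF smi_qr])

lemma L0_multL: "L False 0 F \<Longrightarrow> L d n G \<Longrightarrow> L d n (\<lambda>b l y. F b l y * G b l y)"
  using L_mult[of False 0 F d n G] by simp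

text \<open>The difference of the quintic terms is \<open>d * N1 + cnj d * N2\<close> with exact
  divided differences \<open>N1\<close> and \<open>N2\<close>. Since V is Q modulo \<lambda> and d
  is divisible by \<lambda>, these reduce to 3 Q^4 and 2 Q^4 modulo \<lambda>.\<close>

lemma nonlinear_increment:
  assumes V: "L True 1 (\<lambda>b l y. V b l y - complex_of_real (qr y))" and d: "L True K d" and K: "K \<ge> 1"
  shows "L True (K + 1) (\<lambda>b l y. (V b l y + d b l y) ^ 3 * (cnj (V b l y) + cnj (d b l y)) ^ 2 - V b l y ^ 3 * cnj (V b l y) ^ 2
     - complex_of_real (qr y) ^ 4 * (3 * d b l y + 2 * cnj (d b l y)))"
    "L True K (\<lambda>b l y. (V b l y + d b l y) ^ 3 * (cnj (V b l y) + cnj (d b l y)) ^ 2 - V b l y ^ 3 * cnj (V b l y) ^ 2)"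
proof -
  let ?q = "\<lambda>b l y. complex_of_real (qr y)"
  let ?W = "\<lambda>b l y. V b l y - complex_of_real (qr y)"
  have q: "L False 0 ?q" by (rule L_weaken[OF L_qr]) auto
  have W: "L False 1 ?W" by (rule L_weaken[OF V]) auto
  have Wb: "L False 1 (\<lambda>b l y. cnj (V b l y) - complex_of_real (qr y))" using SP_cnj[OF W] by simp
  have V0: "L False 0 V" using SP_add[OF L_weaken[OF W, of 0 False] q] by simp
  have Vb0: "L False 0 (\<lambda>b l y. cnj (V b l y))" by (rule SP_cnj[OF V0])
  have d0: "L False 0 d" by (rule L_weaken[OF d]) auto
  have db0: "L False 0 (\<lambda>b l y. cnj (d b l y))" by (rule SP_cnj[OF d0])
  have d1: "L False 1 (\<lambda>b l y. d b l y - 0)" using L_weaken[OF d K] by simp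
  have db1: "L False 1 (\<lambda>b l y. cnj (d b l y) - 0)" using SP_cnj[OF d1] by simp
  have db: "L True K (\<lambda>b l y. cnj (d b l y))" by (rule SP_cnj[OF d])
  have z: "L False 0 (\<lambda>b l y. 0)" by (rule SP_zero)
  have n3: "L False 1 (\<lambda>b l y. 3 - 3 :: complex)" using SP_zero by simp
  define N1 where "N1 b l y = (3 * V b l y ^ 2 + 3 * V b l y * d b l y + d b l y ^ 2) * (cnj (V b l y) + cnj (d b l y)) ^ 2" for b l y
  define N2 where "N2 b l y = V b l y ^ 3 * (2 * cnj (V b l y) + cnj (d b l y))" for b l y
  have VV: "L False 1 (\<lambda>b l y. V b l y ^ 2 - ?q b l y ^ 2)"
    using L_cong_mult[OF W W V0 q] by (simp add: power2_eq_square)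
  have A1: "L False 1 (\<lambda>b l y. (3 * V b l y ^ 2 + 3 * V b l y * d b l y + d b l y ^ 2) - 3 * ?q b l y ^ 2)"
  proof -
    have "L False 1 (\<lambda>b l y. 3 * (V b l y ^ 2 - ?q b l y ^ 2) + (3 * V b l y + d b l y) * (d b l y - 0))"
      using L_mult[OF L_numeral(1) VV] L_mult[OF SP_add[OF L0_mult[OF L_numeral(1) V0] d0] d1]
      by (intro SP_add) auto
    then show ?thesis by (rule SP_cong) (simp add: algebra_simps power2_eq_square)
  qed
  have B1: "L False 1 (\<lambda>b l y. (cnj (V b l y) + cnj (d b l y)) - ?q b l y)"
    using SP_add[OF Wb db1] by (simp add: algebra_simps)
  have Bsum: "L False 0 (\<lambda>b l y. cnj (V b l y) + cnj (d b l y))" by (rule SP_add[OF Vb0 db0])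
  have B2: "L False 1 (\<lambda>b l y. (cnj (V b l y) + cnj (d b l y)) ^ 2 - ?q b l y ^ 2)"
    using L_cong_mult[OF B1 B1 Bsum q] by (simp add: power2_eq_square)
  have N1: "L False 1 (\<lambda>b l y. N1 b l y - 3 * ?q b l y ^ 4)"
    unfolding N1_def
    by (rule SP_cong[OF L_cong_mult[OF A1 B2 L0_power[OF Bsum] L0_mult[OF L_numeral(1) L0_power[OF q]]]])
      (simp add: power2_eq_square power4_eq_xxxx mult_ac)
  have V3: "L False 1 (\<lambda>b l y. V b l y ^ 2 * V b l y - ?q b l y ^ 2 * ?q b l y)"
    by (rule L_cong_mult[OF VV W V0 L0_power[OF q]])
  have C1: "L False 1 (\<lambda>b l y. (2 * cnj (V b l y) + cnj (d b l y)) - 2 * ?q b l y)"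
    using SP_add[OF L0_multL[OF L_numeral(1)[of "num.Bit0 num.One"] Wb] db1] by (simp add: algebra_simps)
  have N2: "L False 1 (\<lambda>b l y. N2 b l y - 2 * ?q b l y ^ 4)"
    unfolding N2_def
    by (rule SP_cong[OF L_cong_mult[OF V3 C1 SP_add[OF L0_mult[OF L_numeral(1) Vb0] db0] L0_mult[OF L0_power[OF q] q]]])
      (simp add: power2_eq_square power3_eq_cube power4_eq_xxxx mult_ac)
  have N10: "L False 0 N1" and N20: "L False 0 N2"
    unfolding N1_def N2_def by (intro L0_intros V0 d0 Vb0 db0)+
  have e: "(v + d) ^ 3 * (vb + db) ^ 2 - v ^ 3 * vb ^ 2
      = d * ((3 * v ^ 2 + 3 * v * d + d ^ 2) * (vb + db) ^ 2) + db * (v ^ 3 * (2 * vb + db))" for v vb d db :: complex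
    by (simp add: algebra_simps power2_eq_square power3_eq_cube)
  have "L True (K + 1) (\<lambda>b l y. d b l y * (N1 b l y - 3 * ?q b l y ^ 4) + cnj (d b l y) * (N2 b l y - 2 * ?q b l y ^ 4))"
    using L_mult[OF d N1] L_mult[OF db N2] by (intro SP_add) auto
  then show "L True (K + 1) (\<lambda>b l y. (V b l y + d b l y) ^ 3 * (cnj (V b l y) + cnj (d b l y)) ^ 2 - V b l y ^ 3 * cnj (V b l y) ^ 2
     - complex_of_real (qr y) ^ 4 * (3 * d b l y + 2 * cnj (d b l y)))"
    unfolding e N1_def N2_def by (rule SP_cong) (simp add: algebra_simps)
  have "L True K (\<lambda>b l y. d b l y * N1 b l y + cnj (d b l y) * N2 b l y)"
    using L_mult[OF d N10] L_mult[OF db N20] by (intro SP_add) auto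
  then show "L True K (\<lambda>b l y. (V b l y + d b l y) ^ 3 * (cnj (V b l y) + cnj (d b l y)) ^ 2 - V b l y ^ 3 * cnj (V b l y) ^ 2)"
    unfolding e N1_def N2_def .
qed

lemma rs_increment:
  fixes m t x w al V Vb V1 V2 D Vx a q X A B A2 B2 c d db d1 d2 Dd dx :: complex
  assumes "d = X * (A + x * B)" "db = X * (A - x * B)" "d2 = X * (A2 + x * B2)"
    "Dd = X * (c * A + (c + 1) * x * B)"
  defines "p \<equiv> (1 - m\<^sup>2) * (1 - m * t)\<^sup>2" and "N \<equiv> (V + d) ^ 3 * (Vb + db) ^ 2 - V ^ 3 * Vb ^ 2"
  shows "rs m t x w (al + a * X) (V + d) (Vb + db) (V1 + d1) (V2 + d2) (D + Dd) (Vx + dx)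
    = rs m t x w al V Vb V1 V2 D Vx
     + (X * (A2 - A + 5 * q ^ 4 * A + a * w * q) + x * X * (B2 - B + q ^ 4 * B - c * A))
     + (- (p - 1) * x * Dd - X * x\<^sup>2 * ((c + 1) * B) - p * (al * dx) - p * (a * X * Vx) - p * (a * X * dx)
        + (p - 1) * (d2 - d) + w * p * (al * d) + w * p * (a * X * (V - q)) + w * p * (a * X * d) + w * (p - 1) * (a * X * q)
        + 2 * ((1 - m\<^sup>2) * (1 - m * t) * m * (1 - t\<^sup>2)) * d1
        + (1 - m\<^sup>2) * (3 * m\<^sup>2 * (1 - t\<^sup>2)\<^sup>2 - 4 * m * t * (1 - t\<^sup>2) * (1 - m * t)) * d + ((1 - m\<^sup>2)\<^sup>2 - 1) * N
        + (N - q ^ 4 * (3 * d + 2 * db)) - x * m * ((1 - m * t) * (t - m) / 2) * d)"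
  unfolding rs_def p_def N_def by (rule rs_increment_aux[OF assms(1-4)])

text \<open>Adding x^J \<lambda>^K (A + x B) to V and a0 x^J \<lambda>^K to \<alpha> changes the
  coefficient of x^J \<lambda>^K by -L_+ A + a0 y^2 Q / 4 and that of x^(J+1) \<lambda>^K by -L_- B
  - (J + K) A. Both are made to cancel the sources; all other changes have a higher power of
  \<lambda> or the power x^(J+2). The last two conclusions record the solvability condition, from
  which the first coefficients are read off later.\<close>

lemma resid_step:
  fixes c :: "nat \<Rightarrow> nat \<Rightarrow> real \<Rightarrow> real" and a :: "nat \<Rightarrow> nat \<Rightarrow> real"
  assumes ok: "coeffs_ok \<kappa> c a" and J: "even J" and K: "K \<ge> 1" and w: "J + 2 * K < 2 * \<kappa>"
    and f: "smi True f0" "smi True f1" and G: "SP True (TT \<kappa> (J + 2) K) G"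
    and R: "\<And>b l y. y \<ge> 0 \<Longrightarrow> resid \<sigma> \<kappa> c a b l y =
       xb b ^ J * complex_of_real l ^ K * complex_of_real (f0 y)
       + xb b ^ (J + 1) * complex_of_real l ^ K * complex_of_real (f1 y) + G b l y"
  obtains c' a' A where "coeffs_ok \<kappa> c' a'" "SP True (TT \<kappa> (J + 2) K) (resid \<sigma> \<kappa> c' a')"
    "\<And>j k. k \<noteq> K \<or> j < J \<Longrightarrow> c' j k = c j k \<and> a' j k = a j k"
    "c' J K = (\<lambda>y. c J K y + A y)"
    "hint (\<lambda>y. qr y * (f1 y - real (J + K) * A y)) = 0"
    "real (J + K) * ((a' J K - a J K) / 8 * Iq - 1/2 * hint (\<lambda>y. Lq y * f0 y)) = hint (\<lambda>y. qr y * f1 y)"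
proof -
  \<comment> \<open>The factor with which A reappears at order J + 1. It is nonzero by K >= 1, which
    lets the solvability condition be solved for \<open>a0\<close>.\<close>
  have nz: "real (J + K) \<noteq> 0" using K by simp
  obtain a0 A A' B B' where A: "smi True A" "A' 0 = 0" "\<And>y. y \<ge> 0 \<Longrightarrow> hderiv A (A' y) y"
    "\<And>y. y \<ge> 0 \<Longrightarrow> hderiv A' ((15 * th y ^ 2 - 14) * A y - (f0 y + a0 * (y ^ 2 / 4 * qr y))) y"
    and B: "smi True B" "B' 0 = 0" "\<And>y. y \<ge> 0 \<Longrightarrow> hderiv B (B' y) y"
    "\<And>y. y \<ge> 0 \<Longrightarrow> hderiv B' ((3 * th y ^ 2 - 2) * B y - (f1 y - real (J + K) * A y)) y"
    and o: "hint (\<lambda>y. qr y * (f1 y - real (J + K) * A y)) = 0"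
    "real (J + K) * (a0 / 8 * Iq - 1/2 * hint (\<lambda>y. Lq y * f0 y)) = hint (\<lambda>y. qr y * f1 y)"
    by (rule solve_pair[OF f nz]) (rule that; assumption)
  have hA: "hD A y = A' y" "hD (hD A) y = (15 * th y ^ 2 - 14) * A y - (f0 y + a0 * (y ^ 2 / 4 * qr y))"
    and hB: "hD B y = B' y" "hD (hD B) y = (3 * th y ^ 2 - 2) * B y - (f1 y - real (J + K) * A y)" if "y \<ge> 0" for y
    using deriv_in_half[OF A(3)[OF that] that] deriv_in_half[OF B(3)[OF that] that]
      deriv_in_cong[of "hD A" A' y] deriv_in_cong[of "hD B" B' y] deriv_in_half[OF A(3)] deriv_in_half[OF B(3)]
      deriv_in_half[OF A(4)[OF that] that] deriv_in_half[OF B(4)[OF that] that] that by auto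
  define e where "e j k y = (if (j, k) = (J, K) then A y else 0) + (if (j, k) = (J + 1, K) then B y else 0)" for j k y
  define c' where "c' j k y = c j k y + e j k y" for j k y
  define a' where "a' j k = a j k + (if (j, k) = (J, K) then a0 else 0)" for j k
  \<comment> \<open>Parity: J + 2K is even and below 2\<kappa>, so J + 1 + 2K is below it as well,
    and the truncation never splits a pair.\<close>
  have in1: "(J, K) \<in> Theta \<kappa>" and in2: "(J + 1, K) \<in> Theta \<kappa>"
    using J K w unfolding Theta_iff by presburger+
  have sc: "smi True (c j k)" "hD (c j k) 0 = 0" for j k using ok by (auto simp: coeffs_ok_def)
  have e_cases: "e j k = A \<or> e j k = B \<or> e j k = (\<lambda>_. 0)" for j k by (auto simp: e_def fun_eq_iff)
  have z: "smi True (\<lambda>_. 0)" using sm_zero by blast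
  have hz: "hD (\<lambda>_. 0 :: real) y = 0" if "y \<ge> 0" for y by (rule deriv_in_half[OF _ that]) simp
  have hzz: "hD (hD (\<lambda>_. 0 :: real)) y = 0" if "y \<ge> 0" for y
    using deriv_in_cong[of "hD (\<lambda>_. 0)" "\<lambda>_. 0 :: real" y] hz that by auto
  have se: "smi True (e j k)" for j k using e_cases[of j k] A(1) B(1) z by auto
  have sc': "smi True (c' j k)" for j k
    unfolding c'_def using sm_add[of True "{()}" _ "\<lambda>_. c j k" "\<lambda>_. e j k"] sc se by blast
  have hc': "hD (c' j k) y = hD (c j k) y + hD (e j k) y" if "y \<ge> 0" for j k y
    unfolding c'_def by (rule deriv_in_half[OF _ that]) (intro has_vector_derivative_add smi_hderiv[OF sc(1) that] smi_hderiv[OF se that])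
  have hhc': "hD (hD (c' j k)) y = hD (hD (c j k)) y + hD (hD (e j k)) y" if "y \<ge> 0" for j k y
  proof -
    have "hD (hD (c' j k)) y = hD (\<lambda>y. hD (c j k) y + hD (e j k) y) y"
      by (rule deriv_in_cong) (use hc' that in auto)
    also have "\<dots> = hD (hD (c j k)) y + hD (hD (e j k)) y"
      by (rule deriv_in_half[OF _ that]) (intro has_vector_derivative_add smi_hderiv[OF smi_hD[OF sc(1)] that] smi_hderiv[OF smi_hD[OF se] that])
    finally show ?thesis .
  qed
  have he: "hD (e j k) y = (if (j, k) = (J, K) then hD A y else 0) + (if (j, k) = (J + 1, K) then hD B y else 0)"
    "hD (hD (e j k)) y = (if (j, k) = (J, K) then hD (hD A) y else 0) + (if (j, k) = (J + 1, K) then hD (hD B) y else 0)"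
    if "y \<ge> 0" for j k y
  proof -
    have "e j k = (if (j, k) = (J, K) then A else if (j, k) = (J + 1, K) then B else (\<lambda>_. 0))"
      by (auto simp: e_def fun_eq_iff)
    then show "hD (e j k) y = (if (j, k) = (J, K) then hD A y else 0) + (if (j, k) = (J + 1, K) then hD B y else 0)"
    "hD (hD (e j k)) y = (if (j, k) = (J, K) then hD (hD A) y else 0) + (if (j, k) = (J + 1, K) then hD (hD B) y else 0)"
      using hz[OF that] hzz[OF that] by auto
  qed
  have ok': "coeffs_ok \<kappa> c' a'"
    unfolding coeffs_ok_def using sc' hc'[of 0] he(1)[of 0] sc hA(1)[of 0] hB(1)[of 0] A(2) B(2) ok J
    by (auto simp: a'_def coeffs_ok_def)
  define X where "X b l = xb b ^ J * complex_of_real l ^ K" for b l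
  have Xx: "xb b ^ (J + 1) * complex_of_real l ^ K = xb b * X b l" for b l by (simp add: X_def)
  have sum2: "Sg \<kappa> (\<lambda>j k y. (if (j, k) = (J, K) then u y else 0) + (if (j, k) = (J + 1, K) then v y else 0)) b l y
     = X b l * (complex_of_real (u y) + xb b * complex_of_real (v y))" for u v b l y
    unfolding Sg_add Sg_single[OF in1] Sg_single[OF in2] by (simp add: X_def algebra_simps)
  have Sgc: "Sg \<kappa> u b l y = Sg \<kappa> v b l y" if "\<And>j k. u j k y = v j k y" for u v b l y
    unfolding Sg_def using that by simp
  define d where "d b l y = X b l * (complex_of_real (A y) + xb b * complex_of_real (B y))" for b l y
  define d1 where "d1 b l y = X b l * (complex_of_real (hD A y) + xb b * complex_of_real (hD B y))" for b l y
  define d2 where "d2 b l y = X b l * (complex_of_real (hD (hD A) y) + xb b * complex_of_real (hD (hD B) y))" for b l y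
  define cc where "cc = complex_of_real (real (J + K))"
  define Dd where "Dd b l y = X b l * (cc * complex_of_real (A y) + (cc + 1) * xb b * complex_of_real (B y))" for b l y
  define dx where "dx b l y = Sx \<kappa> e b l y" for b l y
  have V': "Vf \<kappa> c' b l y = Vf \<kappa> c b l y + d b l y" for b l y
  proof -
    have "Sg \<kappa> e b l y = d b l y" unfolding d_def sum2[of A B, symmetric] by (rule Sgc) (simp add: e_def)
    then show ?thesis unfolding Vf_def c'_def Sg_add by simp
  qed
  have V1': "Vy \<kappa> c' b l y = Vy \<kappa> c b l y + d1 b l y" if "y \<ge> 0" for b l y
  proof -
    have "Sg \<kappa> (\<lambda>j k. hD (c' j k)) b l y = Sg \<kappa> (\<lambda>j k y. hD (c j k) y + ((if (j, k) = (J, K) then hD A y else 0) + (if (j, k) = (J + 1, K) then hD B y else 0))) b l y"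
      by (rule Sgc) (simp only: hc'[OF that] he[OF that])
    also have "\<dots> = Sg \<kappa> (\<lambda>j k. hD (c j k)) b l y + d1 b l y" unfolding d1_def sum2[of "hD A" "hD B", symmetric] by (rule Sg_add)
    finally show ?thesis unfolding Vy_def by simp
  qed
  have V2': "Vyy \<kappa> c' b l y = Vyy \<kappa> c b l y + d2 b l y" if "y \<ge> 0" for b l y
  proof -
    have "Sg \<kappa> (\<lambda>j k. hD (hD (c' j k))) b l y = Sg \<kappa> (\<lambda>j k y. hD (hD (c j k)) y + ((if (j, k) = (J, K) then hD (hD A) y else 0) + (if (j, k) = (J + 1, K) then hD (hD B) y else 0))) b l y"
      by (rule Sgc) (simp only: hhc'[OF that] he[OF that])
    also have "\<dots> = Sg \<kappa> (\<lambda>j k. hD (hD (c j k))) b l y + d2 b l y" unfolding d2_def sum2[of "hD (hD A)" "hD (hD B)", symmetric] by (rule Sg_add)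
    finally show ?thesis unfolding Vyy_def by simp
  qed
  have D': "Vd \<kappa> c' b l y = Vd \<kappa> c b l y + Dd b l y" for b l y
  proof -
    have "Vd \<kappa> c' b l y = Sg \<kappa> (\<lambda>j k y. real (j + k) * c j k y + ((if (j, k) = (J, K) then real (J + K) * A y else 0) + (if (j, k) = (J + 1, K) then (real (J + K) + 1) * B y else 0))) b l y"
      unfolding Vd_def by (rule Sgc) (auto simp: c'_def e_def algebra_simps)
    also have "\<dots> = Vd \<kappa> c b l y + X b l * (complex_of_real (real (J + K) * A y) + xb b * complex_of_real ((real (J + K) + 1) * B y))"
      unfolding Vd_def sum2[of "\<lambda>y. real (J + K) * A y" "\<lambda>y. (real (J + K) + 1) * B y", symmetric] by (rule Sg_add)
    finally show ?thesis unfolding Dd_def cc_def by (simp add: mult_ac)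
  qed
  have Sx': "Sx \<kappa> c' b l y = Sx \<kappa> c b l y + dx b l y" for b l y
    unfolding c'_def dx_def by (rule Sx_add)
  have A'': "Af \<kappa> a' b l y = Af \<kappa> a b l y + complex_of_real a0 * X b l" for b l y
  proof -
    have "Af \<kappa> a' b l y = Sg \<kappa> (\<lambda>j k y. a j k + (if (j, k) = (J, K) then a0 else 0)) b l y"
      unfolding Af_def a'_def ..
    also have "\<dots> = Af \<kappa> a b l y + Sg \<kappa> (\<lambda>j k y. if (j, k) = (J, K) then (\<lambda>_. a0) y else 0) b l y"
      unfolding Af_def by (rule Sg_add)
    finally show ?thesis unfolding Sg_single[OF in1] X_def by (simp add: mult_ac)
  qed
  \<comment> \<open>For even J the factor X is real, so conjugating the increment only changes the
    sign of the B term.\<close>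
  have cX: "cnj (X b l) = X b l" for b l
    using J by (auto elim!: evenE simp: X_def power_mult)
  have dbc: "cnj (d b l y) = X b l * (complex_of_real (A y) - xb b * complex_of_real (B y))" for b l y
    unfolding d_def by (simp add: cX)
  text \<open>The increments are divisible by \<open>\<lambda>\<^sup>K\<close>; whatever gains another factor of \<open>\<lambda>\<close> is discarded.\<close>
  let ?t = "\<lambda>b l y. complex_of_real (th y)" and ?m = "\<lambda>b l y. complex_of_real (\<sigma> * l)"
  let ?q = "\<lambda>b l y. complex_of_real (qr y)"
  let ?p = "\<lambda>b l y. (1 - (?m b l y)\<^sup>2) * (1 - ?m b l y * ?t b l y)\<^sup>2"
  let ?pu = "\<lambda>b l y. (1 - (?m b l y)\<^sup>2) * (1 - ?m b l y * ?t b l y) * ?m b l y * (1 - (?t b l y)\<^sup>2)"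
  let ?pv = "\<lambda>b l y. (1 - (?m b l y)\<^sup>2) * (3 * (?m b l y)\<^sup>2 * (1 - (?t b l y)\<^sup>2)\<^sup>2 - 4 * ?m b l y * ?t b l y * (1 - (?t b l y)\<^sup>2) * (1 - ?m b l y * ?t b l y))"
  let ?pw = "\<lambda>b l y. (1 - (?m b l y)\<^sup>2)\<^sup>2"
  let ?pz = "\<lambda>b l y. (1 - ?m b l y * ?t b l y) * (?t b l y - ?m b l y) / 2"
  let ?N = "\<lambda>b l y. (Vf \<kappa> c b l y + d b l y) ^ 3 * (cnj (Vf \<kappa> c b l y) + cnj (d b l y)) ^ 2 - Vf \<kappa> c b l y ^ 3 * cnj (Vf \<kappa> c b l y) ^ 2"
  have m0: "L False 0 ?m" by (rule L_mu0)
  have m1: "L False 1 ?m" by (rule L_mu)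
  have p_0: "L False 0 ?p" by (intro L0_intros m0)
  have p_1: "L False 1 (\<lambda>b l y. ?p b l y - 1)"
  proof -
    have "L False 0 (\<lambda>b l y. - 2 * ?t b l y + ?m b l y * (?t b l y)\<^sup>2 - ?m b l y * (1 - ?m b l y * ?t b l y)\<^sup>2)"
      using L_const[of "-2"] by (intro SP_diff SP_add L0_mult L0_power m0 L_th L_numeral) simp
    from L_mult[OF m1 this] have "L False 1 (\<lambda>b l y. ?m b l y * (- 2 * ?t b l y + ?m b l y * (?t b l y)\<^sup>2 - ?m b l y * (1 - ?m b l y * ?t b l y)\<^sup>2))" by simp
    then show ?thesis by (rule SP_cong) (simp add: algebra_simps power2_eq_square)
  qed
  have p1_1: "L False 1 ?pu"
  proof -
    have "L False 0 (\<lambda>b l y. (1 - (?m b l y)\<^sup>2) * (1 - ?m b l y * ?t b l y) * (1 - (?t b l y)\<^sup>2))"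
      by (intro L0_intros m0)
    from L_mult[OF m1 this] show ?thesis by (simp add: mult_ac)
  qed
  have p2_1: "L False 1 ?pv"
  proof -
    have "L False 0 (\<lambda>b l y. (1 - (?m b l y)\<^sup>2) * (3 * ?m b l y * (1 - (?t b l y)\<^sup>2)\<^sup>2 - 4 * ?t b l y * (1 - (?t b l y)\<^sup>2) * (1 - ?m b l y * ?t b l y)))"
      by (intro L0_intros m0)
    from L_mult[OF m1 this] have "L False 1 (\<lambda>b l y. ?m b l y * ((1 - (?m b l y)\<^sup>2) * (3 * ?m b l y * (1 - (?t b l y)\<^sup>2)\<^sup>2 - 4 * ?t b l y * (1 - (?t b l y)\<^sup>2) * (1 - ?m b l y * ?t b l y))))" by simp
    then show ?thesis by (rule SP_cong) (simp add: algebra_simps power2_eq_square)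
  qed
  have p4_1: "L False 1 (\<lambda>b l y. ?pw b l y - 1)"
  proof -
    have "L False 0 (\<lambda>b l y. ?m b l y * ((?m b l y)\<^sup>2 - 2))" by (intro L0_intros m0)
    from L_mult[OF m1 this] have "L False 1 (\<lambda>b l y. ?m b l y * (?m b l y * ((?m b l y)\<^sup>2 - 2)))" by simp
    then show ?thesis by (rule SP_cong) (simp add: algebra_simps power2_eq_square)
  qed
  have p0_0: "L False 0 ?pz"
  proof -
    have "L False 0 (\<lambda>b l y. complex_of_real (1/2) * ((1 - ?m b l y * ?t b l y) * (?t b l y - ?m b l y)))"
      by (intro L0_intros m0 L_const)
    then show ?thesis by (rule SP_cong) simp
  qed
  have lX: "L False K (\<lambda>b l y. X b l)"
    using SP_term[of J K "{(j, k). K \<le> k}" False "\<lambda>_. 1"] smi_const[of 1] by (simp add: X_def)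
  have AB: "L True 0 (\<lambda>b l y. complex_of_real (u y) + xb b * complex_of_real (v y))" if "smi True u" "smi True v" for u v
    using L_mult[OF L_xb L_real[OF that(2)]] L_real[OF that(1)] by (intro SP_add) auto
  have hs: "smi True (hD A)" "smi True (hD B)" "smi True (hD (hD A))" "smi True (hD (hD B))"
    by (intro smi_hD A(1) B(1))+
  have ld: "L True K d" unfolding d_def[abs_def] using L_mult[OF lX AB[OF A(1) B(1)]] by simp
  have ld1: "L True K d1" unfolding d1_def[abs_def] using L_mult[OF lX AB[OF hs(1,2)]] by simp
  have ld2: "L True K d2" unfolding d2_def[abs_def] using L_mult[OF lX AB[OF hs(3,4)]] by simp
  have lDd: "L True K Dd"
  proof -
    have "smi True (\<lambda>y. real (J + K) * A y)" "smi True (\<lambda>y. (real (J + K) + 1) * B y)" by (intro smi_cmult A(1) B(1))+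
    from L_mult[OF lX AB[OF this]] show ?thesis
      unfolding Dd_def[abs_def] cc_def by (simp add: mult_ac)
  qed
  have ldx: "L True K dx"
  proof -
    have "L True K (\<lambda>b l y. xb b ^ (J - 1) * complex_of_real l ^ K * complex_of_real (real J * A y)
        + xb b ^ (J + 1 - 1) * complex_of_real l ^ K * complex_of_real (real (J + 1) * B y))"
      by (intro SP_add SP_term smi_cmult A(1) B(1)) auto
    then show ?thesis
    proof (rule SP_cong)
      fix b l y
      have "dx b l y = of_nat J * xb b ^ (J - 1) * complex_of_real l ^ K * complex_of_real (A y)
        + of_nat (J + 1) * xb b ^ (J + 1 - 1) * complex_of_real l ^ K * complex_of_real (B y)"
        unfolding dx_def e_def Sx_add Sx_single[OF in1] Sx_single[OF in2] ..
      then show "xb b ^ (J - 1) * complex_of_real l ^ K * complex_of_real (real J * A y)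
        + xb b ^ (J + 1 - 1) * complex_of_real l ^ K * complex_of_real (real (J + 1) * B y) = dx b l y"
        by (simp add: mult_ac)
    qed
  qed
  have lal: "L False 1 (Af \<kappa> a)" unfolding Af_def by (intro L_Sg smi_const)
  have lVx: "L True 1 (Sx \<kappa> c)" by (intro L_Sx sc)
  have lVq: "L True 1 (\<lambda>b l y. Vf \<kappa> c b l y - ?q b l y)" unfolding Vf_def using L_Sg[OF sc(1)] by simp
  have la0: "L False 0 (\<lambda>b l y. complex_of_real a0)" by (rule L_const)
  note W = L_weaken[where n="K+1" and e=True]
  have laX: "L False K (\<lambda>b l y. complex_of_real a0 * X b l)" using L_mult[OF la0 lX] by simp
  let ?w = "\<lambda>b l y. complex_of_real (y\<^sup>2 / 4)"
  have i1: "L True (K+1) (\<lambda>b l y. - (?p b l y - 1) * xb b * Dd b l y)"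
    by (rule W[OF L_mult[OF L_mult[OF SP_minus[OF p_1] L_xb] lDd]]) auto
  have i3: "L True (K+1) (\<lambda>b l y. ?p b l y * (Af \<kappa> a b l y * dx b l y))"
    by (rule W[OF L_mult[OF p_0 L_mult[OF lal ldx]]]) auto
  have i4: "L True (K+1) (\<lambda>b l y. ?p b l y * (complex_of_real a0 * X b l * Sx \<kappa> c b l y))"
    by (rule W[OF L_mult[OF p_0 L_mult[OF laX lVx]]]) auto
  have i5: "L True (K+1) (\<lambda>b l y. ?p b l y * (complex_of_real a0 * X b l * dx b l y))"
    by (rule W[OF L_mult[OF p_0 L_mult[OF laX ldx]]]) (use K in auto)
  have i6: "L True (K+1) (\<lambda>b l y. (?p b l y - 1) * (d2 b l y - d b l y))"
    by (rule W[OF L_mult[OF p_1 SP_diff[OF ld2 ld]]]) auto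
  have i7: "L True (K+1) (\<lambda>b l y. ?w b l y * ?p b l y * (Af \<kappa> a b l y * d b l y))"
    by (rule W[OF L_mult[OF L_mult[OF L_ysq p_0] L_mult[OF lal ld]]]) auto
  have i8: "L True (K+1) (\<lambda>b l y. ?w b l y * ?p b l y * (complex_of_real a0 * X b l * (Vf \<kappa> c b l y - ?q b l y)))"
    by (rule W[OF L_mult[OF L_mult[OF L_ysq p_0] L_mult[OF laX lVq]]]) auto
  have i9: "L True (K+1) (\<lambda>b l y. ?w b l y * ?p b l y * (complex_of_real a0 * X b l * d b l y))"
    by (rule W[OF L_mult[OF L_mult[OF L_ysq p_0] L_mult[OF laX ld]]]) (use K in auto)
  have i10: "L True (K+1) (\<lambda>b l y. ?w b l y * (?p b l y - 1) * (complex_of_real a0 * X b l * ?q b l y))"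
    by (rule W[OF L_mult[OF L_mult[OF L_ysq p_1] L_mult[OF laX L_qr]]]) auto
  have i11: "L True (K+1) (\<lambda>b l y. 2 * ?pu b l y * d1 b l y)"
    by (rule W[OF L_mult[OF L_mult[OF L_numeral(1) p1_1] ld1]]) auto
  have i12: "L True (K+1) (\<lambda>b l y. ?pv b l y * d b l y)"
    by (rule W[OF L_mult[OF p2_1 ld]]) auto
  have i13: "L True (K+1) (\<lambda>b l y. (?pw b l y - 1) * ?N b l y)"
    by (rule W[OF L_mult[OF p4_1 nonlinear_increment(2)[OF lVq ld K]]]) auto
  note i14 = nonlinear_increment(1)[OF lVq ld K]
  have i15: "L True (K+1) (\<lambda>b l y. xb b * ?m b l y * ?pz b l y * d b l y)"
    by (rule W[OF L_mult[OF L_mult[OF L_mult[OF L_xb m1] p0_0] ld]]) auto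
  have toT: "SP True (TT \<kappa> (J + 2) K) F" if "L True (K+1) F" for F
    by (rule SP_weaken[OF that]) (auto simp: TT_def)
  \<comment> \<open>The one increment term without an additional \<lambda>; it belongs to the
    remaining exponents because of its power x^(J+2).\<close>
  have i2: "SP True (TT \<kappa> (J + 2) K) (\<lambda>b l y. X b l * (xb b)\<^sup>2 * ((cc + 1) * complex_of_real (B y)))"
  proof -
    have "SP True (TT \<kappa> (J + 2) K) (\<lambda>b l y. xb b ^ (J + 2) * complex_of_real l ^ K * complex_of_real ((real (J + K) + 1) * B y))"
      by (intro SP_term smi_cmult B(1)) (auto simp: TT_def)
    then show ?thesis by (rule SP_cong) (simp add: X_def cc_def power2_eq_square mult_ac)
  qed
  have Rem: "SP True (TT \<kappa> (J + 2) K) (\<lambda>b l y. G b l y + (- (?p b l y - 1) * xb b * Dd b l y - X b l * (xb b)\<^sup>2 * ((cc + 1) * complex_of_real (B y))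
      - ?p b l y * (Af \<kappa> a b l y * dx b l y) - ?p b l y * (complex_of_real a0 * X b l * Sx \<kappa> c b l y)
      - ?p b l y * (complex_of_real a0 * X b l * dx b l y)
      + (?p b l y - 1) * (d2 b l y - d b l y) + ?w b l y * ?p b l y * (Af \<kappa> a b l y * d b l y)
      + ?w b l y * ?p b l y * (complex_of_real a0 * X b l * (Vf \<kappa> c b l y - ?q b l y))
      + ?w b l y * ?p b l y * (complex_of_real a0 * X b l * d b l y)
      + ?w b l y * (?p b l y - 1) * (complex_of_real a0 * X b l * ?q b l y)
      + 2 * ?pu b l y * d1 b l y + ?pv b l y * d b l y + (?pw b l y - 1) * ?N b l y
      + (?N b l y - ?q b l y ^ 4 * (3 * d b l y + 2 * cnj (d b l y))) - xb b * ?m b l y * ?pz b l y * d b l y))"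
    by (rule SP_add[OF G]) (rule SP_diff[OF SP_add[OF SP_add[OF SP_add[OF SP_add[OF SP_add[OF SP_add[OF SP_add[OF SP_add[OF
      SP_add[OF SP_diff[OF SP_diff[OF SP_diff[OF SP_diff[OF toT[OF i1] i2] toT[OF i3]] toT[OF i4]] toT[OF i5]] toT[OF i6]]
      toT[OF i7]] toT[OF i8]] toT[OF i9]] toT[OF i10]] toT[OF i11]] toT[OF i12]] toT[OF i13]] toT[OF i14]] toT[OF i15]])
  have fin: "SP True (TT \<kappa> (J + 2) K) (resid \<sigma> \<kappa> c' a')"
  proof (rule SP_cong[OF Rem])
    fix b l y :: real assume y: "y \<ge> 0"
    have 1: "complex_of_real (hD (hD A) y) - complex_of_real (A y) + 5 * ?q b l y ^ 4 * complex_of_real (A y) + complex_of_real a0 * ?w b l y * ?q b l y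
       = - complex_of_real (f0 y)"
    proof -
      have "hD (hD A) y - A y + 5 * qr y ^ 4 * A y + a0 * (y\<^sup>2 / 4) * qr y = - f0 y"
        unfolding hA(2)[OF y] qr_4 by (simp add: algebra_simps)
      from arg_cong[OF this, of complex_of_real] show ?thesis
        by (simp only: of_real_add of_real_diff of_real_mult of_real_power of_real_minus of_real_numeral)
    qed
    have 2: "complex_of_real (hD (hD B) y) - complex_of_real (B y) + ?q b l y ^ 4 * complex_of_real (B y) - cc * complex_of_real (A y)
       = - complex_of_real (f1 y)"
    proof -
      have "hD (hD B) y - B y + qr y ^ 4 * B y - real (J + K) * A y = - f1 y"
        unfolding hB(2)[OF y] qr_4 by (simp add: algebra_simps)
      from arg_cong[OF this, of complex_of_real] show ?thesis
        by (simp only: cc_def of_real_add of_real_diff of_real_mult of_real_power of_real_minus of_real_numeral)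
    qed
    have R': "resid \<sigma> \<kappa> c a b l y = X b l * complex_of_real (f0 y) + xb b * X b l * complex_of_real (f1 y) + G b l y"
      unfolding R[OF y] X_def by (simp add: mult_ac)
    show "G b l y + (- (?p b l y - 1) * xb b * Dd b l y - X b l * (xb b)\<^sup>2 * ((cc + 1) * complex_of_real (B y))
      - ?p b l y * (Af \<kappa> a b l y * dx b l y) - ?p b l y * (complex_of_real a0 * X b l * Sx \<kappa> c b l y)
      - ?p b l y * (complex_of_real a0 * X b l * dx b l y)
      + (?p b l y - 1) * (d2 b l y - d b l y) + ?w b l y * ?p b l y * (Af \<kappa> a b l y * d b l y)
      + ?w b l y * ?p b l y * (complex_of_real a0 * X b l * (Vf \<kappa> c b l y - ?q b l y))
      + ?w b l y * ?p b l y * (complex_of_real a0 * X b l * d b l y)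
      + ?w b l y * (?p b l y - 1) * (complex_of_real a0 * X b l * ?q b l y)
      + 2 * ?pu b l y * d1 b l y + ?pv b l y * d b l y + (?pw b l y - 1) * ?N b l y
      + (?N b l y - ?q b l y ^ 4 * (3 * d b l y + 2 * cnj (d b l y))) - xb b * ?m b l y * ?pz b l y * d b l y)
      = resid \<sigma> \<kappa> c' a' b l y" (is "_ + ?rem = _")
    proof -
      have "resid \<sigma> \<kappa> c' a' b l y = resid \<sigma> \<kappa> c a b l y
        + (X b l * (complex_of_real (hD (hD A) y) - complex_of_real (A y) + 5 * ?q b l y ^ 4 * complex_of_real (A y) + complex_of_real a0 * ?w b l y * ?q b l y)
           + xb b * X b l * (complex_of_real (hD (hD B) y) - complex_of_real (B y) + ?q b l y ^ 4 * complex_of_real (B y) - cc * complex_of_real (A y))) + ?rem"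
        unfolding resid_def V' V1'[OF y] V2'[OF y] D' Sx' A'' complex_cnj_add
        by (rule rs_increment[OF d_def dbc d2_def Dd_def])
      then show ?thesis unfolding R' 1 2 by simp
    qed
  qed
  show thesis
  proof (rule that[OF ok' fin])
    show "k \<noteq> K \<or> j < J \<Longrightarrow> c' j k = c j k \<and> a' j k = a j k" for j k
      by (auto simp: c'_def a'_def e_def fun_eq_iff)
    show "c' J K = (\<lambda>y. c J K y + A y)" by (auto simp: c'_def e_def fun_eq_iff)
    show "hint (\<lambda>y. qr y * (f1 y - real (J + K) * A y)) = 0" by (rule o(1))
    show "real (J + K) * ((a' J K - a J K) / 8 * Iq - 1/2 * hint (\<lambda>y. Lq y * f0 y)) = hint (\<lambda>y. qr y * f1 y)"
      using o(2) by (simp add: a'_def)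
  qed
qed

text \<open>Clears the row of exponents with fixed K from left to right, two columns per step. Once
  i + K >= \<kappa> the rest of the row already counts as error and the recursion stops.\<close>

lemma resid_row:
  assumes "coeffs_ok \<kappa> c a" "SP True (TT \<kappa> (2 * i) K) (resid \<sigma> \<kappa> c a)" "K \<ge> 1"
  shows "\<exists>c' a'. coeffs_ok \<kappa> c' a' \<and> SP True (TT \<kappa> 0 (K + 1)) (resid \<sigma> \<kappa> c' a') \<and>
    (\<forall>j k. k \<noteq> K \<or> j < 2 * i \<longrightarrow> c' j k = c j k \<and> a' j k = a j k)"
  using assms(1,2)
proof (induction "\<kappa> - K - i" arbitrary: i c a rule: less_induct)
  case less
  show ?case
  proof (cases "\<kappa> \<le> i + K")
    case True
    then have "TT \<kappa> (2 * i) K \<subseteq> TT \<kappa> 0 (K + 1)" by (auto simp: TT_def)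
    from SP_weaken[OF less.prems(2) this, of True] less.prems(1) show ?thesis by auto
  next
    case False
    have "TT \<kappa> (2 * i) K \<subseteq> insert (2 * i, K) (insert (2 * i + 1, K) (TT \<kappa> (2 * i + 2) K))"
      by (auto simp: TT_def)
    from SP_split[OF less.prems(2) this] obtain f0 G0 where f0: "smi True f0"
      "SP True (insert (2 * i + 1, K) (TT \<kappa> (2 * i + 2) K)) G0"
      "\<And>b l y. y \<ge> 0 \<Longrightarrow> resid \<sigma> \<kappa> c a b l y = xb b ^ (2 * i) * complex_of_real l ^ K * complex_of_real (f0 y) + G0 b l y"
      by metis
    from SP_split[OF f0(2) subset_refl] obtain f1 G1 where f1: "smi True f1"
      "SP True (TT \<kappa> (2 * i + 2) K) G1"
      "\<And>b l y. y \<ge> 0 \<Longrightarrow> G0 b l y = xb b ^ (2 * i + 1) * complex_of_real l ^ K * complex_of_real (f1 y) + G1 b l y"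
      by metis
    have w: "2 * i + 2 * K < 2 * \<kappa>" using False by simp
    have R: "resid \<sigma> \<kappa> c a b l y = xb b ^ (2 * i) * complex_of_real l ^ K * complex_of_real (f0 y)
       + xb b ^ (2 * i + 1) * complex_of_real l ^ K * complex_of_real (f1 y) + G1 b l y" if "y \<ge> 0" for b l y
      using f0(3)[OF that] f1(3)[OF that] by simp
    obtain c' a' A where s: "coeffs_ok \<kappa> c' a'" "SP True (TT \<kappa> (2 * i + 2) K) (resid \<sigma> \<kappa> c' a')"
      "\<And>j k. k \<noteq> K \<or> j < 2 * i \<Longrightarrow> c' j k = c j k \<and> a' j k = a j k"
      by (rule resid_step[OF less.prems(1) _ assms(3) w f0(1) f1(1,2) R]) auto
    have "2 * i + 2 = 2 * (i + 1)" by simp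
    note s2 = s(2)[unfolded this]
    have lt: "\<kappa> - K - (i + 1) < \<kappa> - K - i" using False by simp
    from less.hyps[OF lt s(1) s2] obtain c'' a'' where
      "coeffs_ok \<kappa> c'' a''" "SP True (TT \<kappa> 0 (K + 1)) (resid \<sigma> \<kappa> c'' a'')"
      "\<forall>j k. k \<noteq> K \<or> j < 2 * (i + 1) \<longrightarrow> c'' j k = c' j k \<and> a'' j k = a' j k" by blast
    with s(3) show ?thesis by (intro exI[of _ c''] exI[of _ a'']) auto
  qed
qed

text \<open>For constant \<lambda> the gauged soliton is an exact stationary solution, so the
  stationary terms cancel. What is left is the drift of \<mu> = \<sigma>\<lambda> under \<lambda>' =
  -b \<lambda>.\<close>

lemma resid_zero:
  assumes "y \<ge> 0"
  shows "resid \<sigma> \<kappa> (\<lambda>j k y. 0) (\<lambda>j k. 0) b l y = - (xb b * complex_of_real (\<sigma> * l) *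
     ((1 - complex_of_real (\<sigma> * l) * complex_of_real (th y)) * (complex_of_real (th y) - complex_of_real (\<sigma> * l)) / 2) * complex_of_real (qr y))"
proof -
  have hz: "hD (\<lambda>_. 0 :: real) y = 0" if "y \<ge> 0" for y by (rule deriv_in_half[OF _ that]) simp
  have hzz: "hD (hD (\<lambda>_. 0 :: real)) y = 0"
    using deriv_in_cong[of "hD (\<lambda>_. 0)" "\<lambda>_. 0 :: real" y] hz assms by auto
  define m t q where "m = complex_of_real (\<sigma> * l)" and "t = complex_of_real (th y)" and "q = complex_of_real (qr y)"
  have q5: "q ^ 5 = 3 * (1 - t\<^sup>2) * q"
  proof -
    have "qr y ^ 5 = 3 * (1 - th y ^ 2) * qr y" using qr_4[of y] by (simp add: eval_nat_numeral)
    from arg_cong[OF this, of complex_of_real] show ?thesis by (simp add: q_def t_def)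
  qed
  have V: "Vf \<kappa> (\<lambda>j k y. 0) b l y = q" "Vy \<kappa> (\<lambda>j k y. 0) b l y = - (t * q)"
    "Vyy \<kappa> (\<lambda>j k y. 0) b l y = (3 * t\<^sup>2 - 2) * q" "Vd \<kappa> (\<lambda>j k y. 0) b l y = 0" "Sx \<kappa> (\<lambda>j k y. 0) b l y = 0"
    "Af \<kappa> (\<lambda>j k. 0) b l y = 0"
    using hz[OF assms] hzz by (simp_all add: Vf_def Vy_def Vyy_def Vd_def Sx_def Af_def Sg_def q_def t_def)
  have "cnj q = q" by (simp add: q_def)
  moreover have "q ^ 3 * q ^ 2 = q ^ 5" by (simp add: power_add[symmetric])
  ultimately have "resid \<sigma> \<kappa> (\<lambda>j k y. 0) (\<lambda>j k. 0) b l y =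
     (1 - m\<^sup>2) * (1 - m * t)\<^sup>2 * ((3 * t\<^sup>2 - 2) * q - q)
     + 2 * ((1 - m\<^sup>2) * (1 - m * t) * m * (1 - t\<^sup>2)) * (- (t * q))
     + (1 - m\<^sup>2) * (3 * m\<^sup>2 * (1 - t\<^sup>2)\<^sup>2 - 4 * m * t * (1 - t\<^sup>2) * (1 - m * t)) * q
     + (1 - m\<^sup>2)\<^sup>2 * (3 * (1 - t\<^sup>2) * q) - xb b * m * ((1 - m * t) * (t - m) / 2) * q"
    unfolding resid_def V rs_def m_def[symmetric] t_def[symmetric] using q5 by simp
  also have "\<dots> = - (xb b * m * ((1 - m * t) * (t - m) / 2) * q)"
  proof -
    have "(1 - m\<^sup>2) * (1 - m * t)\<^sup>2 * ((3 * t\<^sup>2 - 2) * q - q)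
     + 2 * ((1 - m\<^sup>2) * (1 - m * t) * m * (1 - t\<^sup>2)) * (- (t * q))
     + (1 - m\<^sup>2) * (3 * m\<^sup>2 * (1 - t\<^sup>2)\<^sup>2 - 4 * m * t * (1 - t\<^sup>2) * (1 - m * t)) * q
     + (1 - m\<^sup>2)\<^sup>2 * (3 * (1 - t\<^sup>2) * q)
     = (1 - m\<^sup>2) * (1 - t\<^sup>2) * q * (- 3 * (1 - m * t)\<^sup>2 - 2 * (1 - m * t) * m * t
       + 3 * m\<^sup>2 * (1 - t\<^sup>2) - 4 * m * t * (1 - m * t) + 3 * (1 - m\<^sup>2))"
      by (simp add: algebra_simps power2_eq_square)
    also have "(- 3 * (1 - m * t)\<^sup>2 - 2 * (1 - m * t) * m * t
       + 3 * m\<^sup>2 * (1 - t\<^sup>2) - 4 * m * t * (1 - m * t) + 3 * (1 - m\<^sup>2)) = 0"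
      by (simp add: algebra_simps power2_eq_square)
    finally show ?thesis by simp
  qed
  finally show ?thesis by (simp only: m_def t_def q_def)
qed

text \<open>The integrand is the derivative of -Q^2 / 2; this is where the factor Q(0)^2 of
  \<open>alpha_star\<close> comes from.\<close>

lemma hint_th_qr: "hint (\<lambda>y. th y * qr y ^ 2) = qr 0 ^ 2 / 2"
proof -
  have s: "smi True (\<lambda>y. (-1/2) * qr y ^ 2)"
    using smi_cmult[OF smi_mult[OF smi_qr smi_qr], of "-1/2"] by (simp add: power2_eq_square)
  have "hderiv (\<lambda>y. (-1/2) * qr y ^ 2) (th y * qr y ^ 2) y" for y
    using hderiv_qr[of y] unfolding has_real_derivative_iff_has_vector_derivative[symmetric]
    by (auto intro!: derivative_eq_intros simp: power2_eq_square)
  from smi_hint_deriv[OF s this] show ?thesis by simp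
qed

text \<open>The pair at (0, 1) is solved separately because its coefficient and its orthogonality
  relation are wanted explicitly; all later steps leave the entry (0, 1) unchanged.\<close>

theorem profile_coefficients:
  assumes "\<kappa> \<ge> 1"
  obtains c a where "coeffs_ok \<kappa> c a" "SP True {(j, k). 2 * \<kappa> \<le> j + 2 * k} (resid \<sigma> \<kappa> c a)"
    "\<kappa> \<ge> 2 \<Longrightarrow> a 0 1 = - 2 * \<sigma> * qr 0 ^ 2 / Iq"
    "\<kappa> \<ge> 2 \<Longrightarrow> hint (\<lambda>y. qr y * (c 0 1 y + \<sigma> / 2 * (th y * qr y))) = 0"
proof -
  define c0 :: "nat \<Rightarrow> nat \<Rightarrow> real \<Rightarrow> real" where "c0 = (\<lambda>j k y. 0)"
  define a0 :: "nat \<Rightarrow> nat \<Rightarrow> real" where "a0 = (\<lambda>j k. 0)"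
  let ?t = "\<lambda>b l y. complex_of_real (th y)" and ?m = "\<lambda>b l y. complex_of_real (\<sigma> * l)"
  have ok0: "coeffs_ok \<kappa> c0 a0"
  proof -
    have "hD (\<lambda>_. 0 :: real) 0 = 0" by (rule deriv_in_half) auto
    then show ?thesis by (simp add: coeffs_ok_def c0_def a0_def sm_zero)
  qed
  \<comment> \<open>At (0, 1) the even source is 0. The odd source -(\<sigma>/2) t Q is the part of
    the drift linear in \<lambda>, and the rest carries \<lambda>^2.\<close>
  have R0: "resid \<sigma> \<kappa> c0 a0 b l y = xb b ^ 0 * complex_of_real l ^ 1 * complex_of_real 0
      + xb b ^ (0 + 1) * complex_of_real l ^ 1 * complex_of_real (- (\<sigma> / 2) * (th y * qr y))
      + xb b * complex_of_real l * (?m b l y * ((1 - ?m b l y * ?t b l y + (?t b l y)\<^sup>2) * (complex_of_real (\<sigma> / 2) * complex_of_real (qr y))))"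
    if "y \<ge> 0" for b l y
    unfolding c0_def a0_def resid_zero[OF that] by (simp add: field_simps power2_eq_square)
  have lqs: "L True 0 (\<lambda>b l y. complex_of_real (\<sigma> / 2) * complex_of_real (qr y))"
    using L_mult[OF L_const[of "\<sigma>/2"] L_qr] by simp
  have "L False 0 (\<lambda>b l y. 1 - ?m b l y * ?t b l y + (?t b l y)\<^sup>2)" by (intro L0_intros L_mu0)
  from L_mult[OF L_lam L_mult[OF L_mu L_mult[OF this lqs]], of \<sigma>]
  have "L True 2 (\<lambda>b l y. complex_of_real l * (?m b l y * ((1 - ?m b l y * ?t b l y + (?t b l y)\<^sup>2) * (complex_of_real (\<sigma> / 2) * complex_of_real (qr y)))))"
    by (simp add: numeral_2_eq_2)
  from L0_multL[OF L_xb this] have G2: "L True 2 (\<lambda>b l y. xb b * complex_of_real l * (?m b l y * ((1 - ?m b l y * ?t b l y + (?t b l y)\<^sup>2) * (complex_of_real (\<sigma> / 2) * complex_of_real (qr y)))))"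
    by (simp add: mult_ac)
  have f1: "smi True (\<lambda>y. - (\<sigma> / 2) * (th y * qr y))"
    using smi_cmult[OF smi_mult[OF smi_qr allI[OF sm_th]], of "- (\<sigma>/2)"] by (simp add: mult_ac)
  have f0: "smi True (\<lambda>y. 0)" using sm_zero by blast
  show thesis
  proof (cases "\<kappa> \<ge> 2")
    case False
    then have k: "\<kappa> = 1" using assms by simp
    have "SP True {(j, k). 2 * \<kappa> \<le> j + 2 * k} (\<lambda>b l y. xb b ^ 1 * complex_of_real l ^ 1 * complex_of_real (- (\<sigma> / 2) * (th y * qr y))
      + xb b * complex_of_real l * (?m b l y * ((1 - ?m b l y * ?t b l y + (?t b l y)\<^sup>2) * (complex_of_real (\<sigma> / 2) * complex_of_real (qr y)))))"
      by (intro SP_add SP_term f1 SP_weaken[OF G2]) (auto simp: k)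
    then have "SP True {(j, k). 2 * \<kappa> \<le> j + 2 * k} (resid \<sigma> \<kappa> c0 a0)"
      by (rule SP_cong) (simp add: R0)
    with ok0 show thesis using that[of c0 a0] False by auto
  next
    case True
    have GT: "SP True (TT \<kappa> (0 + 2) 1) (\<lambda>b l y. xb b * complex_of_real l * (?m b l y * ((1 - ?m b l y * ?t b l y + (?t b l y)\<^sup>2) * (complex_of_real (\<sigma> / 2) * complex_of_real (qr y)))))"
      by (rule SP_weaken[OF G2]) (auto simp: TT_def)
    obtain c1 a1 A where s: "coeffs_ok \<kappa> c1 a1" "SP True (TT \<kappa> (0 + 2) 1) (resid \<sigma> \<kappa> c1 a1)"
      "c1 0 1 = (\<lambda>y. c0 0 1 y + A y)"
      "hint (\<lambda>y. qr y * (- (\<sigma> / 2) * (th y * qr y) - real (0 + 1) * A y)) = 0"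
      "real (0 + 1) * ((a1 0 1 - a0 0 1) / 8 * Iq - 1/2 * hint (\<lambda>y. Lq y * 0)) = hint (\<lambda>y. qr y * (- (\<sigma> / 2) * (th y * qr y)))"
      by (rule resid_step[OF ok0 _ _ _ f0 f1 GT R0]) (use True in auto)
    have "(a1 0 1) / 8 * Iq = - (\<sigma> / 2) * hint (\<lambda>y. th y * qr y ^ 2)"
    proof -
      have "hint (\<lambda>y. qr y * (- (\<sigma> / 2) * (th y * qr y))) = hint (\<lambda>y. - (\<sigma> / 2) * (th y * qr y ^ 2))"
        by (rule hint_cong) (simp add: power2_eq_square)
      also have "\<dots> = - (\<sigma> / 2) * hint (\<lambda>y. th y * qr y ^ 2)" by (rule hint_cmult)
      finally show ?thesis using s(5) by (simp add: a0_def)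
    qed
    then have a1: "a1 0 1 = - 2 * \<sigma> * qr 0 ^ 2 / Iq"
      unfolding hint_th_qr using Iq_pos by (simp add: field_simps)
    have c1: "hint (\<lambda>y. qr y * (c1 0 1 y + \<sigma> / 2 * (th y * qr y))) = 0"
    proof -
      have cA: "c1 0 1 = A" unfolding s(3) by (simp add: c0_def)
      have "hint (\<lambda>y. qr y * (c1 0 1 y + \<sigma> / 2 * (th y * qr y))) = hint (\<lambda>y. (-1) * (qr y * (- (\<sigma> / 2) * (th y * qr y) - real (0 + 1) * A y)))"
        unfolding cA by (rule hint_cong) (simp add: algebra_simps)
      also have "\<dots> = 0" unfolding hint_cmult s(4) by simp
      finally show ?thesis .
    qed
    have "\<exists>c a. coeffs_ok \<kappa> c a \<and> SP True (TT \<kappa> 0 K) (resid \<sigma> \<kappa> c a) \<and> c 0 1 = c1 0 1 \<and> a 0 1 = a1 0 1" if "K \<ge> 2" for K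
      using that
    proof (induction K rule: nat_induct_at_least)
      case base
      have "SP True (TT \<kappa> (2 * 1) 1) (resid \<sigma> \<kappa> c1 a1)" using s(2) by (simp add: numeral_2_eq_2)
      from resid_row[OF s(1) this] show ?case by (auto simp: numeral_2_eq_2)
    next
      case (Suc K)
      then obtain c a where ca: "coeffs_ok \<kappa> c a" "SP True (TT \<kappa> (2 * 0) K) (resid \<sigma> \<kappa> c a)" "c 0 1 = c1 0 1" "a 0 1 = a1 0 1"
        by auto
      have "K \<ge> 1" using Suc.hyps by simp
      from resid_row[OF ca(1,2) this] obtain c' a' where
        "coeffs_ok \<kappa> c' a'" "SP True (TT \<kappa> 0 (K + 1)) (resid \<sigma> \<kappa> c' a')"
        and e: "\<forall>j k. k \<noteq> K \<or> j < 2 * 0 \<longrightarrow> c' j k = c j k \<and> a' j k = a j k" by blast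
      moreover have "c' 0 1 = c 0 1 \<and> a' 0 1 = a 0 1" using e[rule_format, of 1 0] Suc.hyps by simp
      ultimately show ?case using ca(3,4) by (intro exI[of _ c'] exI[of _ a']) simp
    qed
    from this[OF True] obtain c a where ca: "coeffs_ok \<kappa> c a" "SP True (TT \<kappa> 0 \<kappa>) (resid \<sigma> \<kappa> c a)" "c 0 1 = c1 0 1" "a 0 1 = a1 0 1"
      by auto
    \<comment> \<open>Stopping at row \<kappa> suffices, since k >= \<kappa> implies j + 2k >=
      2\<kappa>.\<close>
    have "SP True {(j, k). 2 * \<kappa> \<le> j + 2 * k} (resid \<sigma> \<kappa> c a)"
      by (rule SP_weaken[OF ca(2)]) (auto simp: TT_def)
    then show thesis using that[of c a] ca a1 c1 by auto
  qed
qed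

section \<open>The gauge factor\<close>

lemma tanh_artanh_real: "\<bar>m\<bar> < 1 \<Longrightarrow> tanh (artanh m) = (m::real)"
proof -
  assume m: "\<bar>m\<bar> < 1"
  have "exp (- 2 * artanh m) = inverse ((1 + m) / (1 - m))"
    using m by (simp add: artanh_def exp_minus)
  also have "\<dots> = (1 - m) / (1 + m)" by simp
  finally have "tanh (artanh m) = (1 - (1 - m) / (1 + m)) / (1 + (1 - m) / (1 + m))"
    by (simp only: tanh_real_altdef)
  moreover have "1 - (1 - m) / (1 + m) = m * (2 / (1 + m))" "1 + (1 - m) / (1 + m) = 2 / (1 + m)"
    using m by (simp_all add: field_simps)
  ultimately show ?thesis using m by simp
qed

lemma cosh_artanh_real: "\<bar>m\<bar> < 1 \<Longrightarrow> cosh (artanh (m::real)) = (1 - m\<^sup>2) powr (-1/2)"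
proof -
  assume m: "\<bar>m\<bar> < 1"
  let ?c = "cosh (artanh m)"
  have c: "?c > 0" by simp
  have "sinh (artanh m) = m * ?c" using tanh_artanh_real[OF m] c by (simp add: tanh_def field_simps)
  with hyperbolic_pythagoras[of "artanh m"] have "?c\<^sup>2 * (1 - m\<^sup>2) = 1" by (simp add: algebra_simps power_mult_distrib)
  moreover have p: "1 - m\<^sup>2 > 0" using m by (simp add: abs_square_less_1)
  ultimately have "?c\<^sup>2 = inverse (1 - m\<^sup>2)" by (simp add: field_simps)
  then have "?c = sqrt (inverse (1 - m\<^sup>2))" using c by (metis less_imp_le real_sqrt_abs abs_of_pos)
  also have "\<dots> = inverse ((1 - m\<^sup>2) powr (1/2))" using p by (simp add: real_sqrt_inverse powr_half_sqrt)
  also have "\<dots> = (1 - m\<^sup>2) powr (-1/2)" using powr_minus[of "1 - m\<^sup>2" "1/2"] by simp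
  finally show ?thesis .
qed

text \<open>\<open>Q\<^sub>\<beta> = G Q\<close> with \<open>\<mu> = \<beta> / N\<close>; multiplying by \<open>G\<close> turns the Neumann condition at the vertex
  into the one of \<open>D\<^sub>\<beta>\<close>.\<close>

definition Gg :: "real \<Rightarrow> real \<Rightarrow> real" where
  "Gg m y = (1 - m\<^sup>2) powr (1/4) * (1 - m * th y) powr (-1/2)"

text \<open>The subtraction formula for cosh, with tanh (artanh \<mu>) = \<mu>, gives cosh (2 (y -
  \<tau>)) = cosh (2y) cosh (artanh \<mu>) (1 - \<mu> t).\<close>

lemma Q_beta_gauge:
  assumes "\<bar>\<beta> / real N\<bar> < 1"
  shows "Q_beta N \<beta> i y = complex_of_real (Gg (\<beta> / real N) y * qr y)"
proof -
  define m where "m = \<beta> / real N"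
  have m: "\<bar>m\<bar> < 1" using assms by (simp add: m_def)
  have p: "1 - m\<^sup>2 > 0" using m by (simp add: abs_square_less_1)
  have d: "1 - m * th y > 0" using one_minus_mt_bound(2)[of m "\<bar>m\<bar>" y] m by simp
  let ?c = "cosh (artanh m)"
  have s: "sinh (artanh m) = m * ?c"
    using tanh_artanh_real[OF m] cosh_real_pos[of "artanh m"] by (simp add: tanh_def field_simps)
  have s2: "sinh (2 * y) = cosh (2 * y) * th y" using cosh_real_pos[of "2*y"] by (simp add: tanh_def)
  have e: "2 * (y - tau N \<beta>) = 2 * y - artanh m" by (simp add: tau_def m_def)
  have "cosh (2 * (y - tau N \<beta>)) = cosh (2 * y) * ?c * (1 - m * th y)"
    unfolding e cosh_diff s s2 by (simp add: algebra_simps)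
  also have "\<dots> powr (-1/2) = cosh (2 * y) powr (-1/2) * ?c powr (-1/2) * (1 - m * th y) powr (-1/2)"
    using d cosh_real_pos[of "artanh m"] cosh_real_pos[of "2*y"] by (simp add: powr_mult)
  also have "?c powr (-1/2) = (1 - m\<^sup>2) powr (1/4)"
    unfolding cosh_artanh_real[OF m] powr_powr by simp
  finally show ?thesis unfolding Q_beta_def Gg_def qr_def m_def[symmetric] by (simp add: mult_ac)
qed

text \<open>The logarithmic derivative of \<open>Gg\<close> in y; the companion \<open>g0\<close> is
  the one in the parameter. Reciprocals are kept as separate factors so that \<open>sm_recip\<close>
  applies.\<close>

abbreviation g1 :: "real \<Rightarrow> real \<Rightarrow> real" where
  "g1 m y \<equiv> m * (1 - (th y)\<^sup>2) * (1 / (1 - m * th y))"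

abbreviation g0 :: "real \<Rightarrow> real \<Rightarrow> real" where
  "g0 m y \<equiv> (th y - m) / 2 * (1 / (1 - m\<^sup>2)) * (1 / (1 - m * th y))"

lemma hderiv_Gg:
  assumes "\<bar>m\<bar> < 1"
  shows "hderiv (Gg m) (Gg m y * g1 m y) y"
proof -
  have d: "1 - m * th y > 0" using one_minus_mt_bound(2)[of m "\<bar>m\<bar>" y] assms by simp
  have "((\<lambda>y. (1 - m\<^sup>2) powr (1/4) * (1 - m * th y) powr (-1/2)) has_real_derivative
      (1 - m\<^sup>2) powr (1/4) * (-1/2 * (1 - m * th y) powr (-1/2 - 1) * (- (m * (2 * (1 - (th y)\<^sup>2)))))) (at y within {0..})"
    using d hderiv_tanh2[of y] unfolding has_real_derivative_iff_has_vector_derivative[symmetric]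
    by (auto intro!: derivative_eq_intros)
  moreover have "(1 - m * th y) powr (-1/2 - 1) = (1 - m * th y) powr (-1/2) / (1 - m * th y)"
    using d powr_diff[of "1 - m * th y" "-1/2" 1] by (simp only: powr_one less_imp_le)
  moreover have "A * (-1/2 * (B / (1 - m * th y)) * (- (m * (2 * T)))) = A * B * (m * T * (1 / (1 - m * th y)))" for A B T
    using d by (simp add: field_simps)
  ultimately show ?thesis
    unfolding has_real_derivative_iff_has_vector_derivative[symmetric] Gg_def[abs_def] by (simp only:)
qed

lemma Gg_param_deriv:
  assumes "\<bar>m\<bar> < 1"
  shows "((\<lambda>m. Gg m y) has_real_derivative Gg m y * g0 m y) (at m)"
proof -
  have d: "1 - m * th y > 0" using one_minus_mt_bound(2)[of m "\<bar>m\<bar>" y] assms by simp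
  have p: "1 - m\<^sup>2 > 0" using assms by (simp add: abs_square_less_1)
  have "((\<lambda>m. (1 - m\<^sup>2) powr (1/4) * (1 - m * th y) powr (-1/2)) has_real_derivative
      (1 - m\<^sup>2) powr (1/4) * (-1/2 * (1 - m * th y) powr (-1/2 - 1) * (- th y))
      + 1/4 * (1 - m\<^sup>2) powr (1/4 - 1) * (- (2 * m)) * (1 - m * th y) powr (-1/2)) (at m)"
    using d p by (auto intro!: derivative_eq_intros)
  moreover have "(1 - m * th y) powr (-1/2 - 1) = (1 - m * th y) powr (-1/2) / (1 - m * th y)"
    using d powr_diff[of "1 - m * th y" "-1/2" 1] by (simp only: powr_one less_imp_le)
  moreover have "(1 - m\<^sup>2) powr (1/4 - 1) = (1 - m\<^sup>2) powr (1/4) / (1 - m\<^sup>2)"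
    using p powr_diff[of "1 - m\<^sup>2" "1/4" 1] by (simp only: powr_one less_imp_le)
  moreover have "A * (-1/2 * (B / (1 - m * th y)) * (- th y)) + 1/4 * (A / (1 - m\<^sup>2)) * (- (2 * m)) * B
     = A * B * g0 m y" for A B
  proof -
    define D P where "D = 1 - m * th y" and "P = 1 - m\<^sup>2"
    have "D \<noteq> 0" "P \<noteq> 0" using d p by (auto simp: D_def P_def)
    then have "A * (-1/2 * (B / D) * (- th y)) + 1/4 * (A / P) * (- (2 * m)) * B = A * B * ((th y * P - m * D) / 2 * (1 / P) * (1 / D))"
      by (simp add: field_simps)
    moreover have "th y * P - m * D = th y - m" by (simp add: D_def P_def algebra_simps power2_eq_square)
    ultimately show ?thesis by (simp only: D_def P_def)
  qed
  ultimately show ?thesis unfolding Gg_def[abs_def] by (simp only:)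
qed

text \<open>G^2 is rational in t up to a root independent of y, and G^4 is rational altogether. The
  latter makes the quintic term fit a polynomial residual, the former the expansion of the energy,
  where only squared moduli occur.\<close>

lemma Gg_sq: "\<bar>m\<bar> < 1 \<Longrightarrow> (Gg m y)\<^sup>2 = sqrt (1 - m\<^sup>2) * (1 / (1 - m * th y))"
proof -
  assume m: "\<bar>m\<bar> < 1"
  have d: "1 - m * th y > 0" using one_minus_mt_bound(2)[of m "\<bar>m\<bar>" y] m by simp
  have p: "1 - m\<^sup>2 > 0" using m by (simp add: abs_square_less_1)
  have "(Gg m y)\<^sup>2 = ((1 - m\<^sup>2) powr (1/4) * (1 - m\<^sup>2) powr (1/4)) * ((1 - m * th y) powr (-1/2) * (1 - m * th y) powr (-1/2))"
    by (simp add: Gg_def power2_eq_square mult_ac)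
  also have "\<dots> = (1 - m\<^sup>2) powr (1/2) * (1 - m * th y) powr (-1)"
    unfolding powr_add[symmetric] by simp
  also have "\<dots> = sqrt (1 - m\<^sup>2) * (1 / (1 - m * th y))"
    using d p by (simp only: powr_neg_one powr_half_sqrt less_imp_le)
  finally show ?thesis .
qed

lemma Gg_4: "\<bar>m\<bar> < 1 \<Longrightarrow> (Gg m y) ^ 4 = (1 - m\<^sup>2) * (1 / (1 - m * th y))\<^sup>2"
proof -
  assume m: "\<bar>m\<bar> < 1"
  then have p: "1 - m\<^sup>2 \<ge> 0" by (simp add: abs_square_le_1)
  have "(Gg m y) ^ 4 = ((Gg m y)\<^sup>2)\<^sup>2" by simp
  then show ?thesis unfolding Gg_sq[OF m] power_mult_distrib using p by simp
qed

lemma sm_g1: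
  fixes m :: "'p \<Rightarrow> real"
  assumes m: "\<And>p. p \<in> K \<Longrightarrow> \<bar>m p\<bar> \<le> q" and q: "q < 1"
  shows "sm False K n (\<lambda>p. g1 (m p))"
  by (intro sm_mult_decay(3) sm_diff sm_power sm_th sm_const[where M=1] sm_recip[OF m q]) (use m q in force)+

lemma sm_g0:
  fixes m :: "'p \<Rightarrow> real"
  assumes m: "\<And>p. p \<in> K \<Longrightarrow> \<bar>m p\<bar> \<le> q" and q: "q < 1"
  shows "sm False K n (\<lambda>p. g0 (m p))"
proof -
  have "norm (1 / (1 - (m p)\<^sup>2)) \<le> 1 / (1 - q\<^sup>2)" if "p \<in> K" for p
  proof -
    have "(m p)\<^sup>2 \<le> q\<^sup>2" using m[OF that] by (metis abs_le_square_iff abs_of_nonneg abs_ge_zero order_trans)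
    moreover have "q\<^sup>2 < 1" using m[OF that] q by (simp add: abs_square_less_1)
    ultimately show ?thesis by (simp add: frac_le)
  qed
  note c = sm_const[where c="\<lambda>p. 1 / (1 - (m p)\<^sup>2)", OF this]
  have "sm False K n (\<lambda>p y. (1/2) * (th y - m p) * (1 / (1 - (m p)\<^sup>2)) * (1 / (1 - m p * th y)))"
    by (intro sm_mult_decay(3) sm_diff sm_th sm_const[where M=1] sm_recip[OF m q] c) (use m q in force)+
  then show ?thesis by (rule sm_cong) simp
qed

lemma sm_Gg:
  fixes m :: "'p \<Rightarrow> real"
  assumes m: "\<And>p. p \<in> K \<Longrightarrow> \<bar>m p\<bar> \<le> q" and q: "q < 1"
  shows "sm False K n (\<lambda>p. Gg (m p))"
proof (induction n)
  case 0
  have "norm (Gg (m p) y) \<le> (1 - q) powr (-1/2)" if "p \<in> K" for p y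
  proof -
    have "(m p)\<^sup>2 \<le> 1" using m[OF that] q by (simp add: abs_square_le_1)
    then have "(1 - (m p)\<^sup>2) powr (1/4) \<le> 1" by (intro powr_le1) auto
    moreover have "(1 - m p * th y) powr (-1/2) \<le> (1 - q) powr (-1/2)"
      using one_minus_mt_bound[OF m[OF that] q, of y] q by (intro powr_mono2') auto
    ultimately have "(1 - (m p)\<^sup>2) powr (1/4) * (1 - m p * th y) powr (-1/2) \<le> 1 * (1 - q) powr (-1/2)"
      by (intro mult_mono) auto
    then show ?thesis by (simp add: Gg_def)
  qed
  then show ?case unfolding sm.simps by (rule growth_bounded)
next
  case (Suc n)
  have "sm False K n (\<lambda>p y. Gg (m p) y * g1 (m p) y)"
    by (intro sm_mult_decay(3) Suc sm_g1[OF m q])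
  then show ?case
    by (rule sm_SucI[OF sm_growth[OF Suc] hderiv_Gg, rotated -1]) (use m q in force)
qed

section \<open>Membership in the function spaces\<close>

lemma Ck_on_cong:
  assumes "Ck_on {0..} n f" "\<And>y. y \<ge> 0 \<Longrightarrow> f y = g y"
  shows "Ck_on {0..} n g"
proof -
  have e: "(deriv_in {0..} ^^ m) f y = (deriv_in {0..} ^^ m) g y" if "y \<ge> 0" for m y
    by (rule iter_deriv_in_cong) (use assms that in auto)
  have "(deriv_in {0..} ^^ m) g differentiable at y within {0..}"
    if "(deriv_in {0..} ^^ m) f differentiable at y within {0..}" "y \<ge> 0" for m y
    using that e by (auto intro: differentiable_transform_within[of _ y "{0..}" 1])
  moreover have "continuous_on {0..} ((deriv_in {0..} ^^ n) g)"
    using assms(1) e continuous_on_cong[of "{0..}" "{0..}" "(deriv_in {0..} ^^ n) f" "(deriv_in {0..} ^^ n) g"]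
    by (auto simp: Ck_on_def)
  ultimately show ?thesis using assms(1) by (auto simp: Ck_on_def)
qed

lemma sm_in_Cexp:
  fixes F :: "'p \<Rightarrow> real \<Rightarrow> complex"
  assumes s: "sm True K (Suc \<nu>) F" and p: "p \<in> K" and u: "\<And>i y. i < N \<Longrightarrow> y \<ge> 0 \<Longrightarrow> u i y = c * F p y"
  shows "u \<in> Cexp N \<nu>"
proof -
  have s': "sm True K (Suc \<nu>) (\<lambda>p y. c * F p y)"
    by (rule sm_mult_decay(2)[OF sm_const[where M="norm c"] s]) auto
  have "Ck_on {0..} \<nu> (u i)" if "i < N" for i
    by (rule Ck_on_cong[OF Ck_on_sm[OF s' p]]) (use u that in auto)
  moreover obtain \<rho> C where "\<rho> > 0" "Cexp_norm N \<nu> \<rho> u \<le> ennreal (C * norm c)"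
    using sm_Cexp_norm[OF sm_SucD[OF s]] u p by metis
  then have "\<exists>\<rho>>0. Cexp_norm N \<nu> \<rho> u < \<infinity>" by (auto intro!: exI[of _ \<rho>] simp: order_le_less_trans[OF _ ennreal_less_top] top_unique less_top[symmetric])
  ultimately show ?thesis using u by (auto simp: Cexp_def radial_def)
qed

abbreviation csmi :: "(real \<Rightarrow> complex) \<Rightarrow> bool" where
  "csmi f \<equiv> (\<forall>n. sm True {()} n (\<lambda>_. f))"

lemma csmi_decay:
  assumes "csmi f"
  obtains C \<rho> where "C > 0" "\<rho> > 0" "\<And>y. y \<ge> 0 \<Longrightarrow> norm (f y) \<le> C * exp (- (\<rho> * y))"
proof -
  have "decays {()} (\<lambda>_. f)" using sm_growth[OF assms[rule_format, of 0]] by (simp add: growth_def)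
  then show thesis by (rule decaysE) (use that in blast)
qed

lemma csmi_continuous: "csmi f \<Longrightarrow> continuous_on {0..} f"
  by (rule sm_continuous[of True "{()}" 0 "\<lambda>_. f" "()"]) blast+

lemma csmi_L2: assumes "csmi f" shows "L2_edge f"
proof -
  obtain C \<rho> where C: "C > 0" "\<rho> > 0" "\<And>y. y \<ge> 0 \<Longrightarrow> norm (f y) \<le> C * exp (- (\<rho> * y))"
    using csmi_decay[OF assms] by metis
  have "hintegrable (\<lambda>y. (cmod (f y))\<^sup>2)"
  proof (rule decay_hintegrable)
    show "continuous_on {0..} (\<lambda>y. (cmod (f y))\<^sup>2)" by (intro continuous_intros csmi_continuous assms)
    show "2 * \<rho> > 0" using C by simp
    fix y :: real assume "y \<ge> 0"
    then have "(cmod (f y))\<^sup>2 \<le> (C * exp (- (\<rho> * y)))\<^sup>2" by (intro power_mono C) auto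
    also have "\<dots> = C\<^sup>2 * exp (- (2 * \<rho> * y))" by (simp add: power_mult_distrib power2_eq_square exp_add[symmetric])
    finally show "norm ((cmod (f y))\<^sup>2) \<le> C\<^sup>2 * exp (- (2 * \<rho> * y))" by simp
  qed
  then show ?thesis unfolding L2_edge_def using hborel_continuous[OF csmi_continuous[OF assms]] by simp
qed

text \<open>Brings products with test functions under the decay criterion for integrability; the
  rate 1 is an arbitrary choice.\<close>

lemma compact_support_decay:
  fixes g :: "real \<Rightarrow> complex"
  assumes "continuous_on {0..} g" "\<And>y. y > b \<Longrightarrow> g y = 0"
  obtains C where "\<And>y. y \<ge> 0 \<Longrightarrow> norm (g y) \<le> C * exp (- (1 * y))"
proof -
  have "compact (g ` {0..b})" by (rule compact_continuous_image[OF continuous_on_subset[OF assms(1)]]) auto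
  then obtain M where M: "\<And>y. y \<in> {0..b} \<Longrightarrow> norm (g y) \<le> M"
    using compact_imp_bounded bounded_iff by (metis imageI)
  have "norm (g y) \<le> (\<bar>M\<bar> * exp \<bar>b\<bar>) * exp (- (1 * y))" if "y \<ge> 0" for y
  proof (cases "y \<le> b")
    case True
    have "norm (g y) \<le> \<bar>M\<bar> * 1" using M[of y] True that by auto
    also have "\<dots> \<le> \<bar>M\<bar> * (exp \<bar>b\<bar> * exp (- (1 * y)))"
      unfolding exp_add[symmetric] using True that by (intro mult_left_mono) auto
    finally show ?thesis by simp
  qed (use assms(2) in auto)
  then show thesis using that by blast
qed

lemma csmi_weak_deriv: assumes f: "csmi f" shows "weak_deriv f (hD f)"
  unfolding weak_deriv_def
proof (intro allI impI)
  fix \<phi> :: "real \<Rightarrow> complex" assume t: "test_fun \<phi>"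
  then obtain a b where ab: "a > 0" "\<And>y. y \<notin> {a..b} \<Longrightarrow> \<phi> y = 0" by (auto simp: test_fun_def)
  have k: "Ck_on {0..} 1 \<phi>" using t by (auto simp: test_fun_def)
  have d: "hderiv \<phi> (hD \<phi> y) y" if "y \<ge> 0" for y
    using k that unfolding Ck_on_def deriv_in_def by (auto intro: vector_derivative_works[THEN iffD1])
  have c': "continuous_on {0..} (hD \<phi>)" using k by (simp add: Ck_on_def)
  have c: "continuous_on {0..} \<phi>"
    unfolding continuous_on_eq_continuous_within using d has_vector_derivative_continuous by fastforce
  have z: "hD \<phi> y = 0" if "y > b" "y \<ge> 0" for y
  proof (rule deriv_in_half[OF _ that(2)])
    have zb: "\<phi> x = 0" if "x > b" for x using ab(2)[of x] that by auto
    show "hderiv \<phi> 0 y"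
      by (rule has_vector_derivative_transform_within[of "\<lambda>_. 0" 0 y "{0..}" "y - b"])
        (use that zb in \<open>auto simp: dist_real_def\<close>)
  qed
  have df: "hderiv f (hD f y) y" if "y \<ge> 0" for y
    by (rule sm_hderiv[of True "{()}" 0 "\<lambda>_. f" "()"]) (use f that in blast)+
  have cf: "continuous_on {0..} f" by (rule csmi_continuous[OF f])
  have "csmi (hD f)" using sm_deriv_in[of True "{()}" _ "\<lambda>_. f"] f by blast
  then have cf': "continuous_on {0..} (hD f)" by (rule csmi_continuous)
  have i: "hintegrable g" if gc: "continuous_on {0..} g" and gz: "\<And>y. y > b \<Longrightarrow> y \<ge> 0 \<Longrightarrow> g y = 0" for g :: "real \<Rightarrow> complex"
  proof -
    \<comment> \<open>Cut off on the negative axis, where \<open>g\<close> is not controlled and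
      where \<open>b\<close> may lie.\<close>
    let ?g = "\<lambda>y. if y \<ge> 0 then g y else 0"
    have "continuous_on {0..} ?g" using continuous_on_cong[of "{0..}" "{0..}" g ?g] gc by auto
    moreover have "?g y = 0" if "y > b" for y using gz[OF that] by auto
    ultimately obtain C where "\<And>y. y \<ge> 0 \<Longrightarrow> norm (?g y) \<le> C * exp (- (1 * y))"
      using compact_support_decay[of ?g b] by blast
    then show ?thesis using decay_hintegrable[OF gc, of 1 C] by auto
  qed
  have 1: "hintegrable (\<lambda>y. f y * hD \<phi> y)" by (rule i) (use z cf c' in \<open>auto intro: continuous_intros\<close>)
  have 2: "hintegrable (\<lambda>y. hD f y * \<phi> y)" by (rule i) (use ab cf' c in \<open>auto intro: continuous_intros\<close>)
  obtain C where C: "\<And>y. y \<ge> 0 \<Longrightarrow> norm (f y * \<phi> y) \<le> C * exp (- (1 * y))"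
    by (rule compact_support_decay[of "\<lambda>y. f y * \<phi> y" b]) (use ab cf c in \<open>auto intro: continuous_intros\<close>)
  have "hint (\<lambda>y. f y * hD \<phi> y + hD f y * \<phi> y) = - (f 0 * \<phi> 0)"
    by (rule hint_deriv[OF has_vector_derivative_mult[OF df d] _ zero_less_one C set_integral_add(1)[OF 1 2]])
      (use cf c cf' c' in \<open>auto intro: continuous_intros\<close>)
  \<comment> \<open>Test functions are supported in some \<open>{a..b}\<close> with a > 0, so the
    vertex contributes no boundary term.\<close>
  also have "\<phi> 0 = 0" using ab by auto
  finally have "hint (\<lambda>y. f y * hD \<phi> y) + hint (\<lambda>y. hD f y * \<phi> y) = 0"
    using set_integral_add(2)[OF 1 2] by simp
  then show "hint (\<lambda>y. f y * edge_deriv \<phi> y) = - hint (\<lambda>y. hD f y * \<phi> y)" by (simp add: add_eq_0_iff)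
qed

lemma csmi_hD: "csmi f \<Longrightarrow> csmi (hD f)"
  using sm_deriv_in[of True "{()}" _ "\<lambda>_. f"] by blast

text \<open>All N edges carry the same function, so the vertex condition splits evenly: each slope
  is \<beta>/N times the common value.\<close>

lemma csmi_dom_H:
  assumes f: "csmi f" and N: "N \<ge> 1" and b: "hD f 0 = complex_of_real (\<beta> / real N) * f 0"
  shows "(\<lambda>i. f) \<in> dom_H N \<beta>"
proof -
  have "H2_edge f" unfolding H2_edge_def
    using csmi_L2[OF f] csmi_L2[OF csmi_hD[OF f]] csmi_L2[OF csmi_hD[OF csmi_hD[OF f]]]
      csmi_weak_deriv[OF f] csmi_weak_deriv[OF csmi_hD[OF f]] by blast
  moreover have "Ck_on {0..} 1 f" by (rule Ck_on_sm[of True "{()}" 1 "\<lambda>_. f" "()"]) (use f in blast)+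
  ultimately show ?thesis using N b by (auto simp: dom_H_def)
qed

section \<open>Regularity with respect to the coupling parameter\<close>

text \<open>Regularity in the parameter to order l, pointwise in y. The recursion mirrors
  \<open>sm\<close>, so that closure under sums, products and reciprocals is enough to treat the
  gauge factor.\<close>

primrec bsm :: "bool \<Rightarrow> real set \<Rightarrow> nat \<Rightarrow> (real \<Rightarrow> real \<Rightarrow> real) \<Rightarrow> bool" where
  "bsm d S 0 F = (\<forall>\<beta>\<in>S. smi d (F \<beta>))"
| "bsm d S (Suc l) F = ((\<forall>\<beta>\<in>S. smi d (F \<beta>)) \<and>
     (\<exists>F'. (\<forall>\<beta>\<in>S. \<forall>y\<ge>0. ((\<lambda>\<beta>. F \<beta> y) has_real_derivative F' \<beta> y) (at \<beta>)) \<and> bsm d S l F'))"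

lemma bsm_smi: "bsm d S l F \<Longrightarrow> \<beta> \<in> S \<Longrightarrow> smi d (F \<beta>)" by (cases l) auto

lemma bsm_SucD: "bsm d S (Suc n) F \<Longrightarrow> bsm d S n F"
  by (induction n arbitrary: F) auto

lemma bsm_SucE:
  assumes "bsm d S (Suc l) F"
  obtains F' where "\<And>\<beta> y. \<beta> \<in> S \<Longrightarrow> y \<ge> 0 \<Longrightarrow> ((\<lambda>\<beta>. F \<beta> y) has_real_derivative F' \<beta> y) (at \<beta>)" "bsm d S l F'"
  using assms unfolding bsm.simps by blast

lemma bsm_SucI:
  "(\<And>\<beta>. \<beta> \<in> S \<Longrightarrow> smi d (F \<beta>)) \<Longrightarrow>
   (\<And>\<beta> y. \<beta> \<in> S \<Longrightarrow> y \<ge> 0 \<Longrightarrow> ((\<lambda>\<beta>. F \<beta> y) has_real_derivative F' \<beta> y) (at \<beta>)) \<Longrightarrow> bsm d S l F' \<Longrightarrow> bsm d S (Suc l) F"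
  unfolding bsm.simps by blast

lemma smi_mult': "smi d f \<Longrightarrow> smi e g \<Longrightarrow> smi (d \<or> e) (\<lambda>y. f y * g y)"
  using sm_mult[of d "{()}" _ "\<lambda>_. f" e "\<lambda>_. g"] by blast

lemma smi_add: "smi d f \<Longrightarrow> smi d g \<Longrightarrow> smi d (\<lambda>y. f y + g y)"
  using sm_add[of d "{()}" _ "\<lambda>_. f" "\<lambda>_. g"] by blast

lemma bsm_add: "bsm d S l F \<Longrightarrow> bsm d S l G \<Longrightarrow> bsm d S l (\<lambda>\<beta> y. F \<beta> y + G \<beta> y)"
proof (induction l arbitrary: F G)
  case 0
  then show ?case using smi_add by (auto simp del: sm.simps)
next
  case (Suc l)
  obtain F' where F': "\<And>\<beta> y. \<beta> \<in> S \<Longrightarrow> y \<ge> 0 \<Longrightarrow> ((\<lambda>\<beta>. F \<beta> y) has_real_derivative F' \<beta> y) (at \<beta>)" "bsm d S l F'"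
    using bsm_SucE[OF Suc.prems(1)] by metis
  obtain G' where G': "\<And>\<beta> y. \<beta> \<in> S \<Longrightarrow> y \<ge> 0 \<Longrightarrow> ((\<lambda>\<beta>. G \<beta> y) has_real_derivative G' \<beta> y) (at \<beta>)" "bsm d S l G'"
    using bsm_SucE[OF Suc.prems(2)] by metis
  show ?case
    by (rule bsm_SucI[OF smi_add[OF bsm_smi[OF Suc.prems(1)] bsm_smi[OF Suc.prems(2)]] DERIV_add[OF F'(1) G'(1)] Suc.IH[OF F'(2) G'(2)]])
qed

lemma bsm_mult: "bsm d S l F \<Longrightarrow> bsm e S l G \<Longrightarrow> bsm (d \<or> e) S l (\<lambda>\<beta> y. F \<beta> y * G \<beta> y)"
proof (induction l arbitrary: F G)
  case 0
  then show ?case using smi_mult' by (auto simp del: sm.simps)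
next
  case (Suc l)
  obtain F' where F': "\<And>\<beta> y. \<beta> \<in> S \<Longrightarrow> y \<ge> 0 \<Longrightarrow> ((\<lambda>\<beta>. F \<beta> y) has_real_derivative F' \<beta> y) (at \<beta>)" "bsm d S l F'"
    using bsm_SucE[OF Suc.prems(1)] by metis
  obtain G' where G': "\<And>\<beta> y. \<beta> \<in> S \<Longrightarrow> y \<ge> 0 \<Longrightarrow> ((\<lambda>\<beta>. G \<beta> y) has_real_derivative G' \<beta> y) (at \<beta>)" "bsm e S l G'"
    using bsm_SucE[OF Suc.prems(2)] by metis
  show ?case
  proof (rule bsm_SucI[OF smi_mult'[OF bsm_smi[OF Suc.prems(1)] bsm_smi[OF Suc.prems(2)]]])
    show "((\<lambda>\<beta>. F \<beta> y * G \<beta> y) has_real_derivative F \<beta> y * G' \<beta> y + F' \<beta> y * G \<beta> y) (at \<beta>)"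
      if "\<beta> \<in> S" "y \<ge> 0" for \<beta> y
      using DERIV_mult[OF F'(1)[OF that] G'(1)[OF that]] by (simp add: mult.commute add.commute)
    show "bsm (d \<or> e) S l (\<lambda>\<beta> y. F \<beta> y * G' \<beta> y + F' \<beta> y * G \<beta> y)"
      by (intro bsm_add Suc.IH bsm_SucD[OF Suc.prems(1)] bsm_SucD[OF Suc.prems(2)] F'(2) G'(2))
  qed
qed

lemma bsm_const: "smi d f \<Longrightarrow> bsm d S l (\<lambda>\<beta>. f)"
proof (cases l)
  case (Suc m)
  assume f: "smi d f"
  have z: "bsm d S m (\<lambda>\<beta> y. 0)"
  proof (induction m)
    case (Suc m)
    then show ?case by (intro bsm_SucI[of _ _ _ "\<lambda>_ _. 0"]) (auto intro: sm_zero)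
  qed (auto intro: sm_zero)
  show ?thesis unfolding Suc by (rule bsm_SucI[OF f _ z]) auto
qed auto

lemma bsm_cong: "(\<And>\<beta> y. F \<beta> y = G \<beta> y) \<Longrightarrow> bsm d S l F \<Longrightarrow> bsm d S l G"
  by (metis ext)

lemma bsm_id: "bsm False S l (\<lambda>\<beta> y. \<beta>)"
proof (cases l)
  case (Suc m)
  show ?thesis unfolding Suc
    by (rule bsm_SucI[OF smi_const _ bsm_const[OF smi_const[of 1]]]) auto
qed (auto intro: smi_const[rule_format])

lemma bsm_mult0: "bsm False S l F \<Longrightarrow> bsm False S l G \<Longrightarrow> bsm False S l (\<lambda>\<beta> y. F \<beta> y * G \<beta> y)"
  using bsm_mult[of False S l F False G] by simp

lemma bsm_recip:
  assumes F: "\<And>l. bsm False S l F" and nz: "\<And>\<beta>. \<beta> \<in> S \<Longrightarrow> smi False (\<lambda>y. 1 / F \<beta> y)"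
    "\<And>\<beta> y. \<beta> \<in> S \<Longrightarrow> y \<ge> 0 \<Longrightarrow> F \<beta> y \<noteq> 0"
  shows "bsm False S l (\<lambda>\<beta> y. 1 / F \<beta> y)"
proof (induction l)
  case 0
  show ?case using nz(1) by simp
next
  case (Suc l)
  obtain F' where F': "\<And>\<beta> y. \<beta> \<in> S \<Longrightarrow> y \<ge> 0 \<Longrightarrow> ((\<lambda>\<beta>. F \<beta> y) has_real_derivative F' \<beta> y) (at \<beta>)" "bsm False S l F'"
    using bsm_SucE[OF F[of "Suc l"]] by metis
  show ?case
  proof (rule bsm_SucI[OF nz(1)])
    show "((\<lambda>\<beta>. 1 / F \<beta> y) has_real_derivative (- 1) * F' \<beta> y * (1 / F \<beta> y * (1 / F \<beta> y))) (at \<beta>)"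
      if "\<beta> \<in> S" "y \<ge> 0" for \<beta> y
      using F'(1)[OF that] nz(2)[OF that] by (auto intro!: derivative_eq_intros simp: power2_eq_square)
    show "bsm False S l (\<lambda>\<beta> y. (- 1) * F' \<beta> y * (1 / F \<beta> y * (1 / F \<beta> y)))"
      by (intro bsm_mult0 bsm_const smi_const F'(2) Suc)
  qed
qed

text \<open>The parameter derivative is G times a rational expression in \<beta> and t with
  nonvanishing denominators, so induction on the order closes.\<close>

lemma bsm_Gg:
  fixes N :: nat
  assumes N: "N \<ge> 1"
  defines "S \<equiv> {- real N <..< real N}"
  shows "bsm False S l (\<lambda>\<beta>. Gg (\<beta> / real N))"
proof -
  have m: "\<bar>\<beta> / real N\<bar> < 1" if "\<beta> \<in> S" for \<beta>
    using that N by (auto simp: S_def abs_less_iff field_simps)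
  have b: "bsm False S l (\<lambda>\<beta> y. \<beta> / real N)" for l
    by (rule bsm_cong[OF _ bsm_mult0[OF bsm_id bsm_const[OF smi_const[of "1 / real N"]]]]) simp
  have t: "bsm False S l (\<lambda>\<beta> y. th y)" for l using sm_th by (intro bsm_const) blast
  have c: "bsm False S l (\<lambda>\<beta> y. c)" for l c by (rule bsm_const[OF smi_const])
  have d: "bsm False S l (\<lambda>\<beta> y. 1 - \<beta> / real N * th y)" for l
    by (rule bsm_cong[OF _ bsm_add[OF c[of _ 1] bsm_mult0[OF c[of _ "-1"] bsm_mult0[OF b t]]]]) simp
  have d2: "bsm False S l (\<lambda>\<beta> y. 1 - (\<beta> / real N)\<^sup>2)" for l
    by (rule bsm_cong[OF _ bsm_add[OF c[of _ 1] bsm_mult0[OF c[of _ "-1"] bsm_mult0[OF b b]]]]) (simp add: power2_eq_square)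
  have sr: "smi False (\<lambda>y. 1 / (1 - \<beta> / real N * th y))" if "\<beta> \<in> S" for \<beta>
    using sm_recip[of "{()}" "\<lambda>_. \<beta> / real N" "\<bar>\<beta> / real N\<bar>"] m[OF that] by auto
  have r: "bsm False S l (\<lambda>\<beta> y. 1 / (1 - \<beta> / real N * th y))" for l
  proof (rule bsm_recip[OF d sr])
    fix \<beta> y assume "\<beta> \<in> S"
    from one_minus_mt_bound(2)[OF order_refl m[OF this], of y] show "1 - \<beta> / real N * th y \<noteq> 0" by linarith
  qed
  have r2: "bsm False S l (\<lambda>\<beta> y. 1 / (1 - (\<beta> / real N)\<^sup>2))" for l
  proof (rule bsm_recip[OF d2 smi_const])
    fix \<beta> assume "\<beta> \<in> S"
    then have "(\<beta> / real N)\<^sup>2 < 1" using m by (simp add: abs_square_less_1)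
    then show "1 - (\<beta> / real N)\<^sup>2 \<noteq> 0" by simp
  qed
  have sG: "smi False (Gg (\<beta> / real N))" if "\<beta> \<in> S" for \<beta>
    using sm_Gg[of "{()}" "\<lambda>_. \<beta> / real N" "\<bar>\<beta> / real N\<bar>"] m[OF that] by auto
  show ?thesis
  proof (induction l)
    case 0
    show ?case using sG by simp
  next
    case (Suc l)
    show ?case
    proof (rule bsm_SucI[OF sG])
      show "((\<lambda>\<beta>. Gg (\<beta> / real N) y) has_real_derivative
         (1 / (2 * real N)) * (Gg (\<beta> / real N) y * ((th y + (-1) * (\<beta> / real N)) * (1 / (1 - (\<beta> / real N)\<^sup>2) * (1 / (1 - \<beta> / real N * th y)))))) (at \<beta>)"
        if "\<beta> \<in> S" "y \<ge> 0" for \<beta> y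
      proof -
        have "((\<lambda>\<beta>. \<beta> / real N) has_real_derivative 1 / real N) (at \<beta>)" using N by (auto intro!: derivative_eq_intros)
        from DERIV_chain2[OF Gg_param_deriv[OF m[OF that(1)], of y] this]
        have "((\<lambda>\<beta>. Gg (\<beta> / real N) y) has_real_derivative Gg (\<beta> / real N) y * g0 (\<beta> / real N) y * (1 / real N)) (at \<beta>)" .
        moreover have "g * ((t - m) / 2 * p * r) * (1 / real N) = (1 / (2 * real N)) * (g * ((t + (-1) * m) * (p * r)))" for g t m p r
          by (simp add: algebra_simps diff_divide_distrib)
        ultimately show ?thesis by (simp only:)
      qed
      show "bsm False S l (\<lambda>\<beta> y. (1 / (2 * real N)) * (Gg (\<beta> / real N) y * ((th y + (-1) * (\<beta> / real N)) * (1 / (1 - (\<beta> / real N)\<^sup>2) * (1 / (1 - \<beta> / real N * th y))))))"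
        by (intro bsm_mult0 bsm_add c Suc t b r r2)
    qed
  qed
qed

text \<open>On an open set the derivative relative to the set is the ordinary one, so the
  derivatives supplied by \<open>bsm\<close> are the iterates of \<open>deriv_in\<close>.\<close>

lemma bsm_iter_deriv:
  assumes S: "open S" and F: "\<And>l. bsm d S l F"
  shows "\<exists>F'. bsm d S n F' \<and> (\<forall>\<beta>\<in>S. \<forall>y\<ge>0. (deriv_in S ^^ m) (\<lambda>\<beta>. complex_of_real (F \<beta> y)) \<beta> = complex_of_real (F' \<beta> y))"
proof (induction m arbitrary: n)
  case 0
  show ?case using F by auto
next
  case (Suc m)
  from Suc[of "Suc n"] obtain F1 where F1: "bsm d S (Suc n) F1"
    "\<And>\<beta> y. \<beta> \<in> S \<Longrightarrow> y \<ge> 0 \<Longrightarrow> (deriv_in S ^^ m) (\<lambda>\<beta>. complex_of_real (F \<beta> y)) \<beta> = complex_of_real (F1 \<beta> y)" by blast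
  obtain F' where F': "\<And>\<beta> y. \<beta> \<in> S \<Longrightarrow> y \<ge> 0 \<Longrightarrow> ((\<lambda>\<beta>. F1 \<beta> y) has_real_derivative F' \<beta> y) (at \<beta>)" "bsm d S n F'"
    using bsm_SucE[OF F1(1)] by metis
  have "(deriv_in S ^^ Suc m) (\<lambda>\<beta>. complex_of_real (F \<beta> y)) \<beta> = complex_of_real (F' \<beta> y)" if "\<beta> \<in> S" "y \<ge> 0" for \<beta> y
  proof -
    have "((\<lambda>\<beta>. complex_of_real (F1 \<beta> y)) has_vector_derivative complex_of_real (F' \<beta> y)) (at \<beta>)"
      using F'(1)[OF that] by (intro has_vector_derivative_of_real) (simp add: has_real_derivative_iff_has_vector_derivative)
    then have "((deriv_in S ^^ m) (\<lambda>\<beta>. complex_of_real (F \<beta> y)) has_vector_derivative complex_of_real (F' \<beta> y)) (at \<beta>)"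
      by (rule has_vector_derivative_transform_within_open[OF _ S that(1)]) (use F1(2) that in auto)
    then show ?thesis
      using at_within_open[OF that(1) S] by (simp add: deriv_in_def vector_derivative_at)
  qed
  then show ?case using F'(2) by blast
qed

lemma bsm_differentiable:
  assumes S: "open S" and F: "\<And>l. bsm d S l F" and b: "\<beta> \<in> S" and y: "y \<ge> 0"
  shows "(deriv_in S ^^ m) (\<lambda>\<beta>. complex_of_real (F \<beta> y)) differentiable (at \<beta> within S)"
proof -
  from bsm_iter_deriv[OF S F, of "Suc 0" m] obtain F1 where F1: "bsm d S (Suc 0) F1"
    "\<And>\<beta> y. \<beta> \<in> S \<Longrightarrow> y \<ge> 0 \<Longrightarrow> (deriv_in S ^^ m) (\<lambda>\<beta>. complex_of_real (F \<beta> y)) \<beta> = complex_of_real (F1 \<beta> y)" by blast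
  obtain F' where F': "\<And>\<beta> y. \<beta> \<in> S \<Longrightarrow> y \<ge> 0 \<Longrightarrow> ((\<lambda>\<beta>. F1 \<beta> y) has_real_derivative F' \<beta> y) (at \<beta>)"
    using bsm_SucE[OF F1(1)] by metis
  have "((\<lambda>\<beta>. complex_of_real (F1 \<beta> y)) has_vector_derivative complex_of_real (F' \<beta> y)) (at \<beta>)"
    using F'[OF b y] by (intro has_vector_derivative_of_real) (simp add: has_real_derivative_iff_has_vector_derivative)
  then have "((deriv_in S ^^ m) (\<lambda>\<beta>. complex_of_real (F \<beta> y)) has_vector_derivative complex_of_real (F' \<beta> y)) (at \<beta>)"
    by (rule has_vector_derivative_transform_within_open[OF _ S b]) (use F1(2) y in auto)
  then show ?thesis using differentiableI_vector has_vector_derivative_at_within by blast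
qed

lemma bsm_Ck_on:
  assumes S: "open S" and F: "\<And>l. bsm d S l F" and y: "y \<ge> 0"
  shows "Ck_on S n (\<lambda>\<beta>. complex_of_real (F \<beta> y))"
  unfolding Ck_on_def
  using bsm_differentiable[OF S F _ y] differentiable_imp_continuous_on[of "(deriv_in S ^^ n) (\<lambda>\<beta>. complex_of_real (F \<beta> y))" S]
  by (auto simp: differentiable_on_def)

lemma bsm_Cexp:
  assumes S: "open S" and F: "\<And>l. bsm True S l F" and b: "\<beta> \<in> S"
  shows "(\<lambda>i y. (deriv_in S ^^ l) (\<lambda>\<beta>'. complex_of_real (F \<beta>' y)) \<beta>) \<in> Cexp_inf N"
proof -
  from bsm_iter_deriv[OF S F, of 0 l] obtain F' where F': "bsm True S 0 F'"
    "\<And>\<beta> y. \<beta> \<in> S \<Longrightarrow> y \<ge> 0 \<Longrightarrow> (deriv_in S ^^ l) (\<lambda>\<beta>. complex_of_real (F \<beta> y)) \<beta> = complex_of_real (F' \<beta> y)" by blast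
  have "smi True (F' \<beta>)" by (rule bsm_smi[OF F'(1) b])
  then have "sm True {()} n (\<lambda>_ y. complex_of_real (F' \<beta> y))" for n by (intro sm_of_real) blast
  from sm_in_Cexp[OF this, of "()" N _ 1] F'(2)[OF b] show ?thesis
    by (auto simp: Cexp_inf_def)
qed

section \<open>The profile and its error\<close>

text \<open>The divisor may tend to 0 on K; only the quotient of each single monomial has to be
  bounded. It is applied with 1, with \<lambda> and with (b^2 + \<lambda>)^\<kappa>.\<close>

lemma SP_quot:
  fixes K :: "(real \<times> real) set" and D :: "real \<times> real \<Rightarrow> real"
  assumes "SP d T F"
    and T: "\<And>j k. (j, k) \<in> T \<Longrightarrow> \<exists>C. \<forall>p\<in>K. \<bar>fst p ^ j * snd p ^ k / D p\<bar> \<le> C"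
  shows "sm d K n (\<lambda>p y. F (fst p) (snd p) y / complex_of_real (D p))"
  using assms(1)
proof induction
  case SP_zero
  then show ?case by (simp add: sm_zero)
next
  case (SP_term j k f)
  from T[OF SP_term(1)] obtain C where C: "\<And>p. p \<in> K \<Longrightarrow> \<bar>fst p ^ j * snd p ^ k / D p\<bar> \<le> C" by auto
  have 1: "sm False K n (\<lambda>p y. \<i> ^ j * complex_of_real (fst p ^ j * snd p ^ k / D p))"
    by (rule sm_const[where M=C]) (use C in \<open>simp only: norm_mult norm_power norm_of_real norm_ii power_one mult_1_left\<close>)
  have "sm d K n (\<lambda>p. f)" by (rule sm_reindex[of K "\<lambda>_. ()" "{()}"]) (use SP_term in auto)
  from sm_mult_decay(3)[OF 1 sm_of_real[OF this]] show ?case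
    by (rule sm_cong) (simp add: power_mult_distrib)
next
  case (SP_add F G)
  show ?case by (rule sm_cong[OF sm_add[OF SP_add.IH]]) (simp add: add_divide_distrib)
next
  case (SP_cong F G)
  show ?case by (rule sm_cong[OF SP_cong.IH]) (simp add: SP_cong.hyps)
qed

lemma SP_sm:
  fixes K :: "(real \<times> real) set"
  assumes "SP d T F" and b: "\<And>p. p \<in> K \<Longrightarrow> \<bar>fst p\<bar> \<le> M" "\<And>p. p \<in> K \<Longrightarrow> \<bar>snd p\<bar> \<le> M"
  shows "sm d K n (\<lambda>p y. F (fst p) (snd p) y)"
proof -
  have "\<exists>C. \<forall>p\<in>K. \<bar>fst p ^ j * snd p ^ k / 1\<bar> \<le> C" for j k
  proof (intro exI ballI)
    fix p assume "p \<in> K"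
    then show "\<bar>fst p ^ j * snd p ^ k / 1\<bar> \<le> M ^ j * M ^ k"
      using b[of p] by (simp add: abs_mult power_abs) (intro mult_mono power_mono, auto)
  qed
  from SP_quot[where D="\<lambda>_. 1" and K=K and n=n, OF assms(1) this] show ?thesis by simp
qed

text \<open>With w = b^2 + \<lambda> one has b^2 <= w and \<lambda> <= w, so b^(2j) \<lambda>^(2k)
  <= w^(j + 2k). Working with squares avoids half-integer powers, and the excess over w^(2\<kappa>)
  is absorbed by W.\<close>

lemma weight_bound:
  fixes b l W :: real
  assumes "l \<ge> 0" "b\<^sup>2 + l \<le> W" "2 * \<kappa> \<le> j + 2 * k" "W \<ge> 1"
  shows "\<bar>b ^ j * l ^ k\<bar> \<le> W ^ (j + 2 * k) * (b\<^sup>2 + l) ^ \<kappa>"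
proof -
  define w where "w = b\<^sup>2 + l"
  have w: "w \<ge> 0" "l \<le> w" "b\<^sup>2 \<le> w" using assms by (auto simp: w_def)
  obtain e where e: "j + 2 * k = 2 * \<kappa> + e" using assms(3) le_Suc_ex by blast
  have "(b ^ j * l ^ k)\<^sup>2 = (b\<^sup>2) ^ j * l ^ (2 * k)" by (simp add: power_mult_distrib power_mult[symmetric] mult.commute)
  also have "\<dots> \<le> w ^ j * w ^ (2 * k)" using w assms(1) by (intro mult_mono power_mono) auto
  also have "\<dots> = (w ^ \<kappa>)\<^sup>2 * w ^ e" unfolding power_add[symmetric] e by (simp add: power_add power_mult[symmetric] mult.commute)
  also have "\<dots> \<le> (w ^ \<kappa>)\<^sup>2 * W ^ e" using w assms(2) by (intro mult_left_mono power_mono) (auto simp: w_def)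
  also have "\<dots> \<le> (w ^ \<kappa>)\<^sup>2 * (W ^ (j + 2 * k))\<^sup>2"
  proof (rule mult_left_mono)
    have "W ^ e \<le> W ^ (2 * (j + 2 * k))" using assms(4) e by (intro power_increasing) auto
    then show "W ^ e \<le> (W ^ (j + 2 * k))\<^sup>2" by (simp add: power_mult[symmetric] mult.commute)
  qed auto
  also have "\<dots> = (W ^ (j + 2 * k) * w ^ \<kappa>)\<^sup>2" by (simp add: power_mult_distrib mult.commute)
  finally have "\<bar>b ^ j * l ^ k\<bar> \<le> \<bar>W ^ (j + 2 * k) * w ^ \<kappa>\<bar>" by (simp only: abs_le_square_iff)
  then show ?thesis using w assms(4) by (simp add: w_def)
qed

section \<open>Derivatives of the polynomial part in the parameters\<close>

definition Sl :: "nat \<Rightarrow> (nat \<Rightarrow> nat \<Rightarrow> real \<Rightarrow> real) \<Rightarrow> real \<Rightarrow> real \<Rightarrow> real \<Rightarrow> complex" where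
  "Sl \<kappa> c b l y = (\<Sum>(j, k)\<in>Theta \<kappa>. xb b ^ j * (of_nat k * complex_of_real l ^ (k - 1)) * complex_of_real (c j k y))"

lemma L_Sl: assumes "\<And>j k. smi d (c j k)" shows "L d 0 (Sl \<kappa> c)"
proof -
  have "L d 0 (\<lambda>b l y. xb b ^ fst p * (of_nat (snd p) * complex_of_real l ^ (snd p - 1)) * complex_of_real (c (fst p) (snd p) y))"
    if "p \<in> Theta \<kappa>" for p
  proof -
    have "smi d (\<lambda>y. real (snd p) * c (fst p) (snd p) y)"
      using sm_linear[of "\<lambda>x. real (snd p) * x" d "{()}" _ "\<lambda>_. c (fst p) (snd p)"] assms bounded_linear_mult_right by blast
    then have "L d 0 (\<lambda>b l y. xb b ^ fst p * complex_of_real l ^ (snd p - 1) * complex_of_real (real (snd p) * c (fst p) (snd p) y))"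
      by (rule SP_term[rotated]) simp
    then show ?thesis by (rule SP_cong) (simp add: mult_ac)
  qed
  then show ?thesis unfolding Sl_def[abs_def] case_prod_beta by (intro SP_sum) auto
qed

text \<open>Euler's identity. The combination appears because i times the derivative along b' =
  -b^2, \<lambda>' = -b \<lambda> equals -x times the Euler derivative in (x, \<lambda>).\<close>

lemma Sx_Sl: "xb b * Sx \<kappa> c b l y + complex_of_real l * Sl \<kappa> c b l y = Vd \<kappa> c b l y"
proof -
  have "xb b * (of_nat j * xb b ^ (j - 1) * complex_of_real l ^ k * complex_of_real (c j k y))
     + complex_of_real l * (xb b ^ j * (of_nat k * complex_of_real l ^ (k - 1)) * complex_of_real (c j k y))
     = xb b ^ j * complex_of_real l ^ k * complex_of_real (real (j + k) * c j k y)" for j k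
  proof -
    have 1: "of_nat j * xb b ^ j = of_nat j * (xb b * xb b ^ (j - 1))" by (cases j) auto
    have 2: "of_nat k * complex_of_real l ^ k = of_nat k * (complex_of_real l * complex_of_real l ^ (k - 1))" by (cases k) auto
    have "xb b ^ j * complex_of_real l ^ k * complex_of_real (real (j + k) * c j k y)
      = (of_nat j * xb b ^ j) * complex_of_real l ^ k * complex_of_real (c j k y)
        + xb b ^ j * (of_nat k * complex_of_real l ^ k) * complex_of_real (c j k y)"
      by (simp add: algebra_simps)
    then show ?thesis unfolding 1 2 by (simp add: mult_ac)
  qed
  then show ?thesis
    unfolding Sx_def Sl_def Vd_def Sg_def case_prod_beta sum_distrib_left sum.distrib[symmetric]
    by (intro sum.cong) auto
qed

lemma Sg_chain:
  assumes b: "(b has_real_derivative b') (at s within J)" and l: "(l has_real_derivative l') (at s within J)"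
  shows "((\<lambda>s. Sg \<kappa> c (b s) (l s) y) has_vector_derivative
    \<i> * Sx \<kappa> c (b s) (l s) y * complex_of_real b' + Sl \<kappa> c (b s) (l s) y * complex_of_real l') (at s within J)"
proof -
  have "((\<lambda>s. xb (b s) ^ j * complex_of_real (l s) ^ k * complex_of_real (c j k y)) has_vector_derivative
     \<i> * (of_nat j * xb (b s) ^ (j - 1) * complex_of_real (l s) ^ k * complex_of_real (c j k y)) * complex_of_real b'
     + xb (b s) ^ j * (of_nat k * complex_of_real (l s) ^ (k - 1)) * complex_of_real (c j k y) * complex_of_real l') (at s within J)" for j k
  proof -
    have "((\<lambda>s. b s ^ j * l s ^ k * c j k y) has_real_derivative
       (real j * (b s ^ (j - 1) * b') * l s ^ k + b s ^ j * (real k * (l s ^ (k - 1) * l'))) * c j k y) (at s within J)"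
      using b l by (auto intro!: derivative_eq_intros)
    then have D: "((\<lambda>s. \<i> ^ j * complex_of_real (b s ^ j * l s ^ k * c j k y)) has_vector_derivative
       \<i> ^ j * complex_of_real ((real j * (b s ^ (j - 1) * b') * l s ^ k + b s ^ j * (real k * (l s ^ (k - 1) * l'))) * c j k y)) (at s within J)"
      by (intro has_vector_derivative_mult_right has_vector_derivative_of_real) (simp add: has_real_derivative_iff_has_vector_derivative)
    have E: "\<i> ^ j * complex_of_real ((real j * (b s ^ (j - 1) * b') * l s ^ k + b s ^ j * (real k * (l s ^ (k - 1) * l'))) * c j k y)
       = \<i> * (of_nat j * xb (b s) ^ (j - 1) * complex_of_real (l s) ^ k * complex_of_real (c j k y)) * complex_of_real b'
     + xb (b s) ^ j * (of_nat k * complex_of_real (l s) ^ (k - 1)) * complex_of_real (c j k y) * complex_of_real l'"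
      by (cases j) (simp_all add: power_mult_distrib algebra_simps)
    have "(\<lambda>s. \<i> ^ j * complex_of_real (b s ^ j * l s ^ k * c j k y)) = (\<lambda>s. xb (b s) ^ j * complex_of_real (l s) ^ k * complex_of_real (c j k y))"
      by (rule ext) (simp add: power_mult_distrib mult_ac)
    then show ?thesis using D unfolding E by (simp only:)
  qed
  from has_vector_derivative_sum[of "Theta \<kappa>", OF this[of "fst _" "snd _"]] show ?thesis
    unfolding Sg_def Sx_def Sl_def case_prod_beta sum_distrib_left sum_distrib_right sum.distrib[symmetric] .
qed

lemma hderiv_of_real: "hderiv f f' y \<Longrightarrow> hderiv (\<lambda>y. complex_of_real (f y)) (complex_of_real f') y"
  by (rule has_vector_derivative_of_real) (simp add: has_real_derivative_iff_has_vector_derivative)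

lemma Sg_hderiv:
  assumes "\<And>j k. smi True (c j k)" "y \<ge> 0"
  shows "hderiv (Sg \<kappa> c b l) (Sg \<kappa> (\<lambda>j k. hD (c j k)) b l y) y"
  unfolding Sg_def[abs_def] case_prod_beta
  by (intro has_vector_derivative_sum has_vector_derivative_mult_right hderiv_of_real smi_hderiv[OF assms(1) assms(2)])

lemma hderiv_g1:
  assumes "\<bar>m\<bar> < 1"
  shows "hderiv (g1 m) (- 4 * m * th y * (1 - (th y)\<^sup>2) * (1 / (1 - m * th y)) + 2 * m\<^sup>2 * (1 - (th y)\<^sup>2)\<^sup>2 * (1 / (1 - m * th y))\<^sup>2) y"
proof -
  define T where "T = th y"
  have d: "1 - m * T \<noteq> 0" using one_minus_mt_bound(2)[of m "\<bar>m\<bar>" y] assms by (simp add: T_def)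
  have 1: "hderiv (\<lambda>y. m * (1 - (th y)\<^sup>2)) (m * (- (2 * T * (2 * (1 - T\<^sup>2))))) y"
    using hderiv_tanh2[of y] unfolding has_real_derivative_iff_has_vector_derivative[symmetric] T_def
    by (auto intro!: derivative_eq_intros)
  have 2: "hderiv (\<lambda>y. 1 / (1 - m * th y)) (m * (2 * (1 - T\<^sup>2)) / (1 - m * T)\<^sup>2) y"
    using d hderiv_tanh2[of y] unfolding has_real_derivative_iff_has_vector_derivative[symmetric] T_def
    by (auto intro!: derivative_eq_intros simp: power2_eq_square)
  have "hderiv (g1 m) (m * (1 - T\<^sup>2) * (m * (2 * (1 - T\<^sup>2)) / (1 - m * T)\<^sup>2) + (m * (- (2 * T * (2 * (1 - T\<^sup>2))))) * (1 / (1 - m * T))) y"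
    using has_vector_derivative_mult[OF 1 2] by (simp only: T_def)
  moreover have "m * (1 - T\<^sup>2) * (m * (2 * (1 - T\<^sup>2)) / (1 - m * T)\<^sup>2) + (m * (- (2 * T * (2 * (1 - T\<^sup>2))))) * (1 / (1 - m * T))
     = - 4 * m * T * (1 - T\<^sup>2) * (1 / (1 - m * T)) + 2 * m\<^sup>2 * (1 - T\<^sup>2)\<^sup>2 * (1 / (1 - m * T))\<^sup>2"
  proof -
    define D where "D = 1 - m * T"
    show ?thesis using d unfolding D_def[symmetric] by (simp add: field_simps power2_eq_square)
  qed
  ultimately show ?thesis unfolding T_def by (simp only:)
qed

text \<open>The profile is studied through these properties of the coefficients, together with one
  orthogonality relation that is assumed where the energy is expanded. Since c and a do not depend
  on \<beta> = \<gamma>\<lambda>, that parameter enters through the gauge factor only.\<close>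

locale prof =
  fixes N \<kappa> :: nat and \<gamma> :: real and c :: "nat \<Rightarrow> nat \<Rightarrow> real \<Rightarrow> real" and a :: "nat \<Rightarrow> nat \<Rightarrow> real"
  assumes N: "N \<ge> 1" and kap: "\<kappa> \<ge> 1" and ok: "coeffs_ok \<kappa> c a"
    and res: "SP True {(j, k). 2 * \<kappa> \<le> j + 2 * k} (resid (\<gamma> / real N) \<kappa> c a)"
begin

abbreviation \<sigma> :: real where "\<sigma> \<equiv> \<gamma> / real N"

definition Pj :: "nat \<Rightarrow> nat \<Rightarrow> real \<Rightarrow> graph_fun" where
  "Pj j k \<beta> i y = complex_of_real (Gg (\<beta> / real N) y * c j k y)"

lemma sc: "smi True (c j k)" "hD (c j k) 0 = 0" using ok by (auto simp: coeffs_ok_def)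

abbreviation "V \<equiv> Vf \<kappa> c"
abbreviation "V1 \<equiv> Vy \<kappa> c"
abbreviation "V2 \<equiv> Vyy \<kappa> c"

definition PP :: "real \<Rightarrow> real \<Rightarrow> real \<Rightarrow> complex" where
  "PP b l y = complex_of_real (Gg (\<sigma> * l) y) * V b l y"

definition PPy :: "real \<Rightarrow> real \<Rightarrow> real \<Rightarrow> complex" where
  "PPy b l y = complex_of_real (Gg (\<sigma> * l) y) * (V1 b l y + complex_of_real (g1 (\<sigma> * l) y) * V b l y)"

definition PPyy :: "real \<Rightarrow> real \<Rightarrow> real \<Rightarrow> complex" where
  "PPyy b l y = complex_of_real (Gg (\<sigma> * l) y) * (V2 b l y + 2 * complex_of_real (g1 (\<sigma> * l) y) * V1 b l y
     + complex_of_real (3 * (g1 (\<sigma> * l) y)\<^sup>2 - 4 * th y * g1 (\<sigma> * l) y) * V b l y)"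

definition PPb :: "real \<Rightarrow> real \<Rightarrow> real \<Rightarrow> complex" where
  "PPb b l y = complex_of_real (Gg (\<sigma> * l) y) * (\<i> * Sx \<kappa> c b l y)"

definition PPl :: "real \<Rightarrow> real \<Rightarrow> real \<Rightarrow> complex" where
  "PPl b l y = complex_of_real (Gg (\<sigma> * l) y) * (Sl \<kappa> c b l y + complex_of_real (\<sigma> * g0 (\<sigma> * l) y) * V b l y)"

lemma sig: "\<gamma> * l \<in> {- real N <..< real N} \<longleftrightarrow> \<bar>\<sigma> * l\<bar> < 1"
  using N by (auto simp: abs_less_iff field_simps)

lemma profile_PP:
  assumes "\<bar>\<sigma> * l\<bar> < 1"
  shows "profile N \<gamma> \<kappa> Pj b l i y = PP b l y"
proof -
  have e: "\<gamma> * l / real N = \<sigma> * l" by simp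
  have "\<bar>\<gamma> * l / real N\<bar> < 1" using assms by simp
  note Q = Q_beta_gauge[OF this, of i y]
  have "(\<Sum>(j, k)\<in>Theta \<kappa>. xb b ^ j * complex_of_real l ^ k * Pj j k (\<gamma> * l) i y) = complex_of_real (Gg (\<sigma> * l) y) * Sg \<kappa> c b l y"
    unfolding Pj_def Sg_def sum_distrib_left case_prod_beta by (intro sum.cong) (auto simp: mult_ac)
  then show ?thesis unfolding profile_def Q PP_def Vf_def by (simp add: distrib_left)
qed

lemma V_hderiv: "y \<ge> 0 \<Longrightarrow> hderiv (V b l) (V1 b l y) y"
  unfolding Vf_def[abs_def] Vy_def by (intro has_vector_derivative_add hderiv_of_real hderiv_qr Sg_hderiv sc)

lemma V1_hderiv: "y \<ge> 0 \<Longrightarrow> hderiv (V1 b l) (V2 b l y) y"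
proof -
  assume y: "y \<ge> 0"
  have "hderiv (\<lambda>y. - (th y * qr y)) ((3 * th y ^ 2 - 2) * qr y) y"
    using hderiv_qr[of y] hderiv_tanh2[of y] unfolding has_real_derivative_iff_has_vector_derivative[symmetric]
    by (auto intro!: derivative_eq_intros simp: algebra_simps power2_eq_square)
  then show ?thesis unfolding Vy_def[abs_def] Vyy_def
    by (intro has_vector_derivative_add hderiv_of_real Sg_hderiv smi_hD sc y)
qed

lemma PP_hderiv:
  assumes "\<bar>\<sigma> * l\<bar> < 1" "y \<ge> 0"
  shows "hderiv (PP b l) (PPy b l y) y"
  using has_vector_derivative_mult[OF hderiv_of_real[OF hderiv_Gg[OF assms(1), of y]] V_hderiv[OF assms(2), of b l]]
  unfolding PP_def[abs_def] PPy_def by (simp add: algebra_simps)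

lemma PPy_hderiv:
  assumes "\<bar>\<sigma> * l\<bar> < 1" "y \<ge> 0"
  shows "hderiv (PPy b l) (PPyy b l y) y"
proof -
  define m where "m = \<sigma> * l"
  note h = has_vector_derivative_mult[OF hderiv_of_real[OF hderiv_Gg[OF assms(1), of y]]
      has_vector_derivative_add[OF V1_hderiv[OF assms(2), of b l]
       has_vector_derivative_mult[OF hderiv_of_real[OF hderiv_g1[OF assms(1), of y]] V_hderiv[OF assms(2), of b l]]]]
  have e: "- 4 * m * th y * (1 - (th y)\<^sup>2) * (1 / (1 - m * th y)) + 2 * m\<^sup>2 * (1 - (th y)\<^sup>2)\<^sup>2 * (1 / (1 - m * th y))\<^sup>2
    = 2 * (g1 m y)\<^sup>2 - 4 * th y * g1 m y"
    by (simp add: power2_eq_square mult_ac)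
  have val: "complex_of_real G * (v2 + (complex_of_real g * v1 + complex_of_real (2 * g\<^sup>2 - 4 * t * g) * v)) + complex_of_real (G * g) * (v1 + complex_of_real g * v)
     = complex_of_real G * (v2 + 2 * complex_of_real g * v1 + complex_of_real (3 * g\<^sup>2 - 4 * t * g) * v)" for G g t v v1 v2
    by (simp add: algebra_simps power2_eq_square)
  show ?thesis
    using h unfolding m_def[symmetric] e val unfolding PPy_def[abs_def] PPyy_def m_def[symmetric] .
qed

lemma PP_chain:
  assumes b: "(b has_real_derivative b') (at s within J)" and l: "(l has_real_derivative l') (at s within J)"
    and m: "\<bar>\<sigma> * l s\<bar> < 1"
  shows "((\<lambda>s. PP (b s) (l s) y) has_vector_derivative PPb (b s) (l s) y * complex_of_real b' + PPl (b s) (l s) y * complex_of_real l') (at s within J)"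
proof -
  have "((\<lambda>s. \<sigma> * l s) has_real_derivative \<sigma> * l') (at s within J)" by (rule DERIV_cmult[OF l])
  from DERIV_chain2[OF Gg_param_deriv[OF m, of y] this]
  have G: "((\<lambda>s. complex_of_real (Gg (\<sigma> * l s) y)) has_vector_derivative complex_of_real (Gg (\<sigma> * l s) y * g0 (\<sigma> * l s) y * (\<sigma> * l'))) (at s within J)"
    by (intro has_vector_derivative_of_real) (simp only: has_real_derivative_iff_has_vector_derivative)
  have "((\<lambda>s. V (b s) (l s) y) has_vector_derivative 0 + (\<i> * Sx \<kappa> c (b s) (l s) y * complex_of_real b' + Sl \<kappa> c (b s) (l s) y * complex_of_real l')) (at s within J)"
    unfolding Vf_def[abs_def] by (intro has_vector_derivative_add has_vector_derivative_const Sg_chain[OF b l])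
  from has_vector_derivative_mult[OF G this] show ?thesis
    unfolding PP_def[abs_def] PPb_def PPl_def by (simp add: algebra_simps)
qed

lemma alpha_sum_Af: "alpha_sum \<gamma> \<kappa> (\<lambda>j k \<beta>. a j k) b l = Af \<kappa> a b l y"
  unfolding alpha_sum_def Af_def Sg_def ..

text \<open>Odd coefficients vanish and even powers of ib are real, so \<alpha> is real although its
  summands are formally complex.\<close>

lemma Af_real: "Af \<kappa> a b l y = complex_of_real (Re (Af \<kappa> a b l y))"
proof -
  have "xb b ^ j * complex_of_real l ^ k * complex_of_real (a j k) \<in> \<real>" for j k
  proof (cases "odd j")
    case True
    then show ?thesis using ok by (simp add: coeffs_ok_def)
  next
    case False
    then obtain i where "j = 2 * i" by (auto elim: evenE)
    then have "xb b ^ j = complex_of_real ((- (b\<^sup>2)) ^ i)" by (simp add: power_mult power_mult_distrib)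
    then show ?thesis by simp
  qed
  then have "Af \<kappa> a b l y \<in> \<real>" unfolding Af_def Sg_def case_prod_beta by (intro sum_in_Reals) auto
  then show ?thesis by (simp add: complex_is_Real_iff complex_eq_iff)
qed

text \<open>The error along the exact flow \<open>b' = - b\<^sup>2 + \<alpha>\<close>, \<open>\<lambda>' = - b \<lambda>\<close>.\<close>

definition Psi0 :: "real \<Rightarrow> real \<Rightarrow> real \<Rightarrow> complex" where
  "Psi0 b l y = \<i> * (PPb b l y * (- (complex_of_real b)\<^sup>2 + Af \<kappa> a b l y) + PPl b l y * complex_of_real (- (b * l)))
     + PPyy b l y - PP b l y + complex_of_real (cmod (PP b l y) ^ 4) * PP b l y
     + Af \<kappa> a b l y * complex_of_real (y\<^sup>2 / 4) * PP b l y"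

text \<open>Undoes the multiplication that made the residual polynomial; the claims
  \<open>k1\<close> to \<open>k5\<close> return each coefficient to its form with the reciprocals
  \<open>r\<close> and \<open>s\<close>.\<close>

lemma Psi0_resid:
  assumes m: "\<bar>\<sigma> * l\<bar> < 1"
  shows "Psi0 b l y = complex_of_real (Gg (\<sigma> * l) y * (1 / (1 - (\<sigma> * l)\<^sup>2)) * (1 / (1 - \<sigma> * l * th y))\<^sup>2) * resid \<sigma> \<kappa> c a b l y"
proof -
  define M t G where "M = complex_of_real (\<sigma> * l)" and "t = complex_of_real (th y)" and "G = complex_of_real (Gg (\<sigma> * l) y)"
  define U where "U = V b l y"
  define r s where "r = 1 / (1 - M * t)" and "s = 1 / (1 - M\<^sup>2)"
  have "1 - \<sigma> * l * th y \<noteq> 0" using one_minus_mt_bound(2)[OF order_refl m, of y] by linarith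
  moreover have "(\<sigma> * l)\<^sup>2 < 1" using m by (simp add: abs_square_less_1)
  then have "1 - (\<sigma> * l)\<^sup>2 \<noteq> 0" by simp
  ultimately have "complex_of_real (1 - \<sigma> * l * th y) \<noteq> 0" "complex_of_real (1 - (\<sigma> * l)\<^sup>2) \<noteq> 0" by (simp_all only: of_real_eq_0_iff not_False_eq_True)
  then have "1 - M * t \<noteq> 0" "1 - M\<^sup>2 \<noteq> 0" by (simp_all add: M_def t_def)
  then have rs: "r * (1 - M * t) = 1" "s * (1 - M\<^sup>2) = 1" by (simp_all add: r_def s_def)
  have g1': "complex_of_real (g1 (\<sigma> * l) y) = M * (1 - t\<^sup>2) * r" by (simp add: M_def t_def r_def)
  have g0': "complex_of_real (\<sigma> * g0 (\<sigma> * l) y) = complex_of_real \<sigma> * ((t - M) / 2 * s * r)" by (simp add: M_def t_def r_def s_def)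
  \<comment> \<open>As G is real, the quintic term is G^5 times U^3 and the squared conjugate of U;
    \<open>G5\<close> then replaces G^4 by its rational form.\<close>
  have abs4: "complex_of_real (cmod (G * U) ^ 4) * (G * U) = G ^ 5 * (U ^ 3 * cnj U ^ 2)"
  proof -
    have "complex_of_real (cmod (G * U) ^ 4) = ((G * U) * cnj (G * U))\<^sup>2"
      unfolding complex_norm_square[symmetric] by (simp add: power_mult[symmetric])
    moreover have "cnj G = G" by (simp add: G_def)
    ultimately show ?thesis by (simp add: power2_eq_square eval_nat_numeral mult_ac)
  qed
  have "Gg (\<sigma> * l) y ^ 5 = Gg (\<sigma> * l) y * ((1 - (\<sigma> * l)\<^sup>2) * (1 / (1 - \<sigma> * l * th y))\<^sup>2)"
    using Gg_4[OF m, of y] by (simp add: eval_nat_numeral)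
  from arg_cong[OF this, of complex_of_real] have G5: "G ^ 5 = G * ((1 - M\<^sup>2) * r\<^sup>2)"
    by (simp add: G_def M_def r_def t_def)
  have "Psi0 b l y = G * (- xb b * Vd \<kappa> c b l y - Af \<kappa> a b l y * Sx \<kappa> c b l y + V2 b l y - U + Af \<kappa> a b l y * complex_of_real (y\<^sup>2 / 4) * U
      + 2 * (M * (1 - t\<^sup>2) * r) * V1 b l y + (3 * (M * (1 - t\<^sup>2) * r)\<^sup>2 - 4 * t * (M * (1 - t\<^sup>2) * r)) * U
      + ((1 - M\<^sup>2) * r\<^sup>2) * (U ^ 3 * cnj U ^ 2) - xb b * M * ((t - M) / 2 * s * r) * U)"
  proof -
    have g3: "complex_of_real (3 * (g1 (\<sigma> * l) y)\<^sup>2 - 4 * th y * g1 (\<sigma> * l) y) = 3 * (M * (1 - t\<^sup>2) * r)\<^sup>2 - 4 * t * (M * (1 - t\<^sup>2) * r)"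
      unfolding of_real_diff of_real_mult of_real_power g1'[symmetric] by (simp add: t_def)
    have keyX: "\<i> * (\<i> * X * (- (complex_of_real b)\<^sup>2 + A) + (Y + complex_of_real \<sigma> * Z * U) * complex_of_real (- (b * l)))
       = - (xb b * (xb b * X + complex_of_real l * Y)) - A * X - xb b * M * Z * U" for X A Y Z
      by (simp add: M_def algebra_simps power2_eq_square)
    from keyX[of "Sx \<kappa> c b l y" "Af \<kappa> a b l y" "Sl \<kappa> c b l y" "(t - M) / 2 * s * r", unfolded Sx_Sl]
    have key: "\<i> * (\<i> * Sx \<kappa> c b l y * (- (complex_of_real b)\<^sup>2 + Af \<kappa> a b l y) + (Sl \<kappa> c b l y + complex_of_real \<sigma> * ((t - M) / 2 * s * r) * U) * complex_of_real (- (b * l)))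
       = - (xb b * Vd \<kappa> c b l y) - Af \<kappa> a b l y * Sx \<kappa> c b l y - xb b * M * ((t - M) / 2 * s * r) * U" .
    have fac: "\<i> * (G * u * v + G * w * z) = G * (\<i> * (u * v + w * z))" for u v w z by (simp add: algebra_simps)
    have k0: "\<i> * (G * (\<i> * Sx \<kappa> c b l y) * (- (complex_of_real b)\<^sup>2 + Af \<kappa> a b l y) + G * (Sl \<kappa> c b l y + complex_of_real \<sigma> * ((t - M) / 2 * s * r) * U) * complex_of_real (- (b * l)))
       = G * (- (xb b * Vd \<kappa> c b l y) - Af \<kappa> a b l y * Sx \<kappa> c b l y - xb b * M * ((t - M) / 2 * s * r) * U)"
      unfolding fac key ..
    show ?thesis
      unfolding Psi0_def PPb_def PPl_def PPyy_def PP_def G_def[symmetric] U_def[symmetric]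
      unfolding g3 g0' unfolding k0 abs4 G5 g1'
      by (simp add: algebra_simps)
  qed
  also have "\<dots> = G * s * r\<^sup>2 * resid \<sigma> \<kappa> c a b l y"
  proof -
    have k1: "s * r\<^sup>2 * ((1 - M\<^sup>2) * (1 - M * t)\<^sup>2) = 1"
    proof -
      have "s * r\<^sup>2 * ((1 - M\<^sup>2) * (1 - M * t)\<^sup>2) = (s * (1 - M\<^sup>2)) * (r * (1 - M * t))\<^sup>2" by (simp add: power_mult_distrib mult_ac)
      then show ?thesis unfolding rs by simp
    qed
    have k2: "s * r\<^sup>2 * ((1 - M\<^sup>2) * (1 - M * t) * M * (1 - t\<^sup>2)) = M * (1 - t\<^sup>2) * r"
    proof -
      have "s * r\<^sup>2 * ((1 - M\<^sup>2) * (1 - M * t) * M * (1 - t\<^sup>2)) = (s * (1 - M\<^sup>2)) * (r * (1 - M * t)) * (M * (1 - t\<^sup>2) * r)" by (simp add: power2_eq_square mult_ac)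
      then show ?thesis unfolding rs by simp
    qed
    have k3: "s * r\<^sup>2 * ((1 - M\<^sup>2) * (3 * M\<^sup>2 * (1 - t\<^sup>2)\<^sup>2 - 4 * M * t * (1 - t\<^sup>2) * (1 - M * t)))
        = 3 * (M * (1 - t\<^sup>2) * r)\<^sup>2 - 4 * t * (M * (1 - t\<^sup>2) * r)"
    proof -
      have "s * r\<^sup>2 * ((1 - M\<^sup>2) * (3 * M\<^sup>2 * (1 - t\<^sup>2)\<^sup>2 - 4 * M * t * (1 - t\<^sup>2) * (1 - M * t)))
        = (s * (1 - M\<^sup>2)) * (3 * (M * (1 - t\<^sup>2) * r)\<^sup>2 - 4 * t * (M * (1 - t\<^sup>2) * r) * (r * (1 - M * t)))"
        by (simp only: power2_eq_square right_diff_distrib left_diff_distrib mult_ac)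
      then show ?thesis unfolding rs by simp
    qed
    have k4: "s * r\<^sup>2 * (1 - M\<^sup>2)\<^sup>2 = (1 - M\<^sup>2) * r\<^sup>2"
    proof -
      have "s * r\<^sup>2 * (1 - M\<^sup>2)\<^sup>2 = (s * (1 - M\<^sup>2)) * ((1 - M\<^sup>2) * r\<^sup>2)" by (simp only: power2_eq_square mult_ac)
      then show ?thesis unfolding rs by simp
    qed
    have k5: "s * r\<^sup>2 * ((1 - M * t) * (t - M) / 2) = (t - M) / 2 * s * r"
    proof -
      have "s * r\<^sup>2 * ((1 - M * t) * (t - M) / 2) = (r * (1 - M * t)) * ((t - M) / 2 * s * r)" by (simp add: power2_eq_square mult_ac)
      then show ?thesis unfolding rs by simp
    qed
    have "s * r\<^sup>2 * resid \<sigma> \<kappa> c a b l y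
      = (s * r\<^sup>2 * ((1 - M\<^sup>2) * (1 - M * t)\<^sup>2)) * (- xb b * Vd \<kappa> c b l y - Af \<kappa> a b l y * Sx \<kappa> c b l y + V2 b l y - U + Af \<kappa> a b l y * complex_of_real (y\<^sup>2 / 4) * U)
      + 2 * (s * r\<^sup>2 * ((1 - M\<^sup>2) * (1 - M * t) * M * (1 - t\<^sup>2))) * V1 b l y
      + (s * r\<^sup>2 * ((1 - M\<^sup>2) * (3 * M\<^sup>2 * (1 - t\<^sup>2)\<^sup>2 - 4 * M * t * (1 - t\<^sup>2) * (1 - M * t)))) * U
      + (s * r\<^sup>2 * (1 - M\<^sup>2)\<^sup>2) * (U ^ 3 * cnj U ^ 2) - xb b * M * (s * r\<^sup>2 * ((1 - M * t) * (t - M) / 2)) * U"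
      unfolding resid_def rs_def M_def[symmetric] t_def[symmetric] U_def[symmetric]
      by (simp only: distrib_left right_diff_distrib mult_ac)
    then show ?thesis unfolding k1 k2 k3 k4 k5 by (simp add: mult.assoc)
  qed
  finally show ?thesis by (simp add: G_def s_def r_def M_def t_def power_one_over)
qed

end

lemma interval_at_within_nontriv:
  fixes J :: "real set"
  assumes "is_interval J" "interior J \<noteq> {}" "s \<in> J"
  shows "at s within J \<noteq> bot"
proof -
  have "s islimpt J"
    proof (intro connected_imp_perfect is_interval_connected assms)
    show "J \<noteq> {x}" for x using assms(2) by auto
  qed
  then show ?thesis by (simp add: trivial_limit_within)
qed

context prof begin

text \<open>By compactness |\<sigma>\<lambda>| attains its maximum on the region, which is therefore
  some q < 1; the empty region gets trivial constants.\<close>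

lemma region_bounds:
  assumes "param_region N \<gamma> K"
  obtains q M where "0 \<le> q" "q < 1" "M \<ge> 1" "\<And>p. p \<in> K \<Longrightarrow> \<bar>\<sigma> * snd p\<bar> \<le> q" "\<And>p. p \<in> K \<Longrightarrow> \<bar>fst p\<bar> \<le> M"
    "\<And>p. p \<in> K \<Longrightarrow> \<bar>snd p\<bar> \<le> M" "\<And>p. p \<in> K \<Longrightarrow> snd p \<ge> 0"
proof (cases "K = {}")
  case True
  then show thesis using that[of 0 1] by auto
next
  case False
  have c: "compact K" and s: "\<And>p. p \<in> K \<Longrightarrow> snd p \<ge> 0 \<and> \<bar>\<sigma> * snd p\<bar> < 1"
    using assms sig by (auto simp: param_region_def)
  obtain p1 where p1: "p1 \<in> K" "\<And>p. p \<in> K \<Longrightarrow> \<bar>\<sigma> * snd p\<bar> \<le> \<bar>\<sigma> * snd p1\<bar>"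
  proof -
    have "continuous_on K (\<lambda>p. \<bar>\<sigma> * snd p\<bar>)" by (intro continuous_intros)
    from continuous_attains_sup[OF c False this] that show thesis by blast
  qed
  obtain B where B: "\<And>p. p \<in> K \<Longrightarrow> norm p \<le> B" using compact_imp_bounded[OF c] bounded_iff by metis
  show thesis
  proof (rule that[of "\<bar>\<sigma> * snd p1\<bar>" "max 1 B"])
    show "\<bar>\<sigma> * snd p\<bar> \<le> \<bar>\<sigma> * snd p1\<bar>" if "p \<in> K" for p by (rule p1(2)[OF that])
    show "\<bar>fst p\<bar> \<le> max 1 B" "\<bar>snd p\<bar> \<le> max 1 B" if "p \<in> K" for p
      using B[OF that] norm_fst_le[of "fst p" "snd p"] norm_snd_le[of "snd p" "fst p"] by auto
  qed (use s p1 in auto)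
qed

text \<open>The bounds behind the uniform estimates. In this form they also cover single points and
  segments with \<lambda> = 0, on which the energy is analysed later.\<close>

definition kreg :: "real \<Rightarrow> real \<Rightarrow> (real \<times> real) set \<Rightarrow> bool" where
  "kreg q M K \<longleftrightarrow> 0 \<le> q \<and> q < 1 \<and> M \<ge> 1 \<and> (\<forall>p\<in>K. \<bar>\<sigma> * snd p\<bar> \<le> q \<and> \<bar>fst p\<bar> \<le> M \<and> \<bar>snd p\<bar> \<le> M)"

lemma L_V: "L True 0 V"
  unfolding Vf_def[abs_def] by (rule SP_add[OF L_qr L_weaken[OF L_Sg[OF sc(1)]]]) auto

lemma L_V1: "L True 0 V1"
proof -
  have "smi True (\<lambda>y. - (th y * qr y))" by (intro allI sm_uminus sm_mult_decay(2)[of False] sm_th smi_qr[rule_format])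
  then show ?thesis
    unfolding Vy_def[abs_def] by (intro SP_add L_real L_weaken[OF L_Sg[OF smi_hD[OF sc(1)]]]) auto
qed

lemma L_V2: "L True 0 V2"
proof -
  have "smi True (\<lambda>y. (3 * th y ^ 2 - 2) * qr y)"
    by (intro allI sm_mult_decay(2)[of False] sm_diff sm_mult_decay(3) sm_power sm_th smi_qr[rule_format] sm_const[where M=3]) auto
  then show ?thesis
    unfolding Vyy_def[abs_def] by (intro SP_add L_real L_weaken[OF L_Sg[OF smi_hD[OF smi_hD[OF sc(1)]]]]) auto
qed

context
  fixes q M :: real and K :: "(real \<times> real) set"
  assumes K: "kreg q M K"
begin

lemma kreg': "q < 1" "0 \<le> q" "\<And>p. p \<in> K \<Longrightarrow> \<bar>\<sigma> * snd p\<bar> \<le> q" "\<And>p. p \<in> K \<Longrightarrow> \<bar>fst p\<bar> \<le> M" "\<And>p. p \<in> K \<Longrightarrow> \<bar>snd p\<bar> \<le> M"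
  "\<And>p. p \<in> K \<Longrightarrow> \<bar>\<sigma> * snd p\<bar> < 1"
  using K by (auto simp: kreg_def order_le_less_trans)

lemma SPK: "SP d T F \<Longrightarrow> sm d K n (\<lambda>p. F (fst p) (snd p))"
  by (rule SP_sm[of d T F K M]) (use kreg' in auto)

lemma smK_G: "sm False K n (\<lambda>p y. complex_of_real (Gg (\<sigma> * snd p) y))"
  by (intro sm_of_real sm_Gg[of K "\<lambda>p. \<sigma> * snd p" q]) (use kreg' in auto)

lemma smK_g1: "sm False K n (\<lambda>p y. complex_of_real (g1 (\<sigma> * snd p) y))"
  by (intro sm_of_real sm_g1[of K "\<lambda>p. \<sigma> * snd p" q]) (use kreg' in auto)

lemma smK_g0: "sm False K n (\<lambda>p y. complex_of_real (\<sigma> * g0 (\<sigma> * snd p) y))"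
  by (intro sm_of_real sm_mult_decay(3) sm_const[where M="\<bar>\<sigma>\<bar>"] sm_g0[of K "\<lambda>p. \<sigma> * snd p" q]) (use kreg' in auto)

lemma smK_rec: "sm False K n (\<lambda>p y. complex_of_real (1 / (1 - \<sigma> * snd p * th y)))"
  by (intro sm_of_real sm_recip[of K "\<lambda>p. \<sigma> * snd p" q]) (use kreg' in auto)

lemma smK_rec2: "sm False K n (\<lambda>p y. complex_of_real (1 / (1 - (\<sigma> * snd p)\<^sup>2)))"
proof (rule sm_const[where M="1 / (1 - q\<^sup>2)"])
  fix p assume p: "p \<in> K"
  have "(\<sigma> * snd p)\<^sup>2 \<le> q\<^sup>2" using kreg'(3)[OF p] kreg'(2) by (metis abs_le_square_iff abs_of_nonneg)
  moreover have "q\<^sup>2 < 1" using kreg'(1,2) by (simp add: abs_square_less_1)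
  ultimately have "1 - q\<^sup>2 > 0" "1 - q\<^sup>2 \<le> 1 - (\<sigma> * snd p)\<^sup>2" by auto
  then have "\<bar>1 / (1 - (\<sigma> * snd p)\<^sup>2)\<bar> \<le> 1 / (1 - q\<^sup>2)" by (simp add: frac_le)
  then show "norm (complex_of_real (1 / (1 - (\<sigma> * snd p)\<^sup>2))) \<le> 1 / (1 - q\<^sup>2)" unfolding norm_of_real .
qed

lemma smK_2: "sm False K n (\<lambda>p y. numeral w :: complex)"
  by (rule sm_const[where M="numeral w"]) simp

lemma smK_PP: "sm True K n (\<lambda>p. PP (fst p) (snd p))"
  unfolding PP_def[abs_def] by (intro sm_mult_decay(2)[OF smK_G] SPK[OF L_V])

lemma smK_PPy: "sm True K n (\<lambda>p. PPy (fst p) (snd p))"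
  unfolding PPy_def[abs_def] by (intro sm_mult_decay(2)[OF smK_G] sm_mult_decay(2)[OF smK_g1] sm_add SPK[OF L_V] SPK[OF L_V1])

lemma smK_PPyy: "sm True K n (\<lambda>p. PPyy (fst p) (snd p))"
proof -
  have "sm False K n (\<lambda>p y. 3 * complex_of_real (g1 (\<sigma> * snd p) y)^2 - 4 * (complex_of_real (th y) * complex_of_real (g1 (\<sigma> * snd p) y)))"
    by (intro sm_diff sm_mult_decay(3) smK_2 sm_power smK_g1 sm_of_real sm_th)
  then have 1: "sm False K n (\<lambda>p y. complex_of_real (3 * (g1 (\<sigma> * snd p) y)\<^sup>2 - 4 * th y * g1 (\<sigma> * snd p) y))"
    by (rule sm_cong) (simp only: of_real_diff of_real_mult of_real_power of_real_numeral mult.assoc)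
  have 2: "sm False K n (\<lambda>p y. 2 * complex_of_real (g1 (\<sigma> * snd p) y))"
    by (intro sm_mult_decay(3) smK_2 smK_g1)
  show ?thesis unfolding PPyy_def[abs_def]
    by (intro sm_mult_decay(2)[OF smK_G] sm_mult_decay(2)[OF 1] sm_mult_decay(2)[OF 2] sm_add SPK[OF L_V] SPK[OF L_V1] SPK[OF L_V2])
qed

lemma smK_PPl: "sm True K n (\<lambda>p. PPl (fst p) (snd p))"
  unfolding PPl_def[abs_def]
  by (intro sm_mult_decay(2)[OF smK_G] sm_mult_decay(2)[OF smK_g0] sm_add SPK[OF L_V] SPK[OF L_Sl[OF sc(1)]])

lemma smK_i: "sm False K n (\<lambda>p y. \<i>)" by (rule sm_const[where M=1]) simp

lemma smK_PPb: "sm True K n (\<lambda>p. PPb (fst p) (snd p))"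
  unfolding PPb_def[abs_def]
  by (intro sm_mult_decay(2)[OF smK_G] sm_mult_decay(2)[OF smK_i] SPK[OF L_Sx[OF sc(1)]])

text \<open>Division by \<lambda> or by the weight takes place where \<lambda> > 0; the bounds
  obtained on this part do not deteriorate as \<lambda> tends to 0.\<close>

abbreviation Kp :: "(real \<times> real) set" where "Kp \<equiv> {p \<in> K. snd p > 0}"

text \<open>Every exponent in \<open>Theta\<close> has k >= 1 and the soliton does not involve b, so
  the b-derivative of P is divisible by \<lambda>. This yields the factor \<lambda> in front of the
  defect of b.\<close>

lemma smKp_PPb: "sm True Kp n (\<lambda>p y. PPb (fst p) (snd p) y / complex_of_real (snd p))"
proof -
  have "\<exists>C. \<forall>p\<in>Kp. \<bar>fst p ^ j * snd p ^ k / snd p\<bar> \<le> C" if k: "(j, k) \<in> {(j, k). 1 \<le> k}" for j k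
  proof (intro exI ballI)
    fix p assume p: "p \<in> Kp"
    have "snd p ^ k / snd p = snd p ^ (k - 1)" using p k by (cases k) auto
    then have "\<bar>fst p ^ j * snd p ^ k / snd p\<bar> = \<bar>fst p\<bar> ^ j * \<bar>snd p\<bar> ^ (k - 1)" by (simp add: abs_mult power_abs flip: times_divide_eq_right)
    also have "\<dots> \<le> M ^ j * M ^ (k - 1)"
      using p kreg'(4,5)[of p] by (intro mult_mono power_mono) auto
    finally show "\<bar>fst p ^ j * snd p ^ k / snd p\<bar> \<le> M ^ j * M ^ (k - 1)" .
  qed
  from SP_quot[OF L_Sx[OF sc(1)] this] have 1: "sm True Kp n (\<lambda>p y. Sx \<kappa> c (fst p) (snd p) y / complex_of_real (snd p))" .
  have "sm False Kp n (\<lambda>p y. complex_of_real (Gg (\<sigma> * snd p) y))" "sm False Kp n (\<lambda>p y. \<i>)"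
    by (rule sm_reindex[OF _ smK_G, of Kp "\<lambda>p. p"], simp) (rule sm_reindex[OF _ smK_i, of Kp "\<lambda>p. p"], simp)
  then have "sm True Kp n (\<lambda>p y. complex_of_real (Gg (\<sigma> * snd p) y) * (\<i> * (Sx \<kappa> c (fst p) (snd p) y / complex_of_real (snd p))))"
    by (intro sm_mult_decay(2)[of False] 1)
  then show ?thesis by (rule sm_cong) (simp add: PPb_def)
qed

text \<open>The residual has only exponents with j + 2k >= 2\<kappa>, and
  \<open>weight_bound\<close> compares each such monomial with the weight.\<close>

lemma smKp_Psi0:
  "sm True Kp n (\<lambda>p y. Psi0 (fst p) (snd p) y / complex_of_real (((fst p)\<^sup>2 + snd p) ^ \<kappa>))"
proof -
  have M: "M \<ge> 1" using K by (simp add: kreg_def)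
  have "\<exists>C. \<forall>p\<in>Kp. \<bar>fst p ^ j * snd p ^ k / ((fst p)\<^sup>2 + snd p) ^ \<kappa>\<bar> \<le> C" if k: "(j, k) \<in> {(j, k). 2 * \<kappa> \<le> j + 2 * k}" for j k
  proof (intro exI ballI)
    fix p assume p: "p \<in> Kp"
    have w: "(fst p)\<^sup>2 + snd p > 0" using p by (simp add: add_nonneg_pos)
    have "(fst p)\<^sup>2 \<le> M\<^sup>2" using kreg'(4)[of p] p M by (metis (lifting) abs_le_square_iff abs_of_nonneg mem_Collect_eq order_trans zero_le_one)
    then have "(fst p)\<^sup>2 + snd p \<le> M\<^sup>2 + M" using kreg'(5)[of p] p by auto
    moreover have "M\<^sup>2 + M \<ge> 1" using M by (simp add: add_increasing)
    ultimately have "\<bar>fst p ^ j * snd p ^ k\<bar> \<le> (M\<^sup>2 + M) ^ (j + 2 * k) * ((fst p)\<^sup>2 + snd p) ^ \<kappa>"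
      using p k by (intro weight_bound) auto
    then show "\<bar>fst p ^ j * snd p ^ k / ((fst p)\<^sup>2 + snd p) ^ \<kappa>\<bar> \<le> (M\<^sup>2 + M) ^ (j + 2 * k)"
      using w by (simp add: abs_divide divide_le_eq)
  qed
  from SP_quot[OF res this]
  have 1: "sm True Kp n (\<lambda>p y. resid \<sigma> \<kappa> c a (fst p) (snd p) y / complex_of_real (((fst p)\<^sup>2 + snd p) ^ \<kappa>))" .
  have r: "sm False Kp n F" if "sm False K n F" for F :: "real \<times> real \<Rightarrow> real \<Rightarrow> complex"
    by (rule sm_reindex[OF _ that, of Kp "\<lambda>p. p"]) simp
  have "sm False Kp n (\<lambda>p y. complex_of_real (Gg (\<sigma> * snd p) y) * complex_of_real (1 / (1 - (\<sigma> * snd p)\<^sup>2)) * complex_of_real (1 / (1 - \<sigma> * snd p * th y))^2)"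
    by (intro r sm_mult_decay(3) sm_power smK_G smK_rec smK_rec2)
  from sm_mult_decay(2)[OF this 1]
  have "sm True Kp n (\<lambda>p y. complex_of_real (Gg (\<sigma> * snd p) y) * complex_of_real (1 / (1 - (\<sigma> * snd p)\<^sup>2)) * complex_of_real (1 / (1 - \<sigma> * snd p * th y))^2
     * (resid \<sigma> \<kappa> c a (fst p) (snd p) y / complex_of_real (((fst p)\<^sup>2 + snd p) ^ \<kappa>)))" .
  then show ?thesis
  proof (rule sm_cong)
    fix p y assume "p \<in> Kp"
    then have "\<bar>\<sigma> * snd p\<bar> < 1" using kreg'(6) by auto
    note e = Psi0_resid[OF this, of "fst p" y]
    show "complex_of_real (Gg (\<sigma> * snd p) y) * complex_of_real (1 / (1 - (\<sigma> * snd p)\<^sup>2)) * complex_of_real (1 / (1 - \<sigma> * snd p * th y))^2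
     * (resid \<sigma> \<kappa> c a (fst p) (snd p) y / complex_of_real (((fst p)\<^sup>2 + snd p) ^ \<kappa>)) = Psi0 (fst p) (snd p) y / complex_of_real (((fst p)\<^sup>2 + snd p) ^ \<kappa>)"
      unfolding e of_real_mult of_real_power by simp
  qed
qed

end

lemma csmi_PP:
  assumes "\<bar>\<sigma> * l\<bar> < 1"
  shows "csmi (PP b l)"
proof
  fix n
  have K: "kreg \<bar>\<sigma> * l\<bar> (max 1 (max \<bar>b\<bar> \<bar>l\<bar>)) {(b, l)}" using assms by (auto simp: kreg_def)
  have "sm True {()} n (\<lambda>_. PP (fst (b, l)) (snd (b, l)))"
    by (rule sm_reindex[OF _ smK_PP[OF K], of "{()}" "\<lambda>_. (b, l)"]) simp
  then show "sm True {()} n (\<lambda>_. PP b l)" by simp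
qed

lemma V1_0: "V1 b l 0 = 0"
  unfolding Vy_def Sg_def using sc(2) by simp

text \<open>V has slope 0 at the vertex and \<open>g1 m 0 = m\<close>. As \<sigma>\<lambda> =
  \<gamma>\<lambda>/N, this is the slope that the vertex condition asks of each edge.\<close>

lemma PPy_0: "PPy b l 0 = complex_of_real (\<sigma> * l) * PP b l 0"
  by (simp add: PPy_def PP_def V1_0)

lemma profile_eq: "\<bar>\<sigma> * l\<bar> < 1 \<Longrightarrow> profile N \<gamma> \<kappa> Pj b l = (\<lambda>i. PP b l)"
  by (intro ext profile_PP)

lemma hD_PP: "\<bar>\<sigma> * l\<bar> < 1 \<Longrightarrow> y \<ge> 0 \<Longrightarrow> hD (PP b l) y = PPy b l y"
  by (rule deriv_in_half[OF PP_hderiv])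

lemma hDD_PP: "\<bar>\<sigma> * l\<bar> < 1 \<Longrightarrow> y \<ge> 0 \<Longrightarrow> hD (hD (PP b l)) y = PPyy b l y"
  using deriv_in_cong[of "hD (PP b l)" "PPy b l" y] hD_PP deriv_in_half[OF PPy_hderiv] by auto

lemma profile_dom_H:
  assumes "\<bar>\<sigma> * l\<bar> < 1"
  shows "(\<lambda>i. PP b l) \<in> dom_H N (\<gamma> * l)"
  by (rule csmi_dom_H[OF csmi_PP[OF assms] N]) (simp add: hD_PP[OF assms] PPy_0)

lemma H_op_profile:
  assumes "\<bar>\<sigma> * l\<bar> < 1" "y \<ge> 0"
  shows "H_op N (\<gamma> * l) (\<lambda>i. PP b l) i y = - PPyy b l y"
  using profile_dom_H[OF assms(1)] hDD_PP[OF assms] by (simp add: H_op_def)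

lemma Pj_dom_H:
  assumes "\<beta> \<in> {- real N <..< real N}"
  shows "Pj j k \<beta> \<in> dom_H N \<beta>"
proof -
  have m: "\<bar>\<beta> / real N\<bar> < 1" using assms N by (auto simp: abs_less_iff field_simps)
  define f where "f y = complex_of_real (Gg (\<beta> / real N) y * c j k y)" for y
  have "sm False {()} n (\<lambda>_. Gg (\<beta> / real N))" for n
    by (rule sm_Gg[of "{()}" "\<lambda>_. \<beta> / real N" "\<bar>\<beta> / real N\<bar>"]) (use m in auto)
  then have f: "csmi f" unfolding f_def
    by (intro allI sm_of_real sm_mult_decay(2)[of False] sc(1)[rule_format])
  have "hderiv f (complex_of_real (Gg (\<beta> / real N) 0 * hD (c j k) 0 + Gg (\<beta> / real N) 0 * g1 (\<beta> / real N) 0 * c j k 0)) 0"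
    unfolding f_def by (intro hderiv_of_real has_vector_derivative_mult hderiv_Gg m smi_hderiv[OF sc(1)]) auto
  from deriv_in_half[OF this] have "hD f 0 = complex_of_real (\<beta> / real N) * f 0"
    by (simp add: sc(2) f_def)
  from csmi_dom_H[OF f N this] show ?thesis unfolding f_def Pj_def[abs_def] .
qed

lemma Pj_bsm: "bsm True {- real N <..< real N} l (\<lambda>\<beta> y. Gg (\<beta> / real N) y * c j k y)"
  using bsm_mult[OF bsm_Gg[OF N] bsm_const[OF sc(1)], of l j k] by simp

lemma modulation_point:
  assumes "modulation N \<gamma> J b lam" "s \<in> J"
  shows "\<bar>\<sigma> * lam s\<bar> < 1" "lam s > 0" "(b has_real_derivative deriv_in J b s) (at s within J)"
    "(lam has_real_derivative deriv_in J lam s) (at s within J)" "at s within J \<noteq> bot"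
proof -
  have "\<gamma> * lam s \<in> {- real N <..< real N}" using assms by (auto simp: modulation_def)
  then show "\<bar>\<sigma> * lam s\<bar> < 1" by (simp only: sig)
  show "lam s > 0" using assms by (auto simp: modulation_def)
  have d: "(f has_real_derivative deriv_in J f s) (at s within J)" if "Ck_on J 1 f" for f :: "real \<Rightarrow> real"
    using that assms(2) unfolding Ck_on_def deriv_in_def has_real_derivative_iff_has_vector_derivative
    by (auto intro: vector_derivative_works[THEN iffD1])
  show "(b has_real_derivative deriv_in J b s) (at s within J)" "(lam has_real_derivative deriv_in J lam s) (at s within J)"
    using assms(1) by (auto simp: modulation_def intro: d)
  show "at s within J \<noteq> bot" using interval_at_within_nontriv[OF _ _ assms(2)] assms(1) by (simp add: modulation_def)
qed

abbreviation al :: "nat \<Rightarrow> nat \<Rightarrow> real \<Rightarrow> real" where "al \<equiv> (\<lambda>j k \<beta>. a j k)"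

text \<open>The error is affine in the velocities: relative to the exact flow only the two defects
  enter, multiplied by the parameter derivatives of the profile. The factor \<open>lam s\<close> is
  split off to form the scale-invariant defect of \<lambda>.\<close>

lemma Psi_eq:
  assumes m: "modulation N \<gamma> J b lam" and s: "s \<in> J" and y: "y \<ge> 0"
  shows "Psi N \<gamma> \<kappa> Pj al J b lam s i y = Psi0 (b s) (lam s) y
    + \<i> * (PPb (b s) (lam s) y * (complex_of_real (deriv_in J b s + (b s)\<^sup>2) - alpha_sum \<gamma> \<kappa> al (b s) (lam s))
         + PPl (b s) (lam s) y * complex_of_real (lam s * (deriv_in J lam s / lam s + b s)))"
proof -
  note p = modulation_point[OF m s]
  have "((\<lambda>s. PP (b s) (lam s) y) has_vector_derivative PPb (b s) (lam s) y * complex_of_real (deriv_in J b s)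
      + PPl (b s) (lam s) y * complex_of_real (deriv_in J lam s)) (at s within J)"
    by (rule PP_chain[OF p(3,4,1)])
  then have "((\<lambda>s'. profile N \<gamma> \<kappa> Pj (b s') (lam s') i y) has_vector_derivative PPb (b s) (lam s) y * complex_of_real (deriv_in J b s)
      + PPl (b s) (lam s) y * complex_of_real (deriv_in J lam s)) (at s within J)"
    by (rule has_vector_derivative_transform[OF s, rotated]) (use profile_PP modulation_point(1)[OF m] in auto)
  from vector_derivative_within[OF p(5) this]
  have d: "deriv_in J (\<lambda>s'. profile N \<gamma> \<kappa> Pj (b s') (lam s') i y) s = PPb (b s) (lam s) y * complex_of_real (deriv_in J b s)
      + PPl (b s) (lam s) y * complex_of_real (deriv_in J lam s)" by (simp only: deriv_in_def)
  have l: "lam s * (deriv_in J lam s / lam s + b s) = deriv_in J lam s + b s * lam s" using p(2) by (simp add: field_simps)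
  have al: "alpha_sum \<gamma> \<kappa> al (b s) (lam s) = Af \<kappa> a (b s) (lam s) y" by (rule alpha_sum_Af)
  show ?thesis
    unfolding Psi_def Let_def d profile_eq[OF p(1)] H_op_profile[OF p(1) y] l al Psi0_def
    by (simp add: algebra_simps)
qed

theorem Psi_estimate:
  assumes "param_region N \<gamma> K"
  shows "\<exists>\<rho>>0. \<exists>C>0. \<forall>J b lam. modulation N \<gamma> J b lam \<and> (\<forall>s\<in>J. (b s, lam s) \<in> K) \<longrightarrow>
          (\<forall>s\<in>J. Psi N \<gamma> \<kappa> Pj al J b lam s \<in> Cexp N \<nu> \<and>
             Cexp_norm N \<nu> \<rho> (Psi N \<gamma> \<kappa> Pj al J b lam s)
               \<le> ennreal (C * lam s * mod_defect \<gamma> \<kappa> al J b lam s + C * ((b s)\<^sup>2 + lam s) ^ \<kappa>))"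
proof -
  obtain q M where qM: "0 \<le> q" "q < 1" "M \<ge> 1" "\<And>p. p \<in> K \<Longrightarrow> \<bar>\<sigma> * snd p\<bar> \<le> q" "\<And>p. p \<in> K \<Longrightarrow> \<bar>fst p\<bar> \<le> M"
    "\<And>p. p \<in> K \<Longrightarrow> \<bar>snd p\<bar> \<le> M" "\<And>p. p \<in> K \<Longrightarrow> snd p \<ge> 0"
    by (rule region_bounds[OF assms]) blast
  have kr: "kreg q M K" using qM by (simp add: kreg_def)
  \<comment> \<open>The defects are not bounded a priori, so they are adjoined to the parameters and
    the error is divided by its expected size \<open>Z\<close>; the quotient \<open>F\<close> is
    then uniformly smooth and decaying on \<open>K2\<close>.\<close>
  define K2 :: "((real \<times> real) \<times> (complex \<times> real)) set" where "K2 = {z. fst z \<in> K \<and> snd (fst z) > 0}"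
  define W where "W z = ((fst (fst z))\<^sup>2 + snd (fst z)) ^ \<kappa>" for z :: "(real \<times> real) \<times> (complex \<times> real)"
  define Z where "Z z = snd (fst z) * (\<bar>snd (snd z)\<bar> + cmod (fst (snd z))) + W z" for z :: "(real \<times> real) \<times> (complex \<times> real)"
  have W: "W z > 0" if "z \<in> K2" for z
    using that unfolding W_def K2_def by (intro zero_less_power) (auto simp: add_nonneg_pos)
  have Zp: "Z z > 0" "W z \<le> Z z" "snd (fst z) * cmod (fst (snd z)) \<le> Z z" "snd (fst z) * \<bar>snd (snd z)\<bar> \<le> Z z" if "z \<in> K2" for z
    using W[OF that] that unfolding Z_def K2_def by (auto simp: add_nonneg_pos distrib_left)
  have in2: "fst z \<in> {p \<in> K. snd p > 0}" if "z \<in> K2" for z using that by (simp add: K2_def)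
  have in1: "fst z \<in> K" if "z \<in> K2" for z using that by (simp add: K2_def)
  have c1: "sm False K2 n (\<lambda>z y. complex_of_real (W z / Z z))" for n
    by (rule sm_const[where M=1]) (use Zp W in \<open>auto simp: norm_divide less_imp_le\<close>)
  have c2: "sm False K2 n (\<lambda>z y. complex_of_real (snd (fst z)) * fst (snd z) / complex_of_real (Z z))" for n
    by (rule sm_const[where M=1]) (use Zp in \<open>auto simp: norm_divide norm_mult less_imp_le K2_def\<close>)
  have c3: "sm False K2 n (\<lambda>z y. complex_of_real (snd (fst z) * snd (snd z) / Z z))" for n
    by (rule sm_const[where M=1]) (use Zp in \<open>auto simp: norm_divide norm_mult abs_mult less_imp_le K2_def\<close>)
  define F where "F z y = complex_of_real (W z / Z z) * (Psi0 (fst (fst z)) (snd (fst z)) y / complex_of_real (W z))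
     + \<i> * ((complex_of_real (snd (fst z)) * fst (snd z) / complex_of_real (Z z)) * (PPb (fst (fst z)) (snd (fst z)) y / complex_of_real (snd (fst z)))
        + complex_of_real (snd (fst z) * snd (snd z) / Z z) * PPl (fst (fst z)) (snd (fst z)) y)" for z y
  have F: "sm True K2 n F" for n
  proof -
    have 1: "sm True K2 n (\<lambda>z y. Psi0 (fst (fst z)) (snd (fst z)) y / complex_of_real (W z))"
      using sm_reindex[where h=fst and L=K2, OF in2 smKp_Psi0[OF kr]] unfolding W_def by simp
    have 2: "sm True K2 n (\<lambda>z y. PPb (fst (fst z)) (snd (fst z)) y / complex_of_real (snd (fst z)))"
      using sm_reindex[where h=fst and L=K2, OF in2 smKp_PPb[OF kr]] by simp
    have 3: "sm True K2 n (\<lambda>z. PPl (fst (fst z)) (snd (fst z)))"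
      using sm_reindex[where h=fst and L=K2, OF in1 smK_PPl[OF kr]] by simp
    have "sm False K2 n (\<lambda>z y. \<i>)" by (rule sm_const[where M=1]) simp
    then show ?thesis unfolding F_def[abs_def]
      by (intro sm_add sm_mult_decay(2)[OF c1] sm_mult_decay(2)[OF c2] sm_mult_decay(2)[OF c3] sm_mult_decay(2)[of False _ _ "\<lambda>z y. \<i>"] 1 2 3)
  qed
  obtain \<rho> C where rC: "\<rho> > 0" "C > 0" and bd: "\<And>z v f. z \<in> K2 \<Longrightarrow> (\<And>i y. i < N \<Longrightarrow> y \<ge> 0 \<Longrightarrow> f i y = v * F z y) \<Longrightarrow>
     Cexp_norm N \<nu> \<rho> f \<le> ennreal (C * norm v)"
    by (rule sm_Cexp_norm[OF F[of \<nu>], of N]) blast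
  have "Psi N \<gamma> \<kappa> Pj al J b lam s \<in> Cexp N \<nu> \<and> Cexp_norm N \<nu> \<rho> (Psi N \<gamma> \<kappa> Pj al J b lam s)
      \<le> ennreal (C * lam s * mod_defect \<gamma> \<kappa> al J b lam s + C * ((b s)\<^sup>2 + lam s) ^ \<kappa>)"
    if m: "modulation N \<gamma> J b lam" and inK: "\<forall>s\<in>J. (b s, lam s) \<in> K" and s: "s \<in> J" for J b lam s
  proof -
    define d1 where "d1 = complex_of_real (deriv_in J b s + (b s)\<^sup>2) - alpha_sum \<gamma> \<kappa> al (b s) (lam s)"
    define d2 where "d2 = deriv_in J lam s / lam s + b s"
    define z where "z = ((b s, lam s), (d1, d2))"
    note p = modulation_point[OF m s]
    have z: "z \<in> K2" using inK s p(2) by (simp add: K2_def z_def)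
    have e: "Psi N \<gamma> \<kappa> Pj al J b lam s i y = complex_of_real (Z z) * F z y" if "y \<ge> 0" for i y
      using Zp(1)[OF z] W[OF z] p(2) unfolding Psi_eq[OF m s that] d1_def[symmetric] d2_def[symmetric] F_def
      by (simp add: z_def distrib_left)
    have Zd: "Z z = lam s * mod_defect \<gamma> \<kappa> al J b lam s + ((b s)\<^sup>2 + lam s) ^ \<kappa>"
      by (simp add: Z_def W_def z_def mod_defect_def d1_def d2_def)
    have "Psi N \<gamma> \<kappa> Pj al J b lam s \<in> Cexp N \<nu>"
      by (rule sm_in_Cexp[OF F z]) (rule e)
    moreover have "Cexp_norm N \<nu> \<rho> (Psi N \<gamma> \<kappa> Pj al J b lam s) \<le> ennreal (C * norm (complex_of_real (Z z)))"
      by (rule bd[OF z]) (rule e)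
    moreover have "norm (complex_of_real (Z z)) = lam s * mod_defect \<gamma> \<kappa> al J b lam s + ((b s)\<^sup>2 + lam s) ^ \<kappa>"
      using Zp(1)[OF z] unfolding norm_of_real Zd[symmetric] by simp
    ultimately show ?thesis by (simp add: distrib_left mult.assoc)
  qed
  then show ?thesis using rC by blast
qed

end

section \<open>The energy of the profile\<close>

lemma cmod_sq_deriv:
  assumes "(z has_vector_derivative z') (at s within S)"
  shows "((\<lambda>s. (cmod (z s))\<^sup>2) has_real_derivative 2 * Re (cnj (z s) * z')) (at s within S)"
proof -
  have r: "((\<lambda>s. Re (z s)) has_real_derivative Re z') (at s within S)" "((\<lambda>s. Im (z s)) has_real_derivative Im z') (at s within S)"
    unfolding has_real_derivative_iff_has_vector_derivative
    by (rule bounded_linear.has_vector_derivative[OF bounded_linear_Re assms], rule bounded_linear.has_vector_derivative[OF bounded_linear_Im assms])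
  have "((\<lambda>s. (Re (z s))\<^sup>2 + (Im (z s))\<^sup>2) has_real_derivative 2 * Re (cnj (z s) * z')) (at s within S)"
    using DERIV_add[OF DERIV_power[OF r(1), of 2] DERIV_power[OF r(2), of 2]] by (simp add: algebra_simps)
  then show ?thesis by (simp only: cmod_power2)
qed

lemma hint_scale:
  fixes f :: "real \<Rightarrow> real"
  assumes "l > 0" shows "hint (\<lambda>x. f (x / l)) = l * hint f"
proof -
  have "hint (\<lambda>x. f (x / l)) = (\<integral>x. indicator {0..} x * f (x / l) \<partial>lborel)" by (simp add: set_lebesgue_integral_def)
  also have "\<dots> = \<bar>l\<bar> *\<^sub>R (\<integral>x. indicator {0..} (0 + l * x) * f ((0 + l * x) / l) \<partial>lborel)"
    by (rule lborel_integral_real_affine) (use assms in simp)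
  also have "(\<lambda>x. indicator {0..} (0 + l * x) * f ((0 + l * x) / l)) = (\<lambda>x. indicator {0..} x * f x)"
    using assms by (auto simp: indicator_def fun_eq_iff zero_le_mult_iff)
  finally show ?thesis using assms by (simp add: set_lebesgue_integral_def)
qed

text \<open>Dominated convergence along sequences. The mean value inequality on the convex set of
  points of J within distance \<delta> of \<open>s0\<close> dominates the difference quotients, so a
  bound on the derivative near \<open>s0\<close> is enough.\<close>

lemma deriv_under_hint:
  fixes f f' :: "real \<Rightarrow> real \<Rightarrow> real"
  assumes J: "is_interval J" and s0: "s0 \<in> J" and \<delta>: "\<delta> > 0"
    and d: "\<And>s y. s \<in> J \<Longrightarrow> y \<ge> 0 \<Longrightarrow> ((\<lambda>s. f s y) has_real_derivative f' s y) (at s within J)"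
    and b: "\<And>s y. s \<in> J \<Longrightarrow> \<bar>s - s0\<bar> < \<delta> \<Longrightarrow> y \<ge> 0 \<Longrightarrow> \<bar>f' s y\<bar> \<le> C * exp (- (\<rho> * y))" and \<rho>: "\<rho> > 0"
    and i: "\<And>s. s \<in> J \<Longrightarrow> hintegrable (f s)" and c: "continuous_on {0..} (f' s0)"
  shows "((\<lambda>s. hint (f s)) has_real_derivative hint (f' s0)) (at s0 within J)"
proof -
  let ?Q = "\<lambda>s y. (f s y - f s0 y) / (s - s0)"
  have lim: "((\<lambda>s. hint (?Q s)) \<longlongrightarrow> hint (f' s0)) (at s0 within J)"
    unfolding tendsto_at_iff_sequentially comp_def
  proof (intro allI impI)
    fix X assume X: "\<forall>i. X i \<in> J - {s0}" "X \<longlonglongrightarrow> s0"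
    have Xs: "X n \<in> J" "X n \<noteq> s0" for n using X(1) by auto
    from X(2) \<delta> obtain n0 where n0: "\<And>n. n \<ge> n0 \<Longrightarrow> \<bar>X n - s0\<bar> < \<delta>"
      unfolding LIMSEQ_def dist_real_def by blast
    have "(\<lambda>n. hint (?Q (X (n + n0)))) \<longlonglongrightarrow> hint (f' s0)"
      unfolding set_lebesgue_integral_def
    proof (rule integral_dominated_convergence[where w="\<lambda>y. indicator {0..} y *\<^sub>R (C * exp (- (\<rho> * y)))"])
      show "(\<lambda>y. indicator {0..} y *\<^sub>R f' s0 y) \<in> borel_measurable lborel"
        using hborel_continuous[OF c] by (simp add: set_borel_measurable_def)
      show "(\<lambda>y. indicator {0..} y *\<^sub>R ?Q (X (n + n0)) y) \<in> borel_measurable lborel" for n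
      proof -
        have "hintegrable (?Q (X (n + n0)))"
          by (intro set_integrable_divide set_integral_diff i Xs s0)
        then show ?thesis unfolding set_integrable_def by (rule borel_measurable_integrable)
      qed
      show "integrable lborel (\<lambda>y. indicator {0..} y *\<^sub>R (C * exp (- (\<rho> * y))))"
        using exp_hintegrable[OF \<rho>, of C] by (simp add: set_integrable_def)
      show "AE y in lborel. (\<lambda>n. indicator {0..} y *\<^sub>R ?Q (X (n + n0)) y) \<longlonglongrightarrow> indicator {0..} y *\<^sub>R f' s0 y"
      proof (rule AE_I2)
        fix y :: real
        show "(\<lambda>n. indicator {0..} y *\<^sub>R ?Q (X (n + n0)) y) \<longlonglongrightarrow> indicator {0..} y *\<^sub>R f' s0 y"
        proof (cases "y \<ge> 0")
          case True
          have "((\<lambda>s. ?Q s y) \<longlongrightarrow> f' s0 y) (at s0 within J)"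
            using d[OF s0 True] by (simp add: has_field_derivative_iff)
          then have "(\<lambda>n. ?Q (X n) y) \<longlonglongrightarrow> f' s0 y"
            using X unfolding tendsto_at_iff_sequentially comp_def by blast
          then have "(\<lambda>n. ?Q (X (n + n0)) y) \<longlonglongrightarrow> f' s0 y" by (rule LIMSEQ_ignore_initial_segment)
          then show ?thesis using True by simp
        qed simp
      qed
      show "AE y in lborel. norm (indicator {0..} y *\<^sub>R ?Q (X (n + n0)) y) \<le> indicator {0..} y *\<^sub>R (C * exp (- (\<rho> * y)))" for n
      proof (rule AE_I2)
        fix y :: real
        show "norm (indicator {0..} y *\<^sub>R ?Q (X (n + n0)) y) \<le> indicator {0..} y *\<^sub>R (C * exp (- (\<rho> * y)))"
        proof (cases "y \<ge> 0")
          case True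
          let ?x = "X (n + n0)" and ?S = "J \<inter> ball s0 \<delta>"
          have x: "\<bar>?x - s0\<bar> < \<delta>" by (rule n0) simp
          have cv: "convex ?S" using J by (intro convex_Int) (auto simp: is_interval_convex_1)
          have "norm (f ?x y - f s0 y) \<le> (C * exp (- (\<rho> * y))) * norm (?x - s0)"
          proof (rule field_differentiable_bound[OF cv, of "\<lambda>s. f s y" "\<lambda>s. f' s y"])
            show "((\<lambda>s. f s y) has_field_derivative f' z y) (at z within ?S)" if "z \<in> ?S" for z
              using d[of z y] True that by (auto intro: DERIV_subset)
            show "norm (f' z y) \<le> C * exp (- (\<rho> * y))" if "z \<in> ?S" for z
              using b[of z y] True that by (auto simp: dist_real_def abs_minus_commute)
            show "?x \<in> ?S" "s0 \<in> ?S" using x Xs s0 \<delta> by (auto simp: dist_real_def abs_minus_commute)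
          qed
          then show ?thesis using True Xs(2)[of "n + n0"] by (simp add: abs_divide divide_le_eq)
        qed simp
      qed
    qed
    then show "(\<lambda>n. hint (?Q (X n))) \<longlonglongrightarrow> hint (f' s0)" by (rule LIMSEQ_offset)
  qed
  have e: "hint (?Q s) = (hint (f s) - hint (f s0)) / (s - s0)" if "s \<in> J" for s
    using set_integral_diff(2)[OF i[OF that] i[OF s0]] by simp
  have "((\<lambda>s. (hint (f s) - hint (f s0)) / (s - s0)) \<longlongrightarrow> hint (f' s0)) (at s0 within J)"
    by (rule Lim_transform_within[OF lim zero_less_one]) (rule e)
  then show ?thesis by (simp add: has_field_derivative_iff)
qed

text \<open>The parameter derivative of \<open>g1\<close>, computed next, is the same expression:
  both are the mixed second derivative of log G.\<close>

lemma hderiv_g0: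
  assumes "\<bar>m\<bar> < 1"
  shows "hderiv (g0 m) ((1 - (th y)\<^sup>2) * (1 / (1 - m * th y))\<^sup>2) y"
proof -
  define T D P where "T = th y" and "D = 1 - m * th y" and "P = 1 - m\<^sup>2"
  have d: "D \<noteq> 0" using one_minus_mt_bound(2)[of m "\<bar>m\<bar>" y] assms by (simp add: D_def)
  have "m\<^sup>2 < 1" using assms by (simp add: abs_square_less_1)
  then have p: "P \<noteq> 0" by (simp add: P_def)
  have 1: "hderiv (\<lambda>y. (th y - m) / 2 * (1 / (1 - m\<^sup>2))) ((1 - T\<^sup>2) * (1 / P)) y"
  proof -
    have "hderiv (\<lambda>y. (th y - m) / 2) (1 - T\<^sup>2) y"
      using hderiv_tanh2[of y] unfolding has_real_derivative_iff_has_vector_derivative[symmetric] T_def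
      by (auto intro!: derivative_eq_intros)
    from has_vector_derivative_mult_left[OF this] show ?thesis by (simp only: P_def)
  qed
  have 2: "hderiv (\<lambda>y. 1 / (1 - m * th y)) (m * (2 * (1 - T\<^sup>2)) / D\<^sup>2) y"
    using d hderiv_tanh2[of y] unfolding has_real_derivative_iff_has_vector_derivative[symmetric] T_def D_def
    by (auto intro!: derivative_eq_intros simp: power2_eq_square)
  have "(T - m) / 2 * (1 / P) * (m * (2 * (1 - T\<^sup>2)) / D\<^sup>2) + (1 - T\<^sup>2) * (1 / P) * (1 / D)
      = (1 - T\<^sup>2) * (((T - m) * m + D) / P) * (1 / D)\<^sup>2"
    using d p by (simp add: field_simps power2_eq_square)
  also have "(T - m) * m + D = P" by (simp add: T_def D_def P_def algebra_simps power2_eq_square)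
  finally have "(T - m) / 2 * (1 / P) * (m * (2 * (1 - T\<^sup>2)) / D\<^sup>2) + (1 - T\<^sup>2) * (1 / P) * (1 / D) = (1 - T\<^sup>2) * (1 / D)\<^sup>2"
    using p by simp
  then show ?thesis using has_vector_derivative_mult[OF 1 2] by (simp only: T_def P_def D_def)
qed

lemma g1_param_deriv:
  assumes "\<bar>m\<bar> < 1"
  shows "((\<lambda>m. g1 m y) has_real_derivative (1 - (th y)\<^sup>2) * (1 / (1 - m * th y))\<^sup>2) (at m)"
proof -
  define T where "T = th y"
  have d: "1 - m * T \<noteq> 0" using one_minus_mt_bound(2)[of m "\<bar>m\<bar>" y] assms by (simp add: T_def)
  have "((\<lambda>m. m * (1 - T\<^sup>2) * (1 / (1 - m * T))) has_real_derivative (1 - T\<^sup>2) * (1 / (1 - m * T))\<^sup>2) (at m)"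
    using d by (auto intro!: derivative_eq_intros simp: field_simps power2_eq_square)
  then show ?thesis by (simp only: T_def)
qed

definition Ee :: "real \<Rightarrow> real \<Rightarrow> complex" where
  "Ee b y = exp (\<i> * complex_of_real (- (b * y\<^sup>2 / 4)))"

lemma cmod_Ee: "cmod (Ee b y) = 1" unfolding Ee_def by (simp only: norm_exp_i_times)

lemma Ee_deriv:
  assumes "(f has_real_derivative f') (at s within S)"
  shows "((\<lambda>s. exp (\<i> * complex_of_real (f s))) has_vector_derivative \<i> * complex_of_real f' * exp (\<i> * complex_of_real (f s))) (at s within S)"
proof -
  have 1: "((\<lambda>s. \<i> * complex_of_real (f s)) has_vector_derivative \<i> * complex_of_real f') (at s within S)"
    by (intro has_vector_derivative_mult_right has_vector_derivative_of_real) (use assms in simp)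
  from field_vector_diff_chain_within[OF this, of exp "exp (\<i> * complex_of_real (f s))"]
  show ?thesis by (simp add: comp_def has_field_derivative_at_within)
qed

lemma Ee_hderiv: "hderiv (Ee b) (- \<i> * complex_of_real (b * y / 2) * Ee b y) y"
proof -
  have "((\<lambda>y. - (b * y\<^sup>2 / 4)) has_real_derivative - (b * y / 2)) (at y within {0..})"
    by (auto intro!: derivative_eq_intros)
  from Ee_deriv[OF this] show ?thesis unfolding Ee_def[abs_def] by simp
qed

lemma Ee_chain:
  assumes "(b has_real_derivative b') (at s within J)"
  shows "((\<lambda>s. Ee (b s) y) has_vector_derivative - \<i> * complex_of_real (y\<^sup>2 / 4) * Ee (b s) y * complex_of_real b') (at s within J)"
proof -
  have "((\<lambda>s. - (b s * y\<^sup>2 / 4)) has_real_derivative - (b' * y\<^sup>2 / 4)) (at s within J)"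
    using assms by (auto intro!: derivative_eq_intros)
  from Ee_deriv[OF this] show ?thesis unfolding Ee_def by (simp add: mult_ac)
qed

text \<open>The phase has modulus 1, but each derivative brings a factor b y; tempered growth is the
  class that accommodates this.\<close>

lemma sm_Ee:
  fixes b :: "'p \<Rightarrow> real"
  assumes "\<And>p. p \<in> K \<Longrightarrow> \<bar>b p\<bar> \<le> M"
  shows "sm False K n (\<lambda>p. Ee (b p))"
proof (induction n)
  case 0
  show ?case unfolding sm.simps by (rule growth_bounded[where M=1]) (simp add: cmod_Ee)
next
  case (Suc n)
  have "sm False K n (\<lambda>p y. - \<i> * complex_of_real (b p / 2) * complex_of_real y * Ee (b p) y)"
    by (intro sm_mult_decay(3) Suc sm_of_real sm_y sm_const[where M="M/2"] sm_const[where M=1]) (use assms in auto)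
  then have "sm False K n (\<lambda>p y. - \<i> * complex_of_real (b p * y / 2) * Ee (b p) y)" by (rule sm_cong) simp
  then show ?case by (rule sm_SucI[OF sm_growth[OF Suc] Ee_hderiv])
qed

context prof begin

section \<open>Mixed derivatives and the profile with its quadratic phase\<close>

definition PPyb :: "real \<Rightarrow> real \<Rightarrow> real \<Rightarrow> complex" where
  "PPyb b l y = complex_of_real (Gg (\<sigma> * l) y) * (\<i> * Sx \<kappa> (\<lambda>j k. hD (c j k)) b l y + complex_of_real (g1 (\<sigma> * l) y) * (\<i> * Sx \<kappa> c b l y))"

abbreviation g1m :: "real \<Rightarrow> real \<Rightarrow> real" where
  "g1m m y \<equiv> (1 - (th y)\<^sup>2) * (1 / (1 - m * th y))\<^sup>2"

definition PPyl :: "real \<Rightarrow> real \<Rightarrow> real \<Rightarrow> complex" where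
  "PPyl b l y = complex_of_real (Gg (\<sigma> * l) y) * (Sl \<kappa> (\<lambda>j k. hD (c j k)) b l y + complex_of_real (\<sigma> * g0 (\<sigma> * l) y) * V1 b l y
     + complex_of_real (g1 (\<sigma> * l) y) * (Sl \<kappa> c b l y + complex_of_real (\<sigma> * g0 (\<sigma> * l) y) * V b l y)
     + complex_of_real (\<sigma> * g1m (\<sigma> * l) y) * V b l y)"

lemma Sx_hderiv:
  assumes "y \<ge> 0"
  shows "hderiv (Sx \<kappa> c b l) (Sx \<kappa> (\<lambda>j k. hD (c j k)) b l y) y"
  unfolding Sx_def[abs_def] case_prod_beta
  by (intro has_vector_derivative_sum has_vector_derivative_mult_right hderiv_of_real smi_hderiv[OF sc(1) assms])

lemma Sl_hderiv:
  assumes "y \<ge> 0"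
  shows "hderiv (Sl \<kappa> c b l) (Sl \<kappa> (\<lambda>j k. hD (c j k)) b l y) y"
  unfolding Sl_def[abs_def] case_prod_beta
  by (intro has_vector_derivative_sum has_vector_derivative_mult_right hderiv_of_real smi_hderiv[OF sc(1) assms])

lemma PPb_hderiv:
  assumes "\<bar>\<sigma> * l\<bar> < 1" "y \<ge> 0"
  shows "hderiv (PPb b l) (PPyb b l y) y"
proof -
  note h = has_vector_derivative_mult[OF hderiv_of_real[OF hderiv_Gg[OF assms(1), of y]]
    has_vector_derivative_mult_right[OF Sx_hderiv[OF assms(2), of b l], of \<i>]]
  have "complex_of_real G * (\<i> * X1) + complex_of_real (G * g) * (\<i> * X) = complex_of_real G * (\<i> * X1 + complex_of_real g * (\<i> * X))" for G g X X1
    by (simp add: algebra_simps)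
  then show ?thesis using h unfolding PPb_def[abs_def] PPyb_def by (simp only:)
qed

lemma PPl_hderiv:
  assumes "\<bar>\<sigma> * l\<bar> < 1" "y \<ge> 0"
  shows "hderiv (PPl b l) (PPyl b l y) y"
proof -
  have "hderiv (\<lambda>y. \<sigma> * g0 (\<sigma> * l) y) (\<sigma> * g1m (\<sigma> * l) y) y"
    by (rule has_vector_derivative_mult_right[OF hderiv_g0[OF assms(1)]])
  note h = has_vector_derivative_mult[OF hderiv_of_real[OF hderiv_Gg[OF assms(1), of y]]
    has_vector_derivative_add[OF Sl_hderiv[OF assms(2), of b l]
      has_vector_derivative_mult[OF hderiv_of_real[OF this] V_hderiv[OF assms(2), of b l]]]]
  have "complex_of_real G * (S1 + (complex_of_real z * v1 + complex_of_real z1 * v)) + complex_of_real (G * g) * (S + complex_of_real z * v)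
     = complex_of_real G * (S1 + complex_of_real z * v1 + complex_of_real g * (S + complex_of_real z * v) + complex_of_real z1 * v)" for G g S S1 z z1 v v1
    by (simp add: algebra_simps)
  then show ?thesis using h unfolding PPl_def[abs_def] PPyl_def by (simp only:)
qed

lemma PPy_chain:
  assumes b: "(b has_real_derivative b') (at s within J)" and l: "(l has_real_derivative l') (at s within J)"
    and m: "\<bar>\<sigma> * l s\<bar> < 1"
  shows "((\<lambda>s. PPy (b s) (l s) y) has_vector_derivative PPyb (b s) (l s) y * complex_of_real b' + PPyl (b s) (l s) y * complex_of_real l') (at s within J)"
proof -
  have sl: "((\<lambda>s. \<sigma> * l s) has_real_derivative \<sigma> * l') (at s within J)" by (rule DERIV_cmult[OF l])
  have G: "((\<lambda>s. complex_of_real (Gg (\<sigma> * l s) y)) has_vector_derivative complex_of_real (Gg (\<sigma> * l s) y * g0 (\<sigma> * l s) y * (\<sigma> * l'))) (at s within J)"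
    by (intro has_vector_derivative_of_real) (use DERIV_chain2[OF Gg_param_deriv[OF m, of y] sl] in simp)
  have g: "((\<lambda>s. complex_of_real (g1 (\<sigma> * l s) y)) has_vector_derivative complex_of_real (g1m (\<sigma> * l s) y * (\<sigma> * l'))) (at s within J)"
    by (intro has_vector_derivative_of_real) (use DERIV_chain2[OF g1_param_deriv[OF m, of y] sl] in simp)
  have Vc: "((\<lambda>s. V (b s) (l s) y) has_vector_derivative 0 + (\<i> * Sx \<kappa> c (b s) (l s) y * complex_of_real b' + Sl \<kappa> c (b s) (l s) y * complex_of_real l')) (at s within J)"
    unfolding Vf_def[abs_def] by (intro has_vector_derivative_add has_vector_derivative_const Sg_chain[OF b l])
  have V1c: "((\<lambda>s. V1 (b s) (l s) y) has_vector_derivative 0 + (\<i> * Sx \<kappa> (\<lambda>j k. hD (c j k)) (b s) (l s) y * complex_of_real b' + Sl \<kappa> (\<lambda>j k. hD (c j k)) (b s) (l s) y * complex_of_real l')) (at s within J)"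
    unfolding Vy_def[abs_def] by (intro has_vector_derivative_add has_vector_derivative_const Sg_chain[OF b l])
  note h = has_vector_derivative_mult[OF G has_vector_derivative_add[OF V1c has_vector_derivative_mult[OF g Vc]]]
  have "complex_of_real G * (0 + (\<i> * X1 * complex_of_real b' + S1 * complex_of_real l') + (complex_of_real g * (0 + (\<i> * X * complex_of_real b' + S * complex_of_real l')) + complex_of_real (k * (sg * l')) * v))
      + complex_of_real (G * z * (sg * l')) * (v1 + complex_of_real g * v)
     = complex_of_real G * (\<i> * X1 + complex_of_real g * (\<i> * X)) * complex_of_real b'
      + complex_of_real G * (S1 + complex_of_real (sg * z) * v1 + complex_of_real g * (S + complex_of_real (sg * z) * v) + complex_of_real (sg * k) * v) * complex_of_real l'"
    for G g z k X X1 S S1 v v1 sg by (simp add: algebra_simps)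
  then show ?thesis using h unfolding PPy_def[abs_def] PPyb_def PPyl_def by (simp only:)
qed

text \<open>This is \<open>profile_tilde\<close> up to scaling and a constant phase. The suffixes y,
  b, l mark closed forms of partial derivatives, confirmed by the lemmas that follow.\<close>

definition w :: "real \<Rightarrow> real \<Rightarrow> real \<Rightarrow> complex" where "w b l y = Ee b y * PP b l y"
definition wy :: "real \<Rightarrow> real \<Rightarrow> real \<Rightarrow> complex" where
  "wy b l y = Ee b y * (PPy b l y - \<i> * complex_of_real (b * y / 2) * PP b l y)"
definition wyy :: "real \<Rightarrow> real \<Rightarrow> real \<Rightarrow> complex" where
  "wyy b l y = Ee b y * (PPyy b l y - \<i> * complex_of_real (b * y) * PPy b l y - \<i> * complex_of_real (b / 2) * PP b l y - complex_of_real (b * y / 2)^2 * PP b l y)"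
definition wb :: "real \<Rightarrow> real \<Rightarrow> real \<Rightarrow> complex" where
  "wb b l y = Ee b y * (PPb b l y - \<i> * complex_of_real (y\<^sup>2 / 4) * PP b l y)"
definition wl :: "real \<Rightarrow> real \<Rightarrow> real \<Rightarrow> complex" where "wl b l y = Ee b y * PPl b l y"
definition wyb :: "real \<Rightarrow> real \<Rightarrow> real \<Rightarrow> complex" where
  "wyb b l y = Ee b y * (PPyb b l y - \<i> * complex_of_real (y / 2) * PP b l y - \<i> * complex_of_real (b * y / 2) * PPb b l y
     - \<i> * complex_of_real (y\<^sup>2 / 4) * (PPy b l y - \<i> * complex_of_real (b * y / 2) * PP b l y))"
definition wyl :: "real \<Rightarrow> real \<Rightarrow> real \<Rightarrow> complex" where
  "wyl b l y = Ee b y * (PPyl b l y - \<i> * complex_of_real (b * y / 2) * PPl b l y)"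

lemma hderiv_lin: "hderiv (\<lambda>y. complex_of_real (k * y / 2)) (complex_of_real (k / 2)) y"
  by (rule hderiv_of_real) (auto simp flip: has_real_derivative_iff_has_vector_derivative intro!: derivative_eq_intros)

lemma hderiv_quad: "hderiv (\<lambda>y. complex_of_real (y\<^sup>2 / 4)) (complex_of_real (y / 2)) y"
  by (rule hderiv_of_real) (auto simp flip: has_real_derivative_iff_has_vector_derivative intro!: derivative_eq_intros)

lemma w_hderiv: assumes "\<bar>\<sigma> * l\<bar> < 1" "y \<ge> 0" shows "hderiv (w b l) (wy b l y) y"
  using has_vector_derivative_mult[OF Ee_hderiv[of b y] PP_hderiv[OF assms, of b]]
  unfolding w_def[abs_def] wy_def by (simp add: algebra_simps)

lemma wy_hderiv: assumes "\<bar>\<sigma> * l\<bar> < 1" "y \<ge> 0" shows "hderiv (wy b l) (wyy b l y) y"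
proof -
  note h = has_vector_derivative_mult[OF Ee_hderiv[of b y] has_vector_derivative_diff[OF PPy_hderiv[OF assms, of b]
     has_vector_derivative_mult[OF has_vector_derivative_mult_right[OF hderiv_lin[of b y], of \<i>] PP_hderiv[OF assms, of b]]]]
  have "E * (P2 - (\<i> * complex_of_real (b * y / 2) * P1 + \<i> * complex_of_real (b / 2) * P)) + - \<i> * complex_of_real (b * y / 2) * E * (P1 - \<i> * complex_of_real (b * y / 2) * P)
    = E * (P2 - \<i> * complex_of_real (b * y) * P1 - \<i> * complex_of_real (b / 2) * P - complex_of_real (b * y / 2)^2 * P)" for E P P1 P2
    by (simp add: algebra_simps power2_eq_square)
  then show ?thesis using h unfolding wy_def[abs_def] wyy_def by (simp only:)
qed

lemma wb_hderiv: assumes "\<bar>\<sigma> * l\<bar> < 1" "y \<ge> 0" shows "hderiv (wb b l) (wyb b l y) y"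
proof -
  note h = has_vector_derivative_mult[OF Ee_hderiv[of b y] has_vector_derivative_diff[OF PPb_hderiv[OF assms, of b]
     has_vector_derivative_mult[OF has_vector_derivative_mult_right[OF hderiv_quad[of y], of \<i>] PP_hderiv[OF assms, of b]]]]
  have "E * (Pyb - (\<i> * complex_of_real (y\<^sup>2 / 4) * P1 + \<i> * complex_of_real (y / 2) * P)) + - \<i> * complex_of_real (b * y / 2) * E * (Pb - \<i> * complex_of_real (y\<^sup>2 / 4) * P)
    = E * (Pyb - \<i> * complex_of_real (y / 2) * P - \<i> * complex_of_real (b * y / 2) * Pb
     - \<i> * complex_of_real (y\<^sup>2 / 4) * (P1 - \<i> * complex_of_real (b * y / 2) * P))" for E P P1 Pb Pyb
    by (simp add: algebra_simps power2_eq_square)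
  then show ?thesis using h unfolding wb_def[abs_def] wyb_def by (simp only:)
qed

lemma wl_hderiv: assumes "\<bar>\<sigma> * l\<bar> < 1" "y \<ge> 0" shows "hderiv (wl b l) (wyl b l y) y"
  using has_vector_derivative_mult[OF Ee_hderiv[of b y] PPl_hderiv[OF assms, of b]]
  unfolding wl_def[abs_def] wyl_def by (simp add: algebra_simps)

lemma w_chain:
  assumes b: "(b has_real_derivative b') (at s within J)" and l: "(l has_real_derivative l') (at s within J)"
    and m: "\<bar>\<sigma> * l s\<bar> < 1"
  shows "((\<lambda>s. w (b s) (l s) y) has_vector_derivative wb (b s) (l s) y * complex_of_real b' + wl (b s) (l s) y * complex_of_real l') (at s within J)"
  using has_vector_derivative_mult[OF Ee_chain[OF b, of y] PP_chain[OF b l m, of y]]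
  unfolding w_def wb_def wl_def by (simp add: algebra_simps)

lemma wy_chain:
  assumes b: "(b has_real_derivative b') (at s within J)" and l: "(l has_real_derivative l') (at s within J)"
    and m: "\<bar>\<sigma> * l s\<bar> < 1"
  shows "((\<lambda>s. wy (b s) (l s) y) has_vector_derivative wyb (b s) (l s) y * complex_of_real b' + wyl (b s) (l s) y * complex_of_real l') (at s within J)"
proof -
  have lin: "((\<lambda>s. complex_of_real (b s * y / 2)) has_vector_derivative complex_of_real (b' * y / 2)) (at s within J)"
    by (intro has_vector_derivative_of_real) (use b in \<open>auto intro!: derivative_eq_intros\<close>)
  note h = has_vector_derivative_mult[OF Ee_chain[OF b, of y] has_vector_derivative_diff[OF PPy_chain[OF b l m, of y]
     has_vector_derivative_mult[OF has_vector_derivative_mult_right[OF lin, of \<i>] PP_chain[OF b l m, of y]]]]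
  have "E * (Pyb * complex_of_real b' + Pyl * complex_of_real l' - (\<i> * complex_of_real (bb * y / 2) * (Pb * complex_of_real b' + Pl * complex_of_real l') + \<i> * complex_of_real (b' * y / 2) * P))
     + - \<i> * complex_of_real (y\<^sup>2 / 4) * E * complex_of_real b' * (P1 - \<i> * complex_of_real (bb * y / 2) * P)
    = E * (Pyb - \<i> * complex_of_real (y / 2) * P - \<i> * complex_of_real (bb * y / 2) * Pb
     - \<i> * complex_of_real (y\<^sup>2 / 4) * (P1 - \<i> * complex_of_real (bb * y / 2) * P)) * complex_of_real b'
     + E * (Pyl - \<i> * complex_of_real (bb * y / 2) * Pl) * complex_of_real l'" for E P P1 Pb Pl Pyb Pyl bb
    by (simp add: field_simps)
  then show ?thesis using h unfolding wy_def wyb_def wyl_def by (simp only:)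
qed

text \<open>The equation satisfied by \<open>w\<close>, which has no explicit quadratic potential.\<close>

lemma w_equation:
  "\<i> * (wb b l y * (- (complex_of_real b)\<^sup>2 + Af \<kappa> a b l y) + wl b l y * complex_of_real (- (b * l))
      + complex_of_real b * (w b l y / 2 + complex_of_real y * wy b l y))
   + (wyy b l y + complex_of_real (cmod (w b l y) ^ 4) * w b l y) - w b l y = Ee b y * Psi0 b l y"
proof -
  have n: "cmod (w b l y) = cmod (PP b l y)" by (simp add: w_def norm_mult cmod_Ee)
  define E P where "E = Ee b y" and "P = PP b l y"
  have "\<i> * (E * (Pb - \<i> * complex_of_real (y\<^sup>2 / 4) * P) * (- (complex_of_real b)\<^sup>2 + A) + E * Pl * complex_of_real (- (b * l))
      + complex_of_real b * (E * P / 2 + complex_of_real y * (E * (P1 - \<i> * complex_of_real (b * y / 2) * P))))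
   + (E * (P2 - \<i> * complex_of_real (b * y) * P1 - \<i> * complex_of_real (b / 2) * P - complex_of_real (b * y / 2)^2 * P) + n4 * (E * P)) - E * P
   = E * (\<i> * (Pb * (- (complex_of_real b)\<^sup>2 + A) + Pl * complex_of_real (- (b * l))) + P2 - P + n4 * P + A * complex_of_real (y\<^sup>2 / 4) * P)" for Pb Pl P1 P2 A n4
    by (simp add: field_simps power2_eq_square)
  then show ?thesis unfolding n unfolding w_def wy_def wyy_def wb_def wl_def Psi0_def E_def[symmetric] P_def[symmetric] .
qed

end

lemma sm_Re_cnj:
  assumes "sm True K n F" "sm True K n G"
  shows "sm True K n (\<lambda>p y. Re (cnj (F p y) * G p y))"
  by (intro sm_linear[OF bounded_linear_Re] sm_mult_decay(5) sm_linear[OF bounded_linear_cnj] assms)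

lemma sm_cmod_sq:
  assumes "sm True K n F"
  shows "sm True K n (\<lambda>p y. (cmod (F p y))\<^sup>2)"
proof (rule sm_cong[OF sm_Re_cnj[OF assms assms]])
  fix p y show "Re (cnj (F p y) * F p y) = (cmod (F p y))\<^sup>2"
    unfolding cmod_power2 by (simp add: power2_eq_square)
qed

lemma cmod_powers: "cmod z ^ 4 = ((cmod z)\<^sup>2)\<^sup>2" "cmod z ^ 6 = ((cmod z)\<^sup>2) ^ 3"
  by (simp_all add: power_mult[symmetric])

lemma hint_bounded_on:
  fixes F :: "'p \<Rightarrow> real \<Rightarrow> real"
  assumes "sm True K (Suc 0) F"
  obtains C where "\<And>p. p \<in> K \<Longrightarrow> \<bar>hint (F p)\<bar> \<le> C"
proof -
  have "decays K F" using sm_growth[OF assms] by (simp add: growth_def)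
  then obtain C \<rho> where C: "C > 0" "\<rho> > 0"
    and b: "\<And>p y. p \<in> K \<Longrightarrow> y \<ge> 0 \<Longrightarrow> norm (F p y) \<le> C * exp (- (\<rho> * y))"
    using decaysE[of K F] by metis
  show thesis
  proof (rule that[of "C / \<rho>"])
    fix p assume p: "p \<in> K"
    show "\<bar>hint (F p)\<bar> \<le> C / \<rho>"
      using hint_bound[OF sm_continuous[OF assms p] C(2), of C] b[OF p] by simp
  qed
qed

lemma at_zero_bounded:
  assumes "sm True K n F"
  obtains C where "\<And>p. p \<in> K \<Longrightarrow> norm (F p 0) \<le> C"
proof -
  have "decays K F" using sm_growth[OF assms] by (simp add: growth_def)
  then obtain C \<rho> where "C > 0" "\<rho> > 0"
    and b: "\<And>p y. p \<in> K \<Longrightarrow> y \<ge> 0 \<Longrightarrow> norm (F p y) \<le> C * exp (- (\<rho> * y))"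
    using decaysE[of K F] by metis
  then show thesis using that[of C] b[of _ 0] by simp
qed

lemma hderiv_Re_cnj:
  assumes "hderiv F F' y" "hderiv G G' y"
  shows "hderiv (\<lambda>y. Re (cnj (F y) * G y)) (Re (cnj F' * G y + cnj (F y) * G')) y"
proof -
  have "hderiv (\<lambda>y. cnj (F y)) (cnj F') y" by (rule bounded_linear.has_vector_derivative[OF bounded_linear_cnj assms(1)])
  from bounded_linear.has_vector_derivative[OF bounded_linear_Re has_vector_derivative_mult[OF this assms(2)]]
  show ?thesis by (simp add: add.commute)
qed

text \<open>The conservation law behind the energy estimate: the left-hand side is the variation of the
  energy density, the bracket on the right is an exact derivative.\<close>

lemma energy_density_identity:
  fixes W W1 W2 e e1 S :: complex and b y n2 n3 :: real
  assumes n3: "n3 = n2 * (cmod W)\<^sup>2"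
    and S: "\<i> * (e + complex_of_real b * (W / 2 + complex_of_real y * W1)) + (W2 + complex_of_real n2 * W) - W = S"
  shows "Re (cnj W1 * e1) - n2 * Re (cnj W * e) + b * ((cmod W1)\<^sup>2 - n3 / 3)
    = (Re (cnj W2 * e + cnj W1 * e1)
       + b * (Re (cnj W2 * W + cnj W1 * W1) / 2 + (cmod W1)\<^sup>2 / 2 + y * Re (cnj W1 * W2) + n3 / 6 + y * (n2 * Re (cnj W * W1)))
       + Re (\<i> * (cnj W2 * W + cnj W1 * W1)))
      + Re (\<i> * (cnj (W2 + complex_of_real n2 * W) * S))"
proof -
  define Z where "Z = W2 + complex_of_real n2 * W"
  define T where "T = W / 2 + complex_of_real y * W1"
  have 1: "Re (\<i> * (cnj Z * (\<i> * A + Z - W))) = - Re (cnj Z * A) - Re (\<i> * (cnj Z * W))" for A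
    by (simp add: algebra_simps)
  have 2: "Re (cnj Z * (e + complex_of_real b * T)) = Re (cnj W2 * e) + n2 * Re (cnj W * e)
     + b * (Re (cnj W2 * W) / 2 + y * Re (cnj W1 * W2) + n2 * (cmod W)\<^sup>2 / 2 + n2 * (y * Re (cnj W * W1)))"
    unfolding Z_def T_def cmod_power2 by (simp add: field_simps power2_eq_square)
  have 3: "Re (\<i> * (cnj Z * W)) = Re (\<i> * (cnj W2 * W))"
    unfolding Z_def by (simp add: algebra_simps)
  have 4: "Re (\<i> * (cnj W2 * W + cnj W1 * W1)) = Re (\<i> * (cnj W2 * W))"
    by (simp add: algebra_simps)
  have 5: "Re (cnj W2 * W + cnj W1 * W1) = Re (cnj W2 * W) + (cmod W1)\<^sup>2"
    unfolding cmod_power2 by (simp add: power2_eq_square)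
  have 6: "Re (cnj W2 * e + cnj W1 * e1) = Re (cnj W2 * e) + Re (cnj W1 * e1)" by simp
  show ?thesis
    unfolding S[symmetric] Z_def[symmetric] T_def[symmetric] 1 2 3 4 5 6 n3
    by (simp only: algebra_simps add_divide_distrib diff_divide_distrib)
qed

lemma deriv_combination:
  assumes "(n1 has_real_derivative d1) (at s within S)" "(n2 has_real_derivative d2) (at s within S)"
  shows "((\<lambda>s. n1 s / 2 - n2 s ^ 3 / 6) has_real_derivative d1 / 2 - (n2 s)\<^sup>2 * d2 / 2) (at s within S)"
  using assms by (auto intro!: derivative_eq_intros)

lemma deriv_combination2:
  assumes "(h has_real_derivative d) (at s within S)" "(l has_real_derivative l') (at s within S)" "(p has_real_derivative p') (at s within S)"
  shows "((\<lambda>s. A * h s + g * l s / 2 * p s) has_real_derivative A * d + g / 2 * (l' * p s + l s * p')) (at s within S)"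
  using assms by (auto intro!: derivative_eq_intros simp: algebra_simps)

lemma deriv_combination3:
  assumes "(r1 has_real_derivative d1) (at y within S)" "(r2 has_real_derivative d2) (at y within S)" "(r3 has_real_derivative d3) (at y within S)"
    "(n1 has_real_derivative e1) (at y within S)" "(n has_real_derivative e) (at y within S)"
  shows "((\<lambda>y. r1 y + b * (r2 y / 2 + y * n1 y / 2 + y * n y ^ 3 / 6) + r3 y) has_real_derivative
     d1 + b * (d2 / 2 + (n1 y + y * e1) / 2 + (n y ^ 3 / 6 + y * ((n y)\<^sup>2 * e) / 2)) + d3) (at y within S)"
  using assms by (auto intro!: derivative_eq_intros simp: field_simps)

context prof begin

text \<open>The energy density on one edge, written through squared moduli, which are smooth also
  where w vanishes.\<close>

definition eps :: "real \<Rightarrow> real \<Rightarrow> real \<Rightarrow> real" where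
  "eps b l y = (cmod (wy b l y))\<^sup>2 / 2 - ((cmod (w b l y))\<^sup>2) ^ 3 / 6"

definition epsb :: "real \<Rightarrow> real \<Rightarrow> real \<Rightarrow> real" where
  "epsb b l y = Re (cnj (wy b l y) * wyb b l y) - ((cmod (w b l y))\<^sup>2)\<^sup>2 * Re (cnj (w b l y) * wb b l y)"

definition epsl :: "real \<Rightarrow> real \<Rightarrow> real \<Rightarrow> real" where
  "epsl b l y = Re (cnj (wy b l y) * wyl b l y) - ((cmod (w b l y))\<^sup>2)\<^sup>2 * Re (cnj (w b l y) * wl b l y)"

text \<open>The energy of the rescaled profile is \<open>EE b l / l\<^sup>2\<close>.\<close>

definition EE :: "real \<Rightarrow> real \<Rightarrow> real" where
  "EE b l = real N * hint (eps b l) + \<gamma> * l / 2 * (cmod (PP b l 0))\<^sup>2"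

definition EEb :: "real \<Rightarrow> real \<Rightarrow> real" where
  "EEb b l = real N * hint (epsb b l) + \<gamma> * l * Re (cnj (PP b l 0) * PPb b l 0)"

definition EEl :: "real \<Rightarrow> real \<Rightarrow> real" where
  "EEl b l = real N * hint (epsl b l) + \<gamma> / 2 * (cmod (PP b l 0))\<^sup>2 + \<gamma> * l * Re (cnj (PP b l 0) * PPl b l 0)"

context
  fixes q M :: real and K :: "(real \<times> real) set"
  assumes K: "kreg q M K"
begin

lemma smK_E: "sm False K n (\<lambda>p. Ee (fst p))"
  by (rule sm_Ee[where M=M]) (use kreg'[OF K] in auto)

lemma smK_lin: "sm False K n (\<lambda>p y. complex_of_real (fst p * y / 2))"
proof -
  have "sm False K n (\<lambda>p y. complex_of_real (fst p / 2) * complex_of_real y)"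
    by (intro sm_mult_decay(3) sm_of_real sm_y sm_const[where M="M/2"]) (use kreg'(4)[OF K] in auto)
  then show ?thesis by (rule sm_cong) simp
qed

lemma smK_half: "sm False K n (\<lambda>p y. complex_of_real (fst p / 2))"
  by (rule sm_const[where M="M/2"]) (use kreg'(4)[OF K] in auto)

lemma smK_y: "sm False K n (\<lambda>p y. complex_of_real (y / 2))" "sm False K n (\<lambda>p y. complex_of_real (y\<^sup>2 / 4))"
proof -
  have 1: "sm False K n (\<lambda>p y. complex_of_real (1/2) * complex_of_real y)"
    by (intro sm_mult_decay(3) sm_of_real sm_y sm_const[where M="1/2"]) auto
  then show "sm False K n (\<lambda>p y. complex_of_real (y / 2))" by (rule sm_cong) simp
  from sm_mult_decay(3)[OF 1 1] show "sm False K n (\<lambda>p y. complex_of_real (y\<^sup>2 / 4))"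
    by (rule sm_cong) (simp add: power2_eq_square)
qed

lemma smK_PPyb: "sm True K n (\<lambda>p. PPyb (fst p) (snd p))"
  unfolding PPyb_def[abs_def]
  by (intro sm_mult_decay(2)[OF smK_G[OF K]] sm_mult_decay(2)[OF smK_g1[OF K]] sm_mult_decay(2)[OF smK_i[OF K]] sm_add
      SPK[OF K L_Sx[OF sc(1)]] SPK[OF K L_Sx[OF smi_hD[OF sc(1)]]])

lemma smK_g1m: "sm False K n (\<lambda>p y. complex_of_real (\<sigma> * g1m (\<sigma> * snd p) y))"
  by (intro sm_of_real sm_mult_decay(3) sm_const[where M="\<bar>\<sigma>\<bar>"] sm_diff sm_power sm_th sm_const[where M=1]
      sm_recip[of K "\<lambda>p. \<sigma> * snd p" q]) (use kreg'[OF K] in auto)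

lemma smK_PPyl: "sm True K n (\<lambda>p. PPyl (fst p) (snd p))"
  unfolding PPyl_def[abs_def]
  by (intro sm_mult_decay(2)[OF smK_G[OF K]] sm_mult_decay(2)[OF smK_g1[OF K]] sm_mult_decay(2)[OF smK_g0[OF K]] sm_mult_decay(2)[OF smK_g1m] sm_add
      SPK[OF K L_Sl[OF sc(1)]] SPK[OF K L_Sl[OF smi_hD[OF sc(1)]]] SPK[OF K L_V] SPK[OF K L_V1])

lemmas smK_coeffs = sm_mult_decay(2)[OF smK_E] sm_mult_decay(2)[OF smK_i[OF K]] sm_mult_decay(2)[OF sm_mult_decay(3)[OF smK_i[OF K] smK_lin]]
  sm_mult_decay(2)[OF sm_mult_decay(3)[OF smK_i[OF K] smK_half]] sm_mult_decay(2)[OF sm_mult_decay(3)[OF smK_i[OF K] smK_y(1)]]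
  sm_mult_decay(2)[OF sm_mult_decay(3)[OF smK_i[OF K] smK_y(2)]] sm_mult_decay(2)[OF sm_power[OF smK_lin]]

lemma smK_w: "sm True K n (\<lambda>p. w (fst p) (snd p))"
  unfolding w_def[abs_def] by (intro smK_coeffs smK_PP[OF K])

lemma smK_wy: "sm True K n (\<lambda>p. wy (fst p) (snd p))"
  unfolding wy_def[abs_def] by (intro smK_coeffs sm_diff smK_PP[OF K] smK_PPy[OF K])

lemma smK_wyy: "sm True K n (\<lambda>p. wyy (fst p) (snd p))"
proof -
  have "sm False K n (\<lambda>p y. \<i> * (complex_of_real (fst p * y / 2) + complex_of_real (fst p * y / 2)))"
    by (intro sm_mult_decay(3) sm_add smK_i[OF K] smK_lin)
  then have 1: "sm False K n (\<lambda>p y. \<i> * complex_of_real (fst p * y))" by (rule sm_cong) simp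
  show ?thesis unfolding wyy_def[abs_def]
    by (intro smK_coeffs sm_mult_decay(2)[OF 1] sm_diff smK_PP[OF K] smK_PPy[OF K] smK_PPyy[OF K])
qed

lemma smK_wb: "sm True K n (\<lambda>p. wb (fst p) (snd p))"
  unfolding wb_def[abs_def] by (intro smK_coeffs sm_diff smK_PP[OF K] smK_PPb[OF K])

lemma smK_wl: "sm True K n (\<lambda>p. wl (fst p) (snd p))"
  unfolding wl_def[abs_def] by (intro smK_coeffs smK_PPl[OF K])

lemma smK_wyb: "sm True K n (\<lambda>p. wyb (fst p) (snd p))"
  unfolding wyb_def[abs_def] by (intro smK_coeffs sm_diff smK_PP[OF K] smK_PPy[OF K] smK_PPb[OF K] smK_PPyb)

lemma smK_wyl: "sm True K n (\<lambda>p. wyl (fst p) (snd p))"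
  unfolding wyl_def[abs_def] by (intro smK_coeffs sm_diff smK_PPl[OF K] smK_PPyl)

lemma smK_n: "sm True K n (\<lambda>p y. (cmod (w (fst p) (snd p) y))\<^sup>2)" "sm False K n (\<lambda>p y. (cmod (w (fst p) (snd p) y))\<^sup>2)"
  "sm False K n (\<lambda>p y. ((cmod (w (fst p) (snd p) y))\<^sup>2)\<^sup>2)"
  by (rule sm_cmod_sq[OF smK_w], rule sm_False[OF sm_cmod_sq[OF smK_w]], rule sm_power[OF sm_False[OF sm_cmod_sq[OF smK_w]]])

lemma smK_eps: "sm True K n (\<lambda>p. eps (fst p) (snd p))"
proof -
  have "sm True K n (\<lambda>p y. (1/2) * (cmod (wy (fst p) (snd p) y))\<^sup>2 - (1/6) * (((cmod (w (fst p) (snd p) y))\<^sup>2)\<^sup>2 * (cmod (w (fst p) (snd p) y))\<^sup>2))"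
    by (intro sm_diff sm_mult_decay(2)[of False, OF sm_const[where M=1]] sm_mult_decay(2)[OF smK_n(3)] smK_n(1) sm_cmod_sq[OF smK_wy]) auto
  then show ?thesis by (rule sm_cong) (simp add: eps_def eval_nat_numeral)
qed

lemma smK_epsb: "sm True K n (\<lambda>p. epsb (fst p) (snd p))"
  unfolding epsb_def[abs_def] by (intro sm_diff sm_mult_decay(2)[OF smK_n(3)] sm_Re_cnj smK_w smK_wy smK_wb smK_wyb)

lemma smK_epsl: "sm True K n (\<lambda>p. epsl (fst p) (snd p))"
  unfolding epsl_def[abs_def] by (intro sm_diff sm_mult_decay(2)[OF smK_n(3)] sm_Re_cnj smK_w smK_wy smK_wl smK_wyl)

lemma EE_bounded:
  obtains C where "\<And>p. p \<in> K \<Longrightarrow> \<bar>EE (fst p) (snd p)\<bar> \<le> C" "\<And>p. p \<in> K \<Longrightarrow> \<bar>EEb (fst p) (snd p)\<bar> \<le> C"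
    "\<And>p. p \<in> K \<Longrightarrow> \<bar>EEl (fst p) (snd p)\<bar> \<le> C" "C \<ge> 0"
proof -
  obtain C1 where C1: "\<And>p. p \<in> K \<Longrightarrow> \<bar>hint (eps (fst p) (snd p))\<bar> \<le> C1" by (rule hint_bounded_on[OF smK_eps]) blast
  obtain C2 where C2: "\<And>p. p \<in> K \<Longrightarrow> \<bar>hint (epsb (fst p) (snd p))\<bar> \<le> C2" by (rule hint_bounded_on[OF smK_epsb]) blast
  obtain C3 where C3: "\<And>p. p \<in> K \<Longrightarrow> \<bar>hint (epsl (fst p) (snd p))\<bar> \<le> C3" by (rule hint_bounded_on[OF smK_epsl]) blast
  obtain D1 where D1: "\<And>p. p \<in> K \<Longrightarrow> norm ((cmod (PP (fst p) (snd p) 0))\<^sup>2) \<le> D1" by (rule at_zero_bounded[OF sm_cmod_sq[OF smK_PP[OF K]]]) blast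
  obtain D2 where D2: "\<And>p. p \<in> K \<Longrightarrow> norm (Re (cnj (PP (fst p) (snd p) 0) * PPb (fst p) (snd p) 0)) \<le> D2"
    by (rule at_zero_bounded[OF sm_Re_cnj[OF smK_PP[OF K] smK_PPb[OF K]]]) blast
  obtain D3 where D3: "\<And>p. p \<in> K \<Longrightarrow> norm (Re (cnj (PP (fst p) (snd p) 0) * PPl (fst p) (snd p) 0)) \<le> D3"
    by (rule at_zero_bounded[OF sm_Re_cnj[OF smK_PP[OF K] smK_PPl[OF K]]]) blast
  define T where "T c = real N * \<bar>c\<bar>" for c :: real
  define U where "U c = \<bar>\<gamma>\<bar> * M * \<bar>c\<bar>" for c :: real
  define U' where "U' = \<bar>\<gamma>\<bar> * \<bar>D1\<bar>"
  let ?C = "T C1 + T C2 + T C3 + U D1 + U D2 + U D3 + U'"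
  have M: "M \<ge> 0" using K by (simp add: kreg_def)
  have n: "\<bar>real N * x\<bar> \<le> T c" if "\<bar>x\<bar> \<le> c" for x c
    unfolding T_def abs_mult using that by (intro mult_mono) auto
  have g: "\<bar>\<gamma> * snd p * x\<bar> \<le> U c" if "\<bar>x\<bar> \<le> c" "p \<in> K" for x c p
    unfolding U_def abs_mult using that kreg'(5)[OF K, of p] M by (intro mult_mono) auto
  have nn: "T c \<ge> 0" "U c \<ge> 0" "U' \<ge> 0" for c using M by (auto simp: T_def U_def U'_def)
  have tri: "\<bar>x + z\<bar> \<le> r + t" if "\<bar>x\<bar> \<le> r" "\<bar>z\<bar> \<le> t" for x z r t :: real
    using that by linarith
  show thesis
  proof (rule that[of ?C])
    fix p assume p: "p \<in> K"
    note d = D1[OF p, unfolded real_norm_def] D2[OF p, unfolded real_norm_def] D3[OF p, unfolded real_norm_def]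
    have "\<bar>\<gamma> * snd p * (cmod (PP (fst p) (snd p) 0))\<^sup>2 / 2\<bar> \<le> U D1"
      using g[OF d(1) p] nn(2)[of D1] by linarith
    from tri[OF n[OF C1[OF p]] this] have "\<bar>EE (fst p) (snd p)\<bar> \<le> T C1 + U D1" by (simp add: EE_def)
    then show "\<bar>EE (fst p) (snd p)\<bar> \<le> ?C"
      using nn(1)[of C2] nn(1)[of C3] nn(2)[of D2] nn(2)[of D3] nn(3) by linarith
    from tri[OF n[OF C2[OF p]] g[OF d(2) p]] have "\<bar>EEb (fst p) (snd p)\<bar> \<le> T C2 + U D2" by (simp add: EEb_def)
    then show "\<bar>EEb (fst p) (snd p)\<bar> \<le> ?C"
      using nn(1)[of C1] nn(1)[of C3] nn(2)[of D1] nn(2)[of D3] nn(3) by linarith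
    have "\<bar>\<gamma> * (cmod (PP (fst p) (snd p) 0))\<^sup>2\<bar> \<le> U'"
      unfolding U'_def abs_mult using d(1) by (intro mult_mono) auto
    then have "\<bar>\<gamma> / 2 * (cmod (PP (fst p) (snd p) 0))\<^sup>2\<bar> \<le> U'" using nn(3) by linarith
    from tri[OF tri[OF n[OF C3[OF p]] this] g[OF d(3) p]] have "\<bar>EEl (fst p) (snd p)\<bar> \<le> T C3 + U' + U D3" by (simp add: EEl_def)
    then show "\<bar>EEl (fst p) (snd p)\<bar> \<le> ?C"
      using nn(1)[of C1] nn(1)[of C2] nn(2)[of D1] nn(2)[of D2] by linarith
  qed (use nn in \<open>simp add: add_nonneg_nonneg\<close>)
qed

end

lemma eps_chain:
  assumes b: "(b has_real_derivative b') (at s within J)" and l: "(l has_real_derivative l') (at s within J)"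
    and m: "\<bar>\<sigma> * l s\<bar> < 1"
  shows "((\<lambda>s. eps (b s) (l s) y) has_real_derivative epsb (b s) (l s) y * b' + epsl (b s) (l s) y * l') (at s within J)"
proof -
  note h1 = cmod_sq_deriv[OF wy_chain[OF b l m, of y]] and h2 = cmod_sq_deriv[OF w_chain[OF b l m, of y]]
  from deriv_combination[OF h1 h2] show ?thesis unfolding eps_def
    by (rule back_subst[where P="\<lambda>v. (_ has_real_derivative v) (at s within J)"]) (simp add: epsb_def epsl_def field_simps)
qed

text \<open>The velocities are free functions here because the lemma also serves the curve b = 0,
  \<lambda> = s that starts at \<lambda> = 0, which \<open>modulation\<close> excludes.\<close>

lemma EE_chain_general:
  assumes J: "is_interval J" and cb: "continuous_on J b'" "continuous_on J lam'"
    and p: "\<And>s. s \<in> J \<Longrightarrow> (b has_real_derivative b' s) (at s within J)" "\<And>s. s \<in> J \<Longrightarrow> (lam has_real_derivative lam' s) (at s within J)"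
      "\<And>s. s \<in> J \<Longrightarrow> \<bar>\<sigma> * lam s\<bar> < 1"
    and kr: "kreg q M K" and inK: "\<And>s. s \<in> J \<Longrightarrow> (b s, lam s) \<in> K" and s0: "s0 \<in> J"
  shows "((\<lambda>s. EE (b s) (lam s)) has_real_derivative
     EEb (b s0) (lam s0) * b' s0 + EEl (b s0) (lam s0) * lam' s0) (at s0 within J)"
proof -
  obtain d1 where d1: "d1 > 0" "\<And>s. s \<in> J \<Longrightarrow> dist s s0 < d1 \<Longrightarrow> dist (b' s) (b' s0) < 1"
    using cb(1) s0 unfolding continuous_on_iff by (meson zero_less_one)
  obtain d2 where d2: "d2 > 0" "\<And>s. s \<in> J \<Longrightarrow> dist s s0 < d2 \<Longrightarrow> dist (lam' s) (lam' s0) < 1"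
    using cb(2) s0 unfolding continuous_on_iff by (meson zero_less_one)
  \<comment> \<open>The velocities may be unbounded on J, but by continuity they are bounded near
    \<open>s0\<close>, as differentiation under the integral requires.\<close>
  define B where "B = \<bar>b' s0\<bar> + \<bar>lam' s0\<bar> + 1"
  have B: "\<bar>b' s\<bar> \<le> B" "\<bar>lam' s\<bar> \<le> B" if "s \<in> J" "\<bar>s - s0\<bar> < min d1 d2" for s
    using d1(2)[OF that(1)] d2(2)[OF that(1)] that(2) by (auto simp: B_def dist_real_def)
  define K2 where "K2 = {z :: (real \<times> real) \<times> (real \<times> real). fst z \<in> K \<and> \<bar>fst (snd z)\<bar> \<le> B \<and> \<bar>snd (snd z)\<bar> \<le> B}"
  define F where "F z y = epsb (fst (fst z)) (snd (fst z)) y * fst (snd z) + epsl (fst (fst z)) (snd (fst z)) y * snd (snd z)" for z :: "(real \<times> real) \<times> (real \<times> real)" and y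
  have in1: "fst z \<in> K" if "z \<in> K2" for z using that by (simp add: K2_def)
  have F: "sm True K2 n F" for n
  proof -
    have 1: "sm True K2 n (\<lambda>z. epsb (fst (fst z)) (snd (fst z)))" using sm_reindex[where h=fst and L=K2, OF in1 smK_epsb[OF kr]] by simp
    have 2: "sm True K2 n (\<lambda>z. epsl (fst (fst z)) (snd (fst z)))" using sm_reindex[where h=fst and L=K2, OF in1 smK_epsl[OF kr]] by simp
    have "sm False K2 n (\<lambda>z y. fst (snd z))" "sm False K2 n (\<lambda>z y. snd (snd z))"
      by (rule sm_const[where M=B], simp add: K2_def)+
    then show ?thesis unfolding F_def[abs_def] by (intro sm_add sm_mult_decay(1)[OF 1] sm_mult_decay(1)[OF 2])
  qed
  have "decays K2 F" using sm_growth[OF F] by (simp add: growth_def)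
  then obtain C \<rho> where C: "\<rho> > 0" and Fb: "\<And>z y. z \<in> K2 \<Longrightarrow> y \<ge> 0 \<Longrightarrow> norm (F z y) \<le> C * exp (- (\<rho> * y))"
    using decaysE[of K2 F] by metis
  have z: "((b s, lam s), (b' s, lam' s)) \<in> K2" if "s \<in> J" "\<bar>s - s0\<bar> < min d1 d2" for s
    using B[OF that] inK[OF that(1)] by (simp add: K2_def)
  have z0: "((b s0, lam s0), (b' s0, lam' s0)) \<in> K2" using z[OF s0] d1 d2 by simp
  have hi: "((\<lambda>s. hint (eps (b s) (lam s))) has_real_derivative hint (\<lambda>y. epsb (b s0) (lam s0) y * b' s0 + epsl (b s0) (lam s0) y * lam' s0)) (at s0 within J)"
  proof (rule deriv_under_hint[OF J s0, of "min d1 d2" "\<lambda>s. eps (b s) (lam s)" "\<lambda>s y. epsb (b s) (lam s) y * b' s + epsl (b s) (lam s) y * lam' s" C \<rho>])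
    show "min d1 d2 > 0" using d1 d2 by simp
    show "((\<lambda>s. eps (b s) (lam s) y) has_real_derivative epsb (b s) (lam s) y * b' s + epsl (b s) (lam s) y * lam' s) (at s within J)" if "s \<in> J" for s y
      by (rule eps_chain[OF p[OF that]])
    show "\<bar>epsb (b s) (lam s) y * b' s + epsl (b s) (lam s) y * lam' s\<bar> \<le> C * exp (- (\<rho> * y))" if "s \<in> J" "\<bar>s - s0\<bar> < min d1 d2" "y \<ge> 0" for s y
      using Fb[OF z[OF that(1,2)] that(3)] by (simp add: F_def)
    show "hintegrable (eps (b s) (lam s))" if "s \<in> J" for s
      using sm_hintegrable[OF smK_eps[OF kr] inK[OF that]] by simp
    show "continuous_on {0..} (\<lambda>y. epsb (b s0) (lam s0) y * b' s0 + epsl (b s0) (lam s0) y * lam' s0)"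
      using sm_continuous[OF F z0] by (simp add: F_def[abs_def])
  qed (rule C)
  have split: "hint (\<lambda>y. epsb (b s0) (lam s0) y * b' s0 + epsl (b s0) (lam s0) y * lam' s0) = hint (epsb (b s0) (lam s0)) * b' s0 + hint (epsl (b s0) (lam s0)) * lam' s0"
  proof -
    have "hintegrable (epsb (b s0) (lam s0))" "hintegrable (epsl (b s0) (lam s0))"
      using sm_hintegrable[OF smK_epsb[OF kr] inK[OF s0]] sm_hintegrable[OF smK_epsl[OF kr] inK[OF s0]] by auto
    then show ?thesis by (simp add: set_integral_add)
  qed
  note h0 = cmod_sq_deriv[OF PP_chain[OF p[OF s0], of 0]]
  from deriv_combination2[OF hi p(2)[OF s0] h0] show ?thesis unfolding EE_def
    by (rule back_subst[where P="\<lambda>v. (_ has_real_derivative v) (at s0 within J)"]) (simp only: split EEb_def EEl_def, simp add: algebra_simps)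
qed

lemma EE_chain:
  assumes m: "modulation N \<gamma> J b lam" and kr: "kreg q M K" and inK: "\<And>s. s \<in> J \<Longrightarrow> (b s, lam s) \<in> K" and s0: "s0 \<in> J"
  shows "((\<lambda>s. EE (b s) (lam s)) has_real_derivative
     EEb (b s0) (lam s0) * deriv_in J b s0 + EEl (b s0) (lam s0) * deriv_in J lam s0) (at s0 within J)"
  by (rule EE_chain_general[OF _ _ _ modulation_point(3,4,1)[OF m] kr inK s0]) (use m in \<open>auto simp: modulation_def Ck_on_def\<close>)

section \<open>The energy along the exact flow\<close>

lemma singleton_kreg: "\<bar>\<sigma> * l\<bar> < 1 \<Longrightarrow> kreg \<bar>\<sigma> * l\<bar> (max 1 (max \<bar>b\<bar> \<bar>l\<bar>)) {(b, l)}"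
  by (auto simp: kreg_def)

definition ZZ :: "real \<Rightarrow> real \<Rightarrow> real \<Rightarrow> complex" where
  "ZZ b l y = wyy b l y + complex_of_real (((cmod (w b l y))\<^sup>2)\<^sup>2) * w b l y"

text \<open>Integrates the pointwise identity over an edge. The term with 2 b is the effect of the
  factor \<lambda>^(-2) under \<lambda>' = -b \<lambda>. By w_y(0) = \<sigma>\<lambda> w(0), the
  flux through the vertex cancels against the change of the vertex energy, and only the contribution
  of \<open>Psi0\<close> is left.\<close>

theorem EE_flow:
  assumes m: "\<bar>\<sigma> * l\<bar> < 1"
  shows "EEb b l * (- b\<^sup>2 + Re (Af \<kappa> a b l 0)) + EEl b l * (- (b * l)) + 2 * b * EE b l
    = real N * hint (\<lambda>y. Re (\<i> * (cnj (ZZ b l y) * (Ee b y * Psi0 b l y))))"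
proof -
  define A1 A2 where "A1 = - b\<^sup>2 + Re (Af \<kappa> a b l 0)" and "A2 = - (b * l)"
  define e where "e y = wb b l y * complex_of_real A1 + wl b l y * complex_of_real A2" for y
  define e1 where "e1 y = wyb b l y * complex_of_real A1 + wyl b l y * complex_of_real A2" for y
  define n where "n y = (cmod (w b l y))\<^sup>2" for y
  \<comment> \<open>The flux whose derivative is the bracket of the density identity. The part with
    b comes from the dilation term b (w/2 + y w_y) of the equation, the last part from the term
    -w.\<close>
  define fl where "fl y = Re (cnj (wy b l y) * e y) + b * (Re (cnj (wy b l y) * w b l y) / 2 + y * (cmod (wy b l y))\<^sup>2 / 2 + y * n y ^ 3 / 6)
     + Re (\<i> * (cnj (wy b l y) * w b l y))" for y
  define fl' where "fl' y = (Re (cnj (wyy b l y) * e y + cnj (wy b l y) * e1 y)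
       + b * (Re (cnj (wyy b l y) * w b l y + cnj (wy b l y) * wy b l y) / 2 + (cmod (wy b l y))\<^sup>2 / 2 + y * Re (cnj (wy b l y) * wyy b l y) + n y ^ 3 / 6 + y * ((n y)\<^sup>2 * Re (cnj (w b l y) * wy b l y)))
       + Re (\<i> * (cnj (wyy b l y) * w b l y + cnj (wy b l y) * wy b l y)))" for y
  define R where "R y = Re (\<i> * (cnj (ZZ b l y) * (Ee b y * Psi0 b l y)))" for y
  let ?K = "{(b, l)}"
  note kr = singleton_kreg[OF m, of b]
  have sing: "sm True {()} k (\<lambda>_. F b l)" if "sm True ?K k (\<lambda>p. F (fst p) (snd p))" for F :: "real \<Rightarrow> real \<Rightarrow> real \<Rightarrow> 'z::real_normed_vector" and k
    using sm_reindex[where h="\<lambda>_. (b, l)" and L="{()}" and K="?K" and d=True and n=k and F="\<lambda>p. F (fst p) (snd p)"] that by simp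
  have s: "sm True {()} k (\<lambda>_. w b l)" "sm True {()} k (\<lambda>_. wy b l)" "sm True {()} k (\<lambda>_. wyy b l)" "sm True {()} k (\<lambda>_. wb b l)"
    "sm True {()} k (\<lambda>_. wl b l)" "sm True {()} k (\<lambda>_. wyb b l)" "sm True {()} k (\<lambda>_. wyl b l)" for k
    by (intro sing smK_w[OF kr] smK_wy[OF kr] smK_wyy[OF kr] smK_wb[OF kr] smK_wl[OF kr] smK_wyb[OF kr] smK_wyl[OF kr])+
  have c: "sm False {()} k (\<lambda>_ y. x)" for k and x :: "'z::{real_normed_field}" by (rule sm_const[where M="norm x"]) auto
  have se: "sm True {()} k (\<lambda>_. e)" "sm True {()} k (\<lambda>_. e1)" for k
    unfolding e_def[abs_def] e1_def[abs_def] by (intro sm_add sm_mult_decay(1)[OF _ c] s)+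
  have sn: "sm True {()} k (\<lambda>_. n)" for k unfolding n_def[abs_def] by (intro sm_cmod_sq s)
  have sy: "sm False {()} k (\<lambda>_ y. y :: real)" for k by (rule sm_y)
  have sfl: "sm True {()} k (\<lambda>_. fl)" for k
  proof -
    have "sm True {()} k (\<lambda>_ y. Re (cnj (wy b l y) * e y) + b * ((1/2) * Re (cnj (wy b l y) * w b l y) + (1/2) * (y * (cmod (wy b l y))\<^sup>2) + (1/6) * (y * ((n y)\<^sup>2 * n y)))
     + Re (\<i> * (cnj (wy b l y) * w b l y)))"
      by (intro sm_add sm_Re_cnj sm_mult_decay(2)[OF c] sm_mult_decay(2)[OF sy] sm_mult_decay(2)[OF sm_power[OF sm_False[OF sn]]] sm_cmod_sq
          sm_linear[OF bounded_linear_Re] sm_mult_decay(5) sm_linear[OF bounded_linear_cnj] s se sn)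
    then show ?thesis by (rule sm_cong) (simp add: fl_def eval_nat_numeral)
  qed
  have hn: "hderiv (\<lambda>y. (cmod (w b l y))\<^sup>2) (2 * Re (cnj (w b l y) * wy b l y)) y" "hderiv (\<lambda>y. (cmod (wy b l y))\<^sup>2) (2 * Re (cnj (wy b l y) * wyy b l y)) y" if "y \<ge> 0" for y
    using cmod_sq_deriv[OF w_hderiv[OF m that, of b]] cmod_sq_deriv[OF wy_hderiv[OF m that, of b]]
    unfolding has_real_derivative_iff_has_vector_derivative by auto
  have he: "hderiv e (e1 y) y" if "y \<ge> 0" for y
    unfolding e_def[abs_def] e1_def by (intro has_vector_derivative_add has_vector_derivative_mult_left wb_hderiv wl_hderiv m that)
  have hfl: "hderiv fl (fl' y) y" if y: "y \<ge> 0" for y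
  proof -
    have 3: "hderiv (\<lambda>y. Re (\<i> * (cnj (wy b l y) * w b l y))) (Re (\<i> * (cnj (wyy b l y) * w b l y + cnj (wy b l y) * wy b l y))) y"
    proof -
      have "hderiv (\<lambda>y. cnj (wy b l y)) (cnj (wyy b l y)) y" by (rule bounded_linear.has_vector_derivative[OF bounded_linear_cnj wy_hderiv[OF m y]])
      from bounded_linear.has_vector_derivative[OF bounded_linear_Re has_vector_derivative_mult_right[OF has_vector_derivative_mult[OF this w_hderiv[OF m y, of b]], of \<i>]]
      show ?thesis by (simp add: add.commute)
    qed
    note h = hderiv_Re_cnj[OF wy_hderiv[OF m y, of b] he[OF y]] hderiv_Re_cnj[OF wy_hderiv[OF m y, of b] w_hderiv[OF m y, of b]] hn[OF y] 3
    note h' = h[folded has_real_derivative_iff_has_vector_derivative]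
    from deriv_combination3[OF h'(1,2,5,4,3), of b] show ?thesis
      unfolding fl_def[abs_def] fl'_def n_def has_real_derivative_iff_has_vector_derivative[symmetric]
      by (rule back_subst[where P="\<lambda>v. (_ has_real_derivative v) (at y within {0..})"]) (simp add: field_simps)
  qed
  have pt: "epsb b l y * A1 + epsl b l y * A2 + 2 * b * eps b l y = fl' y + R y" for y
  proof -
    have AA: "complex_of_real A1 = - (complex_of_real b)\<^sup>2 + Af \<kappa> a b l y"
    proof -
      have "Af \<kappa> a b l y = Af \<kappa> a b l 0" by (simp add: Af_def Sg_def)
      then show ?thesis using Af_real[of b l 0] by (simp add: A1_def)
    qed
    have W: "\<i> * (e y + complex_of_real b * (w b l y / 2 + complex_of_real y * wy b l y)) + (wyy b l y + complex_of_real ((n y)\<^sup>2) * w b l y) - w b l y = Ee b y * Psi0 b l y"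
      using w_equation[of b l y] unfolding AA[symmetric] cmod_powers by (simp only: e_def A2_def n_def)
    have n3: "n y ^ 3 = (n y)\<^sup>2 * (cmod (w b l y))\<^sup>2" by (simp add: n_def eval_nat_numeral)
    have "epsb b l y * A1 + epsl b l y * A2 + 2 * b * eps b l y
       = Re (cnj (wy b l y) * e1 y) - (n y)\<^sup>2 * Re (cnj (w b l y) * e y) + b * ((cmod (wy b l y))\<^sup>2 - n y ^ 3 / 3)"
      unfolding epsb_def epsl_def eps_def e_def e1_def n_def by (simp add: algebra_simps)
    also have "\<dots> = fl' y + R y"
      unfolding fl'_def R_def ZZ_def n_def[symmetric] by (rule energy_density_identity[OF n3 W])
    finally show ?thesis .
  qed
  have ie: "hintegrable (eps b l)" "hintegrable (epsb b l)" "hintegrable (epsl b l)"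
    using sm_hintegrable[OF smK_eps[OF kr] insertI1] sm_hintegrable[OF smK_epsb[OF kr] insertI1] sm_hintegrable[OF smK_epsl[OF kr] insertI1] by auto
  have efl: "hD fl y = fl' y" if "y \<ge> 0" for y by (rule deriv_in_half[OF hfl[OF that] that])
  have ifl: "hintegrable fl'"
  proof -
    have "hintegrable (hD fl)" by (rule sm_hintegrable[OF sm_deriv_in[OF sfl] insertI1])
    then show ?thesis using set_integrable_cong[of lborel lborel "{0..}" "{0..}" "hD fl" fl'] efl by auto
  qed
  have L: "hint (\<lambda>y. epsb b l y * A1 + epsl b l y * A2 + 2 * b * eps b l y) = hint (epsb b l) * A1 + hint (epsl b l) * A2 + 2 * b * hint (eps b l)"
    using ie by (simp add: set_integral_add)
  have "hintegrable (\<lambda>y. epsb b l y * A1 + epsl b l y * A2 + 2 * b * eps b l y)"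
    using ie by (intro set_integral_add set_integrable_mult_left set_integrable_mult_right)
  from set_integral_diff(1)[OF this ifl] have iR: "hintegrable R" unfolding pt by simp
  have "hint (\<lambda>y. fl' y + R y) = hint fl' + hint R" by (rule set_integral_add[OF ifl iR])
  also have "hint fl' = - fl 0" by (rule sm_hint_deriv[OF sfl insertI1 hfl])
  also have "fl 0 = \<sigma> * l * Re (cnj (PP b l 0) * e 0) + b * (\<sigma> * l) * (cmod (PP b l 0))\<^sup>2 / 2"
  proof -
    have E: "Ee b 0 = 1" by (simp add: Ee_def)
    have w0: "w b l 0 = PP b l 0" "wy b l 0 = complex_of_real (\<sigma> * l) * PP b l 0" by (simp_all add: w_def wy_def E PPy_0)
    have "Re (cnj (complex_of_real t * p) * x) = t * Re (cnj p * x)" for t p x by (simp add: algebra_simps)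
    moreover have "Re (\<i> * (cnj (complex_of_real t * p) * p)) = 0" for t p by (simp add: algebra_simps)
    moreover have "Re (cnj p * p) = (cmod p)\<^sup>2" for p unfolding cmod_power2 by (simp add: power2_eq_square)
    ultimately show ?thesis unfolding fl_def w0 by (simp only:) simp
  qed
  also have "e 0 = PPb b l 0 * complex_of_real A1 + PPl b l 0 * complex_of_real A2"
    by (simp add: e_def wb_def wl_def Ee_def)
  finally have key: "hint (epsb b l) * A1 + hint (epsl b l) * A2 + 2 * b * hint (eps b l)
     = - (\<sigma> * l * (Re (cnj (PP b l 0) * PPb b l 0) * A1 + Re (cnj (PP b l 0) * PPl b l 0) * A2) + b * (\<sigma> * l) * (cmod (PP b l 0))\<^sup>2 / 2) + hint R"
    unfolding L[symmetric] pt by (simp add: algebra_simps)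
  \<comment> \<open>The fluxes of N edges, each with slope coefficient \<sigma>, balance the single
    vertex term with coefficient \<gamma>.\<close>
  have g: "\<gamma> = real N * \<sigma>" using N by simp
  have "EEb b l * A1 + EEl b l * A2 + 2 * b * EE b l
     = real N * (hint (epsb b l) * A1 + hint (epsl b l) * A2 + 2 * b * hint (eps b l))
      + \<gamma> * l * (Re (cnj (PP b l 0) * PPb b l 0) * A1 + Re (cnj (PP b l 0) * PPl b l 0) * A2) + \<gamma> / 2 * (cmod (PP b l 0))\<^sup>2 * A2 + b * (\<gamma> * l) * (cmod (PP b l 0))\<^sup>2"
    unfolding EEb_def EEl_def EE_def by (simp add: algebra_simps)
  also have "\<dots> = real N * hint R"
  proof -
    have "n * (- (sg * l * X + b * (sg * l) * Y / 2) + H) + n * sg * l * X + n * sg / 2 * Y * (- (b * l)) + b * (n * sg * l) * Y = n * H" for n sg X Y H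
      by (simp add: field_simps)
    from this[of "real N" \<sigma>, folded g] show ?thesis unfolding key unfolding A2_def .
  qed
  finally show ?thesis unfolding A1_def A2_def R_def[abs_def] .
qed

lemma profile_tilde_w:
  assumes m: "\<bar>\<sigma> * l\<bar> < 1"
  shows "profile_tilde N \<gamma> \<kappa> Pj b l \<theta> i x = complex_of_real (l powr (-1/2)) * exp (\<i> * complex_of_real \<theta>) * w b l (x / l)"
proof -
  have "exp (\<i> * complex_of_real (\<theta> - b * (x / l)\<^sup>2 / 4)) = exp (\<i> * complex_of_real \<theta>) * Ee b (x / l)"
    unfolding Ee_def exp_add[symmetric] by (simp add: algebra_simps)
  then show ?thesis unfolding profile_tilde_def Let_def profile_PP[OF m] w_def by (simp only: mult_ac)
qed

text \<open>At the mass-critical power the kinetic and the sextic term both scale like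
  \<lambda>^(-2), the vertex term only like \<lambda>^(-1); hence the factor l in the vertex part of
  \<open>EE\<close>.\<close>

lemma energy_profile:
  assumes m: "\<bar>\<sigma> * l\<bar> < 1" and l: "l > 0"
  shows "energy N \<gamma> (profile_tilde N \<gamma> \<kappa> Pj b l \<theta>) = EE b l / l\<^sup>2"
proof -
  define c0 where "c0 = complex_of_real (l powr (-1/2)) * exp (\<i> * complex_of_real \<theta>)"
  define u where "u = profile_tilde N \<gamma> \<kappa> Pj b l \<theta>"
  have u: "u i x = c0 * w b l (x / l)" for i x unfolding u_def c0_def by (rule profile_tilde_w[OF m])
  have c0: "(cmod c0)\<^sup>2 = 1 / l"
  proof -
    have "cmod c0 = l powr (-1/2)" unfolding c0_def norm_mult norm_exp_i_times by simp
    then have "(cmod c0)\<^sup>2 = l powr (-1/2) * l powr (-1/2)" by (simp add: power2_eq_square)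
    also have "\<dots> = l powr (-1)" unfolding powr_add[symmetric] by simp
    finally show ?thesis using l by (simp add: powr_neg_one)
  qed
  have du: "hD (u i) x = c0 * (wy b l (x / l) / complex_of_real l)" if x: "x \<ge> 0" for i x
  proof -
    have "((\<lambda>x. x / l) has_real_derivative 1 / l) (at x within {0..})" using l by (auto intro!: derivative_eq_intros)
    then have 1: "((\<lambda>x. x / l) has_vector_derivative 1 / l) (at x within {0..})"
      by (simp add: has_real_derivative_iff_has_vector_derivative)
    have "hderiv (w b l) (wy b l (x / l)) (x / l)" by (rule w_hderiv[OF m]) (use x l in auto)
    then have 2: "(w b l has_vector_derivative wy b l (x / l)) (at (x / l) within (\<lambda>x. x / l) ` {0..})"
      by (rule has_vector_derivative_within_subset) (use l in auto)
    from vector_diff_chain_within[OF 1 2]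
    have "hderiv (\<lambda>x. w b l (x / l)) (wy b l (x / l) / complex_of_real l) x"
      by (simp add: comp_def scaleR_conv_of_real field_simps)
    from has_vector_derivative_mult_right[OF this, of c0]
    have "hderiv (u i) (c0 * (wy b l (x / l) / complex_of_real l)) x" unfolding u[abs_def] .
    then show ?thesis by (rule deriv_in_half[OF _ x])
  qed
  note kr = singleton_kreg[OF m, of b]
  have sw: "sm True {(b, l)} 1 (\<lambda>p y. (cmod (w (fst p) (snd p) y))\<^sup>2)" "sm True {(b, l)} 1 (\<lambda>p y. (cmod (wy (fst p) (snd p) y))\<^sup>2)"
    by (intro sm_cmod_sq smK_w[OF kr] smK_wy[OF kr])+
  have sw3: "sm True {(b, l)} 1 (\<lambda>p y. ((cmod (w (fst p) (snd p) y))\<^sup>2)\<^sup>2 * (cmod (w (fst p) (snd p) y))\<^sup>2)"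
    by (intro sm_mult_decay(2)[OF smK_n(3)[OF kr]] sw)
  have i1: "hintegrable (\<lambda>y. (cmod (wy b l y))\<^sup>2)"
    using sm_hintegrable[OF sw(2)[unfolded One_nat_def] insertI1] by simp
  have i2: "hintegrable (\<lambda>y. ((cmod (w b l y))\<^sup>2) ^ 3)"
    using sm_hintegrable[OF sw3[unfolded One_nat_def] insertI1] by (simp add: eval_nat_numeral mult.assoc)
  have k: "(cmod (c0 * (W / complex_of_real l)))\<^sup>2 = (1 / l ^ 3) * (cmod W)\<^sup>2" for W
  proof -
    have "(cmod (c0 * (W / complex_of_real l)))\<^sup>2 = (cmod c0)\<^sup>2 * ((cmod W)\<^sup>2 / (cmod (complex_of_real l))\<^sup>2)"
      by (simp only: norm_mult norm_divide power_mult_distrib power_divide)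
    also have "\<dots> = (1 / l ^ 3) * (cmod W)\<^sup>2" unfolding c0 norm_of_real power2_abs using l by (simp add: field_simps eval_nat_numeral)
    finally show ?thesis .
  qed
  have n1: "hint (\<lambda>x. cmod (hD (u i) x) ^ 2) = hint (\<lambda>y. (cmod (wy b l y))\<^sup>2) / l\<^sup>2" for i
  proof -
    have "hint (\<lambda>x. cmod (hD (u i) x) ^ 2) = hint (\<lambda>x. (1 / l ^ 3) * (cmod (wy b l (x / l)))\<^sup>2)"
      by (rule hint_cong) (simp only: du k)
    also have "\<dots> = (1 / l ^ 3) * (l * hint (\<lambda>y. (cmod (wy b l y))\<^sup>2))"
      unfolding hint_cmult hint_scale[OF l, of "\<lambda>y. (cmod (wy b l y))\<^sup>2"] ..
    finally show ?thesis using l by (simp add: eval_nat_numeral)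
  qed
  have n6: "hint (\<lambda>x. cmod (u i x) ^ 6) = hint (\<lambda>y. ((cmod (w b l y))\<^sup>2) ^ 3) / l\<^sup>2" for i
  proof -
    have "hint (\<lambda>x. cmod (u i x) ^ 6) = hint (\<lambda>x. (1 / l ^ 3) * ((cmod (w b l (x / l)))\<^sup>2) ^ 3)"
      by (rule hint_cong) (simp only: u cmod_powers norm_mult power_mult_distrib c0 power_divide power_one)
    also have "\<dots> = (1 / l ^ 3) * (l * hint (\<lambda>y. ((cmod (w b l y))\<^sup>2) ^ 3))"
      unfolding hint_cmult hint_scale[OF l, of "\<lambda>y. ((cmod (w b l y))\<^sup>2) ^ 3"] ..
    finally show ?thesis using l by (simp add: eval_nat_numeral)
  qed
  have nn: "hint f \<ge> 0" if "\<And>y. f y \<ge> 0" for f :: "real \<Rightarrow> real"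
    unfolding set_lebesgue_integral_def by (rule integral_nonneg_AE) (use that in \<open>auto simp: indicator_def\<close>)
  have 2: "(Lp_norm N 2 (\<lambda>i. hD (u i)))\<^sup>2 = real N * (hint (\<lambda>y. (cmod (wy b l y))\<^sup>2) / l\<^sup>2)"
    unfolding Lp_norm_def n1 using nn[of "\<lambda>y. (cmod (wy b l y))\<^sup>2"] by (subst real_root_pow_pos2) auto
  have 6: "Lp_norm N 6 u ^ 6 = real N * (hint (\<lambda>y. ((cmod (w b l y))\<^sup>2) ^ 3) / l\<^sup>2)"
    unfolding Lp_norm_def n6 using nn[of "\<lambda>y. ((cmod (w b l y))\<^sup>2) ^ 3"] by (subst real_root_pow_pos2) auto
  have w0: "(cmod (u 0 0))\<^sup>2 = (cmod (PP b l 0))\<^sup>2 / l"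
    unfolding u by (simp add: norm_mult power_mult_distrib c0 w_def cmod_Ee)
  have "hint (eps b l) = hint (\<lambda>y. (1/2) * (cmod (wy b l y))\<^sup>2 - (1/6) * ((cmod (w b l y))\<^sup>2) ^ 3)"
    by (rule hint_cong) (simp add: eps_def)
  also have "\<dots> = (1/2) * hint (\<lambda>y. (cmod (wy b l y))\<^sup>2) - (1/6) * hint (\<lambda>y. ((cmod (w b l y))\<^sup>2) ^ 3)"
    by (subst set_integral_diff(2)[OF set_integrable_mult_right[OF i1] set_integrable_mult_right[OF i2]]) (simp only: hint_cmult)
  finally have e: "hint (eps b l) = (1/2) * hint (\<lambda>y. (cmod (wy b l y))\<^sup>2) - (1/6) * hint (\<lambda>y. ((cmod (w b l y))\<^sup>2) ^ 3)" .
  show ?thesis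
    unfolding u_def[symmetric] energy_def 2 6 w0 EE_def e using l by (simp add: field_simps power2_eq_square)
qed

text \<open>The right-hand side of \<open>EE_flow\<close>, divided by the weight, is a multiple of
  the integral of a bounded decaying family.\<close>

lemma EE_flow_bound:
  assumes kr: "kreg q M K"
  obtains C where "C \<ge> 0" "\<And>p. p \<in> K \<Longrightarrow> snd p > 0 \<Longrightarrow>
    \<bar>EEb (fst p) (snd p) * (- (fst p)\<^sup>2 + Re (Af \<kappa> a (fst p) (snd p) 0)) + EEl (fst p) (snd p) * (- (fst p * snd p)) + 2 * fst p * EE (fst p) (snd p)\<bar>
      \<le> C * ((fst p)\<^sup>2 + snd p) ^ \<kappa>"
proof -
  let ?Kp = "{p \<in> K. snd p > 0}"
  have r: "sm d ?Kp n F" if "sm d K n F" for F :: "real \<times> real \<Rightarrow> real \<Rightarrow> complex" and d n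
    by (rule sm_reindex[OF _ that, of ?Kp "\<lambda>p. p"]) simp
  have sZ: "sm True K n (\<lambda>p. ZZ (fst p) (snd p))" for n
    unfolding ZZ_def[abs_def]
    by (intro sm_add smK_wyy[OF kr] sm_mult_decay(2)[OF sm_of_real[OF smK_n(3)[OF kr]]] smK_w[OF kr])
  define F where "F p y = Re (\<i> * (cnj (ZZ (fst p) (snd p) y) * (Ee (fst p) y * (Psi0 (fst p) (snd p) y / complex_of_real (((fst p)\<^sup>2 + snd p) ^ \<kappa>)))))" for p y
  have "sm True ?Kp 1 F"
    unfolding F_def[abs_def]
    by (intro sm_linear[OF bounded_linear_Re] sm_mult_decay(2)[OF r[OF smK_i[OF kr]]] sm_mult_decay(5) sm_linear[OF bounded_linear_cnj] r[OF sZ]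
        sm_mult_decay(2)[OF r[OF smK_E[OF kr]]] smKp_Psi0[OF kr])
  then obtain C where C: "\<And>p. p \<in> ?Kp \<Longrightarrow> \<bar>hint (F p)\<bar> \<le> C" unfolding One_nat_def by (rule hint_bounded_on) blast
  show thesis
  proof (rule that[of "real N * \<bar>C\<bar>"])
    fix p assume p: "p \<in> K" "snd p > 0"
    let ?W = "((fst p)\<^sup>2 + snd p) ^ \<kappa>"
    have W: "?W > 0" using p by (intro zero_less_power) (simp add: add_nonneg_pos)
    have m: "\<bar>\<sigma> * snd p\<bar> < 1" using kreg'(6)[OF kr] p by auto
    have "hint (\<lambda>y. Re (\<i> * (cnj (ZZ (fst p) (snd p) y) * (Ee (fst p) y * Psi0 (fst p) (snd p) y)))) = hint (\<lambda>y. ?W * F p y)"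
    proof (rule hint_cong)
      fix y :: real
      have "F p y = Re (\<i> * (cnj (ZZ (fst p) (snd p) y) * (Ee (fst p) y * Psi0 (fst p) (snd p) y)) / complex_of_real ?W)"
        unfolding F_def by simp
      also have "\<dots> = Re (\<i> * (cnj (ZZ (fst p) (snd p) y) * (Ee (fst p) y * Psi0 (fst p) (snd p) y))) / ?W" by (rule Re_divide_of_real)
      finally have "F p y = \<dots>" .
      moreover have "x = u * f" if "f = x / u" "u > 0" for x u f :: real using that by simp
      ultimately show "Re (\<i> * (cnj (ZZ (fst p) (snd p) y) * (Ee (fst p) y * Psi0 (fst p) (snd p) y))) = ?W * F p y" using W by blast
    qed
    also have "\<dots> = ?W * hint (F p)" by (rule hint_cmult)
    finally have h: "hint (\<lambda>y. Re (\<i> * (cnj (ZZ (fst p) (snd p) y) * (Ee (fst p) y * Psi0 (fst p) (snd p) y)))) = ?W * hint (F p)" .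
    have "\<bar>hint (F p)\<bar> \<le> \<bar>C\<bar>" using C[of p] p by auto
    then have "real N * ?W * \<bar>hint (F p)\<bar> \<le> real N * ?W * \<bar>C\<bar>" using W by (intro mult_left_mono) auto
    then show "\<bar>EEb (fst p) (snd p) * (- (fst p)\<^sup>2 + Re (Af \<kappa> a (fst p) (snd p) 0)) + EEl (fst p) (snd p) * (- (fst p * snd p)) + 2 * fst p * EE (fst p) (snd p)\<bar>
      \<le> real N * \<bar>C\<bar> * ?W"
      unfolding EE_flow[OF m] h using W by (simp add: abs_mult mult_ac)
  qed simp
qed

theorem energy_derivative:
  assumes "param_region N \<gamma> K"
  shows "\<exists>C>0. \<forall>J b lam \<theta>.
          modulation N \<gamma> J b lam \<and> (\<forall>s\<in>J. (b s, lam s) \<in> K) \<longrightarrow>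
          (\<forall>s\<in>J. \<exists>D.
             ((\<lambda>s'. energy N \<gamma> (profile_tilde N \<gamma> \<kappa> Pj (b s') (lam s') (\<theta> s')))
                has_real_derivative D) (at s within J) \<and>
             \<bar>D\<bar> \<le> C * (1 / (lam s)\<^sup>2 * (mod_defect \<gamma> \<kappa> al J b lam s + ((b s)\<^sup>2 + lam s) ^ \<kappa>)))"
proof -
  obtain q M where qM: "0 \<le> q" "q < 1" "M \<ge> 1" "\<And>p. p \<in> K \<Longrightarrow> \<bar>\<sigma> * snd p\<bar> \<le> q" "\<And>p. p \<in> K \<Longrightarrow> \<bar>fst p\<bar> \<le> M"
    "\<And>p. p \<in> K \<Longrightarrow> \<bar>snd p\<bar> \<le> M" "\<And>p. p \<in> K \<Longrightarrow> snd p \<ge> 0"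
    by (rule region_bounds[OF assms]) blast
  have kr: "kreg q M K" using qM by (simp add: kreg_def)
  obtain C1 where C1: "\<And>p. p \<in> K \<Longrightarrow> \<bar>EE (fst p) (snd p)\<bar> \<le> C1" "\<And>p. p \<in> K \<Longrightarrow> \<bar>EEb (fst p) (snd p)\<bar> \<le> C1"
    "\<And>p. p \<in> K \<Longrightarrow> \<bar>EEl (fst p) (snd p)\<bar> \<le> C1" "C1 \<ge> 0" by (rule EE_bounded[OF kr]) blast
  obtain C2 where C2: "C2 \<ge> 0" "\<And>p. p \<in> K \<Longrightarrow> snd p > 0 \<Longrightarrow>
    \<bar>EEb (fst p) (snd p) * (- (fst p)\<^sup>2 + Re (Af \<kappa> a (fst p) (snd p) 0)) + EEl (fst p) (snd p) * (- (fst p * snd p)) + 2 * fst p * EE (fst p) (snd p)\<bar>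
      \<le> C2 * ((fst p)\<^sup>2 + snd p) ^ \<kappa>" by (rule EE_flow_bound[OF kr]) blast
  define C where "C = M * C1 + 2 * C1 + C2 + 1"
  have MC: "M * C1 \<ge> C1" "M * C1 \<ge> 0" using C1(4) qM(3) mult_right_mono[of 1 M C1] by auto
  have C: "C > 0" "C1 \<le> C" "M * C1 + 2 * C1 \<le> C" "C2 \<le> C" using MC C1(4) C2(1) by (auto simp: C_def)
  have main: "\<exists>D. ((\<lambda>s'. energy N \<gamma> (profile_tilde N \<gamma> \<kappa> Pj (b s') (lam s') (\<theta> s'))) has_real_derivative D) (at s within J) \<and>
             \<bar>D\<bar> \<le> C * (1 / (lam s)\<^sup>2 * (mod_defect \<gamma> \<kappa> al J b lam s + ((b s)\<^sup>2 + lam s) ^ \<kappa>))"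
    if m: "modulation N \<gamma> J b lam" and inK: "\<forall>s\<in>J. (b s, lam s) \<in> K" and s: "s \<in> J" for J b lam \<theta> s
  proof -
    note p = modulation_point[OF m s]
    have iK: "(b s, lam s) \<in> K" if "s \<in> J" for s using inK that by blast
    define B L B' L' where "B = b s" and "L = lam s" and "B' = deriv_in J b s" and "L' = deriv_in J lam s"
    define A where "A = Re (Af \<kappa> a B L 0)"
    \<comment> \<open>Writing B' = -B^2 + A + d1 and L' = L (-B + d2) splits the derivative into the
      exact-flow part \<open>X\<close>, already bounded, and terms linear in the defects.\<close>
    define d1 d2 where "d1 = B' + B\<^sup>2 - A" and "d2 = L' / L + B"
    have L: "L > 0" using p(2) by (simp add: L_def)
    define X where "X = EEb B L * (- B\<^sup>2 + A) + EEl B L * (- (B * L)) + 2 * B * EE B L"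
    have d: "((\<lambda>s'. EE (b s') (lam s') / (lam s')\<^sup>2) has_real_derivative
       (EEb B L * B' + EEl B L * L') / L\<^sup>2 - 2 * EE B L * L' / L ^ 3) (at s within J)"
    proof -
      have lin: "((\<lambda>s. f s / (g s)\<^sup>2) has_real_derivative f' / (g s)\<^sup>2 - 2 * f s * g' / g s ^ 3) (at s within J)"
        if "(f has_real_derivative f') (at s within J)" "(g has_real_derivative g') (at s within J)" "g s > 0" for f g :: "real \<Rightarrow> real" and f' g'
        using that by (auto intro!: derivative_eq_intros simp: field_simps eval_nat_numeral)
      from lin[OF EE_chain[OF m kr iK s] p(4,2)] show ?thesis unfolding B_def L_def B'_def L'_def .
    qed
    have e: "(EEb B L * B' + EEl B L * L') / L\<^sup>2 - 2 * EE B L * L' / L ^ 3 = (1 / L\<^sup>2) * (X + EEb B L * d1 + (EEl B L * L - 2 * EE B L) * d2)"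
    proof -
      have B': "B' = - B\<^sup>2 + A + d1" by (simp add: d1_def)
      have L': "L' = L * (- B + d2)" using L by (simp add: d2_def field_simps)
      have id: "(x * u + z * (L * v)) / L\<^sup>2 - 2 * f * (L * v) / L ^ 3 = (1 / L\<^sup>2) * (x * u + z * L * v - 2 * f * v)" for x u z v f :: real
        using L by (simp add: field_simps eval_nat_numeral)
      show ?thesis unfolding L' id unfolding B' X_def by (intro arg_cong[where f = "\<lambda>x. 1 / L\<^sup>2 * x"]) (simp add: algebra_simps)
    qed
    have Xb: "\<bar>X\<bar> \<le> C2 * (B\<^sup>2 + L) ^ \<kappa>" using C2(2)[OF iK[OF s]] p(2) by (simp add: X_def A_def B_def L_def)
    have b1: "\<bar>EEb B L\<bar> \<le> C1" "\<bar>EE B L\<bar> \<le> C1" "\<bar>EEl B L\<bar> \<le> C1" using C1(1-3)[OF iK[OF s]] by (simp_all add: B_def L_def)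
    have LM: "\<bar>L\<bar> \<le> M" using qM(6)[OF iK[OF s]] by (simp add: L_def)
    have b2: "\<bar>EEl B L * L - 2 * EE B L\<bar> \<le> M * C1 + 2 * C1"
    proof -
      have "\<bar>EEl B L * L\<bar> \<le> C1 * M" unfolding abs_mult using b1 LM C1(4) by (intro mult_mono) auto
      then show ?thesis using b1(2) by (simp add: mult.commute)
    qed
    define dd1 where "dd1 = cmod (complex_of_real (B' + B\<^sup>2) - alpha_sum \<gamma> \<kappa> al B L)"
    have d1: "\<bar>d1\<bar> \<le> dd1"
    proof -
      have "complex_of_real (B' + B\<^sup>2) - alpha_sum \<gamma> \<kappa> al B L = complex_of_real d1"
        unfolding alpha_sum_Af[of B L 0] d1_def A_def by (subst Af_real) simp
      then show ?thesis unfolding dd1_def by simp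
    qed
    have W: "(B\<^sup>2 + L) ^ \<kappa> \<ge> 0" using L by simp
    have "\<bar>X + EEb B L * d1 + (EEl B L * L - 2 * EE B L) * d2\<bar> \<le> C * (\<bar>d2\<bar> + dd1 + (B\<^sup>2 + L) ^ \<kappa>)"
    proof -
      have "\<bar>EEb B L * d1\<bar> \<le> C * dd1" unfolding abs_mult using b1(1) d1 C by (intro mult_mono) auto
      moreover have "\<bar>(EEl B L * L - 2 * EE B L) * d2\<bar> \<le> C * \<bar>d2\<bar>" unfolding abs_mult using b2 C by (intro mult_mono) auto
      moreover have "\<bar>X\<bar> \<le> C * (B\<^sup>2 + L) ^ \<kappa>" using Xb mult_right_mono[OF C(4) W] by linarith
      ultimately show ?thesis unfolding distrib_left by linarith
    qed
    then have "\<bar>(1 / L\<^sup>2) * (X + EEb B L * d1 + (EEl B L * L - 2 * EE B L) * d2)\<bar> \<le> (1 / L\<^sup>2) * (C * (\<bar>d2\<bar> + dd1 + (B\<^sup>2 + L) ^ \<kappa>))"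
      unfolding abs_mult by (intro mult_mono) auto
    moreover have "mod_defect \<gamma> \<kappa> al J b lam s = \<bar>d2\<bar> + dd1"
      by (simp add: mod_defect_def d2_def dd1_def B_def L_def B'_def L'_def)
    ultimately have bd: "\<bar>(EEb B L * B' + EEl B L * L') / L\<^sup>2 - 2 * EE B L * L' / L ^ 3\<bar> \<le> C * (1 / (lam s)\<^sup>2 * (mod_defect \<gamma> \<kappa> al J b lam s + ((b s)\<^sup>2 + lam s) ^ \<kappa>))"
      unfolding e by (simp add: B_def L_def mult_ac)
    have "((\<lambda>s'. energy N \<gamma> (profile_tilde N \<gamma> \<kappa> Pj (b s') (lam s') (\<theta> s'))) has_real_derivative
       (EEb B L * B' + EEl B L * L') / L\<^sup>2 - 2 * EE B L * L' / L ^ 3) (at s within J)"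
    proof (rule has_field_derivative_transform_within[OF d zero_less_one s])
      fix s' assume "s' \<in> J"
      from energy_profile[OF modulation_point(1,2)[OF m this]]
      show "EE (b s') (lam s') / (lam s')\<^sup>2 = energy N \<gamma> (profile_tilde N \<gamma> \<kappa> Pj (b s') (lam s') (\<theta> s'))" by simp
    qed
    then show ?thesis using bd by blast
  qed
  show ?thesis by (rule exI[of _ C]) (use C(1) main in blast)
qed

end

section \<open>Expansion of the energy\<close>

text \<open>The binomial series cut after n terms. The remainder is the shifted series, bounded for
  |z| <= q by the sum of absolute values at q.\<close>

lemma sqrt_expansion:
  obtains R :: "real \<Rightarrow> real" where
    "\<And>z. \<bar>z\<bar> < 1 \<Longrightarrow> sqrt (1 + z) = (\<Sum>k<n. ((1/2) gchoose k) * z ^ k) + z ^ n * R z"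
    "\<And>q. q < 1 \<Longrightarrow> \<exists>B. \<forall>z. \<bar>z\<bar> \<le> q \<longrightarrow> \<bar>R z\<bar> \<le> B"
proof -
  define a :: "nat \<Rightarrow> real" where "a k = (1/2) gchoose k" for k
  define R where "R z = (\<Sum>k. a (k + n) * z ^ k)" for z
  have s: "(\<lambda>k. a k * z ^ k) sums (1 + z) powr (1/2)" if "\<bar>z\<bar> < 1" for z
    unfolding a_def by (rule gen_binomial_real[OF that])
  have abs: "summable (\<lambda>k. \<bar>a (k + n) * z ^ k\<bar>)" if "\<bar>z\<bar> < 1" for z
  proof -
    \<comment> \<open>A point strictly between |z| and 1: convergence there gives absolute
      convergence at z.\<close>
    define x where "x = (1 + \<bar>z\<bar>) / 2"
    have x: "\<bar>z\<bar> < \<bar>x\<bar>" "\<bar>x\<bar> < 1" "x \<noteq> 0" using that by (auto simp: x_def)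
    have "summable (\<lambda>k. a (k + n) * x ^ (k + n))" using s[OF x(2)] by (subst summable_iff_shift) (rule sums_summable)
    from summable_mult2[OF this, of "1 / x ^ n"] have "summable (\<lambda>k. a (k + n) * x ^ k)" using x(3) by (simp add: power_add)
    from powser_insidea[OF this, of z] x(1) show ?thesis by simp
  qed
  show thesis
  proof (rule that[of R])
    fix z :: real assume z: "\<bar>z\<bar> < 1"
    have "sqrt (1 + z) = (\<Sum>k. a k * z ^ k)" using s[OF z] z by (simp add: sums_iff powr_half_sqrt)
    also have "\<dots> = (\<Sum>k. a (k + n) * z ^ (k + n)) + (\<Sum>k<n. a k * z ^ k)"
      by (rule suminf_split_initial_segment[OF sums_summable[OF s[OF z]]])
    also have "(\<Sum>k. a (k + n) * z ^ (k + n)) = z ^ n * R z"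
      unfolding R_def using suminf_mult[OF summable_rabs_cancel[OF abs[OF z]], of "z ^ n"] by (simp add: power_add mult_ac)
    finally show "sqrt (1 + z) = (\<Sum>k<n. ((1/2) gchoose k) * z ^ k) + z ^ n * R z" by (simp add: a_def)
  next
    fix q :: real assume "q < 1"
    define q' where "q' = max q 0"
    have q': "\<bar>q'\<bar> < 1" "q' \<ge> 0" using \<open>q < 1\<close> by (auto simp: q'_def)
    have "\<bar>R z\<bar> \<le> (\<Sum>k. \<bar>a (k + n) * q' ^ k\<bar>)" if "\<bar>z\<bar> \<le> q" for z
    proof -
      have z: "\<bar>z\<bar> < 1" "\<bar>z\<bar> \<le> q'" using that \<open>q < 1\<close> by (auto simp: q'_def)
      have "\<bar>R z\<bar> \<le> (\<Sum>k. \<bar>a (k + n) * z ^ k\<bar>)" unfolding R_def by (rule summable_rabs[OF abs[OF z(1)]])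
      also have "\<dots> \<le> (\<Sum>k. \<bar>a (k + n) * q' ^ k\<bar>)"
        using z(2) q'(2) by (intro suminf_le abs z(1) q'(1)) (auto simp: abs_mult power_abs intro!: mult_left_mono power_mono)
      finally show ?thesis .
    qed
    then show "\<exists>B. \<forall>z. \<bar>z\<bar> \<le> q \<longrightarrow> \<bar>R z\<bar> \<le> B" by blast
  qed
qed

lemma geometric_expansion: "a \<noteq> 1 \<Longrightarrow> 1 / (1 - a) = (\<Sum>k<n. a ^ k) + a ^ n * (1 / (1 - a))" for a :: "'a::field"
  by (simp add: sum_gp_strict field_simps)

lemma of_real_geometric:
  assumes "r = (\<Sum>k<n. (s * l * t) ^ k) + (s * l * t) ^ n * r"
  shows "complex_of_real r = (\<Sum>k<n. (complex_of_real (s * l) * complex_of_real t) ^ k)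
    + complex_of_real l ^ n * (complex_of_real s ^ n * complex_of_real t ^ n * complex_of_real r)"
proof -
  have "complex_of_real r = complex_of_real ((\<Sum>k<n. (s * l * t) ^ k) + (s * l * t) ^ n * r)" using assms by simp
  then show ?thesis by (simp only: of_real_add of_real_mult of_real_sum of_real_power power_mult_distrib mult_ac)
qed

lemma Re_of_real_mult: "Re (complex_of_real r * z) = r * Re z"
  by simp

context prof begin

text \<open>G is not polynomial in \<lambda>, so a function is split into a polynomial with
  exponents of any size and \<lambda>^\<kappa> times a uniformly smooth remainder; the latter is of
  error size because \<lambda> <= b^2 + \<lambda>. The class is closed under sums, products and
  conjugation, from which the energy density is built.\<close>

definition expands :: "bool \<Rightarrow> (real \<Rightarrow> real \<Rightarrow> real \<Rightarrow> complex) \<Rightarrow> bool" where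
  "expands d F \<longleftrightarrow> (\<exists>P R. SP d UNIV P \<and> (\<forall>q M K n. kreg q M K \<longrightarrow> sm d K n (\<lambda>p. R (fst p) (snd p))) \<and>
     (\<forall>b l y. \<bar>\<sigma> * l\<bar> < 1 \<longrightarrow> y \<ge> 0 \<longrightarrow> F b l y = P b l y + complex_of_real l ^ \<kappa> * R b l y))"

lemma expandsI:
  assumes "SP d UNIV P" "\<And>q M K n. kreg q M K \<Longrightarrow> sm d K n (\<lambda>p. R (fst p) (snd p))"
    "\<And>b l y. \<bar>\<sigma> * l\<bar> < 1 \<Longrightarrow> y \<ge> 0 \<Longrightarrow> F b l y = P b l y + complex_of_real l ^ \<kappa> * R b l y"
  shows "expands d F"
  unfolding expands_def using assms by blast

lemma expandsE:
  assumes "expands d F"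
  obtains P R where "SP d UNIV P" "\<And>q M K n. kreg q M K \<Longrightarrow> sm d K n (\<lambda>p. R (fst p) (snd p))"
    "\<And>b l y. \<bar>\<sigma> * l\<bar> < 1 \<Longrightarrow> y \<ge> 0 \<Longrightarrow> F b l y = P b l y + complex_of_real l ^ \<kappa> * R b l y"
  using assms unfolding expands_def by blast

lemma expands_SP: "SP d T F \<Longrightarrow> expands d F"
  by (rule expandsI[of d F "\<lambda>b l y. 0"]) (auto intro: SP_weaken sm_zero)

lemma expands_cong: "expands d F \<Longrightarrow> (\<And>b l y. \<bar>\<sigma> * l\<bar> < 1 \<Longrightarrow> y \<ge> 0 \<Longrightarrow> F b l y = G b l y) \<Longrightarrow> expands d G"
  unfolding expands_def by (metis (no_types, lifting))

lemma expands_add: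
  assumes "expands d F" "expands d G" shows "expands d (\<lambda>b l y. F b l y + G b l y)"
proof -
  obtain P R where 1: "SP d UNIV P" "\<And>q M K n. kreg q M K \<Longrightarrow> sm d K n (\<lambda>p. R (fst p) (snd p))"
    "\<And>b l y. \<bar>\<sigma> * l\<bar> < 1 \<Longrightarrow> y \<ge> 0 \<Longrightarrow> F b l y = P b l y + complex_of_real l ^ \<kappa> * R b l y" using assms(1) by (rule expandsE) blast
  obtain P' R' where 2: "SP d UNIV P'" "\<And>q M K n. kreg q M K \<Longrightarrow> sm d K n (\<lambda>p. R' (fst p) (snd p))"
    "\<And>b l y. \<bar>\<sigma> * l\<bar> < 1 \<Longrightarrow> y \<ge> 0 \<Longrightarrow> G b l y = P' b l y + complex_of_real l ^ \<kappa> * R' b l y" using assms(2) by (rule expandsE) blast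
  show ?thesis by (rule expandsI[OF SP_add[OF 1(1) 2(1)] sm_add[OF 1(2) 2(2)]]) (simp_all add: 1(3) 2(3) algebra_simps)
qed

lemma kreg_power: "kreg q M K \<Longrightarrow> sm False K n (\<lambda>p y. complex_of_real (snd p) ^ m)"
  by (intro sm_power sm_of_real sm_const[where M=M]) (auto dest: kreg'(5))

lemma expands_mult:
  assumes "expands d F" "expands e G" shows "expands (d \<or> e) (\<lambda>b l y. F b l y * G b l y)"
proof -
  obtain P R where 1: "SP d UNIV P" "\<And>q M K n. kreg q M K \<Longrightarrow> sm d K n (\<lambda>p. R (fst p) (snd p))"
    "\<And>b l y. \<bar>\<sigma> * l\<bar> < 1 \<Longrightarrow> y \<ge> 0 \<Longrightarrow> F b l y = P b l y + complex_of_real l ^ \<kappa> * R b l y" using assms(1) by (rule expandsE) blast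
  obtain P' R' where 2: "SP e UNIV P'" "\<And>q M K n. kreg q M K \<Longrightarrow> sm e K n (\<lambda>p. R' (fst p) (snd p))"
    "\<And>b l y. \<bar>\<sigma> * l\<bar> < 1 \<Longrightarrow> y \<ge> 0 \<Longrightarrow> G b l y = P' b l y + complex_of_real l ^ \<kappa> * R' b l y" using assms(2) by (rule expandsE) blast
  let ?R = "\<lambda>b l y. P b l y * R' b l y + R b l y * P' b l y + complex_of_real l ^ \<kappa> * (R b l y * R' b l y)"
  show ?thesis
  proof (rule expandsI[of _ _ ?R])
    show "SP (d \<or> e) UNIV (\<lambda>b l y. P b l y * P' b l y)" by (rule SP_mult[OF 1(1) 2(1)]) auto
    show "sm (d \<or> e) K n (\<lambda>p. ?R (fst p) (snd p))" if "kreg q M K" for q M K n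
      by (intro sm_add sm_mult SPK[OF that 1(1)] SPK[OF that 2(1)] 1(2)[OF that] 2(2)[OF that] sm_mult_decay(3) kreg_power[OF that])
  qed (simp add: 1(3) 2(3) algebra_simps)
qed

lemmas expands_mult' = expands_mult[where d=False, simplified] expands_mult[where e=False, simplified] expands_mult[where d=True and e=True, simplified]

lemma expands_cnj: "expands d F \<Longrightarrow> expands d (\<lambda>b l y. cnj (F b l y))"
proof (elim expandsE)
  fix P R assume 1: "SP d UNIV P" "\<And>q M K n. kreg q M K \<Longrightarrow> sm d K n (\<lambda>p. R (fst p) (snd p))"
    "\<And>b l y. \<bar>\<sigma> * l\<bar> < 1 \<Longrightarrow> y \<ge> 0 \<Longrightarrow> F b l y = P b l y + complex_of_real l ^ \<kappa> * R b l y"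
  show ?thesis by (rule expandsI[OF SP_cnj[OF 1(1)] sm_linear[OF bounded_linear_cnj 1(2)]]) (simp_all add: 1(3))
qed

lemma expands_const: "expands False (\<lambda>b l y. complex_of_real u)" by (rule expands_SP[OF L_const])

lemma expands_cmult: "expands d F \<Longrightarrow> expands d (\<lambda>b l y. complex_of_real u * F b l y)"
  by (rule expands_mult'(1)[OF expands_const])

text \<open>The geometric series in \<mu> t cut after \<kappa> terms; its remainder keeps the
  reciprocal as a factor.\<close>

lemma expands_rec: "expands False (\<lambda>b l y. complex_of_real (1 / (1 - \<sigma> * l * th y)))"
proof (rule expandsI[of _ "\<lambda>b l y. \<Sum>k<\<kappa>. (complex_of_real (\<sigma> * l) * complex_of_real (th y)) ^ k"
      "\<lambda>b l y. complex_of_real \<sigma> ^ \<kappa> * complex_of_real (th y) ^ \<kappa> * complex_of_real (1 / (1 - \<sigma> * l * th y))"])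
  show "SP False UNIV (\<lambda>b l y. \<Sum>k<\<kappa>. (complex_of_real (\<sigma> * l) * complex_of_real (th y)) ^ k)"
    by (rule SP_weaken[OF SP_sum[OF L0_power[OF L0_mult[OF L_mu0 L_th]]]]) auto
  show "sm False K n (\<lambda>p y. complex_of_real \<sigma> ^ \<kappa> * complex_of_real (th y) ^ \<kappa> * complex_of_real (1 / (1 - \<sigma> * snd p * th y)))" if "kreg q M K" for q M K n
    by (intro sm_mult_decay(3) sm_power sm_of_real sm_th smK_rec[OF that] sm_const[where M="\<bar>\<sigma>\<bar>"]) auto
next
  fix b l y :: real assume m: "\<bar>\<sigma> * l\<bar> < 1"
  have "1 - x * th y > 0" if "\<bar>x\<bar> < 1" for x using one_minus_mt_bound(2)[of x "\<bar>x\<bar>" y] that by simp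
  from this[OF m] have "\<sigma> * l * th y \<noteq> 1" by linarith
  from geometric_expansion[OF this, of \<kappa>] show "complex_of_real (1 / (1 - \<sigma> * l * th y)) = (\<Sum>k<\<kappa>. (complex_of_real (\<sigma> * l) * complex_of_real (th y)) ^ k)
     + complex_of_real l ^ \<kappa> * (complex_of_real \<sigma> ^ \<kappa> * complex_of_real (th y) ^ \<kappa> * complex_of_real (1 / (1 - \<sigma> * l * th y)))"
    by (rule of_real_geometric)
qed

text \<open>The binomial series in \<mu>^2 cut after \<kappa> terms. The remainder has the power
  \<lambda>^(2\<kappa>), half of which stays inside the remainder function.\<close>

lemma expands_sqrt: "expands False (\<lambda>b l y. complex_of_real (sqrt (1 - (\<sigma> * l)\<^sup>2)))"
proof -
  obtain R :: "real \<Rightarrow> real" where R: "\<And>z. \<bar>z\<bar> < 1 \<Longrightarrow> sqrt (1 + z) = (\<Sum>k<\<kappa>. ((1/2) gchoose k) * z ^ k) + z ^ \<kappa> * R z"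
    "\<And>q. q < 1 \<Longrightarrow> \<exists>B. \<forall>z. \<bar>z\<bar> \<le> q \<longrightarrow> \<bar>R z\<bar> \<le> B" by (rule sqrt_expansion) blast
  show ?thesis
  proof (rule expandsI[of _ "\<lambda>b l y. \<Sum>k<\<kappa>. complex_of_real ((1/2) gchoose k) * (- (complex_of_real (\<sigma> * l))\<^sup>2) ^ k"
        "\<lambda>b l y. complex_of_real (- \<sigma>\<^sup>2) ^ \<kappa> * complex_of_real l ^ \<kappa> * complex_of_real (R (- (\<sigma> * l)\<^sup>2))"])
    show "SP False UNIV (\<lambda>b l y. \<Sum>k<\<kappa>. complex_of_real ((1/2) gchoose k) * (- (complex_of_real (\<sigma> * l))\<^sup>2) ^ k)"
      by (rule SP_weaken[OF SP_sum[OF L0_mult[OF L_const L0_power[OF SP_minus[OF L0_power[OF L_mu0]]]]]]) auto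
    show "sm False K n (\<lambda>p y. complex_of_real (- \<sigma>\<^sup>2) ^ \<kappa> * complex_of_real (snd p) ^ \<kappa> * complex_of_real (R (- (\<sigma> * snd p)\<^sup>2)))"
      if k: "kreg q M K" for q M K n
    proof -
      have "q\<^sup>2 < 1" using kreg'(1,2)[OF k] by (simp add: abs_square_less_1)
      from R(2)[OF this] obtain B where B: "\<And>z. \<bar>z\<bar> \<le> q\<^sup>2 \<Longrightarrow> \<bar>R z\<bar> \<le> B" by blast
      have "\<bar>- (\<sigma> * snd p)\<^sup>2\<bar> \<le> q\<^sup>2" if "p \<in> K" for p
        using power_mono[OF kreg'(3)[OF k that] abs_ge_zero, of 2] unfolding abs_minus_cancel abs_power2 power2_abs .
      then have "sm False K n (\<lambda>p y. complex_of_real (R (- (\<sigma> * snd p)\<^sup>2)))"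
        by (intro sm_of_real sm_const[where M=B]) (auto intro: B simp del: abs_minus_cancel)
      then show ?thesis
        by (intro sm_mult_decay(3)[OF sm_mult_decay(3)[OF sm_const[where M="norm (complex_of_real (- \<sigma>\<^sup>2) ^ \<kappa>)", OF order_refl] kreg_power[OF k]]])
    qed
  next
    fix b l y :: real assume m: "\<bar>\<sigma> * l\<bar> < 1"
    have "\<bar>- (\<sigma> * l)\<^sup>2\<bar> < 1" using m by (simp only: abs_minus_cancel abs_power2 abs_square_less_1)
    from arg_cong[OF R(1)[OF this], of complex_of_real]
    show "complex_of_real (sqrt (1 - (\<sigma> * l)\<^sup>2)) = (\<Sum>k<\<kappa>. complex_of_real ((1/2) gchoose k) * (- (complex_of_real (\<sigma> * l))\<^sup>2) ^ k)
       + complex_of_real l ^ \<kappa> * (complex_of_real (- \<sigma>\<^sup>2) ^ \<kappa> * complex_of_real l ^ \<kappa> * complex_of_real (R (- (\<sigma> * l)\<^sup>2)))"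
    proof -
      have e: "complex_of_real (- (\<sigma> * l)\<^sup>2) ^ \<kappa> = complex_of_real l ^ \<kappa> * (complex_of_real (- \<sigma>\<^sup>2) ^ \<kappa> * complex_of_real l ^ \<kappa>)"
        unfolding power_mult_distrib[symmetric] by (intro arg_cong[where f="\<lambda>x. x ^ \<kappa>"]) (simp add: power2_eq_square)
      assume "complex_of_real (sqrt (1 + - (\<sigma> * l)\<^sup>2)) = complex_of_real ((\<Sum>k<\<kappa>. ((1/2) gchoose k) * (- (\<sigma> * l)\<^sup>2) ^ k) + (- (\<sigma> * l)\<^sup>2) ^ \<kappa> * R (- (\<sigma> * l)\<^sup>2))"
      then have "complex_of_real (sqrt (1 - (\<sigma> * l)\<^sup>2)) = (\<Sum>k<\<kappa>. complex_of_real ((1/2) gchoose k) * complex_of_real (- (\<sigma> * l)\<^sup>2) ^ k)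
          + complex_of_real (- (\<sigma> * l)\<^sup>2) ^ \<kappa> * complex_of_real (R (- (\<sigma> * l)\<^sup>2))"
        by (simp only: of_real_add of_real_mult of_real_power of_real_sum add_uminus_conv_diff)
      then show ?thesis unfolding e by (simp add: mult_ac)
    qed
  qed
qed

lemma expands_Gg_sq: "expands False (\<lambda>b l y. complex_of_real ((Gg (\<sigma> * l) y)\<^sup>2))"
  by (rule expands_cong[OF expands_mult'(1)[OF expands_sqrt expands_rec]]) (simp add: Gg_sq)

lemma expands_g1: "expands False (\<lambda>b l y. complex_of_real (g1 (\<sigma> * l) y))"
proof -
  have "expands False (\<lambda>b l y. complex_of_real (\<sigma> * l) * (1 - (complex_of_real (th y))\<^sup>2) * complex_of_real (1 / (1 - \<sigma> * l * th y)))"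
    by (intro expands_mult'(1)[OF _ expands_rec] expands_SP[where T="{(j, k). 0 \<le> k}"] L0_intros L_mu0)
  then show ?thesis by (rule expands_cong) simp
qed

text \<open>Multiplying by the conjugate turns the gauge factor into G^2, for which an expansion is
  available.\<close>

lemma expands_sq:
  assumes "expands True F"
  shows "expands True (\<lambda>b l y. complex_of_real ((Gg (\<sigma> * l) y)\<^sup>2 * (cmod (F b l y))\<^sup>2))"
  by (rule expands_cong[OF expands_mult'(1)[OF expands_Gg_sq expands_mult'(3)[OF assms expands_cnj[OF assms]]]])
    (simp add: complex_norm_square[symmetric] del: complex_norm_square)

lemma expands_V: "expands True V" by (rule expands_SP[OF L_V])

lemma expands_PP_sq: "expands True (\<lambda>b l y. complex_of_real ((cmod (PP b l y))\<^sup>2))"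
  by (rule expands_cong[OF expands_sq[OF expands_V]]) (simp add: PP_def norm_mult power_mult_distrib)

lemma expands_eps: "expands True (\<lambda>b l y. complex_of_real (eps b l y))"
proof -
  have lin: "L False 0 (\<lambda>b l y. complex_of_real y)" by (intro L_real allI sm_y)
  have U: "expands True (\<lambda>b l y. V1 b l y + (complex_of_real (g1 (\<sigma> * l) y) * V b l y + complex_of_real (-1/2) * (xb b * complex_of_real y * V b l y)))"
    by (intro expands_add expands_SP[OF L_V1] expands_mult'(1)[OF expands_g1 expands_V] expands_cmult
        expands_mult'(1)[OF expands_SP[OF L0_mult[OF L_xb lin]] expands_V])
  have n: "cmod (wy b l y) = cmod (complex_of_real (Gg (\<sigma> * l) y) * (V1 b l y + (complex_of_real (g1 (\<sigma> * l) y) * V b l y + complex_of_real (-1/2) * (xb b * complex_of_real y * V b l y))))" for b l y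
  proof -
    have "PPy b l y - \<i> * complex_of_real (b * y / 2) * PP b l y = complex_of_real (Gg (\<sigma> * l) y) * (V1 b l y + (complex_of_real (g1 (\<sigma> * l) y) * V b l y + complex_of_real (-1/2) * (xb b * complex_of_real y * V b l y)))"
      unfolding PPy_def PP_def of_real_mult[of b] of_real_divide by (simp add: algebra_simps)
    then show ?thesis unfolding wy_def norm_mult[of "Ee b y"] cmod_Ee by simp
  qed
  have 1: "expands True (\<lambda>b l y. complex_of_real ((cmod (wy b l y))\<^sup>2))"
    by (rule expands_cong[OF expands_sq[OF U]]) (simp only: n norm_mult power_mult_distrib norm_of_real power2_abs)
  note p = expands_PP_sq
  have 2: "expands True (\<lambda>b l y. complex_of_real ((cmod (PP b l y))\<^sup>2) * (complex_of_real ((cmod (PP b l y))\<^sup>2) * complex_of_real ((cmod (PP b l y))\<^sup>2)))"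
    by (intro expands_mult'(3) p)
  have "expands True (\<lambda>b l y. complex_of_real (1/2) * complex_of_real ((cmod (wy b l y))\<^sup>2)
     + complex_of_real (-1/6) * (complex_of_real ((cmod (PP b l y))\<^sup>2) * (complex_of_real ((cmod (PP b l y))\<^sup>2) * complex_of_real ((cmod (PP b l y))\<^sup>2))))"
    by (intro expands_add expands_cmult 1 2)
  then show ?thesis
    by (rule expands_cong) (simp add: eps_def w_def norm_mult cmod_Ee eval_nat_numeral)
qed

definition Ev :: "(nat \<times> nat) set" where "Ev = {(j, k). even j \<and> j + 2 * k < 2 * \<kappa>}"

lemma finite_Ev: "finite Ev"
  by (rule finite_subset[of _ "{..2*\<kappa>} \<times> {..\<kappa>}"]) (auto simp: Ev_def)

definition Ep :: "(nat \<times> nat \<Rightarrow> real) \<Rightarrow> real \<Rightarrow> real \<Rightarrow> real" where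
  "Ep e b l = (\<Sum>p\<in>Ev. e p * (b ^ fst p * l ^ snd p))"

text \<open>The sets may lie in \<lambda> = 0, where the coefficients with k = 0 are identified; the
  coefficients \<open>e\<close> are common to all sets and only the constant depends on the
  set.\<close>

definition scalar_expansion :: "(nat \<times> nat \<Rightarrow> real) \<Rightarrow> (real \<Rightarrow> real \<Rightarrow> real) \<Rightarrow> bool" where
  "scalar_expansion e f \<longleftrightarrow> (\<forall>q M K. kreg q M K \<longrightarrow> (\<forall>p\<in>K. snd p \<ge> 0) \<longrightarrow>
     (\<exists>C. \<forall>p\<in>K. \<bar>f (fst p) (snd p) - Ep e (fst p) (snd p)\<bar> \<le> C * ((fst p)\<^sup>2 + snd p) ^ \<kappa>))"

lemma scalar_expansion_add:
  assumes "scalar_expansion e f" "scalar_expansion e' g"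
  shows "scalar_expansion (\<lambda>p. e p + e' p) (\<lambda>b l. f b l + g b l)"
  unfolding scalar_expansion_def
proof (intro allI impI)
  fix q M K assume k: "kreg q M K" "\<forall>p\<in>K. snd p \<ge> 0"
  obtain C where C: "\<forall>p\<in>K. \<bar>f (fst p) (snd p) - Ep e (fst p) (snd p)\<bar> \<le> C * ((fst p)\<^sup>2 + snd p) ^ \<kappa>"
    using assms(1) k unfolding scalar_expansion_def by blast
  obtain C' where C': "\<forall>p\<in>K. \<bar>g (fst p) (snd p) - Ep e' (fst p) (snd p)\<bar> \<le> C' * ((fst p)\<^sup>2 + snd p) ^ \<kappa>"
    using assms(2) k unfolding scalar_expansion_def by blast
  have E: "Ep (\<lambda>p. e p + e' p) b l = Ep e b l + Ep e' b l" for b l by (simp add: Ep_def sum.distrib algebra_simps)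
  have tri: "\<bar>x + y - (s + t)\<bar> \<le> (A + B) * W" if "\<bar>x - s\<bar> \<le> A * W" "\<bar>y - t\<bar> \<le> B * W" for x y s t A B W :: real
    using that unfolding distrib_right by linarith
  show "\<exists>C. \<forall>p\<in>K. \<bar>f (fst p) (snd p) + g (fst p) (snd p) - Ep (\<lambda>p. e p + e' p) (fst p) (snd p)\<bar> \<le> C * ((fst p)\<^sup>2 + snd p) ^ \<kappa>"
    unfolding E by (intro exI[of _ "C + C'"] ballI tri C[rule_format] C'[rule_format])
qed

lemma scalar_expansion_cmult:
  assumes "scalar_expansion e f" shows "scalar_expansion (\<lambda>p. u * e p) (\<lambda>b l. u * f b l)"
  unfolding scalar_expansion_def
proof (intro allI impI)
  fix q M K assume k: "kreg q M K" "\<forall>p\<in>K. snd p \<ge> 0"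
  obtain C where C: "\<forall>p\<in>K. \<bar>f (fst p) (snd p) - Ep e (fst p) (snd p)\<bar> \<le> C * ((fst p)\<^sup>2 + snd p) ^ \<kappa>"
    using assms(1) k unfolding scalar_expansion_def by blast
  have "Ep (\<lambda>p. u * e p) b l = u * Ep e b l" for b l by (simp add: Ep_def sum_distrib_left mult_ac)
  then have "\<bar>u * f b l - Ep (\<lambda>p. u * e p) b l\<bar> = \<bar>u\<bar> * \<bar>f b l - Ep e b l\<bar>" for b l
    by (simp add: abs_mult[symmetric] right_diff_distrib)
  then show "\<exists>C. \<forall>p\<in>K. \<bar>u * f (fst p) (snd p) - Ep (\<lambda>p. u * e p) (fst p) (snd p)\<bar> \<le> C * ((fst p)\<^sup>2 + snd p) ^ \<kappa>"
    using C by (intro exI[of _ "\<bar>u\<bar> * C"]) (auto simp: mult.assoc intro: mult_left_mono)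
qed

lemma scalar_expansion_cong:
  assumes "scalar_expansion e f" "\<And>b l. \<bar>\<sigma> * l\<bar> < 1 \<Longrightarrow> f b l = g b l"
  shows "scalar_expansion e g"
  unfolding scalar_expansion_def
proof (intro allI impI)
  fix q M K assume k: "kreg q M K" "\<forall>p\<in>K. snd p \<ge> 0"
  then obtain C where "\<forall>p\<in>K. \<bar>f (fst p) (snd p) - Ep e (fst p) (snd p)\<bar> \<le> C * ((fst p)\<^sup>2 + snd p) ^ \<kappa>"
    using assms(1) unfolding scalar_expansion_def by blast
  then show "\<exists>C. \<forall>p\<in>K. \<bar>g (fst p) (snd p) - Ep e (fst p) (snd p)\<bar> \<le> C * ((fst p)\<^sup>2 + snd p) ^ \<kappa>"
    using assms(2)[OF kreg'(6)[OF k(1)]] by (intro exI[of _ C]) metis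
qed

lemma Ep_zero: "Ep (\<lambda>p. 0) b l = 0" by (simp add: Ep_def)

text \<open>A monomial with j + 2k below 2\<kappa> is kept, any other is of error size by
  \<open>weight_bound\<close>; the prefactor removes odd powers of b.\<close>

lemma scalar_expansion_term:
  "\<exists>e. scalar_expansion e (\<lambda>b l. (if even j then u else 0) * (b ^ j * l ^ k))"
proof (cases "even j")
  case False
  then show ?thesis by (intro exI[of _ "\<lambda>p. 0"]) (auto simp: scalar_expansion_def Ep_zero intro!: exI[of _ 0])
next
  case True
  show ?thesis
  proof (cases "j + 2 * k < 2 * \<kappa>")
    case jk: True
    have "Ep (\<lambda>p. if p = (j, k) then u else 0) b l = u * (b ^ j * l ^ k)" for b l
      unfolding Ep_def using finite_Ev True jk by (subst sum.remove[of _ "(j, k)"]) (auto simp: Ev_def intro!: sum.neutral)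
    then show ?thesis using True by (intro exI[of _ "\<lambda>p. if p = (j, k) then u else 0"]) (auto simp: scalar_expansion_def intro!: exI[of _ 0])
  next
    case jk: False
    have "\<exists>C. \<forall>p\<in>K. \<bar>u * (fst p ^ j * snd p ^ k)\<bar> \<le> C * ((fst p)\<^sup>2 + snd p) ^ \<kappa>" if k: "kreg q M K" "\<forall>p\<in>K. snd p \<ge> 0" for q M K
    proof (intro exI[of _ "\<bar>u\<bar> * (M\<^sup>2 + M) ^ (j + 2 * k)"] ballI)
      fix p assume p: "p \<in> K"
      have M: "M \<ge> 1" using k by (simp add: kreg_def)
      have "(fst p)\<^sup>2 \<le> M\<^sup>2" using power_mono[OF kreg'(4)[OF k(1) p] abs_ge_zero, of 2] by simp
      moreover have "snd p \<le> M" using kreg'(5)[OF k(1) p] by simp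
      moreover have "M\<^sup>2 + M \<ge> 1" using M by (simp add: add_increasing)
      ultimately have "\<bar>fst p ^ j * snd p ^ k\<bar> \<le> (M\<^sup>2 + M) ^ (j + 2 * k) * ((fst p)\<^sup>2 + snd p) ^ \<kappa>"
        using k(2) p jk by (intro weight_bound) auto
      from mult_left_mono[OF this abs_ge_zero[of u]]
      show "\<bar>u * (fst p ^ j * snd p ^ k)\<bar> \<le> \<bar>u\<bar> * (M\<^sup>2 + M) ^ (j + 2 * k) * ((fst p)\<^sup>2 + snd p) ^ \<kappa>" by (simp add: abs_mult mult.assoc)
    qed
    then show ?thesis using True by (intro exI[of _ "\<lambda>p. 0"]) (simp add: scalar_expansion_def Ep_zero)
  qed
qed

text \<open>Stated for a linear functional so that integration over an edge and evaluation at the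
  vertex, the two ingredients of \<open>EE\<close>, share one argument. \<open>bd\<close> controls
  the functional on the remainder.\<close>

lemma scalar_expansion_functional:
  fixes \<Phi> :: "(real \<Rightarrow> real) \<Rightarrow> real"
  assumes F: "expands True F"
    and add: "\<And>f g. hintegrable f \<Longrightarrow> hintegrable g \<Longrightarrow> \<Phi> (\<lambda>y. f y + g y) = \<Phi> f + \<Phi> g"
    and cmult: "\<And>a f. \<Phi> (\<lambda>y. a * f y) = a * \<Phi> f"
    and cong: "\<And>f g. (\<And>y. y \<ge> 0 \<Longrightarrow> f y = g y) \<Longrightarrow> \<Phi> f = \<Phi> g"
    and bd: "\<And>(K :: (real \<times> real) set) R. sm True K (Suc 0) R \<Longrightarrow> \<exists>C. \<forall>p\<in>K. \<bar>\<Phi> (R p)\<bar> \<le> C"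
  shows "\<exists>e. scalar_expansion e (\<lambda>b l. \<Phi> (\<lambda>y. Re (F b l y)))"
proof -
  obtain P R where P: "SP True UNIV P" and R: "\<And>q M K n. kreg q M K \<Longrightarrow> sm True K n (\<lambda>p. R (fst p) (snd p))"
    and FPR: "\<And>b l y. \<bar>\<sigma> * l\<bar> < 1 \<Longrightarrow> y \<ge> 0 \<Longrightarrow> F b l y = P b l y + complex_of_real l ^ \<kappa> * R b l y" using F by (rule expandsE) blast
  have int: "hintegrable (\<lambda>y. Re (G b l y))" if "sm True {(b, l)} (Suc 0) (\<lambda>p. G (fst p) (snd p))" for b l G
    using sm_hintegrable[OF sm_linear[OF bounded_linear_Re that] insertI1] by simp
  have Pi: "hintegrable (\<lambda>y. Re (G b l y))" if "SP True UNIV G" for b l G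
    by (rule int[OF SP_sm[OF that, where M="max \<bar>b\<bar> \<bar>l\<bar>"]]) auto
  have "\<exists>e. scalar_expansion e (\<lambda>b l. \<Phi> (\<lambda>y. Re (P b l y)))"
    using P
  proof induction
    case SP_zero
    show ?case using cmult[of 0 "\<lambda>y. 0"] by (intro exI[of _ "\<lambda>p. 0"]) (auto simp: scalar_expansion_def Ep_zero intro!: exI[of _ 0])
  next
    case (SP_term j k f)
    obtain r :: real where r: "\<And>b. Re (xb b ^ j) = (if even j then r else 0) * b ^ j"
    proof (cases "even j")
      case True
      then obtain m where "j = 2 * m" by blast
      then have "xb b ^ j = complex_of_real ((-1) ^ m * b ^ j)" for b by (simp add: power_mult power_mult_distrib power_minus[of "(complex_of_real b)\<^sup>2" for b])
      then have "Re (xb b ^ j) = (-1) ^ m * b ^ j" for b by (simp only: Re_complex_of_real)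
      then show ?thesis using True that[of "(-1) ^ m"] by simp
    next
      case False
      then obtain m where "j = Suc (2 * m)" using oddE by fastforce
      then have "xb b ^ j = \<i> * complex_of_real ((-1) ^ m * b ^ j)" for b by (simp add: power_mult power_mult_distrib power_minus[of "(complex_of_real b)\<^sup>2" for b])
      then have "Re (xb b ^ j) = 0" for b by simp
      then show ?thesis using False that[of 0] by simp
    qed
    have re: "Re (xb b ^ j * complex_of_real l ^ k * complex_of_real (f y)) = (if even j then r else 0) * (b ^ j * l ^ k) * f y" for b l y
    proof -
      have "xb b ^ j * complex_of_real l ^ k * complex_of_real (f y) = complex_of_real (l ^ k * f y) * xb b ^ j" by simp
      then show ?thesis by (simp only: Re_of_real_mult r) (simp add: mult_ac)
    qed
    have "\<Phi> (\<lambda>y. Re (xb b ^ j * complex_of_real l ^ k * complex_of_real (f y))) = (if even j then r * \<Phi> f else 0) * (b ^ j * l ^ k)" for b l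
      unfolding re cmult by simp
    then show ?case using scalar_expansion_term[of j "r * \<Phi> f" k] by simp
  next
    case (SP_add G H)
    from SP_add.IH obtain e e' where "scalar_expansion e (\<lambda>b l. \<Phi> (\<lambda>y. Re (G b l y)))" "scalar_expansion e' (\<lambda>b l. \<Phi> (\<lambda>y. Re (H b l y)))" by blast
    from scalar_expansion_add[OF this] show ?case using add[OF Pi[OF SP_add.hyps(1)] Pi[OF SP_add.hyps(2)]] by auto
  next
    case (SP_cong G H)
    then show ?case using cong[of "\<lambda>y. Re (G _ _ y)" "\<lambda>y. Re (H _ _ y)"] by simp
  qed
  then obtain e where e: "scalar_expansion e (\<lambda>b l. \<Phi> (\<lambda>y. Re (P b l y)))" by blast
  have r: "scalar_expansion (\<lambda>p. 0) (\<lambda>b l. l ^ \<kappa> * \<Phi> (\<lambda>y. Re (R b l y)))"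
    unfolding scalar_expansion_def Ep_zero
  proof (intro allI impI)
    fix q M K assume k: "kreg q M K" "\<forall>p\<in>K. snd p \<ge> 0"
    from bd[OF sm_linear[OF bounded_linear_Re R[OF k(1)]]] obtain C where C: "\<And>p. p \<in> K \<Longrightarrow> \<bar>\<Phi> (\<lambda>y. Re (R (fst p) (snd p) y))\<bar> \<le> C" by blast
    have "\<bar>snd p ^ \<kappa> * \<Phi> (\<lambda>y. Re (R (fst p) (snd p) y))\<bar> \<le> \<bar>C\<bar> * ((fst p)\<^sup>2 + snd p) ^ \<kappa>" if p: "p \<in> K" for p
    proof -
      have "\<bar>snd p ^ \<kappa>\<bar> \<le> ((fst p)\<^sup>2 + snd p) ^ \<kappa>" using k(2) p by (auto simp: power_abs intro!: power_mono)
      moreover have "\<bar>\<Phi> (\<lambda>y. Re (R (fst p) (snd p) y))\<bar> \<le> \<bar>C\<bar>" using C[OF p] by simp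
      ultimately show ?thesis unfolding abs_mult[of "snd p ^ \<kappa>"] mult.commute[of "\<bar>C\<bar>"] using k(2) p by (intro mult_mono) auto
    qed
    then show "\<exists>C. \<forall>p\<in>K. \<bar>snd p ^ \<kappa> * \<Phi> (\<lambda>y. Re (R (fst p) (snd p) y)) - 0\<bar> \<le> C * ((fst p)\<^sup>2 + snd p) ^ \<kappa>" unfolding diff_0_right by (intro exI[of _ "\<bar>C\<bar>"] ballI)
  qed
  have "\<Phi> (\<lambda>y. Re (P b l y)) + l ^ \<kappa> * \<Phi> (\<lambda>y. Re (R b l y)) = \<Phi> (\<lambda>y. Re (F b l y))" if m: "\<bar>\<sigma> * l\<bar> < 1" for b l
  proof -
    have iR: "hintegrable (\<lambda>y. Re (R b l y))" by (rule int[OF R[OF singleton_kreg[OF m]]])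
    have "\<Phi> (\<lambda>y. Re (F b l y)) = \<Phi> (\<lambda>y. Re (P b l y) + l ^ \<kappa> * Re (R b l y))"
      by (rule cong) (simp add: FPR[OF m] Re_of_real_mult[of _ "l ^ \<kappa>", unfolded of_real_power])
    also have "\<dots> = \<Phi> (\<lambda>y. Re (P b l y)) + \<Phi> (\<lambda>y. l ^ \<kappa> * Re (R b l y))"
      by (rule add[OF Pi[OF P] set_integrable_mult_right[OF iR]])
    finally show ?thesis unfolding cmult ..
  qed
  from scalar_expansion_cong[OF scalar_expansion_add[OF e r] this] show ?thesis by blast
qed

lemma EE_expansion: obtains e where "scalar_expansion e EE"
proof -
  obtain e1 where e1: "scalar_expansion e1 (\<lambda>b l. hint (\<lambda>y. Re (complex_of_real (eps b l y))))"
  proof -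
    have "\<exists>e. scalar_expansion e (\<lambda>b l. hint (\<lambda>y. Re (complex_of_real (eps b l y))))"
    proof (rule scalar_expansion_functional[OF expands_eps])
      show "\<exists>C. \<forall>p\<in>K. \<bar>hint (R p)\<bar> \<le> C" if "sm True K (Suc 0) R" for K :: "(real \<times> real) set" and R :: "real \<times> real \<Rightarrow> real \<Rightarrow> real"
        by (rule hint_bounded_on[OF that]) blast
    qed (rule set_integral_add(2) hint_cmult hint_cong; simp)+
    then show thesis using that by blast
  qed
  obtain e2 where e2: "scalar_expansion e2 (\<lambda>b l. Re (complex_of_real l * complex_of_real ((cmod (PP b l 0))\<^sup>2)))"
  proof -
    have "\<exists>e. scalar_expansion e (\<lambda>b l. (\<lambda>f. f 0) (\<lambda>y. Re (complex_of_real l * complex_of_real ((cmod (PP b l y))\<^sup>2))))"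
    proof (rule scalar_expansion_functional[OF expands_mult'(1)[OF expands_SP[OF L_lam] expands_PP_sq]])
      show "\<exists>C. \<forall>p\<in>K. \<bar>R p 0\<bar> \<le> C" if "sm True K (Suc 0) R" for K :: "(real \<times> real) set" and R :: "real \<times> real \<Rightarrow> real \<Rightarrow> real"
        using at_zero_bounded[OF that] by (metis real_norm_def)
    qed auto
    then show thesis using that by blast
  qed
  have "scalar_expansion (\<lambda>p. real N * e1 p + \<gamma> / 2 * e2 p) EE"
    by (rule scalar_expansion_cong[OF scalar_expansion_add[OF scalar_expansion_cmult[OF e1, of "real N"] scalar_expansion_cmult[OF e2, of "\<gamma> / 2"]]])
      (simp add: EE_def)
  then show thesis by (rule that)
qed

end

text \<open>Uniqueness of expansions in one variable: letting x tend to 0 kills the constant term,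
  and dividing by x lowers n.\<close>

lemma small_polynomial_zero:
  fixes d :: "nat \<Rightarrow> real"
  assumes "\<And>x. 0 < x \<Longrightarrow> x \<le> 1 \<Longrightarrow> \<bar>\<Sum>j<n. d j * x ^ j\<bar> \<le> C * x ^ n" "j < n"
  shows "d j = 0"
  using assms
proof (induction n arbitrary: d j)
  case (Suc n)
  have d0: "d 0 = 0"
  proof -
    have "((\<lambda>x. \<bar>\<Sum>j<Suc n. d j * x ^ j\<bar>) \<longlongrightarrow> \<bar>\<Sum>j<Suc n. d j * 0 ^ j\<bar>) (at_right 0)"
      by (intro tendsto_intros)
    moreover have "((\<lambda>x. C * x ^ Suc n) \<longlongrightarrow> C * 0 ^ Suc n) (at_right 0)" by (intro tendsto_intros)
    moreover have "\<forall>\<^sub>F x in at_right 0. \<bar>\<Sum>j<Suc n. d j * x ^ j\<bar> \<le> C * x ^ Suc n"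
      unfolding eventually_at_right_field using Suc.prems(1) by (intro exI[of _ 1]) auto
    ultimately have "\<bar>\<Sum>j<Suc n. d j * 0 ^ j\<bar> \<le> C * 0 ^ Suc n" by (intro tendsto_le[of "at_right (0::real)"]) auto
    then show ?thesis unfolding sum.lessThan_Suc_shift by simp
  qed
  have "\<bar>\<Sum>j<n. d (Suc j) * x ^ j\<bar> \<le> C * x ^ n" if x: "0 < x" "x \<le> 1" for x
  proof -
    have "(\<Sum>j<Suc n. d j * x ^ j) = x * (\<Sum>j<n. d (Suc j) * x ^ j)"
      unfolding sum.lessThan_Suc_shift d0 sum_distrib_left by (simp add: mult_ac)
    then have "x * \<bar>\<Sum>j<n. d (Suc j) * x ^ j\<bar> \<le> x * (C * x ^ n)"
      using Suc.prems(1)[OF x] x by (simp add: abs_mult mult_ac)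
    then show ?thesis using x by simp
  qed
  from Suc.IH[OF this] have "d (Suc i) = 0" if "i < n" for i using that by blast
  then show ?case using d0 Suc.prems(2) by (cases j) auto
qed simp

section \<open>Identification of the leading energy coefficients\<close>

lemma Gg_0: "Gg 0 y = 1" by (simp add: Gg_def)

lemma Sg_0: "Sg \<kappa> c b 0 y = 0"
  unfolding Sg_def by (intro sum.neutral) (auto simp: Theta_iff)

text \<open>At the origin only the monomial \<lambda> itself has a nonzero derivative in
  \<lambda>.\<close>

lemma Sl_0:
  assumes "\<kappa> \<ge> 2" shows "Sl \<kappa> c 0 0 y = complex_of_real (c 0 1 y)"
proof -
  have "(0, 1) \<in> Theta \<kappa>" using assms by (simp add: Theta_iff)
  then have "Sl \<kappa> c 0 0 y = complex_of_real (c 0 1 y) + (\<Sum>(j, k)\<in>Theta \<kappa> - {(0, 1)}. xb 0 ^ j * (of_nat k * complex_of_real 0 ^ (k - 1)) * complex_of_real (c j k y))"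
    unfolding Sl_def by (subst sum.remove[OF finite_Theta]) auto
  also have "(\<Sum>(j, k)\<in>Theta \<kappa> - {(0, 1)}. xb 0 ^ j * (of_nat k * complex_of_real 0 ^ (k - 1)) * complex_of_real (c j k y)) = 0"
  proof (intro sum.neutral ballI)
    fix p assume p: "p \<in> Theta \<kappa> - {(0, 1)}"
    obtain j k where jk: "p = (j, k)" by (cases p)
    then have "j > 0 \<or> k - 1 > 0" using p by (auto simp: Theta_iff)
    then show "(case p of (j, k) \<Rightarrow> xb 0 ^ j * (of_nat k * complex_of_real 0 ^ (k - 1)) * complex_of_real (c j k y)) = 0"
      unfolding jk by (auto simp: zero_power)
  qed
  finally show ?thesis by simp
qed

lemma yQ_norm_sq: "(yQ_norm N)\<^sup>2 = real N * Iq"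
proof -
  have "hint (\<lambda>y. cmod (complex_of_real y * Q i y) ^ 2) = Iq" for i
    unfolding Iq_def by (rule hint_cong) (simp add: Q_qr norm_mult power_mult_distrib)
  then have "(yQ_norm N)\<^sup>2 = root 2 (real N * Iq) ^ 2" unfolding yQ_norm_def Lp_norm_def by simp
  also have "\<dots> = real N * Iq" using Iq_pos by (intro real_root_pow_pos2) auto
  finally show ?thesis .
qed

lemma alpha_star_eq: "alpha_star N \<gamma> = - 2 * \<gamma> * (qr 0)\<^sup>2 / (real N * Iq)"
  unfolding alpha_star_def yQ_norm_sq Q_qr by simp

lemma C_Q_eq: "C_Q N = real N * Iq / 8"
  unfolding C_Q_def yQ_norm_sq by simp

text \<open>Q has zero energy, as befits the mass-critical power: the density is the derivative of Q
  Q' / 4, which vanishes at the vertex.\<close>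

lemma hint_pohozaev: "hint (\<lambda>y. (1/2) * ((th y)\<^sup>2 * (qr y)\<^sup>2) + (-1/6) * (qr y) ^ 6) = 0"
proof -
  have s: "smi True (\<lambda>y. (-1/4) * (qr y * (th y * qr y)))"
    by (intro smi_cmult smi_mult[OF smi_qr, of True] allI sm_mult_decay(2)[OF sm_th] smi_qr[rule_format])
  have "hderiv (\<lambda>y. (-1/4) * (qr y * (th y * qr y))) ((1/2) * ((th y)\<^sup>2 * (qr y)\<^sup>2) + (-1/6) * (qr y) ^ 6) y" for y
  proof -
    have "qr y ^ 6 = qr y ^ 4 * qr y ^ 2" by simp
    then have 6: "qr y ^ 6 = 3 * (1 - (th y)\<^sup>2) * (qr y)\<^sup>2" unfolding qr_4 .
    show ?thesis unfolding 6 using hderiv_qr[of y] hderiv_tanh2[of y] unfolding has_real_derivative_iff_has_vector_derivative[symmetric]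
      by (auto intro!: derivative_eq_intros simp: field_simps power2_eq_square)
  qed
  from smi_hint_deriv[OF s this] show ?thesis by simp
qed

context prof begin

lemma V_l0: "V b 0 y = complex_of_real (qr y)" "V1 b 0 y = - complex_of_real (th y * qr y)"
  by (simp_all add: Vf_def Vy_def Sg_0)

lemma PP_l0: "PP b 0 y = complex_of_real (qr y)" "PPy b 0 y = - complex_of_real (th y * qr y)"
  by (simp_all add: PP_def PPy_def V_l0 Gg_0)

text \<open>At \<lambda> = 0 the profile is Q with trivial gauge, and the phase adds b^2 y^2 Q^2 / 4
  to the squared modulus of w_y. As Q has zero energy, b^2 / 8 times the squared norm of yQ is
  left.\<close>

lemma EE_l0: "EE b 0 = C_Q N * b\<^sup>2"
proof -
  have w6: "((cmod (w b 0 y))\<^sup>2) ^ 3 = qr y ^ 6" for y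
    unfolding cmod_powers(2)[symmetric] w_def norm_mult cmod_Ee PP_l0 norm_of_real using qr_pos[of y] by simp
  have wy2: "(cmod (wy b 0 y))\<^sup>2 = (th y)\<^sup>2 * (qr y)\<^sup>2 + b\<^sup>2 / 4 * (y\<^sup>2 * (qr y)\<^sup>2)" for y
  proof -
    have "cmod (wy b 0 y) = cmod (Complex (- (th y * qr y)) (- (b * y / 2 * qr y)))"
      unfolding wy_def norm_mult cmod_Ee PP_l0 by (simp add: Complex_eq mult.assoc)
    then show ?thesis by (simp add: cmod_power2 power_mult_distrib power_divide)
  qed
  have s1: "smi True (\<lambda>y. (1/2) * ((th y)\<^sup>2 * (qr y)\<^sup>2) + (-1/6) * (qr y) ^ 6)"
  proof -
    have "smi True (\<lambda>y. (1/2) * ((qr y * th y) * (qr y * th y)) + (-1/6) * (qr y * (qr y * (qr y * (qr y * (qr y * qr y))))))"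
      by (intro allI sm_add smi_cmult[rule_format] smi_mult[rule_format] smi_qr[rule_format] sm_mult_decay(5) sm_mult_decay(1)[OF _ sm_th])
    then show ?thesis by (simp add: eval_nat_numeral mult_ac)
  qed
  have "hint (eps b 0) = hint (\<lambda>y. ((1/2) * ((th y)\<^sup>2 * (qr y)\<^sup>2) + (-1/6) * (qr y) ^ 6) + b\<^sup>2 / 8 * (y\<^sup>2 * (qr y)\<^sup>2))"
    by (rule hint_cong) (simp only: eps_def w6 wy2, simp add: field_simps)
  also have "\<dots> = b\<^sup>2 / 8 * Iq"
    unfolding hint_add[OF s1 smi_cmult[OF smi_yq]] hint_pohozaev hint_cmult Iq_def by simp
  finally show ?thesis unfolding EE_def C_Q_eq by simp
qed

text \<open>Let r be the \<lambda>-derivative of the profile at the origin. By Q^5 = Q - Q'' the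
  variation of the density is the derivative of Q' r, minus Q r. The first part integrates to 0
  because Q'(0) = 0, the second by orthogonality, and the vertex term remains.\<close>

lemma EEl_00:
  assumes k2: "\<kappa> \<ge> 2" and orth: "hint (\<lambda>y. qr y * (c 0 1 y + \<sigma> / 2 * (th y * qr y))) = 0"
  shows "EEl 0 0 = \<gamma> / 2 * (qr 0)\<^sup>2"
proof -
  define r where "r y = c 0 1 y + \<sigma> / 2 * (th y * qr y)" for y
  have sr: "smi True r" unfolding r_def[abs_def]
  proof -
    have "smi True (c 0 1)" using ok by (simp add: coeffs_ok_def)
    then show "smi True (\<lambda>y. c 0 1 y + \<sigma> / 2 * (th y * qr y))"
      by (intro allI sm_add smi_cmult[rule_format] sm_mult_decay(2)[OF sm_th] smi_qr[rule_format]) blast+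
  qed
  have E: "Ee 0 y = 1" for y by (simp add: Ee_def)
  have wl0: "wl 0 0 y = complex_of_real (r y)" for y
    unfolding wl_def PPl_def by (simp add: E Gg_0 Sl_0[OF k2] V_l0 r_def)
  have w0: "w 0 0 y = complex_of_real (qr y)" "wy 0 0 y = complex_of_real (- (th y * qr y))" for y
    unfolding w_def wy_def by (simp_all add: E PP_l0)
  have hr: "hderiv r (Re (wyl 0 0 y)) y" if "y \<ge> 0" for y
    using bounded_linear.has_vector_derivative[OF bounded_linear_Re wl_hderiv[of 0 y 0]] that by (simp add: wl0[abs_def])
  have e: "epsl 0 0 y = ((3 * (th y)\<^sup>2 - 2) * qr y * r y - th y * qr y * Re (wyl 0 0 y)) - qr y * r y" for y
  proof -
    have "((cmod (w 0 0 y))\<^sup>2)\<^sup>2 = 3 * (1 - (th y)\<^sup>2)" unfolding w0 norm_of_real power2_abs qr_4[symmetric] by simp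
    then have "epsl 0 0 y = - (th y * qr y) * Re (wyl 0 0 y) - 3 * (1 - (th y)\<^sup>2) * (qr y * r y)"
      unfolding epsl_def w0 wl0 by (simp add: Re_of_real_mult)
    then show ?thesis by (simp add: algebra_simps)
  qed
  have hd: "hderiv (\<lambda>y. - (th y * qr y) * r y) ((3 * (th y)\<^sup>2 - 2) * qr y * r y - th y * qr y * Re (wyl 0 0 y)) y" if "y \<ge> 0" for y
    using hderiv_qr[of y] hderiv_tanh2[of y] hr[OF that] unfolding has_real_derivative_iff_has_vector_derivative[symmetric]
    by (auto intro!: derivative_eq_intros simp: algebra_simps power2_eq_square)
  have s1: "smi True (\<lambda>y. - (th y * qr y) * r y)"
    by (intro allI sm_mult_decay(5) sm_uminus sm_mult_decay(2)[OF sm_th] smi_qr[rule_format] sr[rule_format])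
  have s2: "smi True (\<lambda>y. qr y * r y)" by (rule smi_mult[OF smi_qr sr])
  have i1: "hintegrable (\<lambda>y. (3 * (th y)\<^sup>2 - 2) * qr y * r y - th y * qr y * Re (wyl 0 0 y))"
  proof -
    have "hintegrable (hD (\<lambda>y. - (th y * qr y) * r y))" by (rule smi_hintegrable[OF smi_hD[OF s1]])
    then show ?thesis using deriv_in_half[OF hd]
      using set_integrable_cong[of lborel lborel "{0..}" "{0..}" "hD (\<lambda>y. - (th y * qr y) * r y)" "\<lambda>y. (3 * (th y)\<^sup>2 - 2) * qr y * r y - th y * qr y * Re (wyl 0 0 y)"] by auto
  qed
  have "hint (epsl 0 0) = hint (\<lambda>y. (3 * (th y)\<^sup>2 - 2) * qr y * r y - th y * qr y * Re (wyl 0 0 y)) - hint (\<lambda>y. qr y * r y)"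
    unfolding e[abs_def] by (rule set_integral_diff(2)[OF i1 smi_hintegrable[OF s2]])
  also have "hint (\<lambda>y. (3 * (th y)\<^sup>2 - 2) * qr y * r y - th y * qr y * Re (wyl 0 0 y)) = 0"
    using smi_hint_deriv[OF s1 hd] by simp
  also have "hint (\<lambda>y. qr y * r y) = 0" using orth by (simp add: r_def)
  finally show ?thesis unfolding EEl_def PP_l0 by simp
qed

lemma Ep_l0: "Ep e b 0 = (\<Sum>j<2*\<kappa>. (if even j then e (j, 0) else 0) * b ^ j)"
proof -
  have "Ep e b 0 = (\<Sum>p\<in>{p \<in> Ev. snd p = 0}. e p * (b ^ fst p * 0 ^ snd p))"
    unfolding Ep_def using finite_Ev by (intro sum.mono_neutral_right) auto
  also have "\<dots> = (\<Sum>j\<in>{j \<in> {..<2*\<kappa>}. even j}. e (j, 0) * b ^ j)"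
    by (rule sum.reindex_bij_witness[of _ "\<lambda>j. (j, 0)" fst]) (auto simp: Ev_def)
  also have "\<dots> = (\<Sum>j<2*\<kappa>. if even j then e (j, 0) * b ^ j else 0)"
    by (rule sum.inter_filter) simp
  finally show ?thesis by (simp add: if_distrib[of "\<lambda>x. x * _"] cong: if_cong)
qed

lemma expansion_coeff_l0:
  assumes e: "scalar_expansion e EE" and j: "even j" "j < 2 * \<kappa>"
  shows "e (j, 0) = (if j = 2 then C_Q N else 0)"
proof -
  \<comment> \<open>On \<lambda> = 0 the weight is b^(2\<kappa>), a power above the degree of the
    polynomial in question.\<close>
  let ?K = "{p :: real \<times> real. \<bar>fst p\<bar> \<le> 1 \<and> snd p = 0}"
  have "kreg 0 1 ?K" by (auto simp: kreg_def)
  with e obtain C where C: "\<And>p. p \<in> ?K \<Longrightarrow> \<bar>EE (fst p) (snd p) - Ep e (fst p) (snd p)\<bar> \<le> C * ((fst p)\<^sup>2 + snd p) ^ \<kappa>"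
    unfolding scalar_expansion_def by (metis (mono_tags, lifting) mem_Collect_eq order_refl)
  define d where "d j = (if even j then e (j, 0) else 0) - (if j = 2 then C_Q N else 0)" for j :: nat
  have "\<bar>\<Sum>j<2*\<kappa>. d j * x ^ j\<bar> \<le> (C + \<bar>C_Q N\<bar>) * x ^ (2 * \<kappa>)" if x: "0 < x" "x \<le> 1" for x
  proof -
    have "(\<Sum>j<2*\<kappa>. d j * x ^ j) = Ep e x 0 - (\<Sum>j<2*\<kappa>. if j = 2 then C_Q N * x\<^sup>2 else 0)"
      unfolding Ep_l0 sum_subtractf[symmetric] d_def by (intro sum.cong) (auto simp: algebra_simps)
    also have "(\<Sum>j<2*\<kappa>. if j = 2 then C_Q N * x\<^sup>2 else 0) = (if 2 < 2 * \<kappa> then C_Q N * x\<^sup>2 else 0)"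
      by (subst sum.delta) auto
    finally have s: "(\<Sum>j<2*\<kappa>. d j * x ^ j) = Ep e x 0 - (if 2 < 2 * \<kappa> then C_Q N * x\<^sup>2 else 0)" .
    have 1: "\<bar>C_Q N * x\<^sup>2 - Ep e x 0\<bar> \<le> C * x ^ (2 * \<kappa>)"
      using C[of "(x, 0)"] x by (simp add: EE_l0 power_mult)
    \<comment> \<open>For \<kappa> = 1 the exponent 2 lies outside the range of the sum, but b^2 is
      then itself of error size.\<close>
    have 2: "\<bar>C_Q N * x\<^sup>2 - (if 2 < 2 * \<kappa> then C_Q N * x\<^sup>2 else 0)\<bar> \<le> \<bar>C_Q N\<bar> * x ^ (2 * \<kappa>)"
    proof (cases "2 < 2 * \<kappa>")
      case False
      then have "\<kappa> = 1" using kap by simp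
      then show ?thesis by (simp add: abs_mult)
    qed (use x in simp)
    show ?thesis unfolding s distrib_right using 1 2 by linarith
  qed
  from small_polynomial_zero[OF this j(2)] show ?thesis using j(1) by (simp add: d_def)
qed

text \<open>The energy and its expansion are both differentiated in \<lambda> at the origin along b
  = 0. By \<kappa> >= 2 their difference is of order \<lambda>^2, so the derivatives agree.\<close>

lemma expansion_coeff_01:
  assumes e: "scalar_expansion e EE" and k2: "\<kappa> \<ge> 2"
    and orth: "hint (\<lambda>y. qr y * (c 0 1 y + \<sigma> / 2 * (th y * qr y))) = 0"
  shows "e (0, 1) = \<gamma> / 2 * (qr 0)\<^sup>2"
proof -
  \<comment> \<open>Chosen to keep |\<sigma>\<lambda>| <= 1/2 and \<lambda> <= 1 on the
    segment.\<close>
  define \<delta> where "\<delta> = 1 / (2 * (\<bar>\<sigma>\<bar> + 1))"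
  have \<delta>: "\<delta> > 0" "\<delta> \<le> 1" "\<bar>\<sigma>\<bar> * \<delta> \<le> 1/2"
  proof -
    have "1 / (2 * (x + 1)) > 0 \<and> 1 / (2 * (x + 1)) \<le> 1 \<and> x * (1 / (2 * (x + 1))) \<le> 1/2" if "x \<ge> 0" for x :: real
      using that by (auto simp: field_simps)
    from this[OF abs_ge_zero[of \<sigma>]] show "\<delta> > 0" "\<delta> \<le> 1" "\<bar>\<sigma>\<bar> * \<delta> \<le> 1/2" unfolding \<delta>_def by blast+
  qed
  have m: "\<bar>\<sigma> * l\<bar> \<le> 1/2" if "0 \<le> l" "l \<le> \<delta>" for l
  proof -
    have "\<bar>\<sigma> * l\<bar> \<le> \<bar>\<sigma>\<bar> * \<delta>" unfolding abs_mult using that by (intro mult_left_mono) auto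
    then show ?thesis using \<delta>(3) by linarith
  qed
  let ?J = "{0..\<delta>}"
  let ?K = "{p :: real \<times> real. fst p = 0 \<and> 0 \<le> snd p \<and> snd p \<le> \<delta>}"
  have kr: "kreg (1/2) 1 ?K" unfolding kreg_def using m \<delta>(2) by (intro conjI ballI) auto
  have D: "((\<lambda>l. EE 0 l) has_real_derivative \<gamma> / 2 * (qr 0)\<^sup>2) (at 0 within ?J)"
  proof -
    have "((\<lambda>s. EE ((\<lambda>_. 0) s) ((\<lambda>s. s) s)) has_real_derivative EEb 0 0 * 0 + EEl 0 0 * 1) (at 0 within ?J)"
    proof (rule EE_chain_general[where b'="\<lambda>_. 0" and lam'="\<lambda>_. 1" and K="?K" and J="?J", OF _ _ _ _ _ _ kr])
      show "\<bar>\<sigma> * s\<bar> < 1" if "s \<in> ?J" for s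
      proof -
        have "\<bar>\<sigma> * s\<bar> \<le> 1/2" using that by (intro m) auto
        then show ?thesis by linarith
      qed
    qed (use \<delta> in \<open>auto simp: is_interval_cc\<close>)
    then show ?thesis using EEl_00[OF k2 orth] by simp
  qed
  have P: "((\<lambda>l. Ep e 0 l) has_real_derivative e (0, 1)) (at 0 within ?J)"
  proof -
    have "((\<lambda>l. Ep e 0 l) has_real_derivative (\<Sum>p\<in>Ev. e p * (0 ^ fst p * (real (snd p) * 0 ^ (snd p - Suc 0))))) (at 0 within ?J)"
      unfolding Ep_def by (auto intro!: derivative_eq_intros sum.cong)
    also have "(\<Sum>p\<in>Ev. e p * (0 ^ fst p * (real (snd p) * 0 ^ (snd p - Suc 0)))) = e (0, 1)"
    proof -
      have "(0, 1) \<in> Ev" using k2 by (simp add: Ev_def)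
      moreover have "e p * (0 ^ fst p * (real (snd p) * 0 ^ (snd p - Suc 0))) = 0" if "p \<in> Ev - {(0, 1)}" for p
      proof -
        have "fst p > 0 \<or> snd p = 0 \<or> snd p - Suc 0 > 0" using that by (cases p) auto
        then show ?thesis by (auto simp: zero_power)
      qed
      ultimately have "(\<Sum>p\<in>Ev. e p * (0 ^ fst p * (real (snd p) * 0 ^ (snd p - Suc 0)))) = (\<Sum>p\<in>{(0, 1)}. e p * (0 ^ fst p * (real (snd p) * 0 ^ (snd p - Suc 0))))"
        using finite_Ev by (intro sum.mono_neutral_right) blast+
      then show ?thesis by simp
    qed
    finally show ?thesis .
  qed
  obtain C where C: "\<And>p. p \<in> ?K \<Longrightarrow> \<bar>EE (fst p) (snd p) - Ep e (fst p) (snd p)\<bar> \<le> C * ((fst p)\<^sup>2 + snd p) ^ \<kappa>"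
    using e kr unfolding scalar_expansion_def by (metis (mono_tags, lifting) mem_Collect_eq)
  define g where "g l = EE 0 l - Ep e 0 l" for l
  have gb: "\<bar>g l\<bar> \<le> \<bar>C\<bar> * l\<^sup>2" if "l \<in> ?J" for l
  proof -
    have "\<bar>g l\<bar> \<le> C * l ^ \<kappa>" using C[of "(0, l)"] that by (simp add: g_def)
    also have "\<dots> \<le> \<bar>C\<bar> * l\<^sup>2"
      using that \<delta>(2) k2 by (intro mult_mono power_decreasing) auto
    finally show ?thesis .
  qed
  have "g 0 = 0" using gb[of 0] \<delta>(1) by simp
  have "(g has_real_derivative \<gamma> / 2 * (qr 0)\<^sup>2 - e (0, 1)) (at 0 within ?J)"
    unfolding g_def[abs_def] by (rule DERIV_diff[OF D P])
  then have "((\<lambda>l. g l / l) \<longlongrightarrow> \<gamma> / 2 * (qr 0)\<^sup>2 - e (0, 1)) (at 0 within ?J)"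
    unfolding has_field_derivative_iff \<open>g 0 = 0\<close> by simp
  moreover have "((\<lambda>l. g l / l) \<longlongrightarrow> 0) (at 0 within ?J)"
  proof (rule Lim_null_comparison)
    show "\<forall>\<^sub>F l in at 0 within ?J. norm (g l / l) \<le> \<bar>C\<bar> * l"
      unfolding eventually_at
    proof (intro exI[of _ 1] conjI ballI impI)
      fix l assume l: "l \<in> ?J" "l \<noteq> 0 \<and> dist l 0 < 1"
      then have "\<bar>g l\<bar> / l \<le> \<bar>C\<bar> * l\<^sup>2 / l" using gb[OF l(1)] by (intro divide_right_mono) auto
      then show "norm (g l / l) \<le> \<bar>C\<bar> * l" using l by (simp add: power2_eq_square)
    qed simp
    show "((\<lambda>l. \<bar>C\<bar> * l) \<longlongrightarrow> 0) (at 0 within ?J)" by (rule tendsto_eq_intros refl | simp)+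
  qed
  moreover have "at (0::real) within ?J \<noteq> bot" using \<delta>(1) by (intro interval_at_within_nontriv) (auto simp: is_interval_cc)
  ultimately have "\<gamma> / 2 * (qr 0)\<^sup>2 - e (0, 1) = 0" using tendsto_unique by blast
  then show ?thesis by simp
qed

abbreviation Ts :: "(nat \<times> nat) set" where
  "Ts \<equiv> {(j, k) \<in> Theta \<kappa>. even j \<and> real j / 2 + real k \<ge> 2}"

lemma Ts_iff: "(j, k) \<in> Ts \<longleftrightarrow> (j, k) \<in> Ev \<and> k \<ge> 1 \<and> 4 \<le> j + 2 * k"
proof -
  have "real j / 2 + real k \<ge> 2 \<longleftrightarrow> real 4 \<le> real (j + 2 * k)" by auto
  then show ?thesis by (simp only: of_nat_le_iff) (auto simp: Theta_iff Ev_def)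
qed

text \<open>The product of \<open>C_Q\<close> and -2 \<open>alpha_star\<close> is \<gamma> Q(0)^2 /
  2, so both explicit terms of the model energy match the coefficients found for
  \<open>EE\<close>.\<close>

lemma E_mod_scaled:
  assumes l: "l > 0"
  shows "C_Q N * E_mod N \<gamma> \<kappa> \<epsilon> b l = (C_Q N * b\<^sup>2 + \<gamma> / 2 * (qr 0)\<^sup>2 * l + (\<Sum>p\<in>Ts. C_Q N * \<epsilon> (fst p) (snd p) * (b ^ fst p * l ^ snd p))) / l\<^sup>2"
proof -
  have mo: "C_Q N * E_mo N \<gamma> b l = (C_Q N * b\<^sup>2 + \<gamma> / 2 * (qr 0)\<^sup>2 * l) / l\<^sup>2"
    unfolding E_mo_def alpha_star_eq C_Q_eq using l N Iq_pos by (simp add: field_simps power2_eq_square)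
  have "l powi (int k - 2) = l ^ k / l\<^sup>2" for k using l by (simp add: power_int_diff)
  then have "C_Q N * (\<Sum>(j, k)\<in>Ts. \<epsilon> j k * b ^ j * l powi (int k - 2)) = (\<Sum>p\<in>Ts. C_Q N * \<epsilon> (fst p) (snd p) * (b ^ fst p * l ^ snd p)) / l\<^sup>2"
    unfolding sum_distrib_left sum_divide_distrib by (intro sum.cong refl) (simp add: case_prod_beta mult_ac)
  then show ?thesis unfolding E_mod_def distrib_left mo add_divide_distrib by simp
qed

text \<open>For \<kappa> >= 2 the identified coefficients turn this into an identity. For \<kappa> =
  1 the terms in b^2 and \<lambda> lie beyond the expansion but are of the size of the
  error.\<close>

lemma Ep_leading:
  assumes e: "scalar_expansion e EE"
    and orth: "\<kappa> \<ge> 2 \<Longrightarrow> hint (\<lambda>y. qr y * (c 0 1 y + \<sigma> / 2 * (th y * qr y))) = 0"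
  obtains B where "\<And>b l. l \<ge> 0 \<Longrightarrow> \<bar>Ep e b l - (C_Q N * b\<^sup>2 + \<gamma> / 2 * (qr 0)\<^sup>2 * l + (\<Sum>p\<in>Ts. e p * (b ^ fst p * l ^ snd p)))\<bar> \<le> B * (b\<^sup>2 + l) ^ \<kappa>"
proof (cases "\<kappa> \<ge> 2")
  case True
  have "Ep e b l = C_Q N * b\<^sup>2 + \<gamma> / 2 * (qr 0)\<^sup>2 * l + (\<Sum>p\<in>Ts. e p * (b ^ fst p * l ^ snd p))" for b l
  proof -
    let ?f = "\<lambda>p. e p * (b ^ fst p * l ^ snd p)"
    have "(2, 0) \<in> Ev" "(0, 1) \<in> Ev - {(2, 0)}" using True by (auto simp: Ev_def)
    then have "Ep e b l = ?f (2, 0) + (?f (0, 1) + sum ?f (Ev - {(2, 0)} - {(0, 1)}))"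
      unfolding Ep_def using finite_Ev by (simp only: sum.remove finite_Diff)
    also have "sum ?f (Ev - {(2, 0)} - {(0, 1)}) = sum ?f Ts"
    proof (rule sum.mono_neutral_right)
      show "Ts \<subseteq> Ev - {(2, 0)} - {(0, 1)}" using Ts_iff by fastforce
      show "\<forall>p\<in>Ev - {(2, 0)} - {(0, 1)} - Ts. ?f p = 0"
      proof
        fix p assume p: "p \<in> Ev - {(2, 0)} - {(0, 1)} - Ts"
        obtain j k where jk: "p = (j, k)" by (cases p)
        have "k = 0" using p Ts_iff[of j k] unfolding jk by (auto simp: Ev_def elim!: evenE)
        then show "?f p = 0" using p expansion_coeff_l0[OF e, of j] unfolding jk by (auto simp: Ev_def)
      qed
    qed (use finite_Ev in simp)
    finally show ?thesis
      using expansion_coeff_l0[OF e, of 2] expansion_coeff_01[OF e True orth[OF True]] True by simp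
  qed
  then show thesis using that[of 0] by simp
next
  case False
  then have k1: "\<kappa> = 1" using kap by simp
  have E0: "Ev = {(0, 0)}" unfolding Ev_def using k1 by auto
  have "(j, k) \<notin> Ts" for j k unfolding Ts_iff E0 by simp
  moreover have "A = {}" if "\<And>j k. (j, k) \<notin> A" for A :: "(nat \<times> nat) set" using that by auto
  ultimately have T: "Ts = {}" by blast
  have E: "Ep e b l = 0" for b l unfolding Ep_def E0 using expansion_coeff_l0[OF e, of 0] kap by simp
  have "\<bar>C_Q N * b\<^sup>2 + \<gamma> / 2 * (qr 0)\<^sup>2 * l\<bar> \<le> (\<bar>C_Q N\<bar> + \<bar>\<gamma> / 2 * (qr 0)\<^sup>2\<bar>) * (b\<^sup>2 + l) ^ \<kappa>" if "l \<ge> 0" for b l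
  proof -
    have "\<bar>C_Q N * b\<^sup>2\<bar> \<le> \<bar>C_Q N\<bar> * (b\<^sup>2 + l)" "\<bar>\<gamma> / 2 * (qr 0)\<^sup>2 * l\<bar> \<le> \<bar>\<gamma> / 2 * (qr 0)\<^sup>2\<bar> * (b\<^sup>2 + l)"
      unfolding abs_mult[of "C_Q N"] abs_mult[of _ l] using that by (auto intro!: mult_left_mono)
    then show ?thesis unfolding k1 power_one_right distrib_right[of "\<bar>C_Q N\<bar>"] by linarith
  qed
  then show thesis by (intro that) (simp only: T E sum.empty add_0_right diff_0 abs_minus_cancel)
qed

theorem energy_expansion:
  assumes orth: "\<kappa> \<ge> 2 \<Longrightarrow> hint (\<lambda>y. qr y * (c 0 1 y + \<sigma> / 2 * (th y * qr y))) = 0"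
  shows "\<exists>\<epsilon> :: nat \<Rightarrow> nat \<Rightarrow> real. \<forall>K. param_region N \<gamma> K \<longrightarrow>
       (\<exists>C>0. \<forall>J b lam (\<theta> :: real \<Rightarrow> real).
          modulation N \<gamma> J b lam \<and> (\<forall>s\<in>J. (b s, lam s) \<in> K) \<longrightarrow>
          (\<forall>s\<in>J.
             \<bar>energy N \<gamma> (profile_tilde N \<gamma> \<kappa> Pj (b s) (lam s) (\<theta> s))
                - C_Q N * E_mod N \<gamma> \<kappa> \<epsilon> (b s) (lam s)\<bar>
               \<le> C * (((b s)\<^sup>2 + lam s) ^ \<kappa> / (lam s)\<^sup>2)))"
proof -
  obtain e where e: "scalar_expansion e EE" by (rule EE_expansion)
  obtain B where B: "\<And>b l. l \<ge> 0 \<Longrightarrow> \<bar>Ep e b l - (C_Q N * b\<^sup>2 + \<gamma> / 2 * (qr 0)\<^sup>2 * l + (\<Sum>p\<in>Ts. e p * (b ^ fst p * l ^ snd p)))\<bar> \<le> B * (b\<^sup>2 + l) ^ \<kappa>"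
    using Ep_leading[OF e orth] by blast
  \<comment> \<open>The normalization matches the prefactor \<open>C_Q\<close> of the model
    energy.\<close>
  define \<epsilon> where "\<epsilon> j k = e (j, k) / C_Q N" for j k
  have CQ: "C_Q N \<noteq> 0" unfolding C_Q_eq using N Iq_pos by simp
  show ?thesis
  proof (intro exI[of _ \<epsilon>] allI impI)
    fix K assume "param_region N \<gamma> K"
    then obtain q M where qM: "0 \<le> q" "q < 1" "M \<ge> 1" "\<And>p. p \<in> K \<Longrightarrow> \<bar>\<sigma> * snd p\<bar> \<le> q" "\<And>p. p \<in> K \<Longrightarrow> \<bar>fst p\<bar> \<le> M"
      "\<And>p. p \<in> K \<Longrightarrow> \<bar>snd p\<bar> \<le> M" "\<And>p. p \<in> K \<Longrightarrow> snd p \<ge> 0"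
      by (rule region_bounds) blast
    then have kr: "kreg q M K" by (simp add: kreg_def)
    obtain C where C: "\<And>p. p \<in> K \<Longrightarrow> \<bar>EE (fst p) (snd p) - Ep e (fst p) (snd p)\<bar> \<le> C * ((fst p)\<^sup>2 + snd p) ^ \<kappa>"
      using e kr qM(7) unfolding scalar_expansion_def by blast
    have main: "\<bar>energy N \<gamma> (profile_tilde N \<gamma> \<kappa> Pj (b s) (lam s) (\<theta> s)) - C_Q N * E_mod N \<gamma> \<kappa> \<epsilon> (b s) (lam s)\<bar>
        \<le> (\<bar>C\<bar> + \<bar>B\<bar> + 1) * (((b s)\<^sup>2 + lam s) ^ \<kappa> / (lam s)\<^sup>2)"
      if m: "modulation N \<gamma> J b lam" and inK: "\<forall>s\<in>J. (b s, lam s) \<in> K" and s: "s \<in> J" for J b lam \<theta> s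
    proof -
      note p = modulation_point(1,2)[OF m s]
      define W where "W = ((b s)\<^sup>2 + lam s) ^ \<kappa>"
      have W: "W \<ge> 0" unfolding W_def using p(2) by simp
      define Z where "Z = C_Q N * (b s)\<^sup>2 + \<gamma> / 2 * (qr 0)\<^sup>2 * lam s + (\<Sum>p\<in>Ts. e p * (b s ^ fst p * lam s ^ snd p))"
      have "C_Q N * E_mod N \<gamma> \<kappa> \<epsilon> (b s) (lam s) = Z / (lam s)\<^sup>2"
        unfolding E_mod_scaled[OF p(2)] Z_def using CQ by (simp add: \<epsilon>_def)
      then have "\<bar>energy N \<gamma> (profile_tilde N \<gamma> \<kappa> Pj (b s) (lam s) (\<theta> s)) - C_Q N * E_mod N \<gamma> \<kappa> \<epsilon> (b s) (lam s)\<bar>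
          = \<bar>EE (b s) (lam s) - Z\<bar> / (lam s)\<^sup>2"
        unfolding energy_profile[OF p] by (simp add: diff_divide_distrib[symmetric])
      also have "\<dots> \<le> (\<bar>C\<bar> + \<bar>B\<bar> + 1) * W / (lam s)\<^sup>2"
      proof (rule divide_right_mono)
        have "\<bar>EE (b s) (lam s) - Ep e (b s) (lam s)\<bar> \<le> C * W" using C[of "(b s, lam s)"] inK s by (simp add: W_def)
        moreover have "\<bar>Ep e (b s) (lam s) - Z\<bar> \<le> B * W" using B[of "lam s" "b s"] p(2) by (simp add: W_def Z_def)
        moreover have "C * W \<le> \<bar>C\<bar> * W" "B * W \<le> \<bar>B\<bar> * W" using W by (auto intro: mult_right_mono)
        ultimately show "\<bar>EE (b s) (lam s) - Z\<bar> \<le> (\<bar>C\<bar> + \<bar>B\<bar> + 1) * W" unfolding distrib_right using W by linarith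
      qed simp
      finally show ?thesis unfolding W_def by simp
    qed
    show "\<exists>C>0. \<forall>J b lam (\<theta> :: real \<Rightarrow> real).
          modulation N \<gamma> J b lam \<and> (\<forall>s\<in>J. (b s, lam s) \<in> K) \<longrightarrow>
          (\<forall>s\<in>J. \<bar>energy N \<gamma> (profile_tilde N \<gamma> \<kappa> Pj (b s) (lam s) (\<theta> s)) - C_Q N * E_mod N \<gamma> \<kappa> \<epsilon> (b s) (lam s)\<bar>
               \<le> C * (((b s)\<^sup>2 + lam s) ^ \<kappa> / (lam s)\<^sup>2))"
      by (rule exI[of _ "\<bar>C\<bar> + \<bar>B\<bar> + 1"]) (use main in \<open>auto simp: add_nonneg_pos\<close>)
  qed
qed

end

theorem proposition2p3:
  fixes N \<kappa> :: nat and \<gamma> :: real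
  assumes "N \<ge> 1" and "\<kappa> \<ge> 1"
  shows "\<exists>(P :: nat \<Rightarrow> nat \<Rightarrow> real \<Rightarrow> graph_fun) (\<alpha> :: nat \<Rightarrow> nat \<Rightarrow> real \<Rightarrow> real).
    \<comment> \<open>(i)\<close>
    (\<forall>(j, k)\<in>Theta \<kappa>.
       (\<forall>\<beta>\<in>{- real N <..< real N}. P j k \<beta> \<in> dom_H N \<beta>) \<and>
       (\<forall>l. (\<forall>i<N. \<forall>y\<ge>0. Ck_on {- real N <..< real N} l (\<lambda>\<beta>. P j k \<beta> i y)) \<and>
            (\<forall>\<beta>\<in>{- real N <..< real N}.
               (\<lambda>i y. (deriv_in {- real N <..< real N} ^^ l) (\<lambda>\<beta>'. P j k \<beta>' i y) \<beta>)
                 \<in> Cexp_inf N))) \<and>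
    \<comment> \<open>(ii)\<close>
    (\<forall>(j, k)\<in>Theta \<kappa>. \<forall>\<beta>\<in>{- real N <..< real N}. odd j \<longrightarrow> \<alpha> j k \<beta> = 0) \<and>
    \<comment> \<open>(iii)\<close>
    ((0, 1) \<in> Theta \<kappa> \<longrightarrow> \<alpha> 0 1 0 = alpha_star N \<gamma>) \<and>
    \<comment> \<open>(iv)\<close>
    (\<forall>K. param_region N \<gamma> K \<longrightarrow>
       (\<forall>\<nu>. \<exists>\<rho>>0. \<exists>C>0. \<forall>J b lam.
          modulation N \<gamma> J b lam \<and> (\<forall>s\<in>J. (b s, lam s) \<in> K) \<longrightarrow>
          (\<forall>s\<in>J. Psi N \<gamma> \<kappa> P \<alpha> J b lam s \<in> Cexp N \<nu> \<and>
             Cexp_norm N \<nu> \<rho> (Psi N \<gamma> \<kappa> P \<alpha> J b lam s)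
               \<le> ennreal (C * lam s * mod_defect \<gamma> \<kappa> \<alpha> J b lam s
                          + C * ((b s)\<^sup>2 + lam s) ^ \<kappa>)))) \<and>
    \<comment> \<open>(v)\<close>
    (\<forall>K. param_region N \<gamma> K \<longrightarrow>
       (\<exists>C>0. \<forall>J b lam \<theta>.
          modulation N \<gamma> J b lam \<and> (\<forall>s\<in>J. (b s, lam s) \<in> K) \<longrightarrow>
          (\<forall>s\<in>J. \<exists>D.
             ((\<lambda>s'. energy N \<gamma> (profile_tilde N \<gamma> \<kappa> P (b s') (lam s') (\<theta> s')))
                has_real_derivative D) (at s within J) \<and>
             \<bar>D\<bar> \<le> C * (1 / (lam s)\<^sup>2 *
               (mod_defect \<gamma> \<kappa> \<alpha> J b lam s + ((b s)\<^sup>2 + lam s) ^ \<kappa>))))) \<and>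
    \<comment> \<open>(vi)\<close>
    (\<exists>\<epsilon> :: nat \<Rightarrow> nat \<Rightarrow> real. \<forall>K. param_region N \<gamma> K \<longrightarrow>
       (\<exists>C>0. \<forall>J b lam (\<theta> :: real \<Rightarrow> real).
          modulation N \<gamma> J b lam \<and> (\<forall>s\<in>J. (b s, lam s) \<in> K) \<longrightarrow>
          (\<forall>s\<in>J.
             \<bar>energy N \<gamma> (profile_tilde N \<gamma> \<kappa> P (b s) (lam s) (\<theta> s))
                - C_Q N * E_mod N \<gamma> \<kappa> \<epsilon> (b s) (lam s)\<bar>
               \<le> C * (((b s)\<^sup>2 + lam s) ^ \<kappa> / (lam s)\<^sup>2))))"
proof -
  \<comment> \<open>The choice \<sigma> = \<gamma>/N makes \<mu> = \<sigma>\<lambda> equal to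
    \<beta>/N at \<beta> = \<gamma>\<lambda>.\<close>
  obtain c a where ca: "coeffs_ok \<kappa> c a" "SP True {(j, k). 2 * \<kappa> \<le> j + 2 * k} (resid (\<gamma> / real N) \<kappa> c a)"
    and a01: "\<kappa> \<ge> 2 \<Longrightarrow> a 0 1 = - 2 * (\<gamma> / real N) * qr 0 ^ 2 / Iq"
    and orth: "\<kappa> \<ge> 2 \<Longrightarrow> hint (\<lambda>y. qr y * (c 0 1 y + (\<gamma> / real N) / 2 * (th y * qr y))) = 0"
    by (rule profile_coefficients[OF assms(2), of "\<gamma> / real N"]) blast
  interpret prof N \<kappa> \<gamma> c a by unfold_locales (use assms ca in auto)
  have Pj: "Pj j k = (\<lambda>\<beta> i y. complex_of_real (Gg (\<beta> / real N) y * c j k y))" for j k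
    by (intro ext) (rule Pj_def)
  note open_S = open_greaterThanLessThan[of "- real N" "real N"]
  have 1: "\<forall>(j, k)\<in>Theta \<kappa>. (\<forall>\<beta>\<in>{- real N <..< real N}. Pj j k \<beta> \<in> dom_H N \<beta>) \<and>
       (\<forall>l. (\<forall>i<N. \<forall>y\<ge>0. Ck_on {- real N <..< real N} l (\<lambda>\<beta>. Pj j k \<beta> i y)) \<and>
            (\<forall>\<beta>\<in>{- real N <..< real N}.
               (\<lambda>i y. (deriv_in {- real N <..< real N} ^^ l) (\<lambda>\<beta>'. Pj j k \<beta>' i y) \<beta>) \<in> Cexp_inf N))"
    using Pj_dom_H bsm_Ck_on[OF open_S Pj_bsm] bsm_Cexp[OF open_S Pj_bsm] unfolding Pj by blast
  have 2: "\<forall>(j, k)\<in>Theta \<kappa>. \<forall>\<beta>\<in>{- real N <..< real N}. odd j \<longrightarrow> al j k \<beta> = 0"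
    using ca(1) by (auto simp: coeffs_ok_def)
  have 3: "(0, 1) \<in> Theta \<kappa> \<longrightarrow> al 0 1 0 = alpha_star N \<gamma>"
    using a01 by (auto simp: Theta_iff alpha_star_eq)
  have 4: "\<forall>K. param_region N \<gamma> K \<longrightarrow> (\<forall>\<nu>. \<exists>\<rho>>0. \<exists>C>0. \<forall>J b lam. modulation N \<gamma> J b lam \<and> (\<forall>s\<in>J. (b s, lam s) \<in> K) \<longrightarrow>
          (\<forall>s\<in>J. Psi N \<gamma> \<kappa> Pj al J b lam s \<in> Cexp N \<nu> \<and>
             Cexp_norm N \<nu> \<rho> (Psi N \<gamma> \<kappa> Pj al J b lam s)
               \<le> ennreal (C * lam s * mod_defect \<gamma> \<kappa> al J b lam s + C * ((b s)\<^sup>2 + lam s) ^ \<kappa>)))"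
    by (intro allI impI Psi_estimate)
  show ?thesis
    by (rule exI[of _ Pj], rule exI[of _ al], intro conjI)
      (rule 1, rule 2, rule 3, rule 4, intro allI impI energy_derivative, assumption, rule energy_expansion[OF orth])
qed

end
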